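(* Let $R$ be a root system of type $\mathsf{G}_2$, and let $k_1,k_2\in\mathbb{C}$ be the values of the multiplicity function $k$ on the short, respectively long, roots; call $k$ very singular if $\dim L(\mathrm{triv},k)<\infty$. 1. Assume that the polynomials $\phi_r$ defined in the context satisfy, for all integers $q\ge0$, $$\phi_{2q}(\kappa)=\prod_{j=1}^{q}\bigl(\kappa^2-(2j-1)^2\bigr),\qquad \phi_{2q+1}(\kappa)=\kappa\prod_{j=1}^{q}\bigl(\kappa^2-(2j)^2\bigr).$$ Then the multiplicity $k=(k_1,k_2)$ is very singular if and only if there exists an integer $n\ge1$ such that one of the following holds: (a) $n\not\equiv0\pmod 3$ and $k_1+k_2=-\frac n3$; (b) $n\equiv0\pmod 6$ and $(k_1,k_2)$ or $(k_2,k_1)$ is of the form $\bigl(-\tfrac12(\tfrac n3+2j-1),\,-\tfrac12(\tfrac n3-2j+1)\bigr)$ with $j$ an integer, $1\le j\le\frac n6$; (c) $n\equiv3\pmod 6$ and $(k_1,k_2)$ or $(k_2,k_1)$ is of the form $\bigl(-\tfrac12(\tfrac n3+2j),\,-\tfrac12(\tfrac n3-2j)\bigr)$ with $j$ an integer, $0\le j\le\frac{n-3}6$. 2. If $\chi\in\{\mathrm{sgn},\tau,\mathrm{sgn}\otimes\tau\}$, then $\dim L(\chi,k)<\infty$ if and only if the multiplicity $k^\chi$ is very singular. 3. If $\chi\in\{\mathrm{std},\tau\otimes\mathrm{std}\}$, then $\dim L(\chi,k)=\infty$.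
   Context: Let $\mathfrak{a}_{\mathbb{R}}$ be a real vector space of dimension $\ell$, $R\subset\mathfrak{a}_{\mathbb{R}}^*$ a reduced root system (here of type $\mathsf{G}_2$, $\ell=2$), $W$ its Weyl group, $\mathfrak{a}=\mathbb{C}\otimes_{\mathbb{R}}\mathfrak{a}_{\mathbb{R}}$. For $\alpha\in R$ let $r_\alpha$ be the reflection. Let $k:R\to\mathbb{C}$ be $W$-invariant. Let $\mathcal{P}=S(\mathfrak{a}^* )$ with its natural $W$-action. For $y\in\mathfrak{a}$, the Dunkl operator is $T_y=T_y(k)=\partial_y+\sum_{\alpha\in R^+}k_\alpha\frac{\langle\alpha,y\rangle}{\alpha}(1-r_\alpha)\in\mathrm{End}_{\mathbb{C}}(\mathcal{P})$, where $R^+$ is a system of positive roots. The rational Cherednik algebra $\mathcal{H}(k)$ is the subalgebra of $\mathrm{End}_{\mathbb{C}}(\mathcal{P})$ generated by all $w\in W$, all multiplications by $x\in\mathfrak{a}^*$ and all $T_y$, $y\in\mathfrak{a}$. The map $y\mapsto T_y$ extends to an algebra isomorphism $T$ from $S(\mathfrak{a})$ onto $\mathcal{S}=\mathbb{C}[T_y:y\in\mathfrak{a}]$; put $\mathcal{S}_+=\bigoplus_{n\ge1}T(S^n(\mathfrak{a}))$. Multiplication gives $\mathcal{H}(k)=\mathcal{P}\otimes\mathbb{C}W\otimes\mathcal{S}$ as vector spaces; $\mathcal{S}\otimes\mathbb{C}W$ denotes the subalgebra generated by $\mathcal{S}$ and $W$. For an irreducible character $\chi$ of $W$ let $V_\chi$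 be an irreducible $W$-module of character $\chi$, made into an $\mathcal{S}\otimes\mathbb{C}W$-module by $\mathcal{S}_+V_\chi=0$. The Verma module $M(\chi,k)=\mathcal{H}(k)\otimes_{\mathcal{S}\otimes\mathbb{C}W}V_\chi$ has a unique simple quotient, denoted $L(\chi,k)$, an $\mathcal{H}(k)$-module. Let $\alpha_1$ (resp. $\alpha_2$) be a short (resp. long) root. The irreducible characters of $W$ (dihedral of order 12) are $\mathrm{triv}$, $\mathrm{sgn}=\det$, $\tau$, $\mathrm{sgn}\otimes\tau$, $\mathrm{std}$, $\mathrm{std}\otimes\tau$, where $\mathrm{std}$ is the two-dimensional representation $W\hookrightarrow\mathrm{GL}(\mathfrak{a})$ and $\tau$ is one-dimensional with $\tau(r_{\alpha_1})=1$, $\tau(r_{\alpha_2})=-1$. For a one-dimensional character $\chi$, $k^\chi$ is the multiplicity function $k^\chi(\alpha)=\chi(r_\alpha)k_\alpha$. Polynomials: define $\Phi_p(\hbar,\kappa)$, $p\ge0$, by $\Phi_0=1$, $\Phi_1=\kappa$ and, for $p>1$, $\Phi_p(\hbar,\kappa)=\kappa\,\Phi_{p-1}(\hbar,\kappa)+\frac{p-1}{3}(\hbar+3p-4)\,\Phi_{p-2}(\hbar,\kappa)$. For $r\ge0$ let $\phi_r(\kappa)=\Phi_r(-(3r-1),\kappa)$, i.e. $\Phi_r$ evaluated at $\hbar=-(3r-1)$. *)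

theory Defs
  imports
    "HOL-Analysis.Analysis"
    "HOL-Algebra.Generated_Rings"
    "HOL-Algebra.Module"
    "HOL-Algebra.AbelCoset"
    "HOL-Algebra.Free_Abelian_Groups"
begin

section \<open>Root systems\<close>

text \<open>
  The real space is \<open>real ^ 'n\<close> with its standard inner product. The inner product is taken to be
  invariant under the Weyl group (every root system admits such a choice) and is used to identify
  the dual space with \<open>real ^ 'n\<close>: a root \<open>\<alpha>\<close> is the functional \<open>x \<mapsto> \<alpha> \<bullet> x\<close>.
\<close>

definition reflection :: "real ^ 'n \<Rightarrow> real ^ 'n \<Rightarrow> real ^ 'n" where
  "reflection \<alpha> x = x - (2 * (\<alpha> \<bullet> x) / (\<alpha> \<bullet> \<alpha>)) *\<^sub>R \<alpha>"

text \<open>The Cartan number \<open>\<langle>\<beta>, \<alpha>\<^sup>\<or>\<rangle>\<close>.\<close>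

definition cartan_number :: "real ^ 'n \<Rightarrow> real ^ 'n \<Rightarrow> real" where
  "cartan_number \<beta> \<alpha> = 2 * (\<beta> \<bullet> \<alpha>) / (\<alpha> \<bullet> \<alpha>)"

definition reduced_root_system :: "(real ^ 'n) set \<Rightarrow> bool" where
  "reduced_root_system R \<longleftrightarrow>
     finite R \<and> 0 \<notin> R \<and> span R = UNIV \<and>
     (\<forall>\<alpha>\<in>R. \<forall>\<beta>\<in>R. reflection \<alpha> \<beta> \<in> R) \<and>
     (\<forall>\<alpha>\<in>R. \<forall>\<beta>\<in>R. cartan_number \<beta> \<alpha> \<in> \<int>) \<and>
     (\<forall>\<alpha>\<in>R. \<forall>c. c *\<^sub>R \<alpha> \<in> R \<longrightarrow> c = 1 \<or> c = -1)"

definition root_base :: "(real ^ 'n) set \<Rightarrow> (real ^ 'n) set \<Rightarrow> bool" where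
  "root_base R \<Delta> \<longleftrightarrow>
     \<Delta> \<subseteq> R \<and> independent \<Delta> \<and>
     (\<forall>\<beta>\<in>R. \<exists>c :: real ^ 'n \<Rightarrow> int.
        \<beta> = (\<Sum>\<delta>\<in>\<Delta>. real_of_int (c \<delta>) *\<^sub>R \<delta>) \<and>
        ((\<forall>\<delta>\<in>\<Delta>. 0 \<le> c \<delta>) \<or> (\<forall>\<delta>\<in>\<Delta>. c \<delta> \<le> 0)))"

text \<open>In type \<open>G\<^sub>2\<close> the simple root \<open>a\<close> below is short and \<open>b\<close> is long.\<close>

definition root_system_G2 :: "(real ^ 'n) set \<Rightarrow> bool" where
  "root_system_G2 R \<longleftrightarrow>
     reduced_root_system R \<and>
     (\<exists>a b. a \<noteq> b \<and> root_base R {a, b} \<and> cartan_number b a = -3 \<and> cartan_number a b = -1)"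

definition short_root :: "(real ^ 'n) set \<Rightarrow> real ^ 'n \<Rightarrow> bool" where
  "short_root R \<alpha> \<longleftrightarrow> \<alpha> \<in> R \<and> (\<forall>\<beta>\<in>R. norm \<alpha> \<le> norm \<beta>)"

definition long_root :: "(real ^ 'n) set \<Rightarrow> real ^ 'n \<Rightarrow> bool" where
  "long_root R \<alpha> \<longleftrightarrow> \<alpha> \<in> R \<and> (\<forall>\<beta>\<in>R. norm \<beta> \<le> norm \<alpha>)"

definition positive_system :: "(real ^ 'n) set \<Rightarrow> (real ^ 'n) set \<Rightarrow> bool" where
  "positive_system R Rp \<longleftrightarrow>
     (\<exists>v. (\<forall>\<alpha>\<in>R. \<alpha> \<bullet> v \<noteq> 0) \<and> Rp = {\<alpha> \<in> R. 0 < \<alpha> \<bullet> v})"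

inductive_set weyl_group :: "(real ^ 'n) set \<Rightarrow> (real ^ 'n \<Rightarrow> real ^ 'n) set"
  for R where
    id: "id \<in> weyl_group R"
  | refl: "w \<in> weyl_group R \<Longrightarrow> \<alpha> \<in> R \<Longrightarrow> reflection \<alpha> \<circ> w \<in> weyl_group R"

definition multiplicity_function ::
    "(real ^ 'n) set \<Rightarrow> (real ^ 'n \<Rightarrow> complex) \<Rightarrow> bool" where
  "multiplicity_function R k \<longleftrightarrow> (\<forall>w\<in>weyl_group R. \<forall>\<alpha>\<in>R. k (w \<alpha>) = k \<alpha>)"


section \<open>Representations and characters of the Weyl group\<close>

definition irreducible_rep ::
    "(real ^ 'n) set \<Rightarrow> ((real ^ 'n \<Rightarrow> real ^ 'n) \<Rightarrow> complex ^ 'm ^ 'm) \<Rightarrow> bool" where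
  "irreducible_rep R \<rho> \<longleftrightarrow>
     \<rho> id = mat 1 \<and>
     (\<forall>w\<in>weyl_group R. \<forall>w'\<in>weyl_group R. \<rho> (w \<circ> w') = \<rho> w ** \<rho> w') \<and>
     (\<forall>U. vec.subspace U \<and> (\<forall>w\<in>weyl_group R. \<forall>u\<in>U. \<rho> w *v u \<in> U) \<longrightarrow> U = {0} \<or> U = UNIV)"

definition has_character ::
    "(real ^ 'n) set \<Rightarrow> ((real ^ 'n \<Rightarrow> real ^ 'n) \<Rightarrow> complex ^ 'm ^ 'm) \<Rightarrow>
     ((real ^ 'n \<Rightarrow> real ^ 'n) \<Rightarrow> complex) \<Rightarrow> bool" where
  "has_character R \<rho> ch \<longleftrightarrow> (\<forall>w\<in>weyl_group R. trace (\<rho> w) = ch w)"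

definition linear_character ::
    "(real ^ 'n) set \<Rightarrow> ((real ^ 'n \<Rightarrow> real ^ 'n) \<Rightarrow> complex) \<Rightarrow> bool" where
  "linear_character R ch \<longleftrightarrow>
     ch id = 1 \<and> (\<forall>w\<in>weyl_group R. \<forall>w'\<in>weyl_group R. ch (w \<circ> w') = ch w * ch w')"

definition char_sgn :: "(real ^ 'n \<Rightarrow> real ^ 'n) \<Rightarrow> complex" where
  "char_sgn w = of_real (det (matrix w))"

definition char_std :: "(real ^ 'n \<Rightarrow> real ^ 'n) \<Rightarrow> complex" where
  "char_std w = of_real (trace (matrix w))"

definition triv_rep :: "(real ^ 'n \<Rightarrow> real ^ 'n) \<Rightarrow> complex ^ 1 ^ 1" where
  "triv_rep w = mat 1"

definition twisted_multiplicity ::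
    "((real ^ 'n \<Rightarrow> real ^ 'n) \<Rightarrow> complex) \<Rightarrow> (real ^ 'n \<Rightarrow> complex) \<Rightarrow> real ^ 'n \<Rightarrow> complex" where
  "twisted_multiplicity ch k \<alpha> = ch (reflection \<alpha>) * k \<alpha>"


section \<open>The algebra of endomorphisms of the polynomial space\<close>

text \<open>
  \<open>S(\<aa>\<^sup>*)\<close> is the space of complex-valued polynomial functions on the real form
  \<open>real ^ 'n\<close> of \<open>\<aa> = complex ^ 'n\<close>; elements of \<open>\<aa>\<^sup>*\<close> are the real-linear maps from \<open>real ^ 'n\<close> to
  \<open>complex\<close>. Operators are extensional, i.e. equal to \<open>undefined\<close> outside \<open>poly_space\<close>.
\<close>

type_synonym 'n pfun = "real ^ 'n \<Rightarrow> complex"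
type_synonym 'n pop = "'n pfun \<Rightarrow> 'n pfun"

definition poly_space :: "'n::finite pfun set" where
  "poly_space = {f. polynomial_function f}"

definition End_poly :: "'n::finite pop ring" where
  "End_poly =
     \<lparr>carrier = {A \<in> poly_space \<rightarrow>\<^sub>E poly_space.
        (\<forall>f\<in>poly_space. \<forall>g\<in>poly_space. A (\<lambda>x. f x + g x) = (\<lambda>x. A f x + A g x)) \<and>
        (\<forall>c. \<forall>f\<in>poly_space. A (\<lambda>x. c * f x) = (\<lambda>x. c * A f x))},
      monoid.mult = compose poly_space,
      monoid.one = (\<lambda>f\<in>poly_space. f),
      ring.zero = (\<lambda>f\<in>poly_space. (\<lambda>x. 0)),
      ring.add = (\<lambda>A B. \<lambda>f\<in>poly_space. (\<lambda>x. A f x + B f x))\<rparr>"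

definition scalar_op :: "complex \<Rightarrow> 'n::finite pop" where
  "scalar_op c = (\<lambda>f\<in>poly_space. (\<lambda>x. c * f x))"

definition mult_op :: "('n::finite) pfun \<Rightarrow> 'n pop" where
  "mult_op p = (\<lambda>f\<in>poly_space. (\<lambda>x. p x * f x))"

definition group_op :: "(real ^ 'n::finite \<Rightarrow> real ^ 'n) \<Rightarrow> 'n pop" where
  "group_op w = (\<lambda>f\<in>poly_space. (\<lambda>x. f (inv_into UNIV w x)))"


section \<open>Dunkl operators and the rational Cherednik algebra\<close>

definition root_pairing :: "real ^ 'n \<Rightarrow> complex ^ 'n \<Rightarrow> complex" where
  "root_pairing \<alpha> y = (\<Sum>i\<in>UNIV. of_real (\<alpha> $ i) * y $ i)"

definition dir_deriv :: "complex ^ 'n \<Rightarrow> 'n::finite pfun \<Rightarrow> 'n pfun" where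
  "dir_deriv y f x = (\<Sum>i\<in>UNIV. y $ i * frechet_derivative f (at x) (axis i 1))"

text \<open>The polynomial \<open>(f - r\<^sub>\<alpha> f) / \<alpha>\<close>.\<close>

definition divided_difference :: "real ^ 'n \<Rightarrow> 'n::finite pfun \<Rightarrow> 'n pfun" where
  "divided_difference \<alpha> f =
     (THE g. g \<in> poly_space \<and> (\<forall>x. of_real (\<alpha> \<bullet> x) * g x = f x - f (reflection \<alpha> x)))"

definition dunkl_op ::
    "(real ^ 'n) set \<Rightarrow> (real ^ 'n \<Rightarrow> complex) \<Rightarrow> complex ^ 'n \<Rightarrow> 'n::finite pop" where
  "dunkl_op Rp k y =
     (\<lambda>f\<in>poly_space. (\<lambda>x. dir_deriv y f x +
        (\<Sum>\<alpha>\<in>Rp. k \<alpha> * root_pairing \<alpha> y * divided_difference \<alpha> f x)))"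

definition subalgebra_generated :: "'n::finite pop set \<Rightarrow> 'n pop ring" where
  "subalgebra_generated X =
     End_poly\<lparr>carrier := generate_ring End_poly (range scalar_op \<union> X)\<rparr>"

definition cherednik_algebra ::
    "(real ^ 'n) set \<Rightarrow> (real ^ 'n) set \<Rightarrow> (real ^ 'n \<Rightarrow> complex) \<Rightarrow> 'n::finite pop ring" where
  "cherednik_algebra R Rp k =
     subalgebra_generated
       (group_op ` weyl_group R \<union> mult_op ` {x. linear x} \<union> range (dunkl_op Rp k))"

text \<open>The subalgebra \<open>\<S> \<otimes> \<complex>W\<close> generated by \<open>\<S>\<close> and \<open>W\<close>.\<close>

definition parabolic_subalgebra ::
    "(real ^ 'n) set \<Rightarrow> (real ^ 'n) set \<Rightarrow> (real ^ 'n \<Rightarrow> complex) \<Rightarrow> 'n::finite pop ring" where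
  "parabolic_subalgebra R Rp k =
     subalgebra_generated (group_op ` weyl_group R \<union> range (dunkl_op Rp k))"

text \<open>
  \<open>\<S>\<^sub>+ = \<Oplus>\<^sub>n\<^sub>\<ge>\<^sub>1 T(S\<^sup>n(\<aa>))\<close> consists of the linear combinations of products of one or more
  Dunkl operators.
\<close>

inductive_set S_plus ::
    "(real ^ 'n) set \<Rightarrow> (real ^ 'n \<Rightarrow> complex) \<Rightarrow> 'n::finite pop set"
  for Rp k where
    dunkl: "dunkl_op Rp k y \<in> S_plus Rp k"
  | prod: "s \<in> S_plus Rp k \<Longrightarrow> t \<in> S_plus Rp k \<Longrightarrow> s \<otimes>\<^bsub>End_poly\<^esub> t \<in> S_plus Rp k"
  | add: "s \<in> S_plus Rp k \<Longrightarrow> t \<in> S_plus Rp k \<Longrightarrow> s \<oplus>\<^bsub>End_poly\<^esub> t \<in> S_plus Rp k"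
  | scal: "s \<in> S_plus Rp k \<Longrightarrow> scalar_op c \<otimes>\<^bsub>End_poly\<^esub> s \<in> S_plus Rp k"


section \<open>Left modules over a not necessarily commutative ring\<close>

text \<open>
  Left modules are records of type \<open>module\<close>; the locale \<open>module\<close> requires a commutative ring of
  scalars and is not used. The fields \<open>mult\<close> and \<open>one\<close> play no role for modules.

  \<open>tensor_module H B V\<close> is \<open>H \<otimes>\<^sub>B V\<close> for a subring \<open>B\<close> of \<open>H\<close> and a left \<open>B\<close>-module \<open>V\<close>: the
  free abelian group on the pairs \<open>(h, v)\<close> modulo the balancing relations, where \<open>H\<close> acts by left
  multiplication on the first component.
\<close>

definition tensor_relations ::
    "'h ring \<Rightarrow> 'h ring \<Rightarrow> ('h, 'v) module \<Rightarrow> ('h \<times> 'v \<Rightarrow>\<^sub>0 int) set" where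
  "tensor_relations H B V =
     {frag_of (h \<oplus>\<^bsub>H\<^esub> h', v) - frag_of (h, v) - frag_of (h', v) | h h' v.
        h \<in> carrier H \<and> h' \<in> carrier H \<and> v \<in> carrier V} \<union>
     {frag_of (h, v \<oplus>\<^bsub>V\<^esub> v') - frag_of (h, v) - frag_of (h, v') | h v v'.
        h \<in> carrier H \<and> v \<in> carrier V \<and> v' \<in> carrier V} \<union>
     {frag_of (h \<otimes>\<^bsub>H\<^esub> b, v) - frag_of (h, b \<odot>\<^bsub>V\<^esub> v) | h b v.
        h \<in> carrier H \<and> b \<in> carrier B \<and> v \<in> carrier V}"

definition tensor_module ::
    "'h ring \<Rightarrow> 'h ring \<Rightarrow> ('h, 'v) module \<Rightarrow> ('h, ('h \<times> 'v \<Rightarrow>\<^sub>0 int) set) module" where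
  "tensor_module H B V =
     (let F = free_Abelian_group (carrier H \<times> carrier V);
          K = generate F (tensor_relations H B V)
      in \<lparr>carrier = carrier (F Mod K), monoid.mult = undefined, monoid.one = undefined,
          ring.zero = monoid.one (F Mod K), ring.add = monoid.mult (F Mod K),
          smult = (\<lambda>h X. \<Union>x\<in>X.
            K #>\<^bsub>F\<^esub> frag_extend (\<lambda>(h', v). frag_of (h \<otimes>\<^bsub>H\<^esub> h', v)) x)\<rparr>)"

definition quotient_module ::
    "('h, 'v) module \<Rightarrow> 'v set \<Rightarrow> ('h, 'v set) module" where
  "quotient_module M N =
     \<lparr>carrier = a_rcosets\<^bsub>M\<^esub> N, monoid.mult = undefined, monoid.one = undefined,
      ring.zero = N, ring.add = set_add M,
      smult = (\<lambda>h X. \<Union>x\<in>X. N +>\<^bsub>M\<^esub> (h \<odot>\<^bsub>M\<^esub> x))\<rparr>"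

definition maximal_submodule :: "'h ring \<Rightarrow> ('h, 'v) module \<Rightarrow> 'v set \<Rightarrow> bool" where
  "maximal_submodule H M N \<longleftrightarrow>
     submodule N H M \<and> N \<noteq> carrier M \<and>
     (\<forall>N'. submodule N' H M \<and> N \<subseteq> N' \<longrightarrow> N' = N \<or> N' = carrier M)"

text \<open>
  For a module with a unique simple quotient, that is, with a unique maximal submodule.
\<close>

definition simple_quotient :: "'h ring \<Rightarrow> ('h, 'v) module \<Rightarrow> ('h, 'v set) module" where
  "simple_quotient H M = quotient_module M (THE N. maximal_submodule H M N)"

text \<open>The complex numbers act on a module over an algebra of operators through the scalar operators.\<close>

definition finite_dim :: "('n::finite pop, 'v) module \<Rightarrow> bool" where
  "finite_dim M \<longleftrightarrow>
     (\<exists>B. finite B \<and> B \<subseteq> carrier M \<and>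
        (\<forall>x\<in>carrier M. \<exists>a :: 'v \<Rightarrow> complex. x = (\<Oplus>\<^bsub>M\<^esub>b\<in>B. scalar_op (a b) \<odot>\<^bsub>M\<^esub> b)))"


section \<open>Verma modules and their simple quotients\<close>

text \<open>
  \<open>\<phi>\<close> is the representation of \<open>\<S> \<otimes> \<complex>W\<close> that extends \<open>\<rho>\<close> and kills \<open>\<S>\<^sub>+\<close>. Its values on
  \<open>\<S> \<otimes> \<complex>W\<close> are determined by these conditions, and no other values are used.
\<close>

definition extends_rep ::
    "(real ^ 'n) set \<Rightarrow> (real ^ 'n) set \<Rightarrow> (real ^ 'n \<Rightarrow> complex) \<Rightarrow>
     ((real ^ 'n \<Rightarrow> real ^ 'n) \<Rightarrow> complex ^ 'm ^ 'm) \<Rightarrow> ('n::finite pop \<Rightarrow> complex ^ 'm ^ 'm) \<Rightarrow> bool" where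
  "extends_rep R Rp k \<rho> \<phi> \<longleftrightarrow>
     (let B = parabolic_subalgebra R Rp k in
       (\<forall>b\<in>carrier B. \<forall>b'\<in>carrier B. \<phi> (b \<oplus>\<^bsub>B\<^esub> b') = \<phi> b + \<phi> b') \<and>
       (\<forall>b\<in>carrier B. \<forall>b'\<in>carrier B. \<phi> (b \<otimes>\<^bsub>B\<^esub> b') = \<phi> b ** \<phi> b') \<and>
       (\<forall>c. \<phi> (scalar_op c) = mat c) \<and>
       (\<forall>w\<in>weyl_group R. \<phi> (group_op w) = \<rho> w) \<and>
       (\<forall>s\<in>S_plus Rp k. \<phi> s = 0))"

definition inflated_module ::
    "(real ^ 'n) set \<Rightarrow> (real ^ 'n) set \<Rightarrow> (real ^ 'n \<Rightarrow> complex) \<Rightarrow>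
     ((real ^ 'n \<Rightarrow> real ^ 'n) \<Rightarrow> complex ^ 'm ^ 'm) \<Rightarrow> ('n::finite pop, complex ^ 'm) module" where
  "inflated_module R Rp k \<rho> =
     \<lparr>carrier = UNIV, monoid.mult = undefined, monoid.one = undefined, ring.zero = 0, ring.add = (+),
      smult = (\<lambda>b v. (SOME \<phi>. extends_rep R Rp k \<rho> \<phi>) b *v v)\<rparr>"

text \<open>
  \<open>M(\<chi>,k)\<close> and \<open>L(\<chi>,k)\<close> depend on the choice of \<open>V\<^sub>\<chi>\<close>; the argument \<open>\<rho>\<close> is a matrix
  representation of \<open>W\<close> on \<open>V\<^sub>\<chi> = complex ^ 'm\<close>.
\<close>

definition verma_module ::
    "(real ^ 'n) set \<Rightarrow> (real ^ 'n) set \<Rightarrow> (real ^ 'n \<Rightarrow> complex) \<Rightarrow>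
     ((real ^ 'n \<Rightarrow> real ^ 'n) \<Rightarrow> complex ^ 'm ^ 'm) \<Rightarrow>
     ('n::finite pop, ('n pop \<times> (complex ^ 'm) \<Rightarrow>\<^sub>0 int) set) module" where
  "verma_module R Rp k \<rho> =
     tensor_module (cherednik_algebra R Rp k) (parabolic_subalgebra R Rp k)
       (inflated_module R Rp k \<rho>)"

definition L_module ::
    "(real ^ 'n) set \<Rightarrow> (real ^ 'n) set \<Rightarrow> (real ^ 'n \<Rightarrow> complex) \<Rightarrow>
     ((real ^ 'n \<Rightarrow> real ^ 'n) \<Rightarrow> complex ^ 'm ^ 'm) \<Rightarrow>
     ('n::finite pop, ('n pop \<times> (complex ^ 'm) \<Rightarrow>\<^sub>0 int) set set) module" where
  "L_module R Rp k \<rho> = simple_quotient (cherednik_algebra R Rp k) (verma_module R Rp k \<rho>)"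

definition very_singular ::
    "(real ^ 'n::finite) set \<Rightarrow> (real ^ 'n) set \<Rightarrow> (real ^ 'n \<Rightarrow> complex) \<Rightarrow> bool" where
  "very_singular R Rp k \<longleftrightarrow> finite_dim (L_module R Rp k triv_rep)"


section \<open>The polynomials\<close>

fun Phi_poly :: "nat \<Rightarrow> complex \<Rightarrow> complex \<Rightarrow> complex" where
  "Phi_poly 0 h \<kappa> = 1"
| "Phi_poly (Suc 0) h \<kappa> = \<kappa>"
| "Phi_poly (Suc (Suc q)) h \<kappa> =
     (let p = of_nat (Suc (Suc q)) in
       \<kappa> * Phi_poly (Suc q) h \<kappa> + (p - 1) / 3 * (h + 3 * p - 4) * Phi_poly q h \<kappa>)"

definition phi_poly :: "nat \<Rightarrow> complex \<Rightarrow> complex" where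
  "phi_poly r \<kappa> = Phi_poly r (- (3 * of_nat r - 1)) \<kappa>"

end

theory Submission
  imports Defs "HOL-Library.Function_Algebras"
begin

text \<open>
  The module \<open>L(\<chi>,k)\<close> is the space of polynomials with values in \<open>V\<^sub>\<chi>\<close> modulo the radical of the
  contravariant form, that is, modulo the polynomials whose images under all products of Dunkl
  operators vanish at the origin. It is finite-dimensional if and only if the radical contains all
  polynomials of large degree. The Dunkl Laplacian of powers of the squared norm shows that then
  the scalar \<open>\<zeta>\<close> by which the sum of the \<open>k\<^sub>\<alpha> r\<^sub>\<alpha>\<close>, \<open>\<alpha>\<close> positive, acts on \<open>V\<^sub>\<chi>\<close> is a negative integer \<open>- n\<close>.
  For two-dimensional \<open>V\<^sub>\<chi>\<close> the trace gives \<open>\<zeta> = 0\<close>, which is excluded; for one-dimensional \<open>\<chi>\<close> the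
  problem is the one of the trivial character and of the multiplicity \<open>k\<^sup>\<chi>\<close>.

  For the trivial character \<open>\<zeta> = 3 (k\<^sub>1 + k\<^sub>2)\<close>. If \<open>3\<close> does not divide \<open>n\<close>, the \<open>n\<close>-th power of the squared
  norm is in the radical, and so are large powers of the coordinates. If \<open>n = 3 r\<close>, computing the
  Laplacian on monomials in the basic invariants of degrees \<open>2\<close> and \<open>6\<close> shows that \<open>k\<^sub>1 = 1/2 - i\<close> for some
  \<open>1 \<le> i \<le> r\<close>; conversely, if \<open>k\<^sub>1\<close> and \<open>k\<^sub>2\<close> are both negative half-integers, then suitable powers of the
  product of the short roots and of the product of the long roots are singular.
\<close>

text \<open>The definition presents \<open>L_module\<close> as a quotient of a tensor product over
  an algebra of operators on polynomials, and the first obstacle is to let this algebra act on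
  polynomials with values in another representation. An operator is written as a combination of
  terms \<open>p w T_1^i T_2^j\<close>, and the expression is reread in any representation. The
  result does not depend on the expression, because such normal forms are linearly independent
  already on scalar polynomials (\<open>PBW\<close>). The Euler operator, whose eigenvalue in degree
  d is d + \<zeta>, then shows that the radical is the unique maximal submodule. For \<zeta> = - 3 r
  the descent along powers of the squared norm is blocked, since the Laplacian annihilates the power
  3 r. The way around uses the square \<open>uu\<close> of the product of the short roots, whose
  Laplacian involves \<open>ks\<close> but not \<open>kl\<close>. A single half-integer is enough:
  the sum of the two multiplicities is - r, and i \<le> r makes \<open>kl\<close> a negative
  half-integer as well.\<close>

declare plus_fun_apply [simp del] zero_fun_apply [simp del] times_fun_apply [simp del]
  one_fun_apply [simp del] numeral_fun_apply [simp del] minus_apply [simp del] uminus_apply [simp del]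

section \<open>Complex-valued polynomial functions and their grading\<close>

definition pconst :: "complex \<Rightarrow> ('n::finite) pfun" where
  "pconst c = (\<lambda>_. c)"

definition plin :: "real ^ 'n \<Rightarrow> ('n::finite) pfun" where
  "plin v = (\<lambda>x. of_real (v \<bullet> x))"

definition refl_pull :: "real ^ 'n \<Rightarrow> ('n::finite) pfun \<Rightarrow> 'n pfun" where
  "refl_pull \<alpha> f = (\<lambda>x. f (reflection \<alpha> x))"

definition deriv_along :: "real ^ 'n \<Rightarrow> ('n::finite) pfun \<Rightarrow> 'n pfun" where
  "deriv_along v f = (\<lambda>x. frechet_derivative f (at x) v)"

lemma pconst_apply: "pconst c x = c"
  by (simp add: pconst_def)

lemma plin_apply: "plin v x = of_real (v \<bullet> x)"
  by (simp add: plin_def)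

text \<open>Pointwise evaluation of the ring operations is removed from the simpset above, so that
  polynomials are normalised as elements of a commutative ring; this collection brings it back where
  an identity is checked at a point.\<close>

lemmas fun_apply = plus_fun_apply zero_fun_apply times_fun_apply one_fun_apply numeral_fun_apply
  minus_apply uminus_apply pconst_apply plin_apply

lemma pconst_0 [simp]: "pconst 0 = 0" and pconst_1 [simp]: "pconst 1 = 1"
  by (auto simp: fun_eq_iff fun_apply)

lemma pconst_add: "pconst (a + b) = pconst a + pconst b"
  and pconst_mult: "pconst (a * b) = pconst a * pconst b"
  and pconst_minus: "pconst (- a) = - pconst a"
  and pconst_diff: "pconst (a - b) = pconst a - pconst b"
  by (auto simp: fun_eq_iff fun_apply)

lemma plin_add: "plin (u + v) = plin u + plin v"
  and plin_scale: "plin (c *\<^sub>R v) = pconst (of_real c) * plin v"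
  by (auto simp: fun_eq_iff fun_apply inner_add_left)

lemma poly_space_iff_Re_Im:
  "f \<in> poly_space \<longleftrightarrow>
     real_polynomial_function (\<lambda>x. Re (f x)) \<and> real_polynomial_function (\<lambda>x. Im (f x))"
  by (auto simp: poly_space_def polynomial_function_iff_Basis_inner Basis_complex_def inner_complex_def)

lemma poly_space_pconst [simp, intro]: "pconst c \<in> poly_space"
  by (simp add: poly_space_def pconst_def)

lemma poly_space_0 [simp, intro]: "0 \<in> poly_space" and poly_space_1 [simp, intro]: "1 \<in> poly_space"
  using poly_space_pconst[of 0] poly_space_pconst[of 1] by simp_all

lemma poly_space_add [intro]: "f \<in> poly_space \<Longrightarrow> g \<in> poly_space \<Longrightarrow> f + g \<in> poly_space"
  by (auto simp: poly_space_def plus_fun_def)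

lemma poly_space_diff [intro]: "f \<in> poly_space \<Longrightarrow> g \<in> poly_space \<Longrightarrow> f - g \<in> poly_space"
  by (auto simp: poly_space_def fun_diff_def)

lemma poly_space_uminus [intro]: "f \<in> poly_space \<Longrightarrow> - f \<in> poly_space"
  by (auto simp: poly_space_def fun_Compl_def)

lemma poly_space_mult [intro]: "f \<in> poly_space \<Longrightarrow> g \<in> poly_space \<Longrightarrow> f * g \<in> poly_space"
  by (auto simp: poly_space_iff_Re_Im times_fun_apply intro!: real_polynomial_function_diff real_polynomial_function.intros(3,4))

lemma poly_space_sum [intro]: "(\<And>i. i \<in> I \<Longrightarrow> f i \<in> poly_space) \<Longrightarrow> (\<Sum>i\<in>I. f i) \<in> poly_space"
  by (induction I rule: infinite_finite_induct) auto

lemma poly_space_power [intro]: "f \<in> poly_space \<Longrightarrow> f ^ n \<in> poly_space"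
  by (induction n) auto

lemma poly_space_linear: "linear f \<Longrightarrow> f \<in> poly_space"
  by (simp add: poly_space_def linear_conv_bounded_linear polynomial_function_bounded_linear)

lemma poly_space_compose_linear:
  assumes "f \<in> poly_space" "linear w"
  shows "(\<lambda>x. f (w x)) \<in> poly_space"
proof -
  have "polynomial_function (f \<circ> w)"
    using assms by (intro polynomial_function_compose)
      (auto simp: poly_space_def linear_conv_bounded_linear polynomial_function_bounded_linear)
  then show ?thesis by (simp add: poly_space_def o_def)
qed

lemma linear_plin: "linear (plin v)"
  unfolding linear_iff by (simp add: fun_apply inner_add_right scaleR_conv_of_real[where 'a=complex])

lemma poly_space_plin [simp, intro]: "plin v \<in> poly_space"
  by (rule poly_space_linear[OF linear_plin])

text \<open>Complex functionals are split into real vectors, so that every later induction only has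
  to multiply by \<open>plin v\<close> with v real.\<close>

lemma linear_functional_plin:
  fixes f :: "'n::finite pfun"
  assumes "linear f"
  obtains u v where "f = plin u + pconst \<i> * plin v"
proof -
  have *: "f x = plin (\<chi> i. Re (f (axis i 1))) x + \<i> * plin (\<chi> i. Im (f (axis i 1))) x" for x
  proof -
    have "x = (\<Sum>i\<in>UNIV. (x $ i) *\<^sub>R axis i 1)"
      by (simp add: vec_eq_iff axis_def if_distrib cong: if_cong)
    then have "f x = f (\<Sum>i\<in>UNIV. (x $ i) *\<^sub>R axis i 1)" by (rule arg_cong)
    also have "\<dots> = (\<Sum>i\<in>UNIV. (x $ i) *\<^sub>R f (axis i 1))"
      by (simp add: linear_sum[OF assms] linear_cmul[OF assms])
    also have "\<dots> = plin (\<chi> i. Re (f (axis i 1))) x + \<i> * plin (\<chi> i. Im (f (axis i 1))) x"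
      by (simp add: fun_apply complex_eq_iff inner_vec_def mult.commute)
    finally show ?thesis .
  qed
  have "f = plin (\<chi> i. Re (f (axis i 1))) + pconst \<i> * plin (\<chi> i. Im (f (axis i 1)))"
    by (rule ext, subst *) (simp add: fun_apply)
  then show ?thesis by (rule that)
qed

text \<open>Homogeneity is generated by multiplication with linear forms instead of being stated by
  scaling: this gives the induction along which operators of degree - 1 are followed. The zero
  function has every degree.\<close>

inductive homogeneous :: "nat \<Rightarrow> ('n::finite) pfun \<Rightarrow> bool" where
  homogeneous_const: "homogeneous 0 (pconst c)"
| homogeneous_0: "homogeneous d 0"
| homogeneous_add: "homogeneous d f \<Longrightarrow> homogeneous d g \<Longrightarrow> homogeneous d (f + g)"
| homogeneous_plin: "homogeneous d f \<Longrightarrow> homogeneous (Suc d) (plin v * f)"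

lemma homogeneous_poly_space: "homogeneous d f \<Longrightarrow> f \<in> poly_space"
  by (induction rule: homogeneous.induct) auto

lemma homogeneous_cmult: "homogeneous d f \<Longrightarrow> homogeneous d (pconst c * f)"
proof (induction rule: homogeneous.induct)
  case (homogeneous_const a)
  then show ?case using homogeneous.homogeneous_const[of "c * a"] by (simp add: pconst_mult)
next
  case (homogeneous_plin d f v)
  then show ?case using homogeneous.homogeneous_plin[of d "pconst c * f" v] by (simp add: mult.left_commute)
qed (auto simp: homogeneous.homogeneous_0 distrib_left intro: homogeneous.homogeneous_add)

lemma homogeneous_mult: "homogeneous d f \<Longrightarrow> homogeneous e g \<Longrightarrow> homogeneous (d + e) (f * g)"
proof (induction rule: homogeneous.induct)
  case (homogeneous_const c)
  then show ?case by (simp add: homogeneous_cmult)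
qed (auto simp: homogeneous.homogeneous_0 distrib_right mult.assoc
      intro: homogeneous.homogeneous_add homogeneous.homogeneous_plin)

lemma homogeneous_sum: "(\<And>i. i \<in> I \<Longrightarrow> homogeneous d (f i)) \<Longrightarrow> homogeneous d (\<Sum>i\<in>I. f i)"
  by (induction I rule: infinite_finite_induct)
    (auto intro: homogeneous_0 homogeneous_add)

lemma homogeneous_power: "homogeneous d f \<Longrightarrow> homogeneous (d * n) (f ^ n)"
proof (induction n)
  case 0
  then show ?case using homogeneous_const[of 1] by simp
qed (auto dest: homogeneous_mult)

lemma homogeneous_plin1: "homogeneous 1 (plin v)"
  using homogeneous_plin[OF homogeneous_const[of 1], of v] by simp

lemma homogeneous_0_iff: "homogeneous 0 f \<Longrightarrow> f = pconst (f 0)"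
proof (induction "0::nat" f rule: homogeneous.induct)
  case (homogeneous_add f g)
  then show ?case by (metis pconst_add plus_fun_apply)
qed (auto simp: fun_eq_iff fun_apply)

lemma homogeneous_Suc_at_0: "homogeneous (Suc d) f \<Longrightarrow> f 0 = 0"
  by (induction "Suc d" f rule: homogeneous.induct) (auto simp: fun_apply)

text \<open>Once identified with \<open>poly_space\<close>, this set provides an induction principle
  that reduces operator identities to constants, sums and products with one linear form.\<close>

inductive_set polys :: "('n::finite) pfun set" where
  polys_const: "pconst c \<in> polys"
| polys_add: "f \<in> polys \<Longrightarrow> g \<in> polys \<Longrightarrow> f + g \<in> polys"
| polys_plin: "f \<in> polys \<Longrightarrow> plin v * f \<in> polys"

lemma polys_mult: "f \<in> polys \<Longrightarrow> g \<in> polys \<Longrightarrow> f * g \<in> polys"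
proof (induction rule: polys.induct)
  case (polys_const c)
  from polys_const show ?case
  proof (induction rule: polys.induct)
    case (polys_const a)
    then show ?case using polys.polys_const[of "c * a"] by (simp add: pconst_mult)
  next
    case (polys_plin f v)
    then show ?case using polys.polys_plin[of "pconst c * f" v] by (simp add: mult.left_commute)
  qed (auto simp: distrib_left intro: polys.polys_add)
qed (auto simp: distrib_right mult.assoc intro: polys.polys_add polys.polys_plin)

lemma polys_eq: "(polys :: 'a::finite pfun set) = poly_space"
proof (intro equalityI subsetI)
  fix f :: "'a::finite pfun" assume "f \<in> polys"
  then show "f \<in> poly_space" by induction auto
next
  have real: "(\<lambda>x. complex_of_real (f x)) \<in> polys"
    if "real_polynomial_function f" for f :: "real ^ 'a::finite \<Rightarrow> real"
    using that
  proof induction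
    case (linear f)
    then have "linear f" by (rule bounded_linear.linear)
    then have lin: "linear (\<lambda>x. complex_of_real (f x))"
      by (intro linearI) (simp_all add: linear_add linear_cmul scaleR_conv_of_real[where 'a=complex])
    then obtain u v where "(\<lambda>x. complex_of_real (f x)) = plin u + pconst \<i> * plin v"
      by (rule linear_functional_plin)
    moreover have "plin w \<in> polys" for w :: "real ^ 'a"
      using polys_plin[OF polys_const[of 1], of w] by simp
    ultimately show ?case by (auto intro!: polys_add polys_mult polys_const)
  next
    case (const c)
    then show ?case using polys_const[of "of_real c"] by (simp add: pconst_def)
  next
    case (add f g)
    then show ?case using polys_add[OF add.IH] by (simp add: plus_fun_def)
  next
    case (mult f g)
    then show ?case using polys_mult[OF mult.IH] by (simp add: times_fun_def)
  qed
  fix f :: "'a::finite pfun" assume "f \<in> poly_space"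
  then have "(\<lambda>x. complex_of_real (Re (f x))) + pconst \<i> * (\<lambda>x. complex_of_real (Im (f x))) \<in> polys"
    by (intro polys_add polys_mult real) (auto simp: poly_space_iff_Re_Im polys_const)
  moreover have "(\<lambda>x. complex_of_real (Re (f x))) + pconst \<i> * (\<lambda>x. complex_of_real (Im (f x))) = f"
    by (auto simp: fun_eq_iff fun_apply complex_eq_iff)
  ultimately show "f \<in> polys" by simp
qed

lemma poly_space_induct [consumes 1, case_names const add plin]:
  assumes "f \<in> poly_space"
    and "\<And>c. Q (pconst c)"
    and "\<And>f g. f \<in> poly_space \<Longrightarrow> g \<in> poly_space \<Longrightarrow> Q f \<Longrightarrow> Q g \<Longrightarrow> Q (f + g)"
    and "\<And>f v. f \<in> poly_space \<Longrightarrow> Q f \<Longrightarrow> Q (plin v * f)"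
  shows "Q f"
proof -
  have "f \<in> polys" using assms(1) by (simp add: polys_eq)
  then show ?thesis
    by induction (auto simp: polys_eq intro: assms(2-4))
qed

lemma homogeneous_decomposition:
  assumes "f \<in> poly_space"
  obtains N g where "\<And>d. homogeneous d (g d)" "f = (\<Sum>d<N. g d)"
proof -
  \<comment> \<open>Vanishing of the components beyond N is carried along so that two decompositions
    can be extended to a common bound.\<close>
  have "\<exists>N g. (\<forall>d. homogeneous d (g d)) \<and> (\<forall>d\<ge>N. g d = 0) \<and> f = (\<Sum>d<N. g d)"
    using assms
  proof (induction rule: poly_space_induct)
    case (const c)
    show ?case
      by (rule exI[of _ 1], rule exI[of _ "\<lambda>d. if d = 0 then pconst c else 0"])
        (auto simp: homogeneous_0 homogeneous_const)
  next
    case (add f f')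
    then obtain N g N' g' where *: "\<forall>d. homogeneous d (g d)" "\<forall>d\<ge>N. g d = 0" "f = (\<Sum>d<N. g d)"
      "\<forall>d. homogeneous d (g' d)" "\<forall>d\<ge>N'. g' d = 0" "f' = (\<Sum>d<N'. g' d)" by metis
    have "f = (\<Sum>d<max N N'. g d)" "f' = (\<Sum>d<max N N'. g' d)"
      using * by (auto intro!: sum.mono_neutral_left)
    then have "f + f' = (\<Sum>d<max N N'. g d + g' d)" by (simp add: sum.distrib)
    then show ?case using *
      by (intro exI[of _ "max N N'"] exI[of _ "\<lambda>d. g d + g' d"]) (auto intro: homogeneous_add)
  next
    case (plin f v)
    then obtain N g where *: "\<forall>d. homogeneous d (g d)" "\<forall>d\<ge>N. g d = 0" "f = (\<Sum>d<N. g d)"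
      by metis
    define g' where "g' d = (case d of 0 \<Rightarrow> 0 | Suc d \<Rightarrow> plin v * g d)" for d
    have "plin v * f = (\<Sum>d<Suc N. g' d)"
      unfolding sum.lessThan_Suc_shift by (simp add: *(3) g'_def sum_distrib_left)
    then show ?case using *
      by (intro exI[of _ "Suc N"] exI[of _ g'])
        (auto simp: g'_def homogeneous_0 homogeneous_plin split: nat.splits)
  qed
  then show ?thesis using that by metis
qed

subsection \<open>Derivatives\<close>

lemma poly_space_differentiable: "f \<in> poly_space \<Longrightarrow> f differentiable (at x)"
  by (simp add: poly_space_def differentiable_at_polynomial_function)

lemma poly_space_has_derivative:
  "f \<in> poly_space \<Longrightarrow> (f has_derivative (\<lambda>v. deriv_along v f x)) (at x)"
  using poly_space_differentiable[of f x] by (simp add: deriv_along_def frechet_derivative_works)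

lemma deriv_alongI:
  assumes "\<And>x. (f has_derivative (\<lambda>v. f' v x)) (at x)"
  shows "deriv_along v f = f' v"
  unfolding deriv_along_def using frechet_derivative_at[OF assms] by (metis ext)

lemma deriv_along_pconst [simp]: "deriv_along v (pconst c) = 0"
  by (subst deriv_alongI[where f' = "\<lambda>v x. 0"]) (auto simp: pconst_def zero_fun_def)

lemma deriv_along_0 [simp]: "deriv_along v 0 = 0" and deriv_along_1 [simp]: "deriv_along v 1 = 0"
  using deriv_along_pconst[of v 0] deriv_along_pconst[of v 1] by simp_all

lemma deriv_along_plin [simp]: "deriv_along v (plin u) = pconst (of_real (u \<bullet> v))"
  by (subst deriv_alongI[where f' = "\<lambda>v x. of_real (u \<bullet> v)"])
    (auto simp: plin_def pconst_def intro!: derivative_eq_intros)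

lemma deriv_along_add:
  assumes "f \<in> poly_space" "g \<in> poly_space"
  shows "deriv_along v (f + g) = deriv_along v f + deriv_along v g"
proof (subst deriv_alongI[where f' = "\<lambda>v x. deriv_along v f x + deriv_along v g x"])
  show "(f + g has_derivative (\<lambda>v. deriv_along v f x + deriv_along v g x)) (at x)" for x
    unfolding plus_fun_def using assms by (intro has_derivative_add poly_space_has_derivative)
qed (simp add: fun_eq_iff fun_apply)

lemma deriv_along_mult:
  assumes "f \<in> poly_space" "g \<in> poly_space"
  shows "deriv_along v (f * g) = f * deriv_along v g + deriv_along v f * g"
proof (subst deriv_alongI[where f' = "\<lambda>v x. f x * deriv_along v g x + deriv_along v f x * g x"])
  show "(f * g has_derivative (\<lambda>v. f x * deriv_along v g x + deriv_along v f x * g x)) (at x)" for x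
    unfolding times_fun_def using assms by (intro has_derivative_mult poly_space_has_derivative)
qed (simp add: fun_eq_iff fun_apply)

lemma deriv_along_cmult: "f \<in> poly_space \<Longrightarrow> deriv_along v (pconst c * f) = pconst c * deriv_along v f"
  by (simp add: deriv_along_mult)

lemma deriv_along_vector:
  assumes "f \<in> poly_space"
  shows "deriv_along (u + v) f = deriv_along u f + deriv_along v f"
    and "deriv_along (c *\<^sub>R v) f = pconst (of_real c) * deriv_along v f"
  using has_derivative_linear[OF poly_space_has_derivative[OF assms]]
  by (auto simp: fun_eq_iff fun_apply linear_iff scaleR_conv_of_real[where 'a=complex])

lemma poly_space_deriv_along [intro]: "f \<in> poly_space \<Longrightarrow> deriv_along v f \<in> poly_space"
  by (induction rule: poly_space_induct) (auto simp: deriv_along_add deriv_along_mult)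

text \<open>Subtraction is truncated, so degree 0 has its own clause. The clause also serves the
  induction step, where a linear form times a derivative of degree d - 1 has degree d only for d >
  0.\<close>

lemma homogeneous_deriv_along:
  "homogeneous d f \<Longrightarrow> (d = 0 \<longrightarrow> deriv_along v f = 0) \<and> homogeneous (d - 1) (deriv_along v f)"
proof (induction rule: homogeneous.induct)
  case (homogeneous_plin d f u)
  have f: "f \<in> poly_space" by (rule homogeneous_poly_space[OF homogeneous_plin.hyps])
  have "homogeneous d (plin u * deriv_along v f)"
  proof (cases d)
    case 0
    then show ?thesis using homogeneous_plin.IH by (simp add: homogeneous_0)
  next
    case (Suc e)
    then show ?thesis using homogeneous_plin.IH by (auto intro: homogeneous.homogeneous_plin)
  qed
  then show ?case
    using f homogeneous_plin.hyps by (auto simp: deriv_along_mult intro: homogeneous_add homogeneous_cmult)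
qed (auto simp: deriv_along_add homogeneous_poly_space intro: homogeneous.intros)

lemma deriv_along_compose_linear:
  assumes "f \<in> poly_space" "linear w"
  shows "deriv_along v (\<lambda>x. f (w x)) = (\<lambda>x. deriv_along (w v) f (w x))"
proof (rule deriv_alongI)
  fix x
  have "(w has_derivative w) (at x)"
    using assms(2) by (simp add: linear_conv_bounded_linear bounded_linear_imp_has_derivative)
  from has_derivative_compose[OF this poly_space_has_derivative[OF assms(1)]]
  show "((\<lambda>x. f (w x)) has_derivative (\<lambda>v. deriv_along (w v) f (w x))) (at x)" .
qed

subsection \<open>Divided differences\<close>

lemma reflection_linear: "linear (reflection \<alpha>)"
  unfolding linear_iff reflection_def
  by (simp add: algebra_simps inner_add_right scaleR_add_left add_divide_distrib)

lemma reflection_involution [simp]: "reflection \<alpha> (reflection \<alpha> x) = x"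
proof (cases "\<alpha> = 0")
  case False
  then have "reflection \<alpha> \<alpha> = - \<alpha>" by (simp add: reflection_def vec_eq_iff)
  then have "reflection \<alpha> (reflection \<alpha> x) = reflection \<alpha> x + (2 * (\<alpha> \<bullet> x) / (\<alpha> \<bullet> \<alpha>)) *\<^sub>R \<alpha>"
    by (subst (2) reflection_def)
      (simp add: linear_diff[OF reflection_linear] linear_cmul[OF reflection_linear])
  then show ?thesis by (simp add: reflection_def)
qed (simp add: reflection_def)

lemma reflection_inner_inner: "reflection \<alpha> x \<bullet> reflection \<alpha> y = x \<bullet> y"
proof (cases "\<alpha> = 0")
  case False
  define c d where "c = 2 * (\<alpha> \<bullet> x) / (\<alpha> \<bullet> \<alpha>)" and "d = 2 * (\<alpha> \<bullet> y) / (\<alpha> \<bullet> \<alpha>)"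
  have cd: "c * (\<alpha> \<bullet> \<alpha>) = 2 * (\<alpha> \<bullet> x)" "d * (\<alpha> \<bullet> \<alpha>) = 2 * (\<alpha> \<bullet> y)"
    using False by (simp_all add: c_def d_def)
  have "reflection \<alpha> x \<bullet> reflection \<alpha> y = (x - c *\<^sub>R \<alpha>) \<bullet> (y - d *\<^sub>R \<alpha>)"
    by (simp only: reflection_def c_def d_def)
  also have "\<dots> = x \<bullet> y - d * (\<alpha> \<bullet> x) - c * (\<alpha> \<bullet> y) + c * d * (\<alpha> \<bullet> \<alpha>)"
    by (simp add: inner_diff_left inner_diff_right inner_commute[of x \<alpha>] right_diff_distrib)
  also have "\<dots> = x \<bullet> y"
  proof -
    have "2 * (d * (\<alpha> \<bullet> x)) = c * d * (\<alpha> \<bullet> \<alpha>)" "2 * (c * (\<alpha> \<bullet> y)) = c * d * (\<alpha> \<bullet> \<alpha>)"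
      unfolding mult.left_commute[of 2] cd[symmetric] by simp_all
    then show ?thesis by linarith
  qed
  finally show ?thesis .
qed (simp add: reflection_def)

lemma refl_pull_apply: "refl_pull \<alpha> f x = f (reflection \<alpha> x)"
  by (simp add: refl_pull_def)

lemma refl_pull_simps [simp]:
  "refl_pull \<alpha> (f + g) = refl_pull \<alpha> f + refl_pull \<alpha> g"
  "refl_pull \<alpha> (f - g) = refl_pull \<alpha> f - refl_pull \<alpha> g"
  "refl_pull \<alpha> (- f) = - refl_pull \<alpha> f"
  "refl_pull \<alpha> (f * g) = refl_pull \<alpha> f * refl_pull \<alpha> g"
  "refl_pull \<alpha> (pconst c) = pconst c"
  "refl_pull \<alpha> 0 = 0"
  "refl_pull \<alpha> 1 = 1"
  "refl_pull \<alpha> (refl_pull \<alpha> f) = f"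
  by (auto simp: refl_pull_def fun_eq_iff fun_apply)

lemma refl_pull_plin: "refl_pull \<alpha> (plin v) = plin v - pconst (of_real (2 * (\<alpha> \<bullet> v) / (\<alpha> \<bullet> \<alpha>))) * plin \<alpha>"
  by (auto simp: fun_eq_iff fun_apply refl_pull_def reflection_def inner_diff_right inner_commute)

lemma poly_space_refl_pull [intro]: "f \<in> poly_space \<Longrightarrow> refl_pull \<alpha> f \<in> poly_space"
  unfolding refl_pull_def by (rule poly_space_compose_linear[OF _ reflection_linear])

lemma homogeneous_diff: "homogeneous d f \<Longrightarrow> homogeneous d g \<Longrightarrow> homogeneous d (f - g)"
  using homogeneous_add[OF _ homogeneous_cmult[of d g "-1"], of f] by (simp add: pconst_minus)

lemma homogeneous_refl_pull: "homogeneous d f \<Longrightarrow> homogeneous d (refl_pull \<alpha> f)"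
proof (induction rule: homogeneous.induct)
  case (homogeneous_plin d f v)
  have "homogeneous 1 (refl_pull \<alpha> (plin v))"
    unfolding refl_pull_plin by (intro homogeneous_diff homogeneous_cmult homogeneous_plin1)
  from homogeneous_mult[OF this homogeneous_plin.IH] show ?case by simp
qed (auto intro: homogeneous.intros)

text \<open>Where \<alpha> does not vanish one can divide. Any point is approached along the line
  \<open>x + t *\<^sub>R \<alpha>\<close>, which avoids the hyperplane of \<alpha> for small t
  \<noteq> 0, and continuity concludes.\<close>

lemma plin_cancel:
  assumes "\<alpha> \<noteq> 0" "f \<in> poly_space" "g \<in> poly_space" "plin \<alpha> * f = plin \<alpha> * g"
  shows "f = g"
proof
  fix x
  define h where "h t = f (x + t *\<^sub>R \<alpha>) - g (x + t *\<^sub>R \<alpha>)" for t :: real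
  have "continuous_on UNIV f" "continuous_on UNIV g"
    using assms by (auto simp: poly_space_def continuous_on_polymonial_function)
  moreover have "continuous_on UNIV (\<lambda>t. x + t *\<^sub>R \<alpha>)" by (intro continuous_intros)
  ultimately have "continuous_on UNIV (\<lambda>t. f (x + t *\<^sub>R \<alpha>))" "continuous_on UNIV (\<lambda>t. g (x + t *\<^sub>R \<alpha>))"
    by (metis continuous_on_compose2 subset_UNIV)+
  then have "continuous_on UNIV h" unfolding h_def by (rule continuous_on_diff)
  then have "isCont h 0" by (simp add: continuous_on_eq_continuous_at)
  then have lim: "(h \<longlongrightarrow> h 0) (at 0)" by (simp add: isCont_def)
  have "h t = 0" if "\<alpha> \<bullet> (x + t *\<^sub>R \<alpha>) \<noteq> 0" for t
    using fun_cong[OF assms(4), of "x + t *\<^sub>R \<alpha>"] that by (auto simp: fun_apply h_def)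
  moreover have "eventually (\<lambda>t. \<alpha> \<bullet> (x + t *\<^sub>R \<alpha>) \<noteq> 0) (at 0)"
  proof (cases "\<alpha> \<bullet> x = 0")
    case True
    then show ?thesis using assms(1) by (simp add: eventually_at_filter inner_add_right)
  next
    case False
    have "((\<lambda>t. \<alpha> \<bullet> (x + t *\<^sub>R \<alpha>)) \<longlongrightarrow> \<alpha> \<bullet> (x + 0 *\<^sub>R \<alpha>)) (at 0)"
      by (intro tendsto_intros)
    then show ?thesis using False by (intro tendsto_imp_eventually_ne) auto
  qed
  ultimately have "eventually (\<lambda>t. h t = 0) (at 0)" by (simp add: eventually_mono)
  then have "(h \<longlongrightarrow> 0) (at 0)" by (rule tendsto_eventually)
  with lim have "h 0 = 0" using LIM_unique by blast
  then show "f x = g x" by (simp add: h_def)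
qed

lemma divided_difference_eqI:
  assumes "\<alpha> \<noteq> 0" "g \<in> poly_space" "plin \<alpha> * g = f - refl_pull \<alpha> f"
  shows "divided_difference \<alpha> f = g"
  unfolding divided_difference_def
proof (rule the_equality)
  show "g \<in> poly_space \<and> (\<forall>x. of_real (\<alpha> \<bullet> x) * g x = f x - f (reflection \<alpha> x))"
    using assms(2) fun_cong[OF assms(3)] by (auto simp: fun_apply refl_pull_def)
next
  fix g' assume g': "g' \<in> poly_space \<and> (\<forall>x. of_real (\<alpha> \<bullet> x) * g' x = f x - f (reflection \<alpha> x))"
  then have "plin \<alpha> * g' = plin \<alpha> * g"
    unfolding assms(3) by (auto simp: fun_eq_iff fun_apply refl_pull_def)
  then show "g' = g" using plin_cancel assms g' by metis
qed

text \<open>Existence of the quotient follows a twisted Leibniz rule. With r for the reflection,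
  dividing \<open>v f - r(v) r(f)\<close> by \<alpha> gives v times the quotient for f plus the
  constant quotient of \<open>v - r(v)\<close> times \<open>r(f)\<close>.\<close>

lemma divided_difference_works:
  fixes \<alpha> :: "real ^ 'a"
  assumes "\<alpha> \<noteq> 0" "f \<in> poly_space"
  shows "divided_difference \<alpha> f \<in> poly_space"
    and "plin \<alpha> * divided_difference \<alpha> f = f - refl_pull \<alpha> f"
proof -
  have "\<exists>g \<in> poly_space. plin \<alpha> * g = f - refl_pull \<alpha> f" using assms(2)
  proof (induction rule: poly_space_induct)
    case (const c)
    show ?case by (rule bexI[of _ 0]) auto
  next
    case (add f g)
    then obtain f' g' where "f' \<in> poly_space" "g' \<in> poly_space"
      "plin \<alpha> * f' = f - refl_pull \<alpha> f" "plin \<alpha> * g' = g - refl_pull \<alpha> g" by auto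
    then show ?case by (intro bexI[of _ "f' + g'"]) (auto simp: distrib_left)
  next
    case (plin f v)
    then obtain f' where f': "f' \<in> poly_space" "plin \<alpha> * f' = f - refl_pull \<alpha> f" by auto
    define c :: "'a pfun" where "c = pconst (of_real (2 * (\<alpha> \<bullet> v) / (\<alpha> \<bullet> \<alpha>)))"
    have "plin \<alpha> * (plin v * f' + c * refl_pull \<alpha> f) = plin v * (plin \<alpha> * f') + c * plin \<alpha> * refl_pull \<alpha> f"
      by (simp add: algebra_simps)
    also have "\<dots> = plin v * f - refl_pull \<alpha> (plin v * f)"
      unfolding f' by (simp add: refl_pull_plin c_def algebra_simps)
    finally show ?case using f' plin c_def
      by (intro bexI[of _ "plin v * f' + c * refl_pull \<alpha> f"]) auto
  qed
  then obtain g where g: "g \<in> poly_space" "plin \<alpha> * g = f - refl_pull \<alpha> f" by auto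
  have "divided_difference \<alpha> f = g" by (rule divided_difference_eqI[OF assms(1) g])
  with g show "divided_difference \<alpha> f \<in> poly_space"
    and "plin \<alpha> * divided_difference \<alpha> f = f - refl_pull \<alpha> f" by simp_all
qed

lemma poly_space_divided_difference [intro]:
  "\<alpha> \<noteq> 0 \<Longrightarrow> f \<in> poly_space \<Longrightarrow> divided_difference \<alpha> f \<in> poly_space"
  by (rule divided_difference_works)

lemma divided_difference_invariant:
  "\<alpha> \<noteq> 0 \<Longrightarrow> refl_pull \<alpha> f = f \<Longrightarrow> divided_difference \<alpha> f = 0"
  by (rule divided_difference_eqI) auto

lemma divided_difference_pconst [simp]: "\<alpha> \<noteq> 0 \<Longrightarrow> divided_difference \<alpha> (pconst c) = 0"
  by (rule divided_difference_invariant) auto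

lemma divided_difference_0 [simp]: "\<alpha> \<noteq> 0 \<Longrightarrow> divided_difference \<alpha> 0 = 0"
  using divided_difference_pconst[of \<alpha> 0] by simp

lemma divided_difference_add:
  assumes "\<alpha> \<noteq> 0" "f \<in> poly_space" "g \<in> poly_space"
  shows "divided_difference \<alpha> (f + g) = divided_difference \<alpha> f + divided_difference \<alpha> g"
  using assms divided_difference_works[OF assms(1,2)] divided_difference_works[OF assms(1,3)]
  by (intro divided_difference_eqI) (auto simp: distrib_left)

lemma divided_difference_mult:
  assumes "\<alpha> \<noteq> 0" "f \<in> poly_space" "g \<in> poly_space"
  shows "divided_difference \<alpha> (f * g) =
    f * divided_difference \<alpha> g + divided_difference \<alpha> f * refl_pull \<alpha> g"
proof (rule divided_difference_eqI[OF assms(1)])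
  note works = divided_difference_works[OF assms(1)]
  have "plin \<alpha> * (f * divided_difference \<alpha> g + divided_difference \<alpha> f * refl_pull \<alpha> g) =
    f * (plin \<alpha> * divided_difference \<alpha> g) + (plin \<alpha> * divided_difference \<alpha> f) * refl_pull \<alpha> g"
    by (simp add: algebra_simps)
  also have "\<dots> = f * g - refl_pull \<alpha> (f * g)"
    unfolding works(2)[OF assms(2)] works(2)[OF assms(3)] by (simp add: algebra_simps)
  finally show "plin \<alpha> * (f * divided_difference \<alpha> g + divided_difference \<alpha> f * refl_pull \<alpha> g) =
    f * g - refl_pull \<alpha> (f * g)" .
qed (use assms in auto)

lemma divided_difference_cmult:
  "\<alpha> \<noteq> 0 \<Longrightarrow> f \<in> poly_space \<Longrightarrow>
    divided_difference \<alpha> (pconst c * f) = pconst c * divided_difference \<alpha> f"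
  by (simp add: divided_difference_mult)

lemma divided_difference_plin:
  "\<alpha> \<noteq> 0 \<Longrightarrow> divided_difference \<alpha> (plin v) = pconst (of_real (2 * (\<alpha> \<bullet> v) / (\<alpha> \<bullet> \<alpha>)))"
  by (rule divided_difference_eqI) (auto simp: refl_pull_plin mult.commute)

lemma divided_difference_uminus_root:
  assumes "\<alpha> \<noteq> 0" "f \<in> poly_space"
  shows "divided_difference (- \<alpha>) f = - divided_difference \<alpha> f"
proof (rule divided_difference_eqI)
  have "reflection (- \<alpha>) = reflection \<alpha>" by (auto simp: reflection_def)
  moreover have "plin (- \<alpha>) = - plin \<alpha>" by (auto simp: fun_eq_iff fun_apply)
  ultimately show "plin (- \<alpha>) * - divided_difference \<alpha> f = f - refl_pull (- \<alpha>) f"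
    using divided_difference_works(2)[OF assms] by (simp add: refl_pull_def)
qed (use assms in auto)

lemma homogeneous_divided_difference:
  assumes "\<alpha> \<noteq> 0"
  shows "homogeneous d f \<Longrightarrow>
    (d = 0 \<longrightarrow> divided_difference \<alpha> f = 0) \<and> homogeneous (d - 1) (divided_difference \<alpha> f)"
proof (induction rule: homogeneous.induct)
  case (homogeneous_plin d f u)
  have f: "f \<in> poly_space" by (rule homogeneous_poly_space[OF homogeneous_plin.hyps])
  have "homogeneous d (plin u * divided_difference \<alpha> f)"
  proof (cases d)
    case 0
    then show ?thesis using homogeneous_plin.IH by (simp add: homogeneous_0)
  next
    case (Suc e)
    then show ?thesis using homogeneous_plin.IH by (auto intro: homogeneous.homogeneous_plin)
  qed
  then show ?case
    using f homogeneous_plin.hyps assms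
    by (simp add: divided_difference_mult divided_difference_plin
        homogeneous_add homogeneous_cmult homogeneous_refl_pull)
qed (use assms in \<open>simp_all add: divided_difference_add homogeneous_poly_space homogeneous_0 homogeneous_add\<close>)

section \<open>Vector-valued polynomials and Dunkl operators\<close>

definition pull :: "(real ^ 'n \<Rightarrow> real ^ 'n) \<Rightarrow> ('n::finite) pfun \<Rightarrow> 'n pfun" where
  "pull w f = (\<lambda>x. f (inv_into UNIV w x))"

definition vspace :: "('m \<Rightarrow> ('n::finite) pfun) set" where
  "vspace = {F. \<forall>i. F i \<in> poly_space}"

definition vmul :: "('n::finite) pfun \<Rightarrow> ('m \<Rightarrow> 'n pfun) \<Rightarrow> 'm \<Rightarrow> 'n pfun" where
  "vmul p F = (\<lambda>i. p * F i)"

definition mat_act :: "complex ^ 'm ^ 'm \<Rightarrow> ('m \<Rightarrow> ('n::finite) pfun) \<Rightarrow> 'm \<Rightarrow> 'n pfun" where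
  "mat_act A F = (\<lambda>i. \<Sum>j\<in>UNIV. pconst (A $ i $ j) * F j)"

definition vconst :: "complex ^ 'm \<Rightarrow> 'm \<Rightarrow> ('n::finite) pfun" where
  "vconst v = (\<lambda>i. pconst (v $ i))"

text \<open>Linearity is demanded on polynomials only, because \<open>divided_difference\<close> is
  a definite description without a known value elsewhere.\<close>

definition plinear :: "(('n::finite) pfun \<Rightarrow> 'n pfun) \<Rightarrow> bool" where
  "plinear L \<longleftrightarrow> (\<forall>f\<in>poly_space. L f \<in> poly_space \<and>
     (\<forall>g\<in>poly_space. L (f + g) = L f + L g) \<and> (\<forall>c. L (pconst c * f) = pconst c * L f))"

lemma sum_fun_apply: "(\<Sum>i\<in>I. F i) x = (\<Sum>i\<in>I. F i x)"
  by (induction I rule: infinite_finite_induct) (auto simp: plus_fun_apply zero_fun_apply)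

lemma pconst_sum: "pconst (\<Sum>i\<in>I. c i) = (\<Sum>i\<in>I. pconst (c i))"
  by (induction I rule: infinite_finite_induct) (auto simp: pconst_add)

lemma vspace_iff: "F \<in> vspace \<longleftrightarrow> (\<forall>i. F i \<in> poly_space)"
  by (simp add: vspace_def)

lemma vspaceD: "F \<in> vspace \<Longrightarrow> F i \<in> poly_space"
  by (simp add: vspace_def)

lemma vspace_closed [intro]:
  "0 \<in> vspace"
  "F \<in> vspace \<Longrightarrow> G \<in> vspace \<Longrightarrow> F + G \<in> vspace"
  "F \<in> vspace \<Longrightarrow> G \<in> vspace \<Longrightarrow> F - G \<in> vspace"
  "F \<in> vspace \<Longrightarrow> - F \<in> vspace"
  "p \<in> poly_space \<Longrightarrow> F \<in> vspace \<Longrightarrow> vmul p F \<in> vspace"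
  "F \<in> vspace \<Longrightarrow> mat_act A F \<in> vspace"
  "vconst v \<in> vspace"
  by (auto simp: vspace_def vmul_def mat_act_def vconst_def plus_fun_apply zero_fun_apply
      minus_apply uminus_apply)

lemma vspace_sum [intro]:
  fixes F :: "'i \<Rightarrow> 'm::finite \<Rightarrow> ('n::finite) pfun"
  shows "(\<And>i. i \<in> I \<Longrightarrow> F i \<in> vspace) \<Longrightarrow> (\<Sum>i\<in>I. F i) \<in> vspace"
  by (induction I rule: infinite_finite_induct) auto

lemma vmul_simps:
  "vmul p (F + G) = vmul p F + vmul p G"
  "vmul p (F - G) = vmul p F - vmul p G"
  "vmul (p + q) F = vmul p F + vmul q F"
  "vmul (p - q) F = vmul p F - vmul q F"
  "vmul (- p) F = - vmul p F"
  "vmul (p * q) F = vmul p (vmul q F)"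
  "vmul 0 F = 0" "vmul p 0 = 0" "vmul 1 F = F"
  by (auto simp: vmul_def fun_eq_iff fun_apply algebra_simps)

lemma vmul_sum: "vmul p (\<Sum>i\<in>I. F i) = (\<Sum>i\<in>I. vmul p (F i))"
  by (induction I rule: infinite_finite_induct) (auto simp: vmul_simps)

lemma vmul_commute: "vmul p (vmul q F) = vmul q (vmul p F)"
  by (simp add: vmul_def mult.left_commute)

lemma mat_act_simps:
  fixes F :: "'m::finite \<Rightarrow> ('n::finite) pfun"
  shows "mat_act A (F + G) = mat_act A F + mat_act A G"
    and "mat_act A (vmul p F) = vmul p (mat_act A F)"
    and "mat_act A 0 = (0 :: 'm \<Rightarrow> 'n pfun)"
    and "mat_act (mat 1) F = F"
proof -
  show "mat_act A (F + G) = mat_act A F + mat_act A G"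
    by (simp add: mat_act_def fun_eq_iff[where 'a='m] plus_fun_apply distrib_left sum.distrib)
  show "mat_act A (vmul p F) = vmul p (mat_act A F)"
    by (simp add: mat_act_def vmul_def fun_eq_iff[where 'a='m] sum_distrib_left mult_ac)
  show "mat_act A 0 = (0 :: 'm \<Rightarrow> 'n pfun)"
    by (simp add: mat_act_def fun_eq_iff[where 'a='m] zero_fun_apply)
  show "mat_act (mat 1) F = F"
  proof
    fix i
    have "mat_act (mat 1) F i = (\<Sum>j\<in>UNIV. if j = i then F j else 0)"
      unfolding mat_act_def by (rule sum.cong) (auto simp: mat_def)
    then show "mat_act (mat 1) F i = F i" by simp
  qed
qed

lemma mat_act_mat_act: "mat_act A (mat_act B F) = mat_act (A ** B) F"
proof
  fix i
  have "mat_act A (mat_act B F) i = (\<Sum>j\<in>UNIV. \<Sum>l\<in>UNIV. pconst (A $ i $ j) * pconst (B $ j $ l) * F l)"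
    by (simp add: mat_act_def sum_distrib_left mult.assoc)
  also have "\<dots> = (\<Sum>l\<in>UNIV. \<Sum>j\<in>UNIV. pconst (A $ i $ j) * pconst (B $ j $ l) * F l)"
    by (rule sum.swap)
  also have "\<dots> = mat_act (A ** B) F i"
    by (simp add: mat_act_def matrix_matrix_mult_def pconst_sum pconst_mult sum_distrib_right)
  finally show "mat_act A (mat_act B F) i = mat_act (A ** B) F i" .
qed

lemma mat_act_vconst: "mat_act A (vconst v) = vconst (A *v v)"
  by (simp add: mat_act_def vconst_def matrix_vector_mult_def pconst_sum pconst_mult)

lemma vconst_simps:
  "vconst (v + u) = vconst v + vconst u"
  "vconst 0 = 0"
  "vconst (c *s v) = vmul (pconst c) (vconst v)"
  by (auto simp: vconst_def vmul_def fun_eq_iff pconst_add pconst_mult plus_fun_apply zero_fun_apply)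

lemma plinear_sum:
  assumes "plinear L" "\<And>i. i \<in> I \<Longrightarrow> f i \<in> poly_space"
  shows "L (\<Sum>i\<in>I. f i) = (\<Sum>i\<in>I. L (f i))"
  using assms(2)
proof (induction I rule: infinite_finite_induct)
  case (insert i I)
  then show ?case using assms(1) by (simp add: plinear_def poly_space_sum)
next
  case empty
  have "L (pconst 0 * 0) = pconst 0 * L 0" using assms(1) unfolding plinear_def by blast
  then show ?case by simp
next
  case (infinite A)
  have "L (pconst 0 * 0) = pconst 0 * L 0" using assms(1) unfolding plinear_def by blast
  then show ?case using infinite by simp
qed

lemma plinear_0: "plinear L \<Longrightarrow> L 0 = 0"
  using plinear_sum[of L "{}"] by simp

lemma plinear_mat_act:
  assumes "plinear L" "F \<in> vspace"
  shows "(\<lambda>i. L (mat_act A F i)) = mat_act A (\<lambda>i. L (F i))"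
proof
  fix i
  have "L (mat_act A F i) = (\<Sum>j\<in>UNIV. L (pconst (A $ i $ j) * F j))"
    unfolding mat_act_def using assms by (intro plinear_sum) (auto simp: vspace_iff)
  also have "\<dots> = mat_act A (\<lambda>i. L (F i)) i"
    unfolding mat_act_def using assms by (auto simp: vspace_iff plinear_def intro!: sum.cong)
  finally show "L (mat_act A F i) = mat_act A (\<lambda>i. L (F i)) i" .
qed

lemma plinear_deriv_along: "plinear (deriv_along v)"
  by (auto simp: plinear_def deriv_along_add deriv_along_cmult)

lemma plinear_divided_difference: "\<alpha> \<noteq> 0 \<Longrightarrow> plinear (divided_difference \<alpha>)"
  by (auto simp: plinear_def divided_difference_add divided_difference_cmult)

definition vsingle :: "'m \<Rightarrow> ('n::finite) pfun \<Rightarrow> 'm \<Rightarrow> 'n pfun" where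
  "vsingle i f = (\<lambda>j. if j = i then f else 0)"

lemma vsingle_vmul: "vsingle i f = vmul f (vconst (axis i 1))"
  by (auto simp: vsingle_def vmul_def vconst_def axis_def fun_eq_iff)

lemma vspace_sum_vsingle: "F = (\<Sum>i\<in>UNIV. vsingle (i::'m::finite) (F i))"
  by (auto simp: fun_eq_iff[where 'a='m] sum_fun_apply vsingle_def)

lemma vspace_induct [consumes 1, case_names const add plin]:
  fixes F :: "'m::finite \<Rightarrow> ('n::finite) pfun"
  assumes "F \<in> vspace"
    and const: "\<And>v. Q (vconst v)"
    and add: "\<And>F G. F \<in> vspace \<Longrightarrow> G \<in> vspace \<Longrightarrow> Q F \<Longrightarrow> Q G \<Longrightarrow> Q (F + G)"
    and plin: "\<And>F v. F \<in> vspace \<Longrightarrow> Q F \<Longrightarrow> Q (vmul (plin v) F)"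
  shows "Q F"
proof -
  have single: "Q (vsingle i f)" if "f \<in> poly_space" for f and i :: 'm
    using that
  proof (induction rule: poly_space_induct)
    case (const c)
    have "vsingle i (pconst c) = vconst (axis i c)"
      by (auto simp: vsingle_def vconst_def axis_def fun_eq_iff)
    then show ?case using assms(2) by metis
  next
    case (add f g)
    have "vsingle i (f + g) = vsingle i f + vsingle i g"
      by (simp add: vsingle_vmul vmul_simps)
    then show ?case using add assms(3) by (simp add: vspace_def vsingle_def)
  next
    case (plin f v)
    have "vsingle i (plin v * f) = vmul (plin v) (vsingle i f)"
      by (simp add: vsingle_vmul vmul_simps)
    then show ?case using plin assms(4) by (simp add: vspace_def vsingle_def)
  qed
  have "Q (\<Sum>i\<in>I. vsingle i (F i)) \<and> (\<Sum>i\<in>I. vsingle i (F i)) \<in> vspace" for I :: "'m set"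
  proof (induction I rule: infinite_finite_induct)
    case (insert i I)
    moreover have "vsingle i (F i) \<in> vspace"
      using assms(1) by (auto simp: vspace_def vsingle_def)
    moreover have "Q (vsingle i (F i))" by (rule single) (use assms(1) in \<open>simp add: vspace_iff\<close>)
    ultimately show ?case using add by auto
  qed (use const[of 0] in \<open>auto simp: vconst_simps\<close>)
  then show ?thesis using vspace_sum_vsingle[of F] by metis
qed

text \<open>The general theory is developed for root systems in a plane. The orthonormal pair e1, e2
  lets two commuting operators generate all Dunkl operators; type G2 enters only with the locale
  \<open>g2_setting\<close>.\<close>

locale root_data =
  fixes R :: "(real ^ 'n::finite) set" and e1 e2 :: "real ^ 'n" and k :: "real ^ 'n \<Rightarrow> complex"
  assumes finite_R: "finite R" and zero_notin_R: "0 \<notin> R" and span_R: "span R = UNIV"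
    and reflection_R: "\<alpha> \<in> R \<Longrightarrow> \<beta> \<in> R \<Longrightarrow> reflection \<alpha> \<beta> \<in> R"
    and k_invariant: "multiplicity_function R k"
    and orthonormal: "e1 \<bullet> e1 = 1" "e2 \<bullet> e2 = 1" "e1 \<bullet> e2 = 0"
    and coordinates: "x = (x \<bullet> e1) *\<^sub>R e1 + (x \<bullet> e2) *\<^sub>R e2"
begin

abbreviation W where "W \<equiv> weyl_group R"

lemma R_nonzero: "\<alpha> \<in> R \<Longrightarrow> \<alpha> \<noteq> 0"
  using zero_notin_R by blast

lemma reflection_W: "\<alpha> \<in> R \<Longrightarrow> reflection \<alpha> \<in> W"
  using weyl_group.refl[OF weyl_group.id, of \<alpha>] by simp

lemma W_comp: "u \<in> W \<Longrightarrow> w \<in> W \<Longrightarrow> u \<circ> w \<in> W"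
  by (induction rule: weyl_group.induct) (auto simp: comp_assoc intro: weyl_group.refl)

lemma W_linear: "w \<in> W \<Longrightarrow> linear w"
proof (induction rule: weyl_group.induct)
  case (refl w \<alpha>)
  from linear_compose[OF refl(3) reflection_linear] show ?case .
qed (simp add: linear_iff)

lemma W_inner: "w \<in> W \<Longrightarrow> w x \<bullet> w y = x \<bullet> y"
  by (induction rule: weyl_group.induct) (auto simp: reflection_inner_inner)

lemma reflection_o [simp]: "reflection \<alpha> \<circ> reflection \<alpha> = id"
  by auto

lemma bij_reflection: "bij (reflection \<alpha>)"
  by (rule o_bij[of "reflection \<alpha>"]) simp_all

lemma inv_reflection [simp]: "inv_into UNIV (reflection \<alpha>) = reflection \<alpha>"
  by (rule inv_unique_comp) simp_all

lemma W_bij: "w \<in> W \<Longrightarrow> bij w"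
proof (induction rule: weyl_group.induct)
  case (refl w \<alpha>)
  from bij_comp[OF refl(3) bij_reflection] show ?case .
qed (rule bij_id)

lemma W_inv: "w \<in> W \<Longrightarrow> inv_into UNIV w \<in> W"
proof (induction rule: weyl_group.induct)
  case (refl w \<alpha>)
  have "inv_into UNIV (reflection \<alpha> \<circ> w) = inv_into UNIV w \<circ> reflection \<alpha>"
    using o_inv_distrib[OF bij_reflection W_bij[OF refl(1)], of \<alpha>] by simp
  then show ?case using W_comp[OF refl(3) reflection_W[OF refl(2)]] by metis
qed (simp only: inv_id weyl_group.id)

lemma W_inv_apply [simp]: "w \<in> W \<Longrightarrow> inv_into UNIV w (w x) = x" "w \<in> W \<Longrightarrow> w (inv_into UNIV w x) = x"
  by (auto simp: W_bij bij_is_inj bij_is_surj surj_f_inv_f)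

lemma W_inv_linear: "w \<in> W \<Longrightarrow> linear (inv_into UNIV w)"
  using W_linear W_inv by blast

lemma W_inner_inv: "w \<in> W \<Longrightarrow> inv_into UNIV w x \<bullet> y = x \<bullet> w y"
  using W_inner[of w "inv_into UNIV w x" y] by simp

lemma W_R: "w \<in> W \<Longrightarrow> \<alpha> \<in> R \<Longrightarrow> w \<alpha> \<in> R"
  by (induction rule: weyl_group.induct) (auto intro: reflection_R)

lemma W_bij_R: "w \<in> W \<Longrightarrow> bij_betw w R R"
  by (intro bij_betw_byWitness[of _ "inv_into UNIV w"]) (auto simp: W_R W_inv)

lemma k_W: "w \<in> W \<Longrightarrow> \<alpha> \<in> R \<Longrightarrow> k (w \<alpha>) = k \<alpha>"
  using k_invariant by (simp add: multiplicity_function_def)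

lemma reflection_W_conj:
  assumes "w \<in> W" shows "reflection (w \<alpha>) \<circ> w = w \<circ> reflection \<alpha>"
  using assms by (auto simp: fun_eq_iff reflection_def W_inner linear_diff[OF W_linear] linear_cmul[OF W_linear])

text \<open>R spans the space, so an element of W is determined by its restriction to the finite set
  R, which it maps into itself.\<close>

lemma finite_W: "finite W"
proof (rule inj_on_finite)
  show "inj_on (\<lambda>w. restrict w R) W"
  proof (rule inj_onI)
    fix u w assume *: "u \<in> W" "w \<in> W" "restrict u R = restrict w R"
    show "u = w"
    proof
      fix x
      have "x \<in> span R" by (simp add: span_R)
      moreover have "u y = w y" if "y \<in> R" for y
        using fun_cong[OF *(3), of y] that by simp
      ultimately show "u x = w x"
        using linear_eq_on[OF W_linear[OF *(1)] W_linear[OF *(2)]] by blast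
    qed
  qed
  show "(\<lambda>w. restrict w R) ` W \<subseteq> R \<rightarrow>\<^sub>E R" by (auto simp: W_R)
  show "finite (R \<rightarrow>\<^sub>E R)" by (intro finite_PiE finite_R)
qed

lemma uminus_R: "\<alpha> \<in> R \<Longrightarrow> - \<alpha> \<in> R"
proof -
  assume \<alpha>: "\<alpha> \<in> R"
  have "reflection \<alpha> \<alpha> = - \<alpha>" using R_nonzero[OF \<alpha>] by (simp add: reflection_def vec_eq_iff)
  then show ?thesis using reflection_R[OF \<alpha> \<alpha>] by simp
qed

lemma k_uminus: "\<alpha> \<in> R \<Longrightarrow> k (- \<alpha>) = k \<alpha>"
proof -
  assume \<alpha>: "\<alpha> \<in> R"
  have "reflection \<alpha> \<alpha> = - \<alpha>" using R_nonzero[OF \<alpha>] by (simp add: reflection_def vec_eq_iff)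
  then show ?thesis using k_W[OF reflection_W[OF \<alpha>] \<alpha>] by simp
qed

lemma pull_simps [simp]:
  "pull w (f + g) = pull w f + pull w g"
  "pull w (f - g) = pull w f - pull w g"
  "pull w (f * g) = pull w f * pull w g"
  "pull w (pconst c) = pconst c"
  "pull w 0 = 0" "pull w 1 = 1"
  by (auto simp: pull_def fun_eq_iff fun_apply)

lemma pull_reflection: "pull (reflection \<alpha>) f = refl_pull \<alpha> f"
  by (simp add: pull_def refl_pull_def)

lemma pull_plin: "w \<in> W \<Longrightarrow> pull w (plin v) = plin (w v)"
  by (auto simp: pull_def fun_eq_iff fun_apply W_inner_inv inner_commute[of v] inner_commute[of "w v"])

lemma poly_space_pull [intro]: "w \<in> W \<Longrightarrow> f \<in> poly_space \<Longrightarrow> pull w f \<in> poly_space"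
  unfolding pull_def by (rule poly_space_compose_linear) (auto intro: W_inv_linear)

lemma plinear_pull: "w \<in> W \<Longrightarrow> plinear (pull w)"
  by (auto simp: plinear_def)

lemma pull_comp: "u \<in> W \<Longrightarrow> w \<in> W \<Longrightarrow> pull (u \<circ> w) f = pull u (pull w f)"
  by (simp add: pull_def o_inv_distrib W_bij)

lemma pull_deriv_along:
  assumes "w \<in> W" "f \<in> poly_space"
  shows "pull w (deriv_along v f) = deriv_along (w v) (pull w f)"
  using deriv_along_compose_linear[OF assms(2) W_inv_linear[OF assms(1)], of "w v"] assms(1)
  by (simp add: pull_def)

lemma pull_divided_difference:
  assumes "w \<in> W" "f \<in> poly_space" "\<alpha> \<in> R"
  shows "pull w (divided_difference \<alpha> f) = divided_difference (w \<alpha>) (pull w f)"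
proof (rule divided_difference_eqI[symmetric])
  show "w \<alpha> \<noteq> 0" using W_R[OF assms(1,3)] R_nonzero by blast
  have "pull w (refl_pull \<alpha> f) = refl_pull (w \<alpha>) (pull w f)"
    unfolding pull_reflection[symmetric]
    using assms by (simp add: pull_comp[symmetric] reflection_W W_R reflection_W_conj)
  then have "plin (w \<alpha>) * pull w (divided_difference \<alpha> f) = pull w (plin \<alpha> * divided_difference \<alpha> f)"
    using assms by (simp add: pull_plin)
  then show "plin (w \<alpha>) * pull w (divided_difference \<alpha> f) = pull w f - refl_pull (w \<alpha>) (pull w f)"
    using divided_difference_works(2)[OF R_nonzero[OF assms(3)] assms(2)]
      \<open>pull w (refl_pull \<alpha> f) = refl_pull (w \<alpha>) (pull w f)\<close> by simp
qed (use assms R_nonzero in auto)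

section \<open>Dunkl operators with coefficients in a representation\<close>

definition weyl_rep :: "((real ^ 'n \<Rightarrow> real ^ 'n) \<Rightarrow> complex ^ 'm ^ 'm) \<Rightarrow> bool" where
  "weyl_rep \<rho> \<longleftrightarrow> \<rho> id = mat 1 \<and> (\<forall>w\<in>W. \<forall>w'\<in>W. \<rho> (w \<circ> w') = \<rho> w ** \<rho> w')"

lemma weyl_repD: "weyl_rep \<rho> \<Longrightarrow> u \<in> W \<Longrightarrow> w \<in> W \<Longrightarrow> \<rho> (u \<circ> w) = \<rho> u ** \<rho> w"
  by (simp add: weyl_rep_def)

definition vW :: "((real ^ 'n \<Rightarrow> real ^ 'n) \<Rightarrow> complex ^ 'm ^ 'm) \<Rightarrow> (real ^ 'n \<Rightarrow> real ^ 'n) \<Rightarrow>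
    ('m \<Rightarrow> 'n pfun) \<Rightarrow> 'm \<Rightarrow> 'n pfun" where
  "vW \<rho> w F = mat_act (\<rho> w) (\<lambda>i. pull w (F i))"

definition dunkl_coeff :: "real ^ 'n \<Rightarrow> real ^ 'n \<Rightarrow> complex" where
  "dunkl_coeff \<alpha> v = k \<alpha> * of_real (\<alpha> \<bullet> v) / 2"

text \<open>Summing over all roots with weight one half makes the operator manifestly independent of the
  positive system and equivariant.\<close>

definition vT :: "((real ^ 'n \<Rightarrow> real ^ 'n) \<Rightarrow> complex ^ 'm ^ 'm) \<Rightarrow> real ^ 'n \<Rightarrow>
    ('m \<Rightarrow> 'n pfun) \<Rightarrow> 'm \<Rightarrow> 'n pfun" where
  "vT \<rho> v F = (\<lambda>i. deriv_along v (F i)) + (\<Sum>\<alpha>\<in>R. vmul (pconst (dunkl_coeff \<alpha> v))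
     (mat_act (\<rho> (reflection \<alpha>)) (\<lambda>i. divided_difference \<alpha> (F i))))"

lemma vW_closed [intro]: "w \<in> W \<Longrightarrow> F \<in> vspace \<Longrightarrow> vW \<rho> w F \<in> vspace"
  unfolding vW_def by (intro vspace_closed) (auto simp: vspace_iff)

lemma vT_closed [intro]: "F \<in> vspace \<Longrightarrow> vT \<rho> v F \<in> vspace"
  unfolding vT_def
  by (intro vspace_closed vspace_sum) (auto simp: vspace_iff intro!: poly_space_divided_difference[OF R_nonzero])

lemma vW_simps:
  "vW \<rho> w (F + G) = vW \<rho> w F + vW \<rho> w G"
  "vW \<rho> w (vmul p F) = vmul (pull w p) (vW \<rho> w F)"
  "vW \<rho> w 0 = 0"
proof -
  have *: "(\<lambda>i. pull w ((F + G) i)) = (\<lambda>i. pull w (F i)) + (\<lambda>i. pull w (G i))"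
    "(\<lambda>i. pull w (vmul p F i)) = vmul (pull w p) (\<lambda>i. pull w (F i))"
    "(\<lambda>i. pull w (0 i)) = (0 :: 'a \<Rightarrow> 'n pfun)"
    by (simp_all add: fun_eq_iff[where 'a='a] plus_fun_apply zero_fun_apply vmul_def)
  show "vW \<rho> w (F + G) = vW \<rho> w F + vW \<rho> w G"
    "vW \<rho> w (vmul p F) = vmul (pull w p) (vW \<rho> w F)" "vW \<rho> w 0 = 0"
    unfolding vW_def * by (simp_all add: mat_act_simps)
qed

lemma vW_const: "vW \<rho> w (vconst v) = vconst (\<rho> w *v v)"
  by (simp add: vW_def vconst_def) (simp add: mat_act_vconst[unfolded vconst_def])

lemma vW_comp:
  assumes "weyl_rep \<rho>" "u \<in> W" "w \<in> W" "F \<in> vspace"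
  shows "vW \<rho> (u \<circ> w) F = vW \<rho> u (vW \<rho> w F)"
proof -
  have "(\<lambda>i. pull u (mat_act (\<rho> w) (\<lambda>i. pull w (F i)) i)) = mat_act (\<rho> w) (\<lambda>i. pull u (pull w (F i)))"
    using assms by (intro plinear_mat_act plinear_pull) (auto simp: vspace_iff)
  then show ?thesis using assms
    by (simp add: vW_def mat_act_mat_act weyl_rep_def pull_comp)
qed

lemma vW_id: "weyl_rep \<rho> \<Longrightarrow> vW \<rho> id F = F"
  by (simp add: vW_def weyl_rep_def mat_act_simps pull_def)

lemma vT_add:
  assumes "F \<in> vspace" "G \<in> vspace"
  shows "vT \<rho> v (F + G) = vT \<rho> v F + vT \<rho> v G"
proof -
  have "(\<lambda>i. deriv_along v ((F + G) i)) = (\<lambda>i. deriv_along v (F i)) + (\<lambda>i. deriv_along v (G i))"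
    using assms by (simp add: fun_eq_iff[where 'a='a] plus_fun_apply vspace_iff deriv_along_add)
  moreover have "(\<lambda>i. divided_difference \<alpha> ((F + G) i)) =
    (\<lambda>i. divided_difference \<alpha> (F i)) + (\<lambda>i. divided_difference \<alpha> (G i))" if "\<alpha> \<in> R" for \<alpha>
    using assms R_nonzero[OF that]
    by (simp add: fun_eq_iff[where 'a='a] plus_fun_apply vspace_iff divided_difference_add)
  ultimately show ?thesis
    by (simp add: vT_def mat_act_simps vmul_simps sum.distrib)
qed

text \<open>The twisted Leibniz rule moves the reflection onto F; together with the matrix of the
  reflection it becomes the diagonal action \<open>vW\<close>. This formula yields the cross
  relations of the algebra in every representation.\<close>

lemma vT_vmul:
  assumes "F \<in> vspace" "p \<in> poly_space"
  shows "vT \<rho> v (vmul p F) = vmul p (vT \<rho> v F) + vmul (deriv_along v p) F +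
    (\<Sum>\<alpha>\<in>R. vmul (pconst (dunkl_coeff \<alpha> v) * divided_difference \<alpha> p) (vW \<rho> (reflection \<alpha>) F))"
proof -
  have "(\<lambda>i. deriv_along v (vmul p F i)) = vmul p (\<lambda>i. deriv_along v (F i)) + vmul (deriv_along v p) F"
    using assms by (simp add: fun_eq_iff[where 'a='a] plus_fun_apply vspace_iff vmul_def deriv_along_mult)
  moreover have "(\<lambda>i. divided_difference \<alpha> (vmul p F i)) = vmul p (\<lambda>i. divided_difference \<alpha> (F i)) +
      vmul (divided_difference \<alpha> p) (\<lambda>i. pull (reflection \<alpha>) (F i))" if "\<alpha> \<in> R" for \<alpha>
    using assms R_nonzero[OF that]
    by (simp add: fun_eq_iff[where 'a='a] plus_fun_apply vspace_iff vmul_def divided_difference_mult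
        pull_reflection)
  ultimately show ?thesis
    by (simp add: vT_def vW_def mat_act_simps vmul_simps sum.distrib vmul_sum vmul_commute[of p] add_ac)
qed

lemma vT_cmul: "F \<in> vspace \<Longrightarrow> vT \<rho> v (vmul (pconst c) F) = vmul (pconst c) (vT \<rho> v F)"
  by (simp add: vT_vmul vmul_simps R_nonzero)

lemma vT_0: "vT \<rho> v 0 = 0"
  using vT_cmul[of 0 \<rho> v 0] by (simp add: vmul_simps vspace_closed)

lemma vT_sum: "(\<And>i. i \<in> I \<Longrightarrow> F i \<in> vspace) \<Longrightarrow> vT \<rho> v (\<Sum>i\<in>I. F i) = (\<Sum>i\<in>I. vT \<rho> v (F i))"
  by (induction I rule: infinite_finite_induct) (auto simp: vT_0 vT_add vspace_sum)

lemma vT_const: "vT \<rho> v (vconst u) = 0"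
proof -
  have "(\<lambda>i. divided_difference \<alpha> (vconst u i)) = 0" if "\<alpha> \<in> R" for \<alpha>
    using R_nonzero[OF that] by (simp add: vconst_def fun_eq_iff[where 'a='a] zero_fun_apply)
  moreover have "(\<lambda>i. deriv_along v (vconst u i)) = 0"
    by (simp add: vconst_def fun_eq_iff[where 'a='a] zero_fun_apply)
  ultimately show ?thesis by (simp add: vT_def mat_act_simps vmul_simps)
qed

lemma vT_vector:
  assumes "F \<in> vspace"
  shows "vT \<rho> (u + v) F = vT \<rho> u F + vT \<rho> v F"
    and "vT \<rho> (c *\<^sub>R v) F = vmul (pconst (of_real c)) (vT \<rho> v F)"
proof -
  have *: "(\<lambda>i. deriv_along (u + v) (F i)) = (\<lambda>i. deriv_along u (F i)) + (\<lambda>i. deriv_along v (F i))"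
    "(\<lambda>i. deriv_along (c *\<^sub>R v) (F i)) = vmul (pconst (of_real c)) (\<lambda>i. deriv_along v (F i))"
    using assms by (simp_all add: fun_eq_iff[where 'a='a] plus_fun_apply vspace_iff vmul_def deriv_along_vector)
  have c1: "dunkl_coeff \<alpha> (u + v) = dunkl_coeff \<alpha> u + dunkl_coeff \<alpha> v" for \<alpha>
    by (simp add: dunkl_coeff_def inner_add_right distrib_left add_divide_distrib)
  have c2: "dunkl_coeff \<alpha> (c *\<^sub>R v) = of_real c * dunkl_coeff \<alpha> v" for \<alpha>
    by (simp add: dunkl_coeff_def)
  show "vT \<rho> (u + v) F = vT \<rho> u F + vT \<rho> v F"
    by (simp add: vT_def * c1 pconst_add vmul_simps sum.distrib)
  show "vT \<rho> (c *\<^sub>R v) F = vmul (pconst (of_real c)) (vT \<rho> v F)"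
    by (simp add: vT_def * c2 pconst_mult vmul_simps vmul_sum)
qed

text \<open>Conjugation by w permutes the roots and preserves k and the inner products, so the sum
  over all of R is merely reindexed. A sum over positive roots would require a sign argument
  here.\<close>

lemma vW_vT:
  assumes "weyl_rep \<rho>" "w \<in> W" "F \<in> vspace"
  shows "vW \<rho> w (vT \<rho> v F) = vT \<rho> (w v) (vW \<rho> w F)"
proof -
  have F: "F i \<in> poly_space" for i using assms(3) by (simp add: vspace_iff)
  let ?G = "\<lambda>i. pull w (F i)"
  have G: "?G \<in> vspace" using F assms(2) by (auto simp: vspace_iff)
  have 1: "mat_act (\<rho> w) (\<lambda>i. pull w (deriv_along v (F i))) = (\<lambda>i. deriv_along (w v) (vW \<rho> w F i))"
    unfolding vW_def plinear_mat_act[OF plinear_deriv_along G]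
    by (simp add: pull_deriv_along assms F)
  have 2: "vmul (pconst (dunkl_coeff \<alpha> v)) (vW \<rho> w (mat_act (\<rho> (reflection \<alpha>)) (\<lambda>i. divided_difference \<alpha> (F i))))
    = vmul (pconst (dunkl_coeff (w \<alpha>) (w v))) (mat_act (\<rho> (reflection (w \<alpha>)))
        (\<lambda>i. divided_difference (w \<alpha>) (vW \<rho> w F i)))" if \<alpha>: "\<alpha> \<in> R" for \<alpha>
  proof -
    have "dunkl_coeff (w \<alpha>) (w v) = dunkl_coeff \<alpha> v" using assms \<alpha> by (simp add: dunkl_coeff_def k_W W_inner)
    have dd: "(\<lambda>i. divided_difference \<alpha> (F i)) \<in> vspace" using F R_nonzero[OF \<alpha>] by (auto simp: vspace_iff)
    have "vW \<rho> w (mat_act (\<rho> (reflection \<alpha>)) (\<lambda>i. divided_difference \<alpha> (F i))) =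
      mat_act (\<rho> w ** \<rho> (reflection \<alpha>)) (\<lambda>i. pull w (divided_difference \<alpha> (F i)))"
      unfolding vW_def plinear_mat_act[OF plinear_pull[OF assms(2)] dd] by (simp add: mat_act_mat_act)
    also have "\<rho> w ** \<rho> (reflection \<alpha>) = \<rho> (reflection (w \<alpha>)) ** \<rho> w"
      using weyl_repD[OF assms(1) assms(2) reflection_W[OF \<alpha>]]
        weyl_repD[OF assms(1) reflection_W[OF W_R[OF assms(2) \<alpha>]] assms(2)]
      by (simp only: reflection_W_conj[OF assms(2)])
    also have "(\<lambda>i. pull w (divided_difference \<alpha> (F i))) = (\<lambda>i. divided_difference (w \<alpha>) (pull w (F i)))"
      by (simp add: pull_divided_difference assms F \<alpha>)
    also have "mat_act (\<rho> (reflection (w \<alpha>)) ** \<rho> w) \<dots> = mat_act (\<rho> (reflection (w \<alpha>)))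
        (\<lambda>i. divided_difference (w \<alpha>) (vW \<rho> w F i))"
      unfolding vW_def plinear_mat_act[OF plinear_divided_difference[OF R_nonzero[OF W_R[OF assms(2) \<alpha>]]] G]
      by (simp add: mat_act_mat_act)
    finally show ?thesis using \<open>dunkl_coeff (w \<alpha>) (w v) = dunkl_coeff \<alpha> v\<close> by simp
  qed
  have sumW: "vW \<rho> w (\<Sum>i\<in>I. H i) = (\<Sum>i\<in>I. vW \<rho> w (H i))" for I and H :: "real ^ 'n \<Rightarrow> _"
    by (induction I rule: infinite_finite_induct) (auto simp: vW_simps)
  have "vW \<rho> w (vT \<rho> v F) = (\<lambda>i. deriv_along (w v) (vW \<rho> w F i)) +
    (\<Sum>\<alpha>\<in>R. vmul (pconst (dunkl_coeff \<alpha> v)) (vW \<rho> w (mat_act (\<rho> (reflection \<alpha>)) (\<lambda>i. divided_difference \<alpha> (F i)))))"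
    unfolding vT_def vW_simps sumW 1[symmetric] by (simp add: vW_def)
  also have "\<dots> = (\<lambda>i. deriv_along (w v) (vW \<rho> w F i)) +
    (\<Sum>\<alpha>\<in>R. vmul (pconst (dunkl_coeff (w \<alpha>) (w v))) (mat_act (\<rho> (reflection (w \<alpha>)))
        (\<lambda>i. divided_difference (w \<alpha>) (vW \<rho> w F i))))"
    by (simp add: 2)
  also have "\<dots> = vT \<rho> (w v) (vW \<rho> w F)"
    unfolding vT_def
    by (subst (2) sum.reindex_bij_betw[OF W_bij_R[OF assms(2)], symmetric]) simp
  finally show ?thesis .
qed

lemma vT_vector_diff:
  assumes "F \<in> vspace"
  shows "vT \<rho> (u - c *\<^sub>R v) F = vT \<rho> u F - vmul (pconst (of_real c)) (vT \<rho> v F)"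
  using vT_vector(1)[OF assms, of \<rho> "u - c *\<^sub>R v" "c *\<^sub>R v"] vT_vector(2)[OF assms, of \<rho> c v]
  by simp

text \<open>The commutator of two Dunkl operators commutes with multiplication by linear forms, because
  the extra terms are symmetric in the two directions, and it kills constants.\<close>

lemma vT_commute:
  assumes "weyl_rep \<rho>" "F \<in> vspace"
  shows "vT \<rho> u (vT \<rho> v F) = vT \<rho> v (vT \<rho> u F)"
  using assms(2)
proof (induction rule: vspace_induct)
  case (const c)
  then show ?case by (simp add: vT_const vT_0)
next
  case (add F G)
  then show ?case by (simp add: vT_add vT_closed)
next
  case (plin F l)
  define d where "d \<alpha> = (of_real (2 * (\<alpha> \<bullet> l) / (\<alpha> \<bullet> \<alpha>)) :: complex)" for \<alpha>
  define S where "S v G = (\<Sum>\<alpha>\<in>R. vmul (pconst (dunkl_coeff \<alpha> v * d \<alpha>)) (vW \<rho> (reflection \<alpha>) G))" for v G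
  have T: "vT \<rho> v (vmul (plin l) G) = vmul (plin l) (vT \<rho> v G) + vmul (pconst (of_real (l \<bullet> v))) G + S v G"
    if "G \<in> vspace" for v G
    using that by (simp add: vT_vmul S_def d_def divided_difference_plin R_nonzero flip: pconst_mult)
  have Sc: "S v G \<in> vspace" if "G \<in> vspace" for v G
    unfolding S_def using that by (intro vspace_sum vspace_closed(5) vW_closed poly_space_pconst reflection_W)
  have TS: "vT \<rho> v (S u G) = (\<Sum>\<alpha>\<in>R. vmul (pconst (dunkl_coeff \<alpha> u * d \<alpha>)) (vT \<rho> v (vW \<rho> (reflection \<alpha>) G)))"
    if "G \<in> vspace" for v u G
    unfolding S_def using that by (subst vT_sum) (auto simp: reflection_W vT_cmul vW_closed)
  have TT: "vT \<rho> v (vT \<rho> u (vmul (plin l) F)) = vmul (plin l) (vT \<rho> v (vT \<rho> u F)) +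
      vmul (pconst (of_real (l \<bullet> v))) (vT \<rho> u F) + vmul (pconst (of_real (l \<bullet> u))) (vT \<rho> v F) +
      (S v (vT \<rho> u F) + vT \<rho> v (S u F))" for u v
    using plin(1) by (simp add: T vT_add vT_cmul Sc vspace_closed vT_closed)
  have "S v (vT \<rho> u F) + vT \<rho> v (S u F) = S u (vT \<rho> v F) + vT \<rho> u (S v F)" for u v
    unfolding TS[OF plin(1)] unfolding S_def sum.distrib[symmetric]
  proof (rule sum.cong[OF HOL.refl])
    fix \<alpha> assume \<alpha>: "\<alpha> \<in> R"
    let ?G = "vW \<rho> (reflection \<alpha>) F"
    have G: "?G \<in> vspace" using plin(1) \<alpha> by (auto simp: reflection_W)
    have WT: "vW \<rho> (reflection \<alpha>) (vT \<rho> x F) =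
      vT \<rho> x ?G - vmul (pconst (of_real (2 * (\<alpha> \<bullet> x) / (\<alpha> \<bullet> \<alpha>)))) (vT \<rho> \<alpha> ?G)" for x
      unfolding vW_vT[OF assms(1) reflection_W[OF \<alpha>] plin(1)]
      by (subst (1) reflection_def) (rule vT_vector_diff[OF G])
    \<comment> \<open>\<open>dunkl_coeff\<close> is proportional to the pairing of \<alpha> with the
      direction, so this correction is proportional to the product of both pairings and hence
      symmetric in u and v.\<close>
    have "vmul (pconst (dunkl_coeff \<alpha> v * d \<alpha>)) (vmul (pconst (of_real (2 * (\<alpha> \<bullet> u) / (\<alpha> \<bullet> \<alpha>)))) (vT \<rho> \<alpha> ?G))
       = vmul (pconst (dunkl_coeff \<alpha> u * d \<alpha>)) (vmul (pconst (of_real (2 * (\<alpha> \<bullet> v) / (\<alpha> \<bullet> \<alpha>)))) (vT \<rho> \<alpha> ?G))"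
      unfolding vmul_simps(6)[symmetric] pconst_mult[symmetric]
      by (simp add: dunkl_coeff_def mult_ac)
    then show "vmul (pconst (dunkl_coeff \<alpha> v * d \<alpha>)) (vW \<rho> (reflection \<alpha>) (vT \<rho> u F)) +
         vmul (pconst (dunkl_coeff \<alpha> u * d \<alpha>)) (vT \<rho> v ?G) =
         vmul (pconst (dunkl_coeff \<alpha> u * d \<alpha>)) (vW \<rho> (reflection \<alpha>) (vT \<rho> v F)) +
         vmul (pconst (dunkl_coeff \<alpha> v * d \<alpha>)) (vT \<rho> u ?G)"
      unfolding WT by (simp add: vmul_simps)
  qed
  from this[of v u] show ?case unfolding TT plin(2) by (simp add: add_ac)
qed

end

section \<open>Normal forms and the Poincare-Birkhoff-Witt property\<close>

text \<open>The entry \<open>(p, w, i, j)\<close> of a normal form stands for the operator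
  \<open>p \<cdot> w \<cdot> T\<^bsub>e1\<^esub>^i T\<^bsub>e2\<^esub>^j\<close>.\<close>

type_synonym 'n nform = "('n pfun \<times> (real ^ 'n \<Rightarrow> real ^ 'n) \<times> nat \<times> nat) list"

context root_data begin

definition sT :: "real ^ 'n \<Rightarrow> 'n pfun \<Rightarrow> 'n pfun" where
  "sT v f = deriv_along v f + (\<Sum>\<alpha>\<in>R. pconst (dunkl_coeff \<alpha> v) * divided_difference \<alpha> f)"

definition nterm :: "((real ^ 'n \<Rightarrow> real ^ 'n) \<Rightarrow> complex ^ 'm ^ 'm) \<Rightarrow>
    'n pfun \<times> (real ^ 'n \<Rightarrow> real ^ 'n) \<times> nat \<times> nat \<Rightarrow> ('m \<Rightarrow> 'n pfun) \<Rightarrow> 'm \<Rightarrow> 'n pfun" where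
  "nterm \<rho> t F = (case t of (p, w, i, j) \<Rightarrow> vmul p (vW \<rho> w ((vT \<rho> e1 ^^ i) ((vT \<rho> e2 ^^ j) F))))"

definition nf_op :: "((real ^ 'n \<Rightarrow> real ^ 'n) \<Rightarrow> complex ^ 'm ^ 'm) \<Rightarrow>
    'n nform \<Rightarrow> ('m \<Rightarrow> 'n pfun) \<Rightarrow> 'm \<Rightarrow> 'n pfun" where
  "nf_op \<rho> c F = (\<Sum>t\<leftarrow>c. nterm \<rho> t F)"

definition snterm :: "'n pfun \<times> (real ^ 'n \<Rightarrow> real ^ 'n) \<times> nat \<times> nat \<Rightarrow> 'n pfun \<Rightarrow> 'n pfun" where
  "snterm t f = (case t of (p, w, i, j) \<Rightarrow> p * pull w ((sT e1 ^^ i) ((sT e2 ^^ j) f)))"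

definition snf_op :: "'n nform \<Rightarrow> 'n pfun \<Rightarrow> 'n pfun" where
  "snf_op c f = (\<Sum>t\<leftarrow>c. snterm t f)"

definition nf_ok :: "'n nform \<Rightarrow> bool" where
  "nf_ok c \<longleftrightarrow> (\<forall>(p, w, i, j)\<in>set c. p \<in> poly_space \<and> w \<in> W)"

lemma weyl_rep_triv: "weyl_rep (\<lambda>_. mat 1)"
  by (simp add: weyl_rep_def)

lemma vT_triv: "vT (\<lambda>_. mat 1) v F = (\<lambda>i. sT v (F i))"
  by (simp add: vT_def sT_def mat_act_simps fun_eq_iff[where 'a='a] plus_fun_apply sum_fun_apply vmul_def)

lemma vW_triv: "vW (\<lambda>_. mat 1) w F = (\<lambda>i. pull w (F i))"
  by (simp add: vW_def mat_act_simps)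

lemma vT_triv_funpow: "(vT (\<lambda>_. mat 1) v ^^ n) F = (\<lambda>i. (sT v ^^ n) (F i))"
  by (induction n) (auto simp: vT_triv)

lemma nf_op_triv: "nf_op (\<lambda>_. mat 1) c F = (\<lambda>i. snf_op c (F i))"
  by (induction c)
    (auto simp: nf_op_def snf_op_def nterm_def snterm_def fun_eq_iff[where 'a='a] plus_fun_apply zero_fun_apply
      vmul_def vW_triv vT_triv_funpow)

lemma vT_funpow_closed [intro]: "F \<in> vspace \<Longrightarrow> (vT \<rho> v ^^ n) F \<in> vspace"
  by (induction n) auto

lemma sT_closed [intro]: "f \<in> poly_space \<Longrightarrow> sT v f \<in> poly_space"
  unfolding sT_def
  by (intro poly_space_add poly_space_sum poly_space_mult poly_space_divided_difference[OF R_nonzero]) auto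

lemma sT_funpow_closed [intro]: "f \<in> poly_space \<Longrightarrow> (sT v ^^ n) f \<in> poly_space"
  by (induction n) auto

lemma nterm_closed: "p \<in> poly_space \<Longrightarrow> w \<in> W \<Longrightarrow> F \<in> vspace \<Longrightarrow> nterm \<rho> (p, w, i, j) F \<in> vspace"
  by (auto simp: nterm_def)

lemma nf_ok_simps [simp]:
  "nf_ok []" "nf_ok ((p, w, i, j) # c) \<longleftrightarrow> p \<in> poly_space \<and> w \<in> W \<and> nf_ok c"
  "nf_ok (c @ d) \<longleftrightarrow> nf_ok c \<and> nf_ok d"
  by (simp_all add: nf_ok_def ball_Un)

lemma nf_op_simps [simp]:
  "nf_op \<rho> [] F = 0" "nf_op \<rho> (t # c) F = nterm \<rho> t F + nf_op \<rho> c F"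
  "nf_op \<rho> (c @ d) F = nf_op \<rho> c F + nf_op \<rho> d F"
  by (simp_all add: nf_op_def)

lemma nf_op_closed: "nf_ok c \<Longrightarrow> F \<in> vspace \<Longrightarrow> nf_op \<rho> c F \<in> vspace"
  by (induction c) (auto simp: nterm_closed vspace_closed)

text \<open>A single normal form represents an operator in all representations simultaneously.\<close>

definition represents :: "'n nform \<Rightarrow>
    (((real ^ 'n \<Rightarrow> real ^ 'n) \<Rightarrow> complex ^ 'm ^ 'm) \<Rightarrow> ('m \<Rightarrow> 'n pfun) \<Rightarrow> ('m \<Rightarrow> 'n pfun)) \<Rightarrow> bool" where
  "represents c A \<longleftrightarrow> nf_ok c \<and> (\<forall>\<rho> F. weyl_rep \<rho> \<longrightarrow> F \<in> vspace \<longrightarrow> A \<rho> F = nf_op \<rho> c F)"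

lemma represents_add:
  "represents c A \<Longrightarrow> represents d B \<Longrightarrow> represents (c @ d) (\<lambda>\<rho> F. A \<rho> F + B \<rho> F)"
  by (auto simp: represents_def)

lemma represents_mul:
  assumes "represents c A" "p \<in> poly_space"
  shows "\<exists>d. represents d (\<lambda>\<rho> F. vmul p (A \<rho> F))"
proof -
  have "\<exists>d. nf_ok d \<and> (\<forall>(\<rho> :: _ \<Rightarrow> complex ^ 'a ^ 'a) F. nf_op \<rho> d F = vmul p (nf_op \<rho> c F))" if "nf_ok c" for c
    using that
  proof (induction c)
    case (Cons t c)
    obtain q w i j where t: "t = (q, w, i, j)" by (metis prod_cases4)
    from Cons t obtain d where "nf_ok d"
      "\<forall>(\<rho> :: _ \<Rightarrow> complex ^ 'a ^ 'a) F. nf_op \<rho> d F = vmul p (nf_op \<rho> c F)" by auto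
    then show ?case using Cons.prems t assms(2)
      by (intro exI[of _ "(p * q, w, i, j) # d"]) (auto simp: nterm_def vmul_simps)
  qed (auto simp: vmul_simps intro: exI[of _ "[]"])
  then show ?thesis using assms(1) unfolding represents_def by metis
qed

lemma represents_W:
  assumes "represents c A" "w \<in> W"
  shows "\<exists>d. represents d (\<lambda>\<rho> F. vW \<rho> w (A \<rho> F))"
proof -
  have "\<exists>d. nf_ok d \<and> (\<forall>(\<rho> :: _ \<Rightarrow> complex ^ 'a ^ 'a) F. weyl_rep \<rho> \<longrightarrow> F \<in> vspace \<longrightarrow>
      nf_op \<rho> d F = vW \<rho> w (nf_op \<rho> c F))" if "nf_ok c" for c
    using that
  proof (induction c)
    case Nil
    then show ?case by (intro exI[of _ "[]"]) (simp add: vW_simps)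
  next
    case (Cons t c)
    obtain q u i j where t: "t = (q, u, i, j)" by (metis prod_cases4)
    from Cons t obtain d where "nf_ok d"
      "\<forall>(\<rho> :: _ \<Rightarrow> complex ^ 'a ^ 'a) F. weyl_rep \<rho> \<longrightarrow> F \<in> vspace \<longrightarrow>
        nf_op \<rho> d F = vW \<rho> w (nf_op \<rho> c F)" by auto
    moreover have "vW \<rho> (w \<circ> u) ((vT \<rho> e1 ^^ i) ((vT \<rho> e2 ^^ j) F)) =
        vW \<rho> w (vW \<rho> u ((vT \<rho> e1 ^^ i) ((vT \<rho> e2 ^^ j) F)))"
      if "weyl_rep \<rho>" "F \<in> vspace" for \<rho> :: "_ \<Rightarrow> complex ^ 'a ^ 'a" and F
      using Cons.prems t assms(2) that by (intro vW_comp) auto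
    ultimately show ?case using Cons.prems t assms(2)
      by (intro exI[of _ "(pull w q, w \<circ> u, i, j) # d"])
        (simp add: nterm_def vW_simps W_comp poly_space_pull)
  qed
  then show ?thesis using assms(1) unfolding represents_def by metis
qed

lemma vT_funpow_commute:
  assumes "weyl_rep \<rho>" "F \<in> vspace"
  shows "vT \<rho> u ((vT \<rho> v ^^ n) F) = (vT \<rho> v ^^ n) (vT \<rho> u F)"
  using assms(2) by (induction n) (auto simp: vT_commute[OF assms(1), of _ u v] vT_funpow_closed)

text \<open>Moving a Dunkl operator through w turns its direction by the inverse of w. The new
  direction is expanded in e1, e2, which keeps normal forms within powers of two operators.\<close>

lemma vT_vW_decompose:
  assumes "weyl_rep \<rho>" "w \<in> W" "H \<in> vspace"
  shows "vT \<rho> v (vW \<rho> w H) =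
    vmul (pconst (of_real (inv_into UNIV w v \<bullet> e1))) (vW \<rho> w (vT \<rho> e1 H)) +
    vmul (pconst (of_real (inv_into UNIV w v \<bullet> e2))) (vW \<rho> w (vT \<rho> e2 H))"
proof -
  let ?u = "inv_into UNIV w v"
  have "vT \<rho> v (vW \<rho> w H) = vW \<rho> w (vT \<rho> ?u H)"
    using vW_vT[OF assms, of ?u] assms(2) by simp
  also have "vT \<rho> ?u H = vT \<rho> ((?u \<bullet> e1) *\<^sub>R e1 + (?u \<bullet> e2) *\<^sub>R e2) H"
    by (rule arg_cong[where f = "\<lambda>x. vT \<rho> x H"], rule coordinates)
  finally show ?thesis by (simp add: vT_vector[OF assms(3)] vW_simps)
qed

text \<open>A Dunkl operator in front of \<open>p w T_1^i T_2^j\<close> is moved through p by the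
  Leibniz rule. This produces the operator moved through w, the derivative of p, and for each root a
  term whose reflection is absorbed into w.\<close>

lemma represents_T:
  fixes A :: "((real ^ 'n \<Rightarrow> real ^ 'n) \<Rightarrow> complex ^ 'm ^ 'm) \<Rightarrow> ('m \<Rightarrow> 'n pfun) \<Rightarrow> ('m \<Rightarrow> 'n pfun)"
  assumes "represents c A"
  shows "\<exists>d. represents d (\<lambda>\<rho> F. vT \<rho> v (A \<rho> F))"
proof -
  obtain Rl where Rl: "set Rl = R" "distinct Rl" using finite_distinct_list[OF finite_R] by blast
  have "\<exists>d. nf_ok d \<and> (\<forall>(\<rho> :: _ \<Rightarrow> complex ^ 'm ^ 'm) F. weyl_rep \<rho> \<longrightarrow> F \<in> vspace \<longrightarrow>
      nf_op \<rho> d F = vT \<rho> v (nf_op \<rho> c F))" if "nf_ok c" for c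
    using that
  proof (induction c)
    case Nil
    then show ?case by (intro exI[of _ "[]"]) (simp add: vT_0)
  next
    case (Cons t c)
    obtain p w i j where t: "t = (p, w, i, j)" by (metis prod_cases4)
    have p: "p \<in> poly_space" "w \<in> W" "nf_ok c" using Cons.prems t by auto
    from Cons p obtain d where d: "nf_ok d"
      "\<forall>(\<rho> :: _ \<Rightarrow> complex ^ 'm ^ 'm) F. weyl_rep \<rho> \<longrightarrow> F \<in> vspace \<longrightarrow>
        nf_op \<rho> d F = vT \<rho> v (nf_op \<rho> c F)" by auto
    define a b where "a = (of_real (inv_into UNIV w v \<bullet> e1) :: complex)"
      and "b = (of_real (inv_into UNIV w v \<bullet> e2) :: complex)"
    define g where "g \<alpha> = (pconst (dunkl_coeff \<alpha> v) * divided_difference \<alpha> p, reflection \<alpha> \<circ> w, i, j)" for \<alpha>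
    define ds where "ds = [(p * pconst a, w, Suc i, j), (p * pconst b, w, i, Suc j), (deriv_along v p, w, i, j)] @ map g Rl"
    have ds: "nf_op \<rho> ds F = vT \<rho> v (nterm \<rho> t F)" if \<rho>: "weyl_rep \<rho>" and F: "F \<in> vspace"
      for \<rho> :: "_ \<Rightarrow> complex ^ 'm ^ 'm" and F
    proof -
      define H where "H = (vT \<rho> e1 ^^ i) ((vT \<rho> e2 ^^ j) F)"
      have H: "H \<in> vspace" unfolding H_def using F by auto
      \<comment> \<open>Commutativity of the Dunkl operators is used here: the new factor has to
        pass the powers of \<open>vT \<rho> e1\<close>.\<close>
      have "vT \<rho> e2 H = (vT \<rho> e1 ^^ i) ((vT \<rho> e2 ^^ Suc j) F)"
        unfolding H_def by (subst vT_funpow_commute[OF \<rho>]) (use F in auto)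
      moreover have "vT \<rho> e1 H = (vT \<rho> e1 ^^ Suc i) ((vT \<rho> e2 ^^ j) F)"
        by (simp add: H_def)
      moreover have "nf_op \<rho> (map g Rl) F = (\<Sum>\<alpha>\<in>R. nterm \<rho> (g \<alpha>) F)"
        using Rl by (simp add: nf_op_def o_def sum_list_distinct_conv_sum_set)
      moreover have "nterm \<rho> (g \<alpha>) F = vmul (pconst (dunkl_coeff \<alpha> v) * divided_difference \<alpha> p)
          (vW \<rho> (reflection \<alpha>) (vW \<rho> w H))" if "\<alpha> \<in> R" for \<alpha>
        using that p by (simp add: nterm_def g_def H_def[symmetric] vW_comp[OF \<rho> _ _ H] reflection_W)
      ultimately show ?thesis
        using p H by (simp add: ds_def nterm_def t H_def[symmetric] vT_vmul vW_closed vT_vW_decompose[OF \<rho>]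
            a_def b_def vmul_simps add_ac)
    qed
    moreover have "nf_ok ds" using p Rl
      by (auto simp: nf_ok_def ds_def g_def W_comp reflection_W intro!: poly_space_mult poly_space_divided_difference[OF R_nonzero])
    ultimately show ?case using d p t
      by (intro exI[of _ "ds @ d"]) (auto simp: vT_add nterm_closed nf_op_closed)
  qed
  then show ?thesis using assms(1) unfolding represents_def by metis
qed

lemma represents_comp:
  fixes A B :: "((real ^ 'n \<Rightarrow> real ^ 'n) \<Rightarrow> complex ^ 'm ^ 'm) \<Rightarrow> ('m \<Rightarrow> 'n pfun) \<Rightarrow> ('m \<Rightarrow> 'n pfun)"
  assumes "represents c A" "represents d B"
  shows "\<exists>e. represents e (\<lambda>\<rho> F. A \<rho> (B \<rho> F))"
proof -
  have pow: "\<exists>e. represents e (\<lambda>\<rho> F. (vT \<rho> v ^^ n) (B \<rho> F))"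
    if "\<exists>e. represents e B" for B :: "((real ^ 'n \<Rightarrow> real ^ 'n) \<Rightarrow> complex ^ 'm ^ 'm) \<Rightarrow> ('m \<Rightarrow> 'n pfun) \<Rightarrow> ('m \<Rightarrow> 'n pfun)" and v n
    by (induction n) (use that represents_T in auto)
  have "\<exists>e. represents e (\<lambda>\<rho> F. nf_op \<rho> c (B \<rho> F))" if "nf_ok c" for c
    using that
  proof (induction c)
    case Nil
    then show ?case by (intro exI[of _ "[]"]) (simp add: represents_def)
  next
    case (Cons t c)
    obtain p w i j where t: "t = (p, w, i, j)" by (metis prod_cases4)
    have p: "p \<in> poly_space" "w \<in> W" "nf_ok c" using Cons.prems t by auto
    from p(3) Cons.IH obtain e where e: "represents e (\<lambda>\<rho> F. nf_op \<rho> c (B \<rho> F))" by auto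
    have "\<exists>a. represents a (\<lambda>\<rho> F. (vT \<rho> e2 ^^ j) (B \<rho> F))"
      by (rule pow) (use assms(2) in blast)
    then have "\<exists>a. represents a (\<lambda>\<rho> F. (vT \<rho> e1 ^^ i) ((vT \<rho> e2 ^^ j) (B \<rho> F)))"
      by (rule pow)
    then obtain a where "represents a (\<lambda>\<rho> F. (vT \<rho> e1 ^^ i) ((vT \<rho> e2 ^^ j) (B \<rho> F)))" ..
    from represents_W[OF this p(2)] obtain a' where
      "represents a' (\<lambda>\<rho> F. vW \<rho> w ((vT \<rho> e1 ^^ i) ((vT \<rho> e2 ^^ j) (B \<rho> F))))" ..
    from represents_mul[OF this p(1)] obtain a'' where
      "represents a'' (\<lambda>\<rho> F. nterm \<rho> t (B \<rho> F))" unfolding nterm_def t prod.case ..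
    from represents_add[OF this e] show ?case by auto
  qed
  moreover have "nf_ok c" using assms(1) by (simp add: represents_def)
  ultimately obtain e where e: "represents e (\<lambda>\<rho> F. nf_op \<rho> c (B \<rho> F))" by blast
  have "B \<rho> F \<in> vspace" if "weyl_rep \<rho>" "F \<in> vspace" for \<rho> F
    using assms(2) that nf_op_closed unfolding represents_def by metis
  then have "represents e (\<lambda>\<rho> F. A \<rho> (B \<rho> F))"
    using e assms(1) unfolding represents_def by metis
  then show ?thesis ..
qed

end

section \<open>Order of vanishing on regular orbits and linear independence of normal forms\<close>

context root_data begin

text \<open>Vanishing to order d on S: all iterated directional derivatives with fewer than d
  factors are zero at the points of S.\<close>

primrec vanish :: "(real ^ 'n) set \<Rightarrow> nat \<Rightarrow> 'n pfun \<Rightarrow> bool" where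
  "vanish S 0 f \<longleftrightarrow> f \<in> poly_space"
| "vanish S (Suc d) f \<longleftrightarrow> f \<in> poly_space \<and> (\<forall>u\<in>S. f u = 0) \<and> (\<forall>v. vanish S d (deriv_along v f))"

lemma vanish_poly: "vanish S d f \<Longrightarrow> f \<in> poly_space"
  by (cases d) auto

lemma vanish_Suc: "vanish S (Suc d) f \<Longrightarrow> vanish S d f"
  by (induction d arbitrary: f) auto

lemma vanish_SucI:
  "f \<in> poly_space \<Longrightarrow> (\<And>u. u \<in> S \<Longrightarrow> f u = 0) \<Longrightarrow>
    (\<And>v. vanish S d (deriv_along v f)) \<Longrightarrow> vanish S (Suc d) f"
  by simp

lemma vanish_SucD:
  assumes "vanish S (Suc d) f"
  shows "f \<in> poly_space" "u \<in> S \<Longrightarrow> f u = 0" "vanish S d (deriv_along v f)"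
  using assms by simp_all

lemma vanish_add: "vanish S d f \<Longrightarrow> vanish S d g \<Longrightarrow> vanish S d (f + g)"
proof (induction d arbitrary: f g)
  case (Suc d)
  note D = vanish_SucD[OF Suc.prems(1)] vanish_SucD[OF Suc.prems(2)]
  show ?case
  proof (rule vanish_SucI)
    fix v show "vanish S d (deriv_along v (f + g))"
      unfolding deriv_along_add[OF D(1) D(4)] by (rule Suc.IH[OF D(3) D(6)])
    fix u assume "u \<in> S" then show "(f + g) u = 0" using D(2,5) by (simp add: plus_fun_apply)
  qed (rule poly_space_add[OF D(1) D(4)])
qed auto

lemma vanish_0: "vanish S d 0"
proof (induction d)
  case (Suc d)
  show ?case
  proof (rule vanish_SucI)
    show "0 u = (0 :: complex)" for u :: "real ^ 'n" by (rule zero_fun_apply)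
  qed (use Suc in simp_all)
qed simp

lemma vanish_sum: "(\<And>i. i \<in> I \<Longrightarrow> vanish S d (f i)) \<Longrightarrow> vanish S d (\<Sum>i\<in>I. f i)"
  by (induction I rule: infinite_finite_induct) (auto intro: vanish_add vanish_0)

lemma vanish_mult: "p \<in> poly_space \<Longrightarrow> vanish S d f \<Longrightarrow> vanish S d (p * f)"
proof (induction d arbitrary: p f)
  case (Suc d)
  note D = vanish_SucD[OF Suc.prems(2)]
  show ?case
  proof (rule vanish_SucI)
    fix v show "vanish S d (deriv_along v (p * f))"
      unfolding deriv_along_mult[OF Suc.prems(1) D(1)]
      using Suc.prems(1) by (intro vanish_add Suc.IH D(3) vanish_Suc[OF Suc.prems(2)]) auto
    fix u assume "u \<in> S" then show "(p * f) u = 0" using D(2) by (simp add: times_fun_apply)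
  qed (rule poly_space_mult[OF Suc.prems(1) D(1)])
qed auto

lemma vanish_mult_zero:
  assumes l: "l \<in> poly_space" "\<And>u. u \<in> S \<Longrightarrow> l u = 0"
  shows "vanish S d f \<Longrightarrow> vanish S (Suc d) (l * f)"
proof (induction d arbitrary: f)
  case 0
  then have f: "f \<in> poly_space" by simp
  show ?case
  proof (rule vanish_SucI)
    fix u assume "u \<in> S" then show "(l * f) u = 0" using l by (simp add: times_fun_apply)
  qed (use f l in auto)
next
  case (Suc d)
  note D = vanish_SucD[OF Suc.prems]
  show ?case
  proof (rule vanish_SucI)
    fix v show "vanish S (Suc d) (deriv_along v (l * f))"
      unfolding deriv_along_mult[OF l(1) D(1)]
      using l by (intro vanish_add Suc.IH D(3) vanish_mult Suc.prems) auto
    fix u assume "u \<in> S" then show "(l * f) u = 0" using l by (simp add: times_fun_apply)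
  qed (rule poly_space_mult[OF l(1) D(1)])
qed

lemma vanish_diff: "vanish S d f \<Longrightarrow> vanish S d g \<Longrightarrow> vanish S d (f - g)"
  using vanish_add[of S d f "pconst (-1) * g"] vanish_mult[OF poly_space_pconst[of "-1"], of S d g]
  by (simp add: pconst_minus)

lemma vanish_Un: "vanish S d f \<Longrightarrow> vanish S' d f \<Longrightarrow> vanish (S \<union> S') d f"
  by (induction d arbitrary: f) auto

lemma vanish_power:
  assumes "l \<in> poly_space" "\<And>u. u \<in> S \<Longrightarrow> l u = 0"
  shows "vanish S d (l ^ d)"
  by (induction d) (auto intro: vanish_mult_zero[OF assms] simp del: vanish.simps(2))

context
  fixes S :: "(real ^ 'n) set"
  assumes S_W: "\<And>w u. w \<in> W \<Longrightarrow> u \<in> S \<Longrightarrow> w u \<in> S"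
    and S_regular: "\<And>\<alpha> u. \<alpha> \<in> R \<Longrightarrow> u \<in> S \<Longrightarrow> \<alpha> \<bullet> u \<noteq> 0"
begin

lemma vanish_refl_pull: "\<alpha> \<in> R \<Longrightarrow> vanish S d f \<Longrightarrow> vanish S d (refl_pull \<alpha> f)"
proof (induction d arbitrary: f)
  case (Suc d)
  note D = vanish_SucD[OF Suc.prems(2)]
  show ?case
  proof (rule vanish_SucI)
    fix v
    have "deriv_along v (refl_pull \<alpha> f) = refl_pull \<alpha> (deriv_along (reflection \<alpha> v) f)"
      unfolding refl_pull_def by (rule deriv_along_compose_linear[OF D(1) reflection_linear])
    then show "vanish S d (deriv_along v (refl_pull \<alpha> f))" using Suc.IH[OF Suc.prems(1) D(3)] by simp
    fix u assume "u \<in> S" then show "refl_pull \<alpha> f u = 0"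
      using D(2) S_W[OF reflection_W[OF Suc.prems(1)]] by (simp add: refl_pull_def)
  qed (rule poly_space_refl_pull[OF D(1)])
qed auto

text \<open>The form \<alpha> has no zero on S, so division by it does not lower the order of
  vanishing; the induction solves the Leibniz rule for \<alpha> times the derivative of g.\<close>

lemma vanish_plin_cancel:
  "\<alpha> \<in> R \<Longrightarrow> g \<in> poly_space \<Longrightarrow> vanish S d (plin \<alpha> * g) \<Longrightarrow> vanish S d g"
proof (induction d arbitrary: g)
  case (Suc d)
  have g: "vanish S d g" using Suc by (auto dest: vanish_Suc simp del: vanish.simps)
  have "vanish S d (deriv_along v g)" for v
  proof (rule Suc.IH)
    have "vanish S d (deriv_along v (plin \<alpha> * g))" using Suc.prems by simp
    then have "vanish S d (deriv_along v (plin \<alpha> * g) - pconst (of_real (\<alpha> \<bullet> v)) * g)"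
      using vanish_mult[OF _ g] by (intro vanish_diff) auto
    then show "vanish S d (plin \<alpha> * deriv_along v g)"
      using Suc.prems by (simp add: deriv_along_mult)
  qed (use Suc.prems in auto)
  moreover have "g u = 0" if "u \<in> S" for u
    using Suc.prems(3) S_regular[OF Suc.prems(1) that] that by (auto simp: fun_apply)
  ultimately show ?case using Suc.prems by auto
qed auto

text \<open>Only the derivative lowers the order of vanishing: the reflection terms keep it, since S
  is stable under W and regular. In this sense the principal part of a Dunkl operator is the
  directional derivative.\<close>

lemma vanish_sT_diff:
  assumes "vanish S d f"
  shows "vanish S d (sT v f - deriv_along v f)"
proof -
  have f: "f \<in> poly_space" using assms by (rule vanish_poly)
  have "vanish S d (divided_difference \<alpha> f)" if "\<alpha> \<in> R" for \<alpha>
  proof (rule vanish_plin_cancel[OF that])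
    show "vanish S d (plin \<alpha> * divided_difference \<alpha> f)"
      unfolding divided_difference_works(2)[OF R_nonzero[OF that] f]
      by (rule vanish_diff[OF assms vanish_refl_pull[OF that assms]])
  qed (rule divided_difference_works(1)[OF R_nonzero[OF that] f])
  then have "vanish S d (\<Sum>\<alpha>\<in>R. pconst (dunkl_coeff \<alpha> v) * divided_difference \<alpha> f)"
    by (intro vanish_sum vanish_mult) auto
  then show ?thesis by (simp add: sT_def)
qed

text \<open>A word of Dunkl operators agrees with the corresponding word of derivatives up to one
  further order of vanishing. For m = 0 the two therefore have equal values on S.\<close>

lemma vanish_words:
  "vanish S (length vs + m) f \<Longrightarrow> vanish S m (foldr sT vs f) \<and>
     vanish S (Suc m) (foldr sT vs f - foldr deriv_along vs f)"
proof (induction vs arbitrary: m)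
  case Nil
  then show ?case using vanish_0[of S "Suc m"] by simp
next
  case (Cons v vs)
  let ?g = "foldr sT vs f" and ?h = "foldr deriv_along vs f"
  have IH: "vanish S (Suc m) ?g" "vanish S (Suc (Suc m)) (?g - ?h)"
    using Cons.IH[of "Suc m"] Cons.prems by simp_all
  have g: "?g \<in> poly_space" using IH(1) by (rule vanish_poly)
  have "?g - (?g - ?h) \<in> poly_space" by (rule poly_space_diff[OF g vanish_poly[OF IH(2)]])
  then have h: "?h \<in> poly_space" by simp
  have gh: "deriv_along v (?g - ?h) = deriv_along v ?g - deriv_along v ?h"
    using deriv_along_add[of "?g - ?h" ?h v] g h by (simp add: poly_space_diff)
  have 1: "vanish S (Suc m) (sT v ?g - deriv_along v ?g)" by (rule vanish_sT_diff[OF IH(1)])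
  have 2: "vanish S (Suc m) (deriv_along v (?g - ?h))"
    using IH(2) by (subst (asm) vanish.simps) blast
  have 3: "vanish S (Suc m) (sT v ?g - deriv_along v ?h)"
    using vanish_add[OF 1 2] by (simp add: gh)
  have "vanish S m (deriv_along v ?g)" using IH(1) by simp
  from vanish_add[OF vanish_Suc[OF 1] this] have "vanish S m (sT v ?g)" by simp
  with 3 show ?case by simp
qed

end

lemma foldr_replicate_funpow: "foldr f (replicate n a) x = (f a ^^ n) x"
  by (induction n) auto

lemma deriv_along_funpow_closed: "f \<in> poly_space \<Longrightarrow> (deriv_along v ^^ n) f \<in> poly_space"
  by (induction n) auto

lemma deriv_along_power:
  assumes "l \<in> poly_space" "deriv_along v l = pconst c"
  shows "deriv_along v (l ^ n) = pconst (of_nat n * c) * l ^ (n - 1)"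
proof (induction n)
  case (Suc n)
  have "deriv_along v (l ^ Suc n) = l * (pconst (of_nat n * c) * l ^ (n - 1)) + pconst c * l ^ n"
    using assms by (simp add: deriv_along_mult poly_space_power Suc)
  also have "l * (pconst (of_nat n * c) * l ^ (n - 1)) = pconst (of_nat n * c) * l ^ n"
    by (cases n) (auto simp: algebra_simps)
  also have "pconst (of_nat n * c) * l ^ n + pconst c * l ^ n = pconst (of_nat (Suc n) * c) * l ^ n"
    by (simp add: distrib_right pconst_add)
  finally show ?case by simp
qed simp

lemma deriv_along_monomial:
  assumes l: "l \<in> poly_space" "deriv_along v l = 1" and g: "g \<in> poly_space" "deriv_along v g = 0"
  shows "\<exists>c. (deriv_along v ^^ i) (l ^ a * g) = pconst c * l ^ (a - i) * g \<and> (i \<le> a \<longrightarrow> c \<noteq> 0)"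
proof (induction i)
  case 0
  then show ?case by (intro exI[of _ 1]) simp
next
  case (Suc i)
  then obtain c where c: "(deriv_along v ^^ i) (l ^ a * g) = pconst c * l ^ (a - i) * g"
    "i \<le> a \<longrightarrow> c \<noteq> 0" by auto
  have "deriv_along v (pconst c * l ^ (a - i) * g) = pconst c * (pconst (of_nat (a - i)) * l ^ (a - Suc i)) * g"
    using deriv_along_power[OF l(1), of v 1 "a - i"] l g
    by (simp add: deriv_along_mult poly_space_mult poly_space_power)
  then show ?case using c
    by (intro exI[of _ "c * of_nat (a - i)"]) (auto simp: pconst_mult mult.assoc)
qed

text \<open>The witness is the monomial \<open>l1 ^ a * l2 ^ b\<close> in coordinates centred at u0:
  among the derivatives of order a + b only its own survives.\<close>

lemma vanish_nonvanishing_jet: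
  fixes u0 :: "real ^ 'n"
  obtains h where "h \<in> poly_space" "vanish {u0} (a + b) h"
    "\<And>i j. i + j = a + b \<Longrightarrow> ((deriv_along e1 ^^ i) ((deriv_along e2 ^^ j) h)) u0 = 0 \<longleftrightarrow> (i, j) \<noteq> (a, b)"
proof -
  define l1 l2 where "l1 = plin e1 - pconst (of_real (e1 \<bullet> u0))" and "l2 = plin e2 - pconst (of_real (e2 \<bullet> u0))"
  have l: "l1 \<in> poly_space" "l2 \<in> poly_space" "l1 u0 = 0" "l2 u0 = 0"
    by (auto simp: l1_def l2_def fun_apply)
  have dd: "deriv_along v (plin e - pconst c) = deriv_along v (plin e)" for v e and c :: complex
    using deriv_along_add[of "plin e - pconst c" "pconst c" v] by (simp add: poly_space_diff)
  have d: "deriv_along e1 l1 = 1" "deriv_along e2 l2 = 1" "deriv_along e1 l2 = 0" "deriv_along e2 l1 = 0"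
    unfolding l1_def l2_def dd using orthonormal by (simp_all add: inner_commute)
  have dp: "deriv_along e2 (l1 ^ n) = 0" "deriv_along e1 (l2 ^ n) = 0" for n
    using deriv_along_power[of l1 e2 0 n] deriv_along_power[of l2 e1 0 n] l d by simp_all
  have "vanish {u0} (a + b) (l1 ^ a * l2 ^ b)"
  proof (induction a)
    case 0
    then show ?case using vanish_power[of l2 "{u0}" b] l by simp
  next
    case (Suc a)
    from vanish_mult_zero[OF _ _ this, of l1] l show ?case by (simp add: mult.assoc)
  qed
  moreover have "((deriv_along e1 ^^ i) ((deriv_along e2 ^^ j) (l1 ^ a * l2 ^ b))) u0 = 0 \<longleftrightarrow> (i, j) \<noteq> (a, b)"
    if "i + j = a + b" for i j
  proof -
    obtain c where c: "(deriv_along e2 ^^ j) (l2 ^ b * l1 ^ a) = pconst c * l2 ^ (b - j) * l1 ^ a"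
      "j \<le> b \<longrightarrow> c \<noteq> 0"
      using deriv_along_monomial[OF l(2) d(2) poly_space_power[OF l(1)] dp(1), of j b a] by blast
    obtain c' where c': "(deriv_along e1 ^^ i) (l1 ^ a * (pconst c * l2 ^ (b - j))) =
        pconst c' * l1 ^ (a - i) * (pconst c * l2 ^ (b - j))" "i \<le> a \<longrightarrow> c' \<noteq> 0"
      using deriv_along_monomial[OF l(1) d(1), of "pconst c * l2 ^ (b - j)" i a] l dp
      by (metis deriv_along_cmult mult_zero_right poly_space_mult poly_space_pconst poly_space_power)
    have "(deriv_along e1 ^^ i) ((deriv_along e2 ^^ j) (l1 ^ a * l2 ^ b)) =
      pconst c' * l1 ^ (a - i) * (pconst c * l2 ^ (b - j))"
      using c(1) c'(1) by (simp add: mult_ac)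
    then have "((deriv_along e1 ^^ i) ((deriv_along e2 ^^ j) (l1 ^ a * l2 ^ b))) u0 =
      c' * (l1 ^ (a - i)) u0 * (c * (l2 ^ (b - j)) u0)"
      by (simp add: fun_apply)
    moreover have "(l1 ^ n) u0 = (if n = 0 then 1 else 0)" "(l2 ^ n) u0 = (if n = 0 then 1 else 0)" for n
      using l by (cases n; simp add: fun_apply)+
    ultimately show ?thesis using c(2) c'(2) that by auto
  qed
  ultimately show ?thesis using l by (intro that[of "l1 ^ a * l2 ^ b"]) auto
qed

text \<open>Built as the product over s in S of the d-th power of the squared distance to s, then
  scaled to the value 1 at u0.\<close>

lemma separating_polynomial:
  fixes u0 :: "real ^ 'n"
  assumes "finite S" "u0 \<notin> S"
  obtains q where "q \<in> poly_space" "vanish S d q" "q u0 = 1"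
proof -
  have "\<exists>q. q \<in> poly_space \<and> vanish S d q \<and> q u0 \<noteq> 0"
    using assms
  proof (induction S rule: finite_induct)
    case empty
    have "vanish {} d f" if "f \<in> poly_space" for f :: "'n pfun"
      using that by (induction d arbitrary: f) auto
    then have "vanish {} d 1" by simp
    moreover have "(1 :: 'n pfun) u0 \<noteq> 0" by (simp add: one_fun_apply)
    ultimately show ?case by (intro exI[of _ 1]) simp
  next
    case (insert s S)
    then obtain q where q: "q \<in> poly_space" "vanish S d q" "q u0 \<noteq> 0" by auto
    define l where "l = (\<lambda>e. plin e - pconst (of_real (e \<bullet> s)))"
    define g where "g = l e1 * l e1 + l e2 * l e2"
    have g: "g \<in> poly_space" unfolding g_def l_def by auto
    have gu: "g u = of_real ((e1 \<bullet> (u - s))\<^sup>2 + (e2 \<bullet> (u - s))\<^sup>2)" for u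
      by (simp add: g_def l_def fun_apply inner_diff_right power2_eq_square)
    have gs: "vanish {s} d (g ^ d)"
      by (rule vanish_power[OF g]) (simp add: gu)
    have "(g u0 = 0) \<longleftrightarrow> u0 = s"
    proof
      assume "g u0 = 0"
      then have "(e1 \<bullet> (u0 - s))\<^sup>2 + (e2 \<bullet> (u0 - s))\<^sup>2 = 0" unfolding gu by (simp only: of_real_eq_0_iff)
      then have "e1 \<bullet> (u0 - s) = 0" "e2 \<bullet> (u0 - s) = 0" by (simp_all add: sum_power2_eq_zero_iff)
      then show "u0 = s" using coordinates[of "u0 - s"] by (simp add: inner_commute)
    qed (simp add: gu)
    then have "g u0 \<noteq> 0" using insert.prems by auto
    have "vanish (insert s S) d (g ^ d * q)"
      using vanish_Un[of "{s}" d "g ^ d * q" S] vanish_mult[of q "{s}" d "g ^ d"] gs q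
        vanish_mult[of "g ^ d" S d q] g by (auto simp: mult.commute[of q])
    moreover have "(g ^ d * q) u0 \<noteq> 0"
    proof -
      have "(g ^ n) u0 = g u0 ^ n" for n by (induction n) (auto simp: fun_apply)
      then show ?thesis using \<open>g u0 \<noteq> 0\<close> q by (simp add: fun_apply)
    qed
    ultimately show ?case using g q by (intro exI[of _ "g ^ d * q"]) auto
  qed
  then obtain q where q: "q \<in> poly_space" "vanish S d q" "q u0 \<noteq> 0" by auto
  show ?thesis
    by (rule that[of "pconst (1 / q u0) * q"]) (use q in \<open>auto intro!: vanish_mult simp: fun_apply\<close>)
qed

text \<open>The set where f is nonzero is open and nonempty, whereas the root hyperplanes and the
  coincidence sets of two distinct group elements are finitely many null sets.\<close>

lemma regular_point:
  assumes "f \<in> poly_space" "f \<noteq> 0"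
  obtains x where "f x \<noteq> 0" "\<And>\<alpha>. \<alpha> \<in> R \<Longrightarrow> \<alpha> \<bullet> x \<noteq> 0"
    "\<And>u w. u \<in> W \<Longrightarrow> w \<in> W \<Longrightarrow> u x = w x \<Longrightarrow> u = w"
proof -
  define B where "B = (\<Union>\<alpha>\<in>R. {x. \<alpha> \<bullet> x = 0}) \<union> (\<Union>p\<in>{p \<in> W \<times> W. fst p \<noteq> snd p}. {x. fst p x = snd p x})"
  have neg: "negligible {x. u x = w x}" if "u \<in> W" "w \<in> W" "u \<noteq> w" for u w
  proof -
    obtain y where y: "u y \<noteq> w y" using \<open>u \<noteq> w\<close> by auto
    define a where "a = u y - w y"
    \<comment> \<open>The vector b puts the coincidence set into a hyperplane: b pairs with x to
      \<open>a \<bullet> (u x - w x)\<close>, which is nonzero at x = y by the choice of a.\<close>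
    define b where "b = inv_into UNIV u a - inv_into UNIV w a"
    have ba: "b \<bullet> x = a \<bullet> (u x - w x)" for x
      using that W_inner_inv by (simp add: b_def inner_diff_left inner_diff_right)
    have "b \<bullet> y \<noteq> 0" using y by (simp add: ba a_def)
    then have "b \<noteq> 0" by auto
    then have "negligible {x. b \<bullet> x = 0}" by (intro negligible_hyperplane) auto
    moreover have "{x. u x = w x} \<subseteq> {x. b \<bullet> x = 0}" by (auto simp: ba)
    ultimately show ?thesis by (rule negligible_subset)
  qed
  have "finite (W \<times> W)" using finite_W by simp
  then have "negligible B" unfolding B_def
    using neg R_nonzero finite_R
    by (intro negligible_Un negligible_Union finite_imageI) (auto intro!: negligible_hyperplane)
  have "continuous_on UNIV f"
    using assms(1) by (auto simp: poly_space_def continuous_on_polymonial_function)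
  then have "open {x. f x \<noteq> 0}"
    by (intro open_Collect_neq continuous_intros)
  moreover have "{x. f x \<noteq> 0} \<noteq> {}" using assms(2) by (auto simp: fun_eq_iff fun_apply)
  ultimately have "\<not> negligible {x. f x \<noteq> 0}" using open_not_negligible by blast
  then have "\<not> {x. f x \<noteq> 0} \<subseteq> B"
    using negligible_subset[OF \<open>negligible B\<close>] by blast
  then obtain x where "f x \<noteq> 0" "x \<notin> B" by blast
  then show ?thesis by (intro that[of x]) (auto simp: B_def)
qed

text \<open>A list may repeat a group element with the same exponents; what matters is the sum of
  the coefficients over the repetitions.\<close>

definition nf_coeff :: "'n nform \<Rightarrow> (real ^ 'n \<Rightarrow> real ^ 'n) \<times> nat \<times> nat \<Rightarrow> 'n pfun" where
  "nf_coeff c s = (\<Sum>t\<leftarrow>c. if snd t = s then fst t else 0)"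

lemma nf_coeff_poly: "nf_ok c \<Longrightarrow> nf_coeff c s \<in> poly_space"
  unfolding nf_coeff_def by (induction c) auto

lemma nf_op_nf_coeff:
  assumes "finite I" "snd ` set c \<subseteq> I"
  shows "nf_op \<rho> c F = (\<Sum>s\<in>I. nterm \<rho> (nf_coeff c s, s) F)"
  using assms(2)
proof (induction c)
  case Nil
  then show ?case by (simp add: nf_coeff_def nterm_def vmul_simps split: prod.splits)
next
  case (Cons t c)
  have "(\<Sum>s\<in>I. nterm \<rho> (nf_coeff (t # c) s, s) F) =
    (\<Sum>s\<in>I. (if s = snd t then nterm \<rho> (fst t, s) F else 0) + nterm \<rho> (nf_coeff c s, s) F)"
    by (intro sum.cong) (auto simp: nf_coeff_def nterm_def vmul_simps split: prod.splits)
  also have "\<dots> = nterm \<rho> t F + nf_op \<rho> c F"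
    using Cons assms(1) by (simp add: sum.distrib)
  finally show ?case by simp
qed

lemma snf_op_nf_coeff:
  assumes "finite I" "snd ` set c \<subseteq> I"
  shows "snf_op c f = (\<Sum>s\<in>I. snterm (nf_coeff c s, s) f)"
  using assms(2)
proof (induction c)
  case Nil
  then show ?case by (simp add: snf_op_def nf_coeff_def snterm_def split: prod.splits)
next
  case (Cons t c)
  have "(\<Sum>s\<in>I. snterm (nf_coeff (t # c) s, s) f) =
    (\<Sum>s\<in>I. (if s = snd t then snterm (fst t, s) f else 0) + snterm (nf_coeff c s, s) f)"
    by (intro sum.cong) (auto simp: nf_coeff_def snterm_def distrib_right split: prod.splits)
  also have "\<dots> = snterm t f + snf_op c f"
    using Cons assms(1) by (simp add: sum.distrib)
  finally show ?case by (simp add: snf_op_def)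
qed

text \<open>Evaluate at a regular point on a polynomial that vanishes to high order at all but one point
  of the orbit: only the terms of top degree attached to a single group element survive.\<close>

lemma nf_coeff_zero:
  assumes ok: "nf_ok c" and zero: "\<And>f. f \<in> poly_space \<Longrightarrow> snf_op c f = 0"
  shows "nf_coeff c s = 0"
proof (rule ccontr)
  assume s: "nf_coeff c s \<noteq> 0"
  define I where "I = snd ` set c"
  have I: "finite I" "snd ` set c \<subseteq> I" by (auto simp: I_def)
  have IW: "w \<in> W" if "(w, i, j) \<in> I" for w i j using that ok by (force simp: I_def nf_ok_def)
  have notI: "nf_coeff c s = 0" if "s \<notin> I" for s
  proof -
    have "(\<Sum>t\<leftarrow>c. if snd t = s then fst t else 0) = (\<Sum>t\<leftarrow>c. 0)"
      using that by (intro arg_cong[where f = sum_list] map_cong) (auto simp: I_def)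
    then show ?thesis by (simp add: nf_coeff_def)
  qed
  define D where "D = (\<lambda>s :: (real ^ 'n \<Rightarrow> real ^ 'n) \<times> nat \<times> nat. fst (snd s) + snd (snd s))"
  define I' where "I' = {s \<in> I. nf_coeff c s \<noteq> 0}"
  have "s \<in> I" using s notI by blast
  then have "finite I'" "s \<in> I'" using I s by (auto simp: I'_def)
  \<comment> \<open>The largest number of Dunkl operators in a term with nonzero collected
    coefficient.\<close>
  define d where "d = Max (D ` I')"
  have "d \<in> D ` I'" unfolding d_def using \<open>finite I'\<close> \<open>s \<in> I'\<close> by (intro Max_in) auto
  then obtain w0 a b where t0: "(w0, a, b) \<in> I'" "a + b = d" by (auto simp: D_def)
  have dmax: "i + j \<le> d" if "(w, i, j) \<in> I'" for w i j
  proof -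
    have "D (w, i, j) \<le> Max (D ` I')" using \<open>finite I'\<close> that by (intro Max_ge) auto
    then show ?thesis by (simp add: d_def D_def)
  qed
  have w0: "w0 \<in> W" using t0 IW by (auto simp: I'_def)
  obtain x where x: "nf_coeff c (w0, a, b) x \<noteq> 0" "\<And>\<alpha>. \<alpha> \<in> R \<Longrightarrow> \<alpha> \<bullet> x \<noteq> 0"
    "\<And>u w. u \<in> W \<Longrightarrow> w \<in> W \<Longrightarrow> u x = w x \<Longrightarrow> u = w"
    using regular_point[OF nf_coeff_poly[OF ok], of "(w0, a, b)"] t0 by (auto simp: I'_def)
  define Orb where "Orb = (\<lambda>w. w x) ` W"
  have Orb_W: "w u \<in> Orb" if "w \<in> W" "u \<in> Orb" for w u
  proof -
    obtain v where v: "v \<in> W" "u = v x" using \<open>u \<in> Orb\<close> by (auto simp: Orb_def)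
    have "(w \<circ> v) x \<in> Orb" unfolding Orb_def by (rule imageI[OF W_comp[OF that(1) v(1)]])
    then show ?thesis by (simp add: v)
  qed
  have Orb_reg: "\<alpha> \<bullet> u \<noteq> 0" if \<alpha>: "\<alpha> \<in> R" and u: "u \<in> Orb" for \<alpha> u
  proof -
    obtain w where w: "w \<in> W" "u = w x" using u by (auto simp: Orb_def)
    then have "inv_into UNIV w \<alpha> \<bullet> x = \<alpha> \<bullet> u" by (simp add: W_inner_inv)
    then show ?thesis using x(2)[OF W_R[OF W_inv[OF w(1)] \<alpha>]] by simp
  qed
  \<comment> \<open>\<open>pull w0\<close> evaluates at the inverse image, so the value at x of the
    chosen term reads its argument at u0.\<close>
  define u0 where "u0 = inv_into UNIV w0 x"
  have u0: "u0 \<in> Orb" using W_inv[OF w0] by (auto simp: u0_def Orb_def)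
  obtain q where q: "q \<in> poly_space" "vanish (Orb - {u0}) (Suc d) q" "q u0 = 1"
    using separating_polynomial[of "Orb - {u0}" u0 "Suc d"] finite_W by (auto simp: Orb_def simp del: vanish.simps)
  obtain h where h: "h \<in> poly_space" "vanish {u0} (a + b) h"
    "\<And>i j. i + j = a + b \<Longrightarrow> ((deriv_along e1 ^^ i) ((deriv_along e2 ^^ j) h)) u0 = 0 \<longleftrightarrow> (i, j) \<noteq> (a, b)"
    using vanish_nonvanishing_jet by blast
  \<comment> \<open>q vanishes to order d + 1 on the rest of the orbit and is 1 at u0; at u0 the
    only nonzero derivative of h of order d in the directions e1, e2 is the one for (a, b).\<close>
  define f where "f = q * h"
  have f: "f \<in> poly_space" using q h by (auto simp: f_def)
  have f1: "vanish (Orb - {u0}) (Suc d) f"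
    unfolding f_def mult.commute[of q] using h(1) q(2) by (rule vanish_mult)
  have f2: "vanish {u0} d f"
    unfolding f_def using vanish_mult[OF q(1) h(2)] t0 by simp
  have f3: "vanish {u0} (Suc d) (f - h)"
  proof -
    have "vanish {u0} (Suc d) ((q - 1) * h)"
      using h(2) q t0(2) by (intro vanish_mult_zero) (auto simp: fun_apply)
    then show ?thesis by (simp add: f_def algebra_simps)
  qed
  have "insert u0 Orb = Orb" using u0 by auto
  then have fO: "vanish Orb d f"
    using vanish_Un[OF f2 vanish_Suc[OF f1]] by simp
  have word0: "((deriv_along e1 ^^ i) ((deriv_along e2 ^^ j) g)) u = 0"
    if "vanish S (Suc (i + j)) g" "u \<in> S" for i j g S u
  proof -
    have "vanish S m (foldr deriv_along vs g)" if "vanish S (length vs + m) g" for vs m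
      using that
    proof (induction vs arbitrary: m)
      case (Cons v vs)
      then have "vanish S (Suc m) (foldr deriv_along vs g)" by (simp del: vanish.simps)
      from vanish_SucD(3)[OF this] show ?case by simp
    qed simp
    from this[of "replicate i e1 @ replicate j e2" 1] that
    show ?thesis by (simp add: foldr_replicate_funpow add.commute)
  qed
  have wordT: "((sT e1 ^^ i) ((sT e2 ^^ j) f)) u =
      (if i + j = d then ((deriv_along e1 ^^ i) ((deriv_along e2 ^^ j) f)) u else 0)"
    if "i + j \<le> d" "u \<in> Orb" for i j u
  proof -
    let ?vs = "replicate i e1 @ replicate j e2"
    have eq: "foldr sT ?vs f = (sT e1 ^^ i) ((sT e2 ^^ j) f)"
      "foldr deriv_along ?vs f = (deriv_along e1 ^^ i) ((deriv_along e2 ^^ j) f)"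
      by (simp_all add: foldr_replicate_funpow)
    obtain m where m: "d = length ?vs + m" using le_Suc_ex[OF \<open>i + j \<le> d\<close>] by auto
    have *: "vanish Orb m (foldr sT ?vs f)" "vanish Orb (Suc m) (foldr sT ?vs f - foldr deriv_along ?vs f)"
      using vanish_words[of Orb ?vs m f] Orb_W Orb_reg fO m by blast+
    show ?thesis
    proof (cases "i + j = d")
      case True
      then show ?thesis using *(2) that(2) unfolding eq by (simp add: fun_apply)
    next
      case False
      then obtain m' where "m = Suc m'" using m by (cases m) auto
      then show ?thesis using *(1) that(2) False unfolding eq by simp
    qed
  qed
  have "snf_op c f x = 0" using zero[OF f] by (simp add: fun_apply)
  moreover have "snf_op c f x = (\<Sum>s\<in>I. snterm (nf_coeff c s, s) f x)"
    by (simp add: snf_op_nf_coeff[OF I] sum_fun_apply)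
  moreover have "snterm (nf_coeff c t, t) f x = 0" if t: "t \<in> I" "t \<noteq> (w0, a, b)" for t
  proof -
    obtain w i j where tw: "t = (w, i, j)" by (cases t) auto
    have w: "w \<in> W" using IW t tw by auto
    define u where "u = inv_into UNIV w x"
    have u: "u \<in> Orb" using W_inv[OF w] by (auto simp: u_def Orb_def)
    have val: "snterm (nf_coeff c t, t) f x = nf_coeff c t x * ((sT e1 ^^ i) ((sT e2 ^^ j) f)) u"
      by (simp add: snterm_def tw times_fun_apply pull_def u_def)
    show ?thesis
    proof (cases "nf_coeff c t = 0")
      case True
      then show ?thesis unfolding val by (simp add: zero_fun_apply)
    next
      case False
      then have "i + j \<le> d" using dmax t tw by (auto simp: I'_def)
      \<comment> \<open>Either there are too few operators for the order of vanishing, or the degree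
        is full but the point of the orbit is another one, or the point and hence the group element
        agree and the exponents differ.\<close>
      consider "i + j < d" | "i + j = d" "u \<noteq> u0" | "i + j = d" "u = u0" using \<open>i + j \<le> d\<close> by linarith
      then show ?thesis
      proof cases
        case 1
        then show ?thesis using wordT[OF \<open>i + j \<le> d\<close> u] by (simp add: val)
      next
        case 2
        then have "((deriv_along e1 ^^ i) ((deriv_along e2 ^^ j) f)) u = 0"
          using word0[of "Orb - {u0}" i j f u] f1 u by (simp del: vanish.simps)
        then show ?thesis using wordT[OF \<open>i + j \<le> d\<close> u] by (simp add: val)
      next
        case 3
        then have "inv_into UNIV w = inv_into UNIV w0"
          using x(3)[OF W_inv[OF w] W_inv[OF w0]] by (simp add: u_def u0_def)
        then have "w = w0" using W_inv_apply(1)[OF w] W_inv_apply(2)[OF w0] by (metis ext W_inv_apply)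
        then have ij: "(i, j) \<noteq> (a, b)" using t tw by auto
        have "((deriv_along e1 ^^ i) ((deriv_along e2 ^^ j) (f - h))) u0 = 0"
          using word0[of "{u0}" i j "f - h" u0] f3 3 by (simp del: vanish.simps)
        moreover have "(deriv_along e1 ^^ i) ((deriv_along e2 ^^ j) (f - h)) =
          (deriv_along e1 ^^ i) ((deriv_along e2 ^^ j) f) - (deriv_along e1 ^^ i) ((deriv_along e2 ^^ j) h)"
        proof -
          have 1: "deriv_along v (g - g') = deriv_along v g - deriv_along v g'"
            if "g \<in> poly_space" "g' \<in> poly_space" for v and g g' :: "'n pfun"
            using deriv_along_add[of "g - g'" g' v] that by (simp add: poly_space_diff)
          have 2: "(deriv_along v ^^ n) (g - g') = (deriv_along v ^^ n) g - (deriv_along v ^^ n) g'"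
            if "g \<in> poly_space" "g' \<in> poly_space" for v n and g g' :: "'n pfun"
            by (induction n) (use that in \<open>auto simp: 1 deriv_along_funpow_closed\<close>)
          show ?thesis using f h by (simp add: 2 deriv_along_funpow_closed)
        qed
        ultimately have "((deriv_along e1 ^^ i) ((deriv_along e2 ^^ j) f)) u0 = 0"
          using h(3)[of i j] ij 3 t0 by (simp add: fun_apply)
        then show ?thesis using wordT[OF \<open>i + j \<le> d\<close> u] 3 by (simp add: val)
      qed
    qed
  qed
  ultimately have "snterm (nf_coeff c (w0, a, b), (w0, a, b)) f x = 0"
    using I(1) t0(1) sum.remove[of I "(w0, a, b)" "\<lambda>s. snterm (nf_coeff c s, s) f x"]
    by (simp add: I'_def)
  moreover have "snterm (nf_coeff c (w0, a, b), (w0, a, b)) f x =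
      nf_coeff c (w0, a, b) x * ((deriv_along e1 ^^ a) ((deriv_along e2 ^^ b) f)) u0"
    using wordT[of a b u0] t0 u0 by (simp add: snterm_def times_fun_apply pull_def u0_def)
  ultimately have "((deriv_along e1 ^^ a) ((deriv_along e2 ^^ b) f)) u0 = 0" using x(1) by simp
  moreover have "((deriv_along e1 ^^ a) ((deriv_along e2 ^^ b) (f - h))) u0 = 0"
    using word0[of "{u0}" a b "f - h" u0] f3 t0 by (simp del: vanish.simps)
  moreover have "(deriv_along e1 ^^ a) ((deriv_along e2 ^^ b) (f - h)) =
    (deriv_along e1 ^^ a) ((deriv_along e2 ^^ b) f) - (deriv_along e1 ^^ a) ((deriv_along e2 ^^ b) h)"
  proof -
    have 1: "deriv_along v (g - g') = deriv_along v g - deriv_along v g'"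
      if "g \<in> poly_space" "g' \<in> poly_space" for v and g g' :: "'n pfun"
      using deriv_along_add[of "g - g'" g' v] that by (simp add: poly_space_diff)
    have 2: "(deriv_along v ^^ n) (g - g') = (deriv_along v ^^ n) g - (deriv_along v ^^ n) g'"
      if "g \<in> poly_space" "g' \<in> poly_space" for v n and g g' :: "'n pfun"
      by (induction n) (use that in \<open>auto simp: 1 deriv_along_funpow_closed\<close>)
    show ?thesis using f h by (simp add: 2 deriv_along_funpow_closed)
  qed
  ultimately show False using h(3)[of a b] by (simp add: fun_apply)
qed

text \<open>All collected coefficients vanish as soon as the normal form kills scalar polynomials,
  and then it is zero in every representation. This makes the action \<open>act\<close> below well
  defined.\<close>

theorem PBW:
  assumes "nf_ok c" "\<And>f. f \<in> poly_space \<Longrightarrow> snf_op c f = 0"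
  shows "nf_op \<rho> c F = 0"
  using nf_op_nf_coeff[of "snd ` set c" c \<rho> F] nf_coeff_zero[OF assms]
  by (simp add: nterm_def vmul_simps split: prod.splits)

end

section \<open>The action of the Cherednik algebra on vector-valued polynomials\<close>

lemma End_poly_simps:
  "\<one>\<^bsub>End_poly\<^esub> = (\<lambda>f\<in>poly_space. f)"
  "\<zero>\<^bsub>End_poly\<^esub> = (\<lambda>f\<in>poly_space. 0)"
  "A \<oplus>\<^bsub>End_poly\<^esub> B = (\<lambda>f\<in>poly_space. A f + B f)"
  "A \<otimes>\<^bsub>End_poly\<^esub> B = compose poly_space A B"
  by (simp_all add: End_poly_def plus_fun_def zero_fun_def)

lemma End_poly_carrier:
  "A \<in> carrier End_poly \<longleftrightarrow> A \<in> poly_space \<rightarrow>\<^sub>E poly_space \<and> plinear A"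
  by (auto simp: End_poly_def plinear_def plus_fun_def times_fun_def pconst_def)

lemma End_poly_ext:
  assumes "A \<in> carrier End_poly" "B \<in> carrier End_poly" "\<And>f. f \<in> poly_space \<Longrightarrow> A f = B f"
  shows "A = B"
  by (rule PiE_ext[of A poly_space "\<lambda>_. poly_space" B]) (use assms in \<open>simp_all add: End_poly_carrier\<close>)

lemma End_poly_restrict:
  "plinear L \<Longrightarrow> (\<lambda>f\<in>poly_space. L f) \<in> carrier End_poly"
  by (auto simp: End_poly_carrier plinear_def)

lemma End_poly_plinear: "A \<in> carrier End_poly \<Longrightarrow> plinear A"
  by (simp add: End_poly_carrier)

lemma plinear_closed: "plinear L \<Longrightarrow> f \<in> poly_space \<Longrightarrow> L f \<in> poly_space"
  by (simp add: plinear_def)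

lemma plinear_add_op: "plinear A \<Longrightarrow> plinear B \<Longrightarrow> plinear (\<lambda>f. A f + B f)"
  by (auto simp: plinear_def distrib_left add_ac)

lemma plinear_comp_op: "plinear A \<Longrightarrow> plinear B \<Longrightarrow> plinear (\<lambda>f. A (B f))"
  by (auto simp: plinear_def)

lemma plinear_mult_op: "p \<in> poly_space \<Longrightarrow> plinear (\<lambda>f. p * f)"
  by (auto simp: plinear_def distrib_left mult.left_commute)

lemma plinear_sum_op: "(\<And>i. i \<in> I \<Longrightarrow> plinear (A i)) \<Longrightarrow> plinear (\<lambda>f. \<Sum>i\<in>I. A i f)"
proof (induction I rule: infinite_finite_induct)
  case (insert i I)
  then show ?case by (auto intro: plinear_add_op)
qed (auto simp: plinear_def)

lemma End_poly_closed:
  assumes "A \<in> carrier End_poly" "B \<in> carrier End_poly"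
  shows "A \<oplus>\<^bsub>End_poly\<^esub> B \<in> carrier End_poly" "A \<otimes>\<^bsub>End_poly\<^esub> B \<in> carrier End_poly"
  unfolding End_poly_simps compose_def
  by (rule End_poly_restrict[OF plinear_add_op[OF assms[THEN End_poly_plinear]]]
      End_poly_restrict[OF plinear_comp_op[OF assms[THEN End_poly_plinear]]])+

lemma End_poly_apply:
  assumes "f \<in> poly_space"
  shows "\<one>\<^bsub>End_poly\<^esub> f = f" "\<zero>\<^bsub>End_poly\<^esub> f = 0"
    "(A \<oplus>\<^bsub>End_poly\<^esub> B) f = A f + B f" "(A \<otimes>\<^bsub>End_poly\<^esub> B) f = A (B f)"
  using assms by (simp_all add: End_poly_simps compose_eq)

lemma End_poly_one_zero: "\<one>\<^bsub>End_poly\<^esub> \<in> carrier End_poly" "\<zero>\<^bsub>End_poly\<^esub> \<in> carrier End_poly"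
  unfolding End_poly_simps by (auto intro!: End_poly_restrict simp: plinear_def)

lemma End_poly_maps: "A \<in> carrier End_poly \<Longrightarrow> f \<in> poly_space \<Longrightarrow> A f \<in> poly_space"
  by (rule plinear_closed[OF End_poly_plinear])

lemma End_poly_add: "A \<in> carrier End_poly \<Longrightarrow> f \<in> poly_space \<Longrightarrow> g \<in> poly_space \<Longrightarrow> A (f + g) = A f + A g"
  using End_poly_plinear[of A] by (simp add: plinear_def)

lemma ring_End_poly: "ring (End_poly :: ('n::finite) pop ring)"
proof (rule ringI)
  show "abelian_group (End_poly :: 'n pop ring)"
  proof (rule abelian_groupI)
    fix x :: "'n pop" assume x: "x \<in> carrier End_poly"
    let ?y = "\<lambda>f\<in>poly_space. pconst (-1) * x f"
    have "?y \<in> carrier End_poly"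
      by (rule End_poly_restrict[OF plinear_comp_op[OF plinear_mult_op[OF poly_space_pconst] End_poly_plinear[OF x]]])
    moreover have "?y \<oplus>\<^bsub>End_poly\<^esub> x = \<zero>\<^bsub>End_poly\<^esub>"
      by (rule End_poly_ext) (use x \<open>?y \<in> carrier End_poly\<close> in
        \<open>auto intro!: End_poly_closed End_poly_one_zero simp: End_poly_apply pconst_minus\<close>)
    ultimately show "\<exists>y\<in>carrier End_poly. y \<oplus>\<^bsub>End_poly\<^esub> x = \<zero>\<^bsub>End_poly\<^esub>" by blast
  qed (auto intro!: End_poly_ext End_poly_closed End_poly_one_zero simp: End_poly_apply add_ac)
  show "Group.monoid (End_poly :: 'n pop ring)"
    by (rule monoidI)
      (auto intro!: End_poly_ext End_poly_closed End_poly_one_zero simp: End_poly_apply End_poly_maps)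
qed (auto intro!: End_poly_ext End_poly_closed simp: End_poly_apply End_poly_maps End_poly_add)

lemma End_poly_a_inv:
  assumes "A \<in> carrier End_poly" "f \<in> poly_space"
  shows "(\<ominus>\<^bsub>End_poly\<^esub> A) f = - A f"
proof -
  interpret ring End_poly by (rule ring_End_poly)
  have "(\<ominus>\<^bsub>End_poly\<^esub> A \<oplus>\<^bsub>End_poly\<^esub> A) f = 0"
    using l_neg[OF assms(1)] End_poly_apply(2)[OF assms(2)] by simp
  then show ?thesis using End_poly_apply(3)[OF assms(2)] by (simp add: eq_neg_iff_add_eq_0)
qed

lemma scalar_op_apply: "f \<in> poly_space \<Longrightarrow> scalar_op c f = pconst c * f"
  by (simp add: scalar_op_def times_fun_def pconst_def)

lemma mult_op_apply: "f \<in> poly_space \<Longrightarrow> mult_op p f = p * f"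
  by (simp add: mult_op_def times_fun_def)

lemma group_op_apply: "f \<in> poly_space \<Longrightarrow> group_op w f = pull w f"
  by (simp add: group_op_def pull_def)

lemma mult_op_carrier: "p \<in> poly_space \<Longrightarrow> mult_op p \<in> carrier End_poly"
  using End_poly_restrict[OF plinear_mult_op[of p]] by (simp add: mult_op_def times_fun_def)

lemma scalar_op_eq_mult_op: "scalar_op c = mult_op (pconst c)"
  by (simp add: scalar_op_def mult_op_def pconst_def)

definition Re_vec :: "complex ^ 'n \<Rightarrow> real ^ 'n" where "Re_vec y = (\<chi> i. Re (y $ i))"
definition Im_vec :: "complex ^ 'n \<Rightarrow> real ^ 'n" where "Im_vec y = (\<chi> i. Im (y $ i))"

lemma vec_expansion: "(v :: real ^ 'n::finite) = (\<Sum>i\<in>UNIV. (v $ i) *\<^sub>R axis i 1)"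
  by (simp add: vec_eq_iff axis_def if_distrib cong: if_cong)

lemma dir_deriv_eq:
  assumes "f \<in> poly_space"
  shows "dir_deriv y f = deriv_along (Re_vec y) f + pconst \<i> * deriv_along (Im_vec y) f"
proof
  fix x
  have lin: "linear (frechet_derivative f (at x))"
    using poly_space_differentiable[OF assms] by (rule linear_frechet_derivative)
  have *: "frechet_derivative f (at x) v = (\<Sum>i\<in>UNIV. of_real (v $ i) * frechet_derivative f (at x) (axis i 1))" for v
    by (subst vec_expansion) (simp add: linear_sum[OF lin] linear_cmul[OF lin] scaleR_conv_of_real[where 'a=complex])
  show "dir_deriv y f x = (deriv_along (Re_vec y) f + pconst \<i> * deriv_along (Im_vec y) f) x"
    unfolding fun_apply deriv_along_def dir_deriv_def *[of "Re_vec y"] *[of "Im_vec y"]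
    by (simp add: Re_vec_def Im_vec_def sum_distrib_left sum.distrib[symmetric] mult.assoc[symmetric]
        distrib_right[symmetric] flip: complex_eq)
qed

lemma root_pairing_eq: "root_pairing \<alpha> y = of_real (\<alpha> \<bullet> Re_vec y) + \<i> * of_real (\<alpha> \<bullet> Im_vec y)"
  by (simp add: root_pairing_def inner_vec_def Re_vec_def Im_vec_def complex_eq_iff)

locale dunkl_setting = root_data R e1 e2 k for R :: "(real ^ 'n::finite) set" and e1 e2 k +
  fixes Rp
  assumes positive: "positive_system R Rp"
begin

abbreviation H where "H \<equiv> cherednik_algebra R Rp k"
abbreviation B where "B \<equiv> parabolic_subalgebra R Rp k"

lemma sum_R_even:
  assumes "\<And>\<alpha>. \<alpha> \<in> R \<Longrightarrow> g (- \<alpha>) = g \<alpha>"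
  shows "(\<Sum>\<alpha>\<in>R. g \<alpha>) = (\<Sum>\<alpha>\<in>Rp. g \<alpha>) + (\<Sum>\<alpha>\<in>Rp. g \<alpha>)"
proof -
  obtain v where v: "\<forall>\<alpha>\<in>R. \<alpha> \<bullet> v \<noteq> 0" "Rp = {\<alpha> \<in> R. 0 < \<alpha> \<bullet> v}"
    using positive by (auto simp: positive_system_def)
  have "R = Rp \<union> uminus ` Rp"
  proof (intro equalityI subsetI)
    fix \<alpha> assume \<alpha>: "\<alpha> \<in> R"
    show "\<alpha> \<in> Rp \<union> uminus ` Rp"
    proof (cases "0 < \<alpha> \<bullet> v")
      case False
      then have "- \<alpha> \<in> Rp" using v \<alpha> uminus_R[OF \<alpha>] by (force simp: not_less le_less)
      then have "- (- \<alpha>) \<in> uminus ` Rp" by (rule imageI)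
      then show ?thesis by simp
    qed (use v \<alpha> in auto)
  qed (use v uminus_R in auto)
  moreover have "Rp \<inter> uminus ` Rp = {}" using v by auto
  moreover have "finite Rp" using finite_R v by auto
  ultimately have "(\<Sum>\<alpha>\<in>R. g \<alpha>) = (\<Sum>\<alpha>\<in>Rp. g \<alpha>) + (\<Sum>\<alpha>\<in>uminus ` Rp. g \<alpha>)"
    by (simp add: sum.union_disjoint)
  also have "(\<Sum>\<alpha>\<in>uminus ` Rp. g \<alpha>) = (\<Sum>\<alpha>\<in>Rp. g (- \<alpha>))"
    by (subst sum.reindex) (auto simp: inj_on_def)
  also have "\<dots> = (\<Sum>\<alpha>\<in>Rp. g \<alpha>)" by (rule sum.cong) (use assms v in auto)
  finally show ?thesis .
qed

text \<open>Coefficient and divided difference both change sign under passage from \<alpha> to -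
  \<alpha>, so the sum over positive roots is half of the sum over R with doubled coefficients. A
  complex direction acts through its real and imaginary parts.\<close>

lemma dunkl_op_apply:
  assumes "f \<in> poly_space"
  shows "dunkl_op Rp k y f = sT (Re_vec y) f + pconst \<i> * sT (Im_vec y) f"
proof -
  let ?c = "\<lambda>\<alpha>. dunkl_coeff \<alpha> (Re_vec y) + \<i> * dunkl_coeff \<alpha> (Im_vec y)"
  have even: "pconst (?c (- \<alpha>)) * divided_difference (- \<alpha>) f = pconst (?c \<alpha>) * divided_difference \<alpha> f"
    if "\<alpha> \<in> R" for \<alpha>
  proof -
    have "?c (- \<alpha>) = - ?c \<alpha>" by (simp add: dunkl_coeff_def k_uminus[OF that])
    then show ?thesis
      by (simp only: divided_difference_uminus_root[OF R_nonzero[OF that] assms] pconst_minus minus_mult_minus)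
  qed
  have "dunkl_op Rp k y f = dir_deriv y f + (\<Sum>\<alpha>\<in>Rp. pconst (k \<alpha> * root_pairing \<alpha> y) * divided_difference \<alpha> f)"
    using assms by (simp add: dunkl_op_def fun_eq_iff[where 'a="real ^ 'n"] fun_apply sum_fun_apply)
  also have "(\<Sum>\<alpha>\<in>Rp. pconst (k \<alpha> * root_pairing \<alpha> y) * divided_difference \<alpha> f) =
    (\<Sum>\<alpha>\<in>Rp. pconst (?c \<alpha>) * divided_difference \<alpha> f + pconst (?c \<alpha>) * divided_difference \<alpha> f)"
  proof (rule sum.cong[OF HOL.refl])
    fix \<alpha>
    have "k \<alpha> * root_pairing \<alpha> y = ?c \<alpha> + ?c \<alpha>"
      by (simp add: root_pairing_eq dunkl_coeff_def algebra_simps)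
    then show "pconst (k \<alpha> * root_pairing \<alpha> y) * divided_difference \<alpha> f =
        pconst (?c \<alpha>) * divided_difference \<alpha> f + pconst (?c \<alpha>) * divided_difference \<alpha> f"
      by (simp only: pconst_add[of "?c \<alpha>" "?c \<alpha>"] distrib_right)
  qed
  also have "\<dots> = (\<Sum>\<alpha>\<in>R. pconst (?c \<alpha>) * divided_difference \<alpha> f)"
    unfolding sum.distrib
    by (rule sum_R_even[where g = "\<lambda>\<alpha>. pconst (?c \<alpha>) * divided_difference \<alpha> f", OF even, symmetric])
  also have "\<dots> = (\<Sum>\<alpha>\<in>R. pconst (dunkl_coeff \<alpha> (Re_vec y)) * divided_difference \<alpha> f) +
      pconst \<i> * (\<Sum>\<alpha>\<in>R. pconst (dunkl_coeff \<alpha> (Im_vec y)) * divided_difference \<alpha> f)"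
    by (simp add: pconst_add pconst_mult distrib_right sum.distrib sum_distrib_left mult.assoc)
  finally show ?thesis
    by (simp add: dir_deriv_eq[OF assms] sT_def distrib_left add_ac)
qed

lemma plinear_sT: "plinear (sT v)"
  unfolding sT_def
  by (rule plinear_add_op[OF plinear_deriv_along plinear_sum_op[OF plinear_comp_op[OF
      plinear_mult_op[OF poly_space_pconst] plinear_divided_difference[OF R_nonzero]]]])

lemma dunkl_op_carrier: "dunkl_op Rp k y \<in> carrier End_poly"
proof -
  have "dunkl_op Rp k y = (\<lambda>f\<in>poly_space. sT (Re_vec y) f + pconst \<i> * sT (Im_vec y) f)"
    using dunkl_op_apply[of _ y] by (auto simp: fun_eq_iff[where 'a="'n pfun"] dunkl_op_def)
  also have "\<dots> \<in> carrier End_poly"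
    by (rule End_poly_restrict[OF plinear_add_op[OF plinear_sT plinear_comp_op[OF
        plinear_mult_op[OF poly_space_pconst] plinear_sT]]])
  finally show ?thesis .
qed

lemma group_op_carrier: "w \<in> W \<Longrightarrow> group_op w \<in> carrier End_poly"
  using End_poly_restrict[OF plinear_pull, of w] by (simp add: group_op_def pull_def)

definition H_gens where
  "H_gens = range scalar_op \<union> (group_op ` W \<union> mult_op ` {x. linear x} \<union> range (dunkl_op Rp k))"

definition B_gens where
  "B_gens = range scalar_op \<union> (group_op ` W \<union> range (dunkl_op Rp k))"

lemma H_simps: "carrier H = generate_ring End_poly H_gens"
  "h \<oplus>\<^bsub>H\<^esub> h' = h \<oplus>\<^bsub>End_poly\<^esub> h'" "h \<otimes>\<^bsub>H\<^esub> h' = h \<otimes>\<^bsub>End_poly\<^esub> h'"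
  by (simp_all add: cherednik_algebra_def subalgebra_generated_def H_gens_def)

lemma B_simps: "carrier B = generate_ring End_poly B_gens"
  "h \<oplus>\<^bsub>B\<^esub> h' = h \<oplus>\<^bsub>End_poly\<^esub> h'" "h \<otimes>\<^bsub>B\<^esub> h' = h \<otimes>\<^bsub>End_poly\<^esub> h'"
  by (simp_all add: parabolic_subalgebra_def subalgebra_generated_def B_gens_def)

lemma H_gens_carrier: "H_gens \<subseteq> carrier End_poly"
  by (auto simp: H_gens_def scalar_op_eq_mult_op dunkl_op_carrier group_op_carrier mult_op_carrier
      poly_space_linear)

lemma H_carrier: "h \<in> carrier H \<Longrightarrow> h \<in> carrier End_poly"
  using ring.generate_ring_in_carrier[OF ring_End_poly H_gens_carrier] by (simp add: H_simps)

lemma B_H: "b \<in> carrier B \<Longrightarrow> b \<in> carrier H"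
  using ring.mono_generate_ring[OF ring_End_poly _ H_gens_carrier, of B_gens]
  by (auto simp: H_simps B_simps B_gens_def H_gens_def)

lemma H_closed:
  "h \<in> carrier H \<Longrightarrow> h' \<in> carrier H \<Longrightarrow> h \<oplus>\<^bsub>End_poly\<^esub> h' \<in> carrier H"
  "h \<in> carrier H \<Longrightarrow> h' \<in> carrier H \<Longrightarrow> h \<otimes>\<^bsub>End_poly\<^esub> h' \<in> carrier H"
  "scalar_op c \<in> carrier H" "w \<in> W \<Longrightarrow> group_op w \<in> carrier H" "dunkl_op Rp k y \<in> carrier H"
  "linear x \<Longrightarrow> mult_op x \<in> carrier H"
  unfolding H_simps H_gens_def by (auto intro: generate_ring.intros)

lemma B_closed:
  "h \<in> carrier B \<Longrightarrow> h' \<in> carrier B \<Longrightarrow> h \<oplus>\<^bsub>End_poly\<^esub> h' \<in> carrier B"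
  "h \<in> carrier B \<Longrightarrow> h' \<in> carrier B \<Longrightarrow> h \<otimes>\<^bsub>End_poly\<^esub> h' \<in> carrier B"
  "scalar_op c \<in> carrier B" "w \<in> W \<Longrightarrow> group_op w \<in> carrier B" "dunkl_op Rp k y \<in> carrier B"
  unfolding B_simps B_gens_def by (auto intro: generate_ring.intros)

lemma mult_op_H: "p \<in> poly_space \<Longrightarrow> mult_op p \<in> carrier H"
proof (induction rule: poly_space_induct)
  case (const c)
  then show ?case using H_closed(3) by (simp add: scalar_op_eq_mult_op)
next
  case (add f g)
  have "mult_op (f + g) = mult_op f \<oplus>\<^bsub>End_poly\<^esub> mult_op g"
    by (rule End_poly_ext) (use add in \<open>auto intro!: mult_op_carrier End_poly_closed
        simp: End_poly_apply mult_op_apply distrib_right\<close>)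
  then show ?case using H_closed(1) add by metis
next
  case (plin f v)
  have "mult_op (plin v * f) = mult_op (plin v) \<otimes>\<^bsub>End_poly\<^esub> mult_op f"
    by (rule End_poly_ext) (use plin in \<open>auto intro!: mult_op_carrier End_poly_closed
        simp: End_poly_apply mult_op_apply mult.assoc poly_space_mult\<close>)
  then show ?case using H_closed(2)[OF H_closed(6)[OF linear_plin] plin(2)] by metis
qed

section \<open>Normal forms of operators and the action they define\<close>

definition has_nf :: "'n pop \<Rightarrow> 'n nform \<Rightarrow> bool" where
  "has_nf h c \<longleftrightarrow> nf_ok c \<and> (\<forall>f\<in>poly_space. h f = snf_op c f)"

lemma snf_op_simps [simp]:
  "snf_op [] f = 0" "snf_op (t # c) f = snterm t f + snf_op c f"
  "snf_op (c @ d) f = snf_op c f + snf_op d f"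
  by (simp_all add: snf_op_def)

definition nf_neg :: "'n nform \<Rightarrow> 'n nform" where
  "nf_neg c = map (\<lambda>(p, s). (- p, s)) c"

lemma nf_neg_simps:
  "nf_ok c \<Longrightarrow> nf_ok (nf_neg c)" "snf_op (nf_neg c) f = - snf_op c f" "nf_op \<rho> (nf_neg c) F = - nf_op \<rho> c F"
  by (induction c) (auto simp: nf_neg_def snterm_def nterm_def vmul_simps)

text \<open>One normal form e serves the given representations and scalar polynomials at once: the
  scalar statement is the case of the trivial representation on the same index type, read off in one
  component.\<close>

lemma nf_comp:
  assumes "nf_ok c" "nf_ok d"
  obtains e where "nf_ok e" "\<And>f. f \<in> poly_space \<Longrightarrow> snf_op e f = snf_op c (snf_op d f)"
    "\<And>\<rho> F. weyl_rep \<rho> \<Longrightarrow> F \<in> vspace \<Longrightarrow> nf_op (\<rho> :: _ \<Rightarrow> complex ^ 'm ^ 'm) e F = nf_op \<rho> c (nf_op \<rho> d F)"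
proof -
  have "represents c (\<lambda>(\<rho> :: _ \<Rightarrow> complex ^ 'm ^ 'm) F. nf_op \<rho> c F)"
    "represents d (\<lambda>(\<rho> :: _ \<Rightarrow> complex ^ 'm ^ 'm) F. nf_op \<rho> d F)"
    using assms by (auto simp: represents_def)
  then obtain e where e: "represents e (\<lambda>(\<rho> :: _ \<Rightarrow> complex ^ 'm ^ 'm) F. nf_op \<rho> c (nf_op \<rho> d F))"
    using represents_comp by blast
  have "snf_op e f = snf_op c (snf_op d f)" if "f \<in> poly_space" for f
  proof -
    have "(\<lambda>_ :: 'm. f) \<in> vspace" using that by (simp add: vspace_def)
    then have "nf_op (\<lambda>_. mat 1 :: complex ^ 'm ^ 'm) c (nf_op (\<lambda>_. mat 1) d (\<lambda>_. f)) = nf_op (\<lambda>_. mat 1) e (\<lambda>_. f)"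
      using e weyl_rep_triv unfolding represents_def by blast
    then show ?thesis unfolding nf_op_triv by (metis (no_types))
  qed
  then show ?thesis using e by (intro that[of e]) (auto simp: represents_def)
qed

lemma has_nf_scalar: "has_nf (mult_op p) [(p, id, 0, 0)]" if "p \<in> poly_space"
  using that by (auto simp: has_nf_def mult_op_apply snterm_def weyl_group.id pull_def)

lemma has_nf_group: "has_nf (group_op w) [(1, w, 0, 0)]" if "w \<in> W"
  using that by (auto simp: has_nf_def group_op_apply snterm_def)

lemma sT_vector:
  assumes "f \<in> poly_space"
  shows "sT v f = pconst (of_real (v \<bullet> e1)) * sT e1 f + pconst (of_real (v \<bullet> e2)) * sT e2 f"
proof -
  have F: "(\<lambda>_ :: 1. f) \<in> vspace" using assms by (simp add: vspace_def)
  have "vT (\<lambda>_. mat 1 :: complex ^ 1 ^ 1) v (\<lambda>_. f) =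
    vT (\<lambda>_. mat 1) ((v \<bullet> e1) *\<^sub>R e1 + (v \<bullet> e2) *\<^sub>R e2) (\<lambda>_. f)"
    by (rule arg_cong[where f = "\<lambda>x. vT _ x _"], rule coordinates)
  also have "\<dots> = vmul (pconst (of_real (v \<bullet> e1))) (vT (\<lambda>_. mat 1) e1 (\<lambda>_. f)) +
      vmul (pconst (of_real (v \<bullet> e2))) (vT (\<lambda>_. mat 1) e2 (\<lambda>_. f))"
    by (simp add: vT_vector[OF F])
  finally show ?thesis
    unfolding vT_triv by (simp add: vmul_def fun_eq_iff[where 'a=1] plus_fun_apply)
qed

lemma vT_coordinates:
  assumes "F \<in> vspace"
  shows "vT \<rho> v F = vmul (pconst (of_real (v \<bullet> e1))) (vT \<rho> e1 F) + vmul (pconst (of_real (v \<bullet> e2))) (vT \<rho> e2 F)"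
proof -
  have "vT \<rho> v F = vT \<rho> ((v \<bullet> e1) *\<^sub>R e1 + (v \<bullet> e2) *\<^sub>R e2) F"
    by (rule arg_cong[where f = "\<lambda>x. vT \<rho> x F"], rule coordinates)
  then show ?thesis by (simp add: vT_vector[OF assms])
qed

abbreviation cpair :: "complex ^ 'n \<Rightarrow> real ^ 'n \<Rightarrow> complex" where
  "cpair y e \<equiv> of_real (Re_vec y \<bullet> e) + \<i> * of_real (Im_vec y \<bullet> e)"

lemma has_nf_dunkl: "has_nf (dunkl_op Rp k y) [(pconst (cpair y e1), id, 1, 0), (pconst (cpair y e2), id, 0, 1)]"
  unfolding has_nf_def
  by (auto simp: dunkl_op_apply snterm_def pull_def weyl_group.id sT_vector[of _ "Re_vec y"] sT_vector[of _ "Im_vec y"]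
      pconst_add pconst_mult algebra_simps)

lemma has_nf_add:
  "has_nf h c \<Longrightarrow> has_nf h' d \<Longrightarrow> has_nf (h \<oplus>\<^bsub>End_poly\<^esub> h') (c @ d)"
  by (auto simp: has_nf_def End_poly_apply)

lemma has_nf_neg: "h \<in> carrier End_poly \<Longrightarrow> has_nf h c \<Longrightarrow> has_nf (\<ominus>\<^bsub>End_poly\<^esub> h) (nf_neg c)"
  by (auto simp: has_nf_def End_poly_a_inv nf_neg_simps)

lemma snf_op_closed: "nf_ok c \<Longrightarrow> f \<in> poly_space \<Longrightarrow> snf_op c f \<in> poly_space"
  by (induction c) (auto simp: snterm_def split: prod.splits
    intro!: poly_space_add poly_space_mult poly_space_pull sT_funpow_closed)

lemma has_nf_mult:
  assumes "has_nf h c" "has_nf h' d"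
  obtains e where "has_nf (h \<otimes>\<^bsub>End_poly\<^esub> h') e"
    "\<And>\<rho> F. weyl_rep \<rho> \<Longrightarrow> F \<in> vspace \<Longrightarrow> nf_op (\<rho> :: _ \<Rightarrow> complex ^ 'm ^ 'm) e F = nf_op \<rho> c (nf_op \<rho> d F)"
proof -
  have cd: "nf_ok c" "nf_ok d" using assms by (auto simp: has_nf_def)
  obtain e where e: "nf_ok e" "\<And>f. f \<in> poly_space \<Longrightarrow> snf_op e f = snf_op c (snf_op d f)"
    "\<And>\<rho> F. weyl_rep \<rho> \<Longrightarrow> F \<in> vspace \<Longrightarrow> nf_op (\<rho> :: _ \<Rightarrow> complex ^ 'm ^ 'm) e F = nf_op \<rho> c (nf_op \<rho> d F)"
    using nf_comp[OF cd] by blast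
  have "has_nf (h \<otimes>\<^bsub>End_poly\<^esub> h') e"
    using assms e(1,2) snf_op_closed[OF cd(2)] by (auto simp: has_nf_def End_poly_apply)
  then show ?thesis using e(3) that by blast
qed

lemma H_has_nf:
  assumes "h \<in> carrier H"
  obtains c where "has_nf h c"
proof -
  have "\<exists>c. has_nf h c"
    using assms unfolding H_simps
  proof (induction rule: generate_ring.induct)
    case one
    have "has_nf \<one>\<^bsub>End_poly\<^esub> [(1, id, 0, 0)]"
      by (auto simp: has_nf_def End_poly_apply snterm_def weyl_group.id pull_def)
    then show ?case ..
  next
    case (incl h)
    then consider c where "h = mult_op (pconst c)" | w where "w \<in> W" "h = group_op w"
      | x where "linear x" "h = mult_op x" | y where "h = dunkl_op Rp k y"
      unfolding H_gens_def by (auto simp: scalar_op_eq_mult_op)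
    then show ?case
    proof cases
      case 1
      then show ?thesis using has_nf_scalar[OF poly_space_pconst] by blast
    next
      case 2
      then show ?thesis using has_nf_group by blast
    next
      case 3
      then show ?thesis using has_nf_scalar[OF poly_space_linear] by blast
    next
      case 4
      then show ?thesis using has_nf_dunkl by blast
    qed
  next
    case (a_inv h)
    then show ?case using has_nf_neg H_carrier H_simps by metis
  next
    case (eng_add h1 h2)
    then show ?case using has_nf_add by blast
  next
    case (eng_mult h1 h2)
    then obtain c d where cd: "has_nf h1 c" "has_nf h2 d" by blast
    obtain e where "has_nf (h1 \<otimes>\<^bsub>End_poly\<^esub> h2) e"
      by (rule has_nf_mult[OF cd, where 'm = 1])
    then show ?case ..
  qed
  then show ?thesis using that by blast
qed

definition act :: "((real ^ 'n \<Rightarrow> real ^ 'n) \<Rightarrow> complex ^ 'm ^ 'm) \<Rightarrow> 'n pop \<Rightarrow>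
    ('m \<Rightarrow> 'n pfun) \<Rightarrow> 'm \<Rightarrow> 'n pfun" where
  "act \<rho> h = nf_op \<rho> (SOME c. has_nf h c)"

text \<open>The difference of two normal forms of the same operator kills scalar polynomials, so
  \<open>PBW\<close> applies and the choice made in \<open>act\<close> does not matter.\<close>

lemma act_eq:
  assumes "has_nf h c"
  shows "act \<rho> h F = nf_op \<rho> c F"
proof -
  let ?d = "SOME c. has_nf h c"
  have d: "has_nf h ?d" using assms by (rule someI)
  have "nf_op \<rho> (c @ nf_neg ?d) F = 0"
    by (rule PBW) (use assms d in \<open>auto simp: has_nf_def nf_neg_simps\<close>)
  then show ?thesis by (simp add: act_def nf_neg_simps)
qed

context
  fixes \<rho> :: "(real ^ 'n \<Rightarrow> real ^ 'n) \<Rightarrow> complex ^ 'm ^ 'm"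
  assumes \<rho>: "weyl_rep \<rho>"
begin

lemma act_closed: "h \<in> carrier H \<Longrightarrow> F \<in> vspace \<Longrightarrow> act \<rho> h F \<in> vspace"
  by (metis H_has_nf act_eq nf_op_closed has_nf_def)

lemma act_add_left:
  assumes "h \<in> carrier H" "h' \<in> carrier H"
  shows "act \<rho> (h \<oplus>\<^bsub>End_poly\<^esub> h') F = act \<rho> h F + act \<rho> h' F"
proof -
  obtain c d where cd: "has_nf h c" "has_nf h' d" using assms H_has_nf by metis
  show ?thesis by (simp only: act_eq[OF cd(1)] act_eq[OF cd(2)] act_eq[OF has_nf_add[OF cd]] nf_op_simps)
qed

lemma act_neg_left:
  assumes "h \<in> carrier H" shows "act \<rho> (\<ominus>\<^bsub>End_poly\<^esub> h) F = - act \<rho> h F"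
proof -
  obtain c where c: "has_nf h c" using assms H_has_nf by metis
  show ?thesis by (simp only: act_eq[OF c] act_eq[OF has_nf_neg[OF H_carrier[OF assms] c]] nf_neg_simps)
qed

lemma act_mult:
  assumes "h \<in> carrier H" "h' \<in> carrier H" "F \<in> vspace"
  shows "act \<rho> (h \<otimes>\<^bsub>End_poly\<^esub> h') F = act \<rho> h (act \<rho> h' F)"
proof -
  obtain c d where cd: "has_nf h c" "has_nf h' d" using assms H_has_nf by metis
  obtain e where "has_nf (h \<otimes>\<^bsub>End_poly\<^esub> h') e"
    "\<And>\<rho> F. weyl_rep \<rho> \<Longrightarrow> F \<in> vspace \<Longrightarrow> nf_op (\<rho> :: _ \<Rightarrow> complex ^ 'm ^ 'm) e F = nf_op \<rho> c (nf_op \<rho> d F)"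
    using has_nf_mult[OF cd] by blast
  then show ?thesis using cd \<rho> assms(3) by (simp add: act_eq)
qed

lemma act_mult_op: "p \<in> poly_space \<Longrightarrow> act \<rho> (mult_op p) F = vmul p F"
  by (simp add: act_eq[OF has_nf_scalar] nterm_def vW_id[OF \<rho>])

lemma act_scalar_op: "act \<rho> (scalar_op c) F = vmul (pconst c) F"
  by (simp add: scalar_op_eq_mult_op act_mult_op)

lemma act_one: "act \<rho> \<one>\<^bsub>End_poly\<^esub> F = F"
proof -
  have "has_nf \<one>\<^bsub>End_poly\<^esub> [(1, id, 0, 0)]"
    by (auto simp: has_nf_def End_poly_apply snterm_def weyl_group.id pull_def)
  then show ?thesis by (simp add: act_eq nterm_def vW_id[OF \<rho>] vmul_simps)
qed

lemma act_group_op: "w \<in> W \<Longrightarrow> act \<rho> (group_op w) F = vW \<rho> w F"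
  by (simp add: act_eq[OF has_nf_group] nterm_def vmul_simps)

lemma act_dunkl_op:
  assumes "F \<in> vspace"
  shows "act \<rho> (dunkl_op Rp k y) F = vT \<rho> (Re_vec y) F + vmul (pconst \<i>) (vT \<rho> (Im_vec y) F)"
  unfolding act_eq[OF has_nf_dunkl] vT_coordinates[OF assms, of \<rho> "Re_vec y"] vT_coordinates[OF assms, of \<rho> "Im_vec y"]
  by (simp add: nterm_def vW_id[OF \<rho>] vmul_simps pconst_add pconst_mult add_ac)

lemma vT_funpow_add:
  "F \<in> vspace \<Longrightarrow> G \<in> vspace \<Longrightarrow> (vT \<rho> v ^^ n) (F + G) = (vT \<rho> v ^^ n) F + (vT \<rho> v ^^ n) G"
  by (induction n) (auto simp: vT_add vT_funpow_closed)

lemma nf_op_add: "F \<in> vspace \<Longrightarrow> G \<in> vspace \<Longrightarrow> nf_op \<rho> c (F + G) = nf_op \<rho> c F + nf_op \<rho> c G"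
proof (induction c)
  case (Cons t c)
  have "nterm \<rho> t (F + G) = nterm \<rho> t F + nterm \<rho> t G"
    using Cons.prems by (cases t) (simp add: nterm_def vT_funpow_add vT_funpow_closed vW_simps vmul_simps)
  then show ?case using Cons by (simp add: add_ac)
qed auto

lemma act_add: "F \<in> vspace \<Longrightarrow> G \<in> vspace \<Longrightarrow> act \<rho> h (F + G) = act \<rho> h F + act \<rho> h G"
  by (simp add: act_def nf_op_add)

lemma act_0: "act \<rho> h 0 = 0"
  using act_add[of 0 0 h] by (simp add: vspace_closed)

end

end

section \<open>The maximal submodule\<close>

definition vhomogeneous :: "nat \<Rightarrow> ('m \<Rightarrow> ('n::finite) pfun) \<Rightarrow> bool" where
  "vhomogeneous d F \<longleftrightarrow> (\<forall>i. homogeneous d (F i))"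

lemma vhomogeneous_closed:
  fixes F G :: "'m::finite \<Rightarrow> ('n::finite) pfun"
  shows "vhomogeneous d F \<Longrightarrow> F \<in> vspace"
    and "vhomogeneous d F \<Longrightarrow> vhomogeneous d G \<Longrightarrow> vhomogeneous d (F + G)"
    and "vhomogeneous d (0 :: 'm \<Rightarrow> 'n pfun)"
    and "homogeneous e p \<Longrightarrow> vhomogeneous d F \<Longrightarrow> vhomogeneous (e + d) (vmul p F)"
    and "vhomogeneous d F \<Longrightarrow> vhomogeneous d (vmul (pconst c) F)"
    and "vhomogeneous d F \<Longrightarrow> vhomogeneous d (mat_act A F)"
    and "vhomogeneous 0 (vconst v :: 'm \<Rightarrow> 'n pfun)"
proof -
  show "vhomogeneous d F \<Longrightarrow> F \<in> vspace"
    by (auto simp: vhomogeneous_def vspace_def intro: homogeneous_poly_space)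
  show "vhomogeneous d F \<Longrightarrow> vhomogeneous d G \<Longrightarrow> vhomogeneous d (F + G)"
    by (auto simp: vhomogeneous_def plus_fun_apply[of F G] intro: homogeneous_add)
  show "vhomogeneous d (0 :: 'm \<Rightarrow> 'n pfun)"
    by (simp only: vhomogeneous_def zero_fun_apply homogeneous_0 simp_thms)
  show "homogeneous e p \<Longrightarrow> vhomogeneous d F \<Longrightarrow> vhomogeneous (e + d) (vmul p F)"
    by (auto simp: vhomogeneous_def vmul_def intro: homogeneous_mult)
  show "vhomogeneous d F \<Longrightarrow> vhomogeneous d (vmul (pconst c) F)"
    by (auto simp: vhomogeneous_def vmul_def intro: homogeneous_cmult)
  show "vhomogeneous d F \<Longrightarrow> vhomogeneous d (mat_act A F)"
    by (auto simp: vhomogeneous_def mat_act_def intro!: homogeneous_sum homogeneous_cmult)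
  show "vhomogeneous 0 (vconst v :: 'm \<Rightarrow> 'n pfun)"
    by (auto simp: vhomogeneous_def vconst_def intro: homogeneous_const)
qed

lemma vhomogeneous_sum:
  fixes F :: "'i \<Rightarrow> 'm::finite \<Rightarrow> ('n::finite) pfun"
  shows "(\<And>i. i \<in> I \<Longrightarrow> vhomogeneous d (F i)) \<Longrightarrow> vhomogeneous d (\<Sum>i\<in>I. F i)"
  by (induction I rule: infinite_finite_induct) (auto intro: vhomogeneous_closed)

lemma vhomogeneous_0_vconst:
  assumes "vhomogeneous 0 F"
  shows "F = vconst (\<chi> i. F i 0)"
proof
  fix i
  have "homogeneous 0 (F i)" using assms by (simp add: vhomogeneous_def)
  from homogeneous_0_iff[OF this] show "F i = vconst (\<chi> i. F i 0) i"
    unfolding vconst_def vec_lambda_beta .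
qed

lemma vhomogeneous_decomposition:
  fixes F :: "'m::finite \<Rightarrow> ('n::finite) pfun"
  assumes "F \<in> vspace"
  obtains N G where "\<And>d. vhomogeneous d (G d)" "F = (\<Sum>d<N. G d)"
proof -
  have "\<exists>N g. (\<forall>d. homogeneous d (g d)) \<and> F i = (\<Sum>d<N. g d)" for i
    using homogeneous_decomposition[OF vspaceD[OF assms, of i]] by metis
  then obtain N g where g: "\<And>i d. homogeneous d (g i d)" "\<And>i. F i = (\<Sum>d<N i. g i d)" by metis
  define M where "M = Max (range N)"
  have N: "N i \<le> M" for i unfolding M_def by (rule Max_ge) auto
  define G where "G d i = (if d < N i then g i d else 0)" for d i
  have "F i = (\<Sum>d<M. G d) i" for i
  proof -
    have "F i = (\<Sum>d<M. if d < N i then g i d else 0)"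
      by (subst g(2), rule sum.mono_neutral_cong_left) (use N[of i] in auto)
    also have "\<dots> = (\<Sum>d<M. G d i)" by (simp only: G_def)
    finally show ?thesis by (simp only: sum_fun_apply)
  qed
  then have "F = (\<Sum>d<M. G d)" by (rule ext)
  moreover have "vhomogeneous d (G d)" for d
    using g(1) by (auto simp: vhomogeneous_def G_def intro: homogeneous_0)
  ultimately show ?thesis using that by blast
qed

context dunkl_setting begin

definition form_radical :: "((real ^ 'n \<Rightarrow> real ^ 'n) \<Rightarrow> complex ^ 'm ^ 'm) \<Rightarrow> ('m \<Rightarrow> 'n pfun) set" where
  "form_radical \<rho> = {F \<in> vspace. \<forall>vs i. foldr (vT \<rho>) vs F i 0 = 0}"

definition stable :: "((real ^ 'n \<Rightarrow> real ^ 'n) \<Rightarrow> complex ^ 'm ^ 'm) \<Rightarrow> ('m \<Rightarrow> 'n pfun) set \<Rightarrow> bool" where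
  "stable \<rho> Y \<longleftrightarrow> Y \<subseteq> vspace \<and> 0 \<in> Y \<and> (\<forall>F\<in>Y. \<forall>G\<in>Y. F + G \<in> Y) \<and> (\<forall>h\<in>carrier H. \<forall>F\<in>Y. act \<rho> h F \<in> Y)"

definition cofinite_radical :: "((real ^ 'n \<Rightarrow> real ^ 'n) \<Rightarrow> complex ^ 'm ^ 'm) \<Rightarrow> bool" where
  "cofinite_radical \<rho> \<longleftrightarrow> (\<exists>N. \<forall>d\<ge>N. \<forall>F. vhomogeneous d F \<longrightarrow> F \<in> form_radical \<rho>)"

text \<open>Both \<alpha> and - \<alpha> occur in R with the same reflection, hence the weight 1/2:
  the scalar is that of the sum over positive roots.\<close>

definition central_scalar :: "((real ^ 'n \<Rightarrow> real ^ 'n) \<Rightarrow> complex ^ 'm ^ 'm) \<Rightarrow> complex \<Rightarrow> bool" where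
  "central_scalar \<rho> \<zeta> \<longleftrightarrow> (\<forall>v. (\<Sum>\<alpha>\<in>R. (k \<alpha> / 2) *s (\<rho> (reflection \<alpha>) *v v)) = \<zeta> *s v)"

context
  fixes \<rho> :: "(real ^ 'n \<Rightarrow> real ^ 'n) \<Rightarrow> complex ^ 'm ^ 'm"
  assumes \<rho>: "weyl_rep \<rho>"
begin

lemma foldr_vT_closed: "F \<in> vspace \<Longrightarrow> foldr (vT \<rho>) vs F \<in> vspace"
  by (induction vs) auto

lemma foldr_vT_add:
  "F \<in> vspace \<Longrightarrow> G \<in> vspace \<Longrightarrow> foldr (vT \<rho>) vs (F + G) = foldr (vT \<rho>) vs F + foldr (vT \<rho>) vs G"
  by (induction vs) (auto simp: vT_add foldr_vT_closed)

lemma foldr_vT_cmul: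
  "F \<in> vspace \<Longrightarrow> foldr (vT \<rho>) vs (vmul (pconst c) F) = vmul (pconst c) (foldr (vT \<rho>) vs F)"
  by (induction vs) (auto simp: vT_cmul foldr_vT_closed)

lemma foldr_vT_0: "foldr (vT \<rho>) vs 0 = 0"
  by (induction vs) (auto simp: vT_0)

lemma radical_vspace: "F \<in> form_radical \<rho> \<Longrightarrow> F \<in> vspace"
  by (simp add: form_radical_def)

lemma radicalD: "F \<in> form_radical \<rho> \<Longrightarrow> foldr (vT \<rho>) vs F i 0 = 0"
  by (simp add: form_radical_def)

lemma radical_0: "0 \<in> form_radical \<rho>"
proof -
  have "(0 :: 'm \<Rightarrow> 'n pfun) i 0 = 0" for i by (simp only: zero_fun_apply)
  then show ?thesis by (simp add: form_radical_def foldr_vT_0 vspace_closed)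
qed

lemma radical_add:
  assumes "F \<in> form_radical \<rho>" "G \<in> form_radical \<rho>" shows "F + G \<in> form_radical \<rho>"
proof -
  have "(A + A') i 0 = A i 0 + A' i 0" for A A' :: "'m \<Rightarrow> 'n pfun" and i by (simp only: plus_fun_apply)
  with assms show ?thesis by (simp add: form_radical_def foldr_vT_add vspace_closed)
qed

lemma radical_cmul: "F \<in> form_radical \<rho> \<Longrightarrow> vmul (pconst c) F \<in> form_radical \<rho>"
  by (simp add: form_radical_def foldr_vT_cmul vspace_closed) (simp add: vmul_def times_fun_apply)

lemma radical_diff: "F \<in> form_radical \<rho> \<Longrightarrow> G \<in> form_radical \<rho> \<Longrightarrow> F - G \<in> form_radical \<rho>"
  using radical_add[of F "vmul (pconst (-1)) G"] radical_cmul[of G "-1"]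
  by (simp add: pconst_minus vmul_simps)

lemma radical_sum: "(\<And>i. i \<in> I \<Longrightarrow> F i \<in> form_radical \<rho>) \<Longrightarrow> (\<Sum>i\<in>I. F i) \<in> form_radical \<rho>"
  by (induction I rule: infinite_finite_induct) (auto intro: radical_add radical_0)

lemma radical_vT: "F \<in> form_radical \<rho> \<Longrightarrow> vT \<rho> v F \<in> form_radical \<rho>"
  using radicalD[of F "vs @ [v]" for vs] by (auto simp: form_radical_def vT_closed)

lemma radical_vW:
  assumes "F \<in> form_radical \<rho>" "w \<in> W"
  shows "vW \<rho> w F \<in> form_radical \<rho>"
proof -
  have *: "foldr (vT \<rho>) vs (vW \<rho> w G) = vW \<rho> w (foldr (vT \<rho>) (map (inv_into UNIV w) vs) G)"
    if "G \<in> vspace" for vs G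
    using that assms(2)
    by (induction vs) (simp_all add: vW_vT[OF \<rho>] foldr_vT_closed)
  have "inv_into UNIV w 0 = 0" using W_inv_linear[OF assms(2)] by (rule linear_0)
  then have "vW \<rho> w G i 0 = (\<Sum>j\<in>UNIV. \<rho> w $ i $ j * G j 0)" for G i
    unfolding vW_def mat_act_def sum_fun_apply times_fun_apply pconst_apply pull_def by simp
  then show ?thesis using assms by (auto simp: form_radical_def * vW_closed)
qed

text \<open>Induction on the word from the operator that acts first: T_v (l F) is l T_v F plus a
  combination of F and its images under reflections, which lie in the radical. For the empty word, l
  vanishes at 0.\<close>

lemma radical_plin:
  assumes "F \<in> form_radical \<rho>"
  shows "vmul (plin l) F \<in> form_radical \<rho>"
proof -
  have zero: "foldr (vT \<rho>) vs (vmul (plin l) F) i 0 = 0" if "F \<in> form_radical \<rho>" for vs F i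
    using that
  proof (induction vs arbitrary: F rule: rev_induct)
    case Nil
    then show ?case by (simp add: vmul_def times_fun_apply plin_apply)
  next
    case (snoc v vs)
    have F: "F \<in> vspace" using snoc.prems by (rule radical_vspace)
    let ?G = "vmul (deriv_along v (plin l)) F +
      (\<Sum>\<alpha>\<in>R. vmul (pconst (dunkl_coeff \<alpha> v) * divided_difference \<alpha> (plin l)) (vW \<rho> (reflection \<alpha>) F))"
    have "?G = vmul (pconst (of_real (l \<bullet> v))) F + (\<Sum>\<alpha>\<in>R. vmul (pconst (dunkl_coeff \<alpha> v *
        of_real (2 * (\<alpha> \<bullet> l) / (\<alpha> \<bullet> \<alpha>)))) (vW \<rho> (reflection \<alpha>) F))"
      by (simp add: divided_difference_plin R_nonzero flip: pconst_mult)
    also have "\<dots> \<in> form_radical \<rho>"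
      by (intro radical_add radical_cmul radical_sum radical_vW snoc.prems reflection_W)
    finally have G: "?G \<in> form_radical \<rho>" .
    have TF: "vmul (plin l) (vT \<rho> v F) \<in> vspace" using F by auto
    have "foldr (vT \<rho>) (vs @ [v]) (vmul (plin l) F) =
        foldr (vT \<rho>) vs (vmul (plin l) (vT \<rho> v F)) + foldr (vT \<rho>) vs ?G"
      using foldr_vT_add[OF TF radical_vspace[OF G], of vs] F by (simp add: vT_vmul add.assoc)
    then have "foldr (vT \<rho>) (vs @ [v]) (vmul (plin l) F) i 0 =
        foldr (vT \<rho>) vs (vmul (plin l) (vT \<rho> v F)) i 0 + foldr (vT \<rho>) vs ?G i 0"
      by (simp only: plus_fun_apply)
    then show ?case
      unfolding snoc.IH[OF radical_vT[OF snoc.prems]] radicalD[OF G] by simp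
  qed
  moreover have "vmul (plin l) F \<in> vspace"
    by (rule vspace_closed(5)[OF poly_space_plin radical_vspace[OF assms]])
  ultimately show ?thesis unfolding form_radical_def mem_Collect_eq using zero[OF assms] by (intro conjI allI)
qed

lemma radical_vmul:
  assumes "p \<in> poly_space" "F \<in> form_radical \<rho>"
  shows "vmul p F \<in> form_radical \<rho>"
  using assms(1)
  by (induction rule: poly_space_induct)
    (auto simp: vmul_simps intro: radical_add radical_plin radical_cmul assms(2))

lemma stable_radical: "stable \<rho> (form_radical \<rho>)"
proof -
  have "act \<rho> h F \<in> form_radical \<rho>" if "h \<in> carrier H" "F \<in> form_radical \<rho>" for h F
    using that unfolding H_simps
  proof (induction arbitrary: F rule: generate_ring.induct)
    case one
    then show ?case by (simp add: act_one[OF \<rho>])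
  next
    case (incl h)
    then consider c where "h = scalar_op c" | w where "w \<in> W" "h = group_op w"
      | x where "linear x" "h = mult_op x" | y where "h = dunkl_op Rp k y"
      unfolding H_gens_def by auto
    then show ?case
    proof cases
      case 1
      then show ?thesis using incl by (simp add: act_scalar_op[OF \<rho>] radical_cmul)
    next
      case 2
      then show ?thesis using incl by (simp add: act_group_op[OF \<rho>] radical_vW)
    next
      case 3
      then show ?thesis using incl by (simp add: act_mult_op[OF \<rho>] poly_space_linear radical_vmul)
    next
      case 4
      then show ?thesis using incl
        by (simp add: act_dunkl_op[OF \<rho>] radical_vspace radical_add radical_cmul radical_vT)
    qed
  next
    case (a_inv h)
    then have "act \<rho> (\<ominus>\<^bsub>End_poly\<^esub> h) F = vmul (pconst (-1)) (act \<rho> h F)"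
      by (simp add: act_neg_left[OF \<rho>] H_simps pconst_minus vmul_simps)
    then show ?case using a_inv by (simp add: radical_cmul)
  next
    case (eng_add h1 h2)
    then show ?case by (simp add: act_add_left[OF \<rho>] H_simps radical_add)
  next
    case (eng_mult h1 h2)
    then show ?case by (simp add: act_mult[OF \<rho>] H_simps radical_vspace)
  qed
  then show ?thesis by (auto simp: stable_def radical_0 radical_add radical_vspace)
qed

lemma vconst_radical: "vconst v \<in> form_radical \<rho> \<Longrightarrow> v = 0"
  using radicalD[of "vconst v" "[]"] by (simp add: vconst_def pconst_apply vec_eq_iff)

lemma vhomogeneous_vT:
  assumes "vhomogeneous d F"
  shows "(d = 0 \<longrightarrow> vT \<rho> v F = 0) \<and> vhomogeneous (d - 1) (vT \<rho> v F)"
proof -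
  have F: "homogeneous d (F i)" for i using assms by (simp add: vhomogeneous_def)
  have "vT \<rho> v F = 0" if "d = 0"
    using assms that vhomogeneous_0_vconst[of F] vT_const[of \<rho> v] by metis
  moreover have "vhomogeneous (d - 1) (vT \<rho> v F)"
    unfolding vT_def
  proof (intro vhomogeneous_closed(2,5,6) vhomogeneous_sum)
    show "vhomogeneous (d - 1) (\<lambda>i. deriv_along v (F i))"
      unfolding vhomogeneous_def using homogeneous_deriv_along[OF F] by blast
    show "vhomogeneous (d - 1) (\<lambda>i. divided_difference \<alpha> (F i))" if "\<alpha> \<in> R" for \<alpha>
      unfolding vhomogeneous_def using homogeneous_divided_difference[OF R_nonzero[OF that] F] by blast
  qed
  ultimately show ?thesis by blast
qed

lemma vhomogeneous_foldr_vT: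
  "vhomogeneous d F \<Longrightarrow> (if d < length vs then foldr (vT \<rho>) vs F = 0
     else vhomogeneous (d - length vs) (foldr (vT \<rho>) vs F))"
proof (induction vs)
  case (Cons v vs)
  show ?case
  proof (cases "d < length vs")
    case True
    then show ?thesis using Cons by (simp add: vT_0)
  next
    case False
    then have h: "vhomogeneous (d - length vs) (foldr (vT \<rho>) vs F)" using Cons by auto
    show ?thesis using vhomogeneous_vT[OF h, of v] False
      by (cases "d = length vs") (auto simp: Suc_diff_Suc)
  qed
qed simp

lemma vhomogeneous_foldr_at_0:
  assumes "vhomogeneous d F" "length vs \<noteq> d"
  shows "foldr (vT \<rho>) vs F i 0 = 0"
proof (cases "d < length vs")
  case True
  then have "foldr (vT \<rho>) vs F = 0" using vhomogeneous_foldr_vT[OF assms(1), of vs] by simp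
  then show ?thesis by (simp only: zero_fun_apply)
next
  case False
  then obtain e where e: "d - length vs = Suc e" using assms(2) by (cases "d - length vs") auto
  have "homogeneous (Suc e) (foldr (vT \<rho>) vs F i)"
    using vhomogeneous_foldr_vT[OF assms(1), of vs] False unfolding e by (simp add: vhomogeneous_def)
  then show ?thesis by (rule homogeneous_Suc_at_0)
qed

text \<open>At the origin a word of length d only sees the component of degree d: components of
  lower degree are annihilated, those of higher degree keep a positive degree and vanish
  there.\<close>

lemma radical_graded:
  assumes "\<And>d. vhomogeneous d (G d)" "(\<Sum>d<N. G d) \<in> form_radical \<rho>" "d < N"
  shows "G d \<in> form_radical \<rho>"
proof -
  have G: "G d \<in> vspace" for d using assms(1) vhomogeneous_closed(1) by blast
  have "foldr (vT \<rho>) vs (G d) i 0 = 0" for vs i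
  proof (cases "length vs = d")
    case True
    have "foldr (vT \<rho>) vs (\<Sum>d\<in>I. G d) = (\<Sum>d\<in>I. foldr (vT \<rho>) vs (G d))" for I
      using G by (induction I rule: infinite_finite_induct) (auto simp: foldr_vT_0 foldr_vT_add vspace_sum)
    then have "(\<Sum>d<N. foldr (vT \<rho>) vs (G d) i 0) = 0"
      using radicalD[OF assms(2), of vs i] by (simp add: sum_fun_apply)
    moreover have "(\<Sum>d<N. foldr (vT \<rho>) vs (G d) i 0) = (\<Sum>e<N. if e = d then foldr (vT \<rho>) vs (G d) i 0 else 0)"
      using True by (intro sum.cong) (auto simp: vhomogeneous_foldr_at_0[OF assms(1)])
    ultimately show ?thesis using assms(3) by simp
  qed (rule vhomogeneous_foldr_at_0[OF assms(1)])
  then show ?thesis using G by (simp add: form_radical_def)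
qed

lemma homogeneous_Euler:
  "homogeneous d f \<Longrightarrow> plin e1 * deriv_along e1 f + plin e2 * deriv_along e2 f = pconst (of_nat d) * f"
proof (induction rule: homogeneous.induct)
  case (homogeneous_add d f g)
  then show ?case by (simp add: deriv_along_add homogeneous_poly_space distrib_left flip: homogeneous_add.IH)
next
  case (homogeneous_plin d f v)
  have f: "f \<in> poly_space" using homogeneous_plin.hyps by (rule homogeneous_poly_space)
  have v: "plin v = pconst (of_real (v \<bullet> e1)) * plin e1 + pconst (of_real (v \<bullet> e2)) * plin e2"
    by (subst coordinates[of v]) (simp add: plin_add plin_scale)
  have "plin e1 * deriv_along e1 (plin v * f) + plin e2 * deriv_along e2 (plin v * f) =
    plin v * (plin e1 * deriv_along e1 f + plin e2 * deriv_along e2 f) +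
    (pconst (of_real (v \<bullet> e1)) * plin e1 + pconst (of_real (v \<bullet> e2)) * plin e2) * f"
    using f by (simp add: deriv_along_mult algebra_simps)
  also have "\<dots> = plin v * (pconst (of_nat d) * f) + plin v * f"
    unfolding homogeneous_plin.IH v[symmetric] ..
  finally show ?case by (simp add: pconst_add algebra_simps)
qed simp_all

text \<open>The Euler field with Dunkl operators in place of derivatives. The reflection sum
  compensates for their nonlocal parts, so that homogeneous elements become eigenvectors.\<close>

definition euler :: "('m \<Rightarrow> 'n pfun) \<Rightarrow> 'm \<Rightarrow> 'n pfun" where
  "euler F = vmul (plin e1) (vT \<rho> e1 F) + vmul (plin e2) (vT \<rho> e2 F) +
     (\<Sum>\<alpha>\<in>R. vmul (pconst (k \<alpha> / 2)) (vW \<rho> (reflection \<alpha>) F))"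

lemma sum_mat_act_central:
  assumes "central_scalar \<rho> \<zeta>"
  shows "(\<Sum>\<alpha>\<in>R. vmul (pconst (k \<alpha> / 2)) (mat_act (\<rho> (reflection \<alpha>)) F)) = vmul (pconst \<zeta>) F"
proof (intro ext)
  fix i x
  let ?v = "\<chi> j. F j x"
  have "(\<Sum>\<alpha>\<in>R. vmul (pconst (k \<alpha> / 2)) (mat_act (\<rho> (reflection \<alpha>)) F)) i x =
    (\<Sum>\<alpha>\<in>R. (k \<alpha> / 2) *s (\<rho> (reflection \<alpha>) *v ?v)) $ i"
    by (simp add: sum_fun_apply vmul_def mat_act_def times_fun_apply pconst_apply matrix_vector_mult_def)
  also have "\<dots> = vmul (pconst \<zeta>) F i x"
    using assms by (simp add: central_scalar_def vmul_def times_fun_apply pconst_apply)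
  finally show "(\<Sum>\<alpha>\<in>R. vmul (pconst (k \<alpha> / 2)) (mat_act (\<rho> (reflection \<alpha>)) F)) i x = vmul (pconst \<zeta>) F i x" .
qed

lemma plin_coordinates: "plin v = pconst (of_real (v \<bullet> e1)) * plin e1 + pconst (of_real (v \<bullet> e2)) * plin e2"
  by (subst coordinates[of v]) (simp add: plin_add plin_scale)

text \<open>Summed over e1 and e2 the coefficients reassemble the linear form \<alpha>, and \<alpha>
  times the divided difference is F minus its reflection. The reflected part cancels against the
  correction in \<open>euler\<close>; the derivatives leave d and the matrices leave
  \<zeta>.\<close>

lemma euler_vhomogeneous:
  assumes "central_scalar \<rho> \<zeta>" "vhomogeneous d F"
  shows "euler F = vmul (pconst (of_nat d + \<zeta>)) F"
proof -
  have F: "homogeneous d (F i)" "F i \<in> poly_space" for i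
    using assms(2) homogeneous_poly_space by (auto simp: vhomogeneous_def)
  let ?D = "\<lambda>\<alpha>. mat_act (\<rho> (reflection \<alpha>)) (\<lambda>i. divided_difference \<alpha> (F i))"
  have 1: "vmul (plin e1) (\<lambda>i. deriv_along e1 (F i)) + vmul (plin e2) (\<lambda>i. deriv_along e2 (F i)) =
      vmul (pconst (of_nat d)) F"
    using homogeneous_Euler[OF F(1)] by (simp add: vmul_def fun_eq_iff[where 'a='m] plus_fun_apply)
  have 2: "vmul (plin e1) (vmul (pconst (dunkl_coeff \<alpha> e1)) (?D \<alpha>)) +
      vmul (plin e2) (vmul (pconst (dunkl_coeff \<alpha> e2)) (?D \<alpha>)) + vmul (pconst (k \<alpha> / 2)) (vW \<rho> (reflection \<alpha>) F) =
      vmul (pconst (k \<alpha> / 2)) (mat_act (\<rho> (reflection \<alpha>)) F)" if \<alpha>: "\<alpha> \<in> R" for \<alpha>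
  proof -
    have c: "dunkl_coeff \<alpha> e = k \<alpha> / 2 * of_real (\<alpha> \<bullet> e)" for e by (simp add: dunkl_coeff_def)
    have "vmul (plin e1) (vmul (pconst (dunkl_coeff \<alpha> e1)) (?D \<alpha>)) +
        vmul (plin e2) (vmul (pconst (dunkl_coeff \<alpha> e2)) (?D \<alpha>)) =
      vmul (pconst (k \<alpha> / 2)) (vmul (plin \<alpha>) (?D \<alpha>))"
      unfolding plin_coordinates[of \<alpha>] c pconst_mult vmul_simps(1,3,6)
        vmul_commute[of "plin e1"] vmul_commute[of "plin e2"] ..
    also have "vmul (plin \<alpha>) (?D \<alpha>) = mat_act (\<rho> (reflection \<alpha>)) (\<lambda>i. plin \<alpha> * divided_difference \<alpha> (F i))"
      using mat_act_simps(2)[of "\<rho> (reflection \<alpha>)" "plin \<alpha>" "\<lambda>i. divided_difference \<alpha> (F i)"]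
      by (simp add: vmul_def)
    also have "(\<lambda>i. plin \<alpha> * divided_difference \<alpha> (F i)) = F - (\<lambda>i. pull (reflection \<alpha>) (F i))"
      using divided_difference_works(2)[OF R_nonzero[OF \<alpha>] F(2)]
      by (simp add: pull_reflection fun_eq_iff[where 'a='m] minus_apply)
    also have "mat_act (\<rho> (reflection \<alpha>)) \<dots> = mat_act (\<rho> (reflection \<alpha>)) F - vW \<rho> (reflection \<alpha>) F"
      using mat_act_simps(1)[of "\<rho> (reflection \<alpha>)" "F - (\<lambda>i. pull (reflection \<alpha>) (F i))" "\<lambda>i. pull (reflection \<alpha>) (F i)"]
      by (simp add: vW_def eq_diff_eq)
    finally show ?thesis by (simp add: vmul_simps)
  qed
  have "euler F = (vmul (plin e1) (\<lambda>i. deriv_along e1 (F i)) + vmul (plin e2) (\<lambda>i. deriv_along e2 (F i))) +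
    (\<Sum>\<alpha>\<in>R. vmul (plin e1) (vmul (pconst (dunkl_coeff \<alpha> e1)) (?D \<alpha>)) +
      vmul (plin e2) (vmul (pconst (dunkl_coeff \<alpha> e2)) (?D \<alpha>)) + vmul (pconst (k \<alpha> / 2)) (vW \<rho> (reflection \<alpha>) F))"
    unfolding euler_def vT_def vmul_simps vmul_sum sum.distrib by (simp only: add_ac)
  also have "\<dots> = vmul (pconst (of_nat d)) F + vmul (pconst \<zeta>) F"
    unfolding 1 sum_mat_act_central[OF assms(1), symmetric] by (simp add: 2)
  finally show ?thesis by (simp add: pconst_add vmul_simps)
qed

lemma stableD:
  assumes "stable \<rho> Y" "F \<in> Y"
  shows "F \<in> vspace" "G \<in> Y \<Longrightarrow> F + G \<in> Y" "vmul (pconst c) F \<in> Y" "p \<in> poly_space \<Longrightarrow> vmul p F \<in> Y"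
    "w \<in> W \<Longrightarrow> vW \<rho> w F \<in> Y" "vT \<rho> v F \<in> Y" "G \<in> Y \<Longrightarrow> F - G \<in> Y" "euler F \<in> Y"
proof -
  show F: "F \<in> vspace" using assms by (auto simp: stable_def)
  have add: "F + G \<in> Y" if "F \<in> Y" "G \<in> Y" for F G using assms(1) that by (auto simp: stable_def)
  show "G \<in> Y \<Longrightarrow> F + G \<in> Y" using add assms(2) .
  have A: "act \<rho> h F \<in> Y" if "h \<in> carrier H" "F \<in> Y" for h F
    using assms(1) that by (auto simp: stable_def)
  have C: "vmul (pconst c) F \<in> Y" if "F \<in> Y" for c F
    using A[OF H_closed(3) that] by (simp add: act_scalar_op[OF \<rho>])
  then show "vmul (pconst c) F \<in> Y" using assms(2) by simp
  have M: "vmul p F \<in> Y" if "p \<in> poly_space" "F \<in> Y" for p F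
    using A[OF mult_op_H[OF that(1)] that(2)] by (simp add: act_mult_op[OF \<rho> that(1)])
  then show "p \<in> poly_space \<Longrightarrow> vmul p F \<in> Y" using assms(2) by simp
  have Wc: "vW \<rho> w F \<in> Y" if "w \<in> W" for w
    using A[OF H_closed(4)[OF that] assms(2)] by (simp add: act_group_op[OF \<rho> that])
  then show "w \<in> W \<Longrightarrow> vW \<rho> w F \<in> Y" .
  have T: "vT \<rho> v F \<in> Y" for v
  proof -
    \<comment> \<open>A real direction is the complex vector with imaginary part 0, and the Dunkl
      operator of direction 0 is 0.\<close>
    have "Re_vec (\<chi> i. of_real (v $ i)) = v" "Im_vec (\<chi> i. of_real (v $ i)) = 0"
      by (simp_all add: Re_vec_def Im_vec_def vec_eq_iff)
    moreover have "vT \<rho> 0 F = 0" using vT_vector(2)[OF F, of \<rho> 0 0] by (simp add: vmul_simps)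
    ultimately show ?thesis
      using A[OF H_closed(5) assms(2), of "\<chi> i. of_real (v $ i)"]
      by (simp add: act_dunkl_op[OF \<rho> F] vmul_simps)
  qed
  then show "vT \<rho> v F \<in> Y" .
  show "F - G \<in> Y" if "G \<in> Y"
    using add[OF assms(2) C[OF that, of "-1"]] by (simp add: pconst_minus vmul_simps)
  have "(\<Sum>\<alpha>\<in>I. vmul (pconst (k \<alpha> / 2)) (vW \<rho> (reflection \<alpha>) F)) \<in> Y" if "I \<subseteq> R" for I
    using that
    by (induction I rule: infinite_finite_induct) (use assms(1) in \<open>auto simp: stable_def intro!: add C Wc reflection_W\<close>)
  then show "euler F \<in> Y" unfolding euler_def by (auto intro!: add M T)
qed

text \<open>The Euler operator separates the degrees, so a stable subspace that is not contained in the
  radical contains a nonzero constant.\<close>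

lemma stable_top:
  assumes irr: "\<And>U. vec.subspace U \<Longrightarrow> (\<And>w u. w \<in> W \<Longrightarrow> u \<in> U \<Longrightarrow> \<rho> w *v u \<in> U) \<Longrightarrow> U = {0} \<or> U = UNIV"
    and central: "central_scalar \<rho> \<zeta>"
    and Y: "stable \<rho> Y" "\<not> Y \<subseteq> form_radical \<rho>"
  shows "Y = vspace"
proof -
  have lowest: "\<exists>c. c \<noteq> 0 \<and> vmul (pconst c) (g 0) \<in> Y"
    if "\<And>d. vhomogeneous d (g d)" "(\<Sum>d<Suc M. g d) \<in> Y" for M and g :: "nat \<Rightarrow> 'm \<Rightarrow> 'n pfun"
    using that
  proof (induction M arbitrary: g)
    case 0
    then show ?case by (intro exI[of _ 1]) (simp add: vmul_simps)
  next
    case (Suc M)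
    \<comment> \<open>Subtracting the top eigenvalue multiplies degree d by d - (M + 1): the top
      component disappears, and the constant one keeps a nonzero factor.\<close>
    define g' where "g' d = vmul (pconst (of_nat d - of_nat (Suc M))) (g d)" for d
    have g: "g d \<in> vspace" for d using Suc.prems(1) vhomogeneous_closed(1) by blast
    have eu_sum: "euler (\<Sum>d\<in>I. g d) = (\<Sum>d\<in>I. euler (g d))" if "finite I" for I
    proof -
      have zero: "euler 0 = 0" by (simp add: euler_def vT_0 vW_simps vmul_simps)
      have add: "euler (F + G) = euler F + euler G" if "F \<in> vspace" "G \<in> vspace" for F G
        using that by (simp add: euler_def vT_add vW_simps vmul_simps sum.distrib add_ac)
      show ?thesis using that g by (induction I rule: finite_induct) (auto simp: vspace_sum zero add)
    qed
    have "euler (\<Sum>d<Suc (Suc M). g d) - vmul (pconst (of_nat (Suc M) + \<zeta>)) (\<Sum>d<Suc (Suc M). g d) =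
      (\<Sum>d<Suc (Suc M). g' d)"
      unfolding eu_sum[OF finite_lessThan] vmul_sum sum_subtractf[symmetric] g'_def
      by (intro sum.cong HOL.refl)
        (simp only: euler_vhomogeneous[OF central Suc.prems(1)] vmul_simps(4)[symmetric] pconst_diff[symmetric], simp)
    also have "\<dots> = (\<Sum>d<Suc M. g' d)" by (subst sum.lessThan_Suc) (simp add: g'_def vmul_simps)
    finally have "(\<Sum>d<Suc M. g' d) \<in> Y"
      using stableD(3,7,8)[OF Y(1)] Suc.prems(2) by metis
    moreover have "vhomogeneous d (g' d)" for d
      unfolding g'_def by (rule vhomogeneous_closed(5)[OF Suc.prems(1)])
    ultimately obtain c where c: "c \<noteq> 0" "vmul (pconst c) (g' 0) \<in> Y" using Suc.IH by metis
    have "vmul (pconst c) (g' 0) = vmul (pconst (c * - of_nat (Suc M))) (g 0)"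
      unfolding g'_def by (simp only: vmul_simps(6)[symmetric] pconst_mult[symmetric]) simp
    then show ?case using c by (intro exI[of _ "c * - of_nat (Suc M)"]) (simp del: of_nat_Suc)
  qed
  obtain F where F: "F \<in> Y" "F \<notin> form_radical \<rho>" using Y(2) by blast
  then obtain vs i where vs: "foldr (vT \<rho>) vs F i 0 \<noteq> 0"
    using stableD(1)[OF Y(1)] by (auto simp: form_radical_def)
  \<comment> \<open>The word that detects F moves its nonzero value into the constant term, and G
    still lies in Y.\<close>
  define G where "G = foldr (vT \<rho>) vs F"
  have "foldr (vT \<rho>) us F \<in> Y" for us
    by (induction us) (auto intro: F(1) stableD(6)[OF Y(1)])
  then have G: "G \<in> Y" by (simp add: G_def)
  obtain N g where g: "\<And>d. vhomogeneous d (g d)" "G = (\<Sum>d<N. g d)"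
    using vhomogeneous_decomposition[OF stableD(1)[OF Y(1) G]] by metis
  define g' where "g' d = (if d < N then g d else 0)" for d
  have g': "vhomogeneous d (g' d)" for d using g(1) by (auto simp: g'_def intro: vhomogeneous_closed)
  have Gg: "G = (\<Sum>d<Suc N. g' d)"
    unfolding g(2) by (rule sum.mono_neutral_cong_left) (auto simp: g'_def)
  obtain c where c: "c \<noteq> 0" "vmul (pconst c) (g' 0) \<in> Y" using lowest[OF g'] G Gg by metis
  have "vmul (pconst (1 / c)) (vmul (pconst c) (g' 0)) = g' 0"
    using c(1) by (simp add: vmul_simps flip: vmul_simps(6) pconst_mult)
  then have g0: "g' 0 \<in> Y" using stableD(3)[OF Y(1) c(2), of "1 / c"] by simp
  define v where "v = (\<chi> i. g' 0 i 0)"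
  have gv: "g' 0 = vconst v" unfolding v_def by (rule vhomogeneous_0_vconst[OF g'])
  have "G i 0 = (\<Sum>d<Suc N. g' d i 0)" unfolding Gg by (simp only: sum_fun_apply)
  also have "\<dots> = g' 0 i 0 + (\<Sum>d<N. g' (Suc d) i 0)" by (rule sum.lessThan_Suc_shift)
  also have "(\<Sum>d<N. g' (Suc d) i 0) = 0"
    using g' by (intro sum.neutral) (auto simp: vhomogeneous_def intro: homogeneous_Suc_at_0)
  finally have "v $ i \<noteq> 0" using vs by (simp add: v_def G_def)
  then have v: "v \<noteq> 0" by auto
  \<comment> \<open>The constants in Y form an invariant subspace. Irreducibility then gives all
    constants, and multiplication by polynomials gives all of \<open>vspace\<close>.\<close>
  define U where "U = {u. vconst u \<in> Y}"
  have "vec.subspace U"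
    unfolding vec.subspace_def U_def using Y(1) stableD(2,3)[OF Y(1)]
    by (auto simp: vconst_simps stable_def)
  moreover have "\<rho> w *v u \<in> U" if "w \<in> W" "u \<in> U" for w u
    using stableD(5)[OF Y(1), of "vconst u" w] that by (simp add: U_def vW_const)
  moreover have "v \<in> U" using g0 gv by (simp add: U_def)
  ultimately have "U = UNIV" using irr[of U] v by auto
  then have const: "vconst u \<in> Y" for u by (auto simp: U_def)
  have "F \<in> Y" if "F \<in> vspace" for F
    using that by (induction rule: vspace_induct) (auto intro: const stableD(2,4)[OF Y(1)])
  then show ?thesis using Y(1) by (auto simp: stable_def)
qed

subsection \<open>The Dunkl Laplacian on powers of the norm\<close>

definition nsq :: "'n pfun" where "nsq = plin e1 * plin e1 + plin e2 * plin e2"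

lemma nsq_apply: "nsq x = of_real (x \<bullet> x)"
proof -
  have "x \<bullet> x = ((x \<bullet> e1) *\<^sub>R e1 + (x \<bullet> e2) *\<^sub>R e2) \<bullet> ((x \<bullet> e1) *\<^sub>R e1 + (x \<bullet> e2) *\<^sub>R e2)"
    using coordinates[of x] by simp
  also have "\<dots> = (x \<bullet> e1) * (x \<bullet> e1) + (x \<bullet> e2) * (x \<bullet> e2)"
    using orthonormal by (simp add: inner_add_left inner_add_right inner_commute[of e2 e1])
  finally show ?thesis by (simp add: nsq_def fun_apply inner_commute)
qed

lemma nsq_poly [intro]: "nsq \<in> poly_space"
  by (auto simp: nsq_def)

lemma refl_pull_nsq: "refl_pull \<alpha> nsq = nsq"
  by (rule ext) (simp add: refl_pull_apply nsq_apply reflection_inner_inner)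

lemma refl_pull_power: "refl_pull \<alpha> (f ^ n) = refl_pull \<alpha> f ^ n"
  by (induction n) auto

lemma deriv_along_nsq: "deriv_along v nsq = pconst 2 * plin v"
proof -
  have "deriv_along v nsq = pconst 2 * (pconst (of_real (v \<bullet> e1)) * plin e1 + pconst (of_real (v \<bullet> e2)) * plin e2)"
    by (auto simp: nsq_def deriv_along_add deriv_along_mult poly_space_mult inner_commute
        fun_eq_iff fun_apply algebra_simps)
  then show ?thesis by (simp flip: plin_coordinates)
qed

lemma deriv_along_nsq_power:
  "deriv_along v (nsq ^ Suc m) = pconst (2 * of_nat (Suc m)) * nsq ^ m * plin v"
proof (induction m)
  case (Suc m)
  have "deriv_along v (nsq ^ Suc (Suc m)) = nsq * deriv_along v (nsq ^ Suc m) + pconst 2 * plin v * nsq ^ Suc m"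
    using deriv_along_mult[OF nsq_poly poly_space_power[OF nsq_poly, of "Suc m"], of v]
    by (simp add: deriv_along_nsq)
  also have "\<dots> = pconst (2 * of_nat (Suc m)) * nsq ^ Suc m * plin v + pconst 2 * nsq ^ Suc m * plin v"
    unfolding Suc by (simp add: algebra_simps)
  also have "\<dots> = pconst (2 * of_nat (Suc m) + 2) * nsq ^ Suc m * plin v"
    by (simp only: pconst_add distrib_right)
  also have "2 * of_nat (Suc m) + 2 = (2 * of_nat (Suc (Suc m)) :: complex)" by simp
  finally show ?case .
qed (simp add: deriv_along_nsq)

lemma vT_invariant_mul:
  assumes "p \<in> poly_space" "\<And>\<alpha>. \<alpha> \<in> R \<Longrightarrow> refl_pull \<alpha> p = p" "F \<in> vspace"
  shows "vT \<rho> v (vmul p F) = vmul p (vT \<rho> v F) + vmul (deriv_along v p) F"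
  using assms by (simp add: vT_vmul divided_difference_invariant R_nonzero vmul_simps)

text \<open>Multiplication by an invariant obeys the ordinary Leibniz rule. The inner operators
  produce 2 (m + 1) times \<open>nsq ^ m\<close> and linear forms; then the linear forms contribute
  2 + 2 \<zeta>, and Euler's identity for \<open>nsq ^ m\<close> contributes 2 m.\<close>

lemma vLaplace_nsq:
  assumes "central_scalar \<rho> \<zeta>"
  shows "vT \<rho> e1 (vT \<rho> e1 (vmul (nsq ^ Suc m) (vconst u))) + vT \<rho> e2 (vT \<rho> e2 (vmul (nsq ^ Suc m) (vconst u))) =
    vmul (pconst (4 * of_nat (Suc m) * (of_nat (Suc m) + \<zeta>)) * nsq ^ m) (vconst u)"
proof -
  have inv: "refl_pull \<alpha> (nsq ^ n) = nsq ^ n" for n \<alpha> by (simp add: refl_pull_power refl_pull_nsq)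
  define X where "X v = vmul (plin v) (vconst u :: 'm \<Rightarrow> 'n pfun)" for v
  have X: "X v \<in> vspace" for v by (auto simp: X_def)
  have T1: "vT \<rho> v (vmul (nsq ^ Suc m) (vconst u)) = vmul (pconst (2 * of_nat (Suc m))) (vmul (nsq ^ m) (X v))" for v
    using vT_invariant_mul[OF poly_space_power[OF nsq_poly] inv, of "vconst u" v "Suc m"]
    unfolding vT_const deriv_along_nsq_power by (auto simp: vmul_simps X_def)
  have T2: "vT \<rho> v (X v) = vmul (pconst (of_real (v \<bullet> v))) (vconst u) +
      (\<Sum>\<alpha>\<in>R. vmul (pconst (k \<alpha> * of_real ((\<alpha> \<bullet> v) * (\<alpha> \<bullet> v) / (\<alpha> \<bullet> \<alpha>)))) (vconst (\<rho> (reflection \<alpha>) *v u)))" for v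
  proof -
    have "vT \<rho> v (X v) = vmul (pconst (of_real (v \<bullet> v))) (vconst u) +
      (\<Sum>\<alpha>\<in>R. vmul (pconst (dunkl_coeff \<alpha> v) * pconst (of_real (2 * (\<alpha> \<bullet> v) / (\<alpha> \<bullet> \<alpha>)))) (vconst (\<rho> (reflection \<alpha>) *v u)))"
      unfolding X_def by (subst vT_vmul) (auto simp: vT_const vmul_simps(8) vW_const divided_difference_plin R_nonzero)
    moreover have "pconst (dunkl_coeff \<alpha> v) * pconst (of_real (2 * (\<alpha> \<bullet> v) / (\<alpha> \<bullet> \<alpha>))) =
        (pconst (k \<alpha> * of_real ((\<alpha> \<bullet> v) * (\<alpha> \<bullet> v) / (\<alpha> \<bullet> \<alpha>))) :: 'n pfun)" for \<alpha>
      by (simp add: dunkl_coeff_def flip: pconst_mult)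
    ultimately show ?thesis by (simp only:)
  qed
  \<comment> \<open>Pythagoras for \<alpha>: adding the two directions makes every reflection enter
    with its full multiplicity.\<close>
  have sq: "(\<alpha> \<bullet> e1) * (\<alpha> \<bullet> e1) / (\<alpha> \<bullet> \<alpha>) + (\<alpha> \<bullet> e2) * (\<alpha> \<bullet> e2) / (\<alpha> \<bullet> \<alpha>) = 1" if "\<alpha> \<in> R" for \<alpha>
  proof -
    have "nsq \<alpha> = of_real ((\<alpha> \<bullet> e1) * (\<alpha> \<bullet> e1) + (\<alpha> \<bullet> e2) * (\<alpha> \<bullet> e2))"
      by (simp add: nsq_def fun_apply inner_commute)
    then have "(\<alpha> \<bullet> e1) * (\<alpha> \<bullet> e1) + (\<alpha> \<bullet> e2) * (\<alpha> \<bullet> e2) = \<alpha> \<bullet> \<alpha>"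
      unfolding nsq_apply by (simp only: of_real_eq_iff)
    then show ?thesis using R_nonzero[OF that] by (simp flip: add_divide_distrib)
  qed
  have "vT \<rho> e1 (X e1) + vT \<rho> e2 (X e2) = vmul (pconst 2) (vconst u) +
      (\<Sum>\<alpha>\<in>R. vmul (pconst (k \<alpha>)) (vconst (\<rho> (reflection \<alpha>) *v u)))"
  proof -
    have "vmul (pconst (k \<alpha> * of_real ((\<alpha> \<bullet> e1) * (\<alpha> \<bullet> e1) / (\<alpha> \<bullet> \<alpha>)))) G +
        vmul (pconst (k \<alpha> * of_real ((\<alpha> \<bullet> e2) * (\<alpha> \<bullet> e2) / (\<alpha> \<bullet> \<alpha>)))) G = vmul (pconst (k \<alpha>)) G"
      if "\<alpha> \<in> R" for \<alpha> and G :: "'m \<Rightarrow> 'n pfun"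
      unfolding vmul_simps(3)[symmetric] pconst_add[symmetric] distrib_left[symmetric] of_real_add[symmetric] sq[OF that]
      by simp
    moreover have "vmul (pconst (of_real (e1 \<bullet> e1))) (vconst u) + vmul (pconst (of_real (e2 \<bullet> e2))) (vconst u) =
      vmul (pconst 2) (vconst u)"
      unfolding vmul_simps(3)[symmetric] pconst_add[symmetric] orthonormal by simp
    ultimately show ?thesis unfolding T2
      by (simp add: sum.distrib[symmetric] add.assoc add.left_commute[of "sum _ R"])
  qed
  also have "(\<Sum>\<alpha>\<in>R. vmul (pconst (k \<alpha>)) (vconst (\<rho> (reflection \<alpha>) *v u))) = vmul (pconst (2 * \<zeta>)) (vconst u)"
  proof -
    have "vmul (pconst 2) (\<Sum>\<alpha>\<in>R. vmul (pconst (k \<alpha> / 2)) (mat_act (\<rho> (reflection \<alpha>)) (vconst u))) =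
      vmul (pconst 2) (vmul (pconst \<zeta>) (vconst u))"
      by (simp only: sum_mat_act_central[OF assms])
    then show ?thesis
      unfolding vmul_sum mat_act_vconst by (simp add: vmul_simps flip: vmul_simps(6) pconst_mult)
  qed
  finally have T3: "vT \<rho> e1 (X e1) + vT \<rho> e2 (X e2) = vmul (pconst (2 + 2 * \<zeta>)) (vconst u)"
    by (simp add: pconst_add vmul_simps)
  have T4: "vT \<rho> v (vmul (nsq ^ m) (X v)) = vmul (nsq ^ m) (vT \<rho> v (X v)) +
      vmul (deriv_along v (nsq ^ m)) (X v)" for v
    by (rule vT_invariant_mul[OF poly_space_power[OF nsq_poly] inv X])
  have T5: "vmul (deriv_along e1 (nsq ^ m)) (X e1) + vmul (deriv_along e2 (nsq ^ m)) (X e2) =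
      vmul (pconst (2 * of_nat m) * nsq ^ m) (vconst u)"
  proof (cases m)
    case (Suc l)
    have "deriv_along e1 (nsq ^ m) * plin e1 + deriv_along e2 (nsq ^ m) * plin e2 = pconst (2 * of_nat m) * nsq ^ m"
      unfolding Suc deriv_along_nsq_power by (simp add: nsq_def algebra_simps)
    then show ?thesis by (simp add: X_def flip: vmul_simps(6) vmul_simps(3))
  qed (simp add: vmul_simps)
  have "vT \<rho> e1 (vT \<rho> e1 (vmul (nsq ^ Suc m) (vconst u))) + vT \<rho> e2 (vT \<rho> e2 (vmul (nsq ^ Suc m) (vconst u))) =
    vmul (pconst (2 * of_nat (Suc m))) (vmul (nsq ^ m) (vT \<rho> e1 (X e1) + vT \<rho> e2 (X e2)) +
      (vmul (deriv_along e1 (nsq ^ m)) (X e1) + vmul (deriv_along e2 (nsq ^ m)) (X e2)))"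
    unfolding T1 by (simp add: vT_cmul X vspace_closed poly_space_power nsq_poly T4 vmul_simps add_ac)
  also have "\<dots> = vmul (pconst (2 * of_nat (Suc m)) * (pconst (2 + 2 * \<zeta>) + pconst (2 * of_nat m)) * nsq ^ m) (vconst u)"
    unfolding T3 T5 by (simp add: vmul_simps(3)[symmetric] vmul_simps(6)[symmetric] algebra_simps)
  also have "pconst (2 * of_nat (Suc m)) * (pconst (2 + 2 * \<zeta>) + pconst (2 * of_nat m)) =
    (pconst (4 * of_nat (Suc m) * (of_nat (Suc m) + \<zeta>)) :: 'n pfun)"
    unfolding pconst_add[symmetric] pconst_mult[symmetric] by (rule arg_cong[of _ _ pconst]) (simp add: algebra_simps)
  finally show ?thesis .
qed

text \<open>If none of the factors m + 1 + \<zeta> vanished, the Laplacian would lead from a high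
  power of \<open>nsq\<close> in the radical down to a nonzero constant in it.\<close>

lemma cofinite_imp_central:
  assumes "central_scalar \<rho> \<zeta>" "cofinite_radical \<rho>"
  obtains n :: nat where "n \<ge> 1" "\<zeta> = - of_nat n"
proof (rule ccontr)
  assume neg: "\<not> thesis"
  note result = that
  define u :: "complex ^ 'm" where "u = 1"
  obtain N where N: "\<And>d F. d \<ge> N \<Longrightarrow> vhomogeneous d F \<Longrightarrow> F \<in> form_radical \<rho>"
    using assms(2) by (auto simp: cofinite_radical_def)
  have hom: "homogeneous (2 * m) (nsq ^ m)" for m
  proof -
    have "homogeneous 2 nsq" unfolding nsq_def
      using homogeneous_mult[OF homogeneous_plin1 homogeneous_plin1] by (intro homogeneous_add) (auto simp: numeral_2_eq_2)
    from homogeneous_power[OF this] show ?thesis .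
  qed
  have "vhomogeneous (2 * N + 0) (vmul (nsq ^ N) (vconst u :: 'm \<Rightarrow> 'n pfun))"
    by (rule vhomogeneous_closed(4)[OF hom vhomogeneous_closed(7)])
  then have start: "vmul (nsq ^ N) (vconst u) \<in> form_radical \<rho>" by (intro N) auto
  have step: "vmul (nsq ^ m) (vconst u) \<in> form_radical \<rho>" if "vmul (nsq ^ Suc m) (vconst u) \<in> form_radical \<rho>" for m
  proof -
    let ?c = "4 * of_nat (Suc m) * (of_nat (Suc m) + \<zeta>)"
    have "vmul (pconst ?c * nsq ^ m) (vconst u) \<in> form_radical \<rho>"
      unfolding vLaplace_nsq[OF assms(1), symmetric] using that by (intro radical_add radical_vT)
    then have "vmul (pconst (1 / ?c)) (vmul (pconst ?c * nsq ^ m) (vconst u)) \<in> form_radical \<rho>"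
      by (rule radical_cmul)
    moreover have "?c \<noteq> 0"
      using neg result[of "Suc m"] add_eq_0_iff[of "of_nat (Suc m)" \<zeta>] by (auto simp del: of_nat_Suc)
    ultimately show ?thesis
      by (simp add: vmul_simps(6)[symmetric] mult.assoc[symmetric] pconst_mult[symmetric] del: of_nat_Suc)
  qed
  have "vmul (nsq ^ (N - j)) (vconst u) \<in> form_radical \<rho>" for j
  proof (induction j)
    case (Suc j)
    show ?case
    proof (cases "j < N")
      case True
      then have "N - j = Suc (N - Suc j)" by simp
      then show ?thesis using Suc step by metis
    qed (use Suc in simp)
  qed (use start in simp)
  from this[of N] have "vmul (nsq ^ 0) (vconst u) \<in> form_radical \<rho>" by simp
  then show False using vconst_radical[of u] by (simp add: vmul_simps u_def)
qed

end

end

section \<open>Verma modules and their simple quotients\<close>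

text \<open>\<open>M\<close> stands for any realisation of the Verma module; \<open>\<Theta>\<close> identifies it with the
  vector-valued polynomials.\<close>

locale verma_model = dunkl_setting R e1 e2 k Rp
  for R :: "(real ^ 'n::finite) set" and e1 e2 k Rp +
  fixes \<rho> :: "(real ^ 'n \<Rightarrow> real ^ 'n) \<Rightarrow> complex ^ 'm ^ 'm"
    and \<zeta> :: complex
    and M :: "('n pop, 'v) module"
    and \<Theta> :: "'v \<Rightarrow> 'm \<Rightarrow> 'n pfun"
  assumes \<rho>: "weyl_rep \<rho>"
    and irreducible: "\<And>U. vec.subspace U \<Longrightarrow> (\<And>w u. w \<in> W \<Longrightarrow> u \<in> U \<Longrightarrow> \<rho> w *v u \<in> U) \<Longrightarrow> U = {0} \<or> U = UNIV"
    and central: "central_scalar \<rho> \<zeta>"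
    and M_abelian: "abelian_group M"
    and \<Theta>_bij: "bij_betw \<Theta> (carrier M) vspace"
    and \<Theta>_add: "x \<in> carrier M \<Longrightarrow> y \<in> carrier M \<Longrightarrow> \<Theta> (x \<oplus>\<^bsub>M\<^esub> y) = \<Theta> x + \<Theta> y"
    and M_smult: "h \<in> carrier H \<Longrightarrow> x \<in> carrier M \<Longrightarrow> h \<odot>\<^bsub>M\<^esub> x \<in> carrier M"
    and \<Theta>_smult: "h \<in> carrier H \<Longrightarrow> x \<in> carrier M \<Longrightarrow> \<Theta> (h \<odot>\<^bsub>M\<^esub> x) = act \<rho> h (\<Theta> x)"
begin

abbreviation rad where "rad \<equiv> form_radical \<rho>"

lemma \<Theta>_vspace: "x \<in> carrier M \<Longrightarrow> \<Theta> x \<in> vspace"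
  using \<Theta>_bij by (auto simp: bij_betw_def)

lemma \<Theta>_inj: "x \<in> carrier M \<Longrightarrow> y \<in> carrier M \<Longrightarrow> \<Theta> x = \<Theta> y \<Longrightarrow> x = y"
  using \<Theta>_bij by (auto simp: bij_betw_def dest: inj_onD)

lemma \<Theta>_surj: assumes "F \<in> vspace" obtains x where "x \<in> carrier M" "\<Theta> x = F"
  using \<Theta>_bij assms that by (metis bij_betw_imp_surj_on imageE)

lemma M_closed: "x \<in> carrier M \<Longrightarrow> y \<in> carrier M \<Longrightarrow> x \<oplus>\<^bsub>M\<^esub> y \<in> carrier M" "\<zero>\<^bsub>M\<^esub> \<in> carrier M"
  "x \<in> carrier M \<Longrightarrow> \<ominus>\<^bsub>M\<^esub> x \<in> carrier M"
  using M_abelian abelian_group.a_inv_closed abelian_monoid.a_closed abelian_monoid.zero_closed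
  by (auto simp: abelian_group_def intro: abelian_group.a_inv_closed[OF M_abelian])

lemma \<Theta>_zero: "\<Theta> \<zero>\<^bsub>M\<^esub> = 0"
proof -
  have "\<zero>\<^bsub>M\<^esub> \<oplus>\<^bsub>M\<^esub> \<zero>\<^bsub>M\<^esub> = \<zero>\<^bsub>M\<^esub>"
    using abelian_monoid.r_zero[of M] M_abelian M_closed(2) by (simp add: abelian_group_def)
  then show ?thesis using \<Theta>_add[OF M_closed(2) M_closed(2)] by simp
qed

lemma \<Theta>_neg: "x \<in> carrier M \<Longrightarrow> \<Theta> (\<ominus>\<^bsub>M\<^esub> x) = - \<Theta> x"
proof -
  assume x: "x \<in> carrier M"
  have "\<Theta> (\<ominus>\<^bsub>M\<^esub> x) + \<Theta> x = 0"
    using \<Theta>_add[OF M_closed(3)[OF x] x] abelian_group.l_neg[OF M_abelian x] \<Theta>_zero by simp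
  then show ?thesis by (simp add: eq_neg_iff_add_eq_0)
qed

lemma submodule_iff:
  "submodule N H M \<longleftrightarrow> N \<subseteq> carrier M \<and> \<zero>\<^bsub>M\<^esub> \<in> N \<and> (\<forall>x\<in>N. \<forall>y\<in>N. x \<oplus>\<^bsub>M\<^esub> y \<in> N) \<and>
    (\<forall>x\<in>N. \<ominus>\<^bsub>M\<^esub> x \<in> N) \<and> (\<forall>h\<in>carrier H. \<forall>x\<in>N. h \<odot>\<^bsub>M\<^esub> x \<in> N)"
  unfolding submodule_def subgroup_def submodule_axioms_def by (auto simp: a_inv_def)

lemma stable_image:
  assumes "submodule N H M" shows "stable \<rho> (\<Theta> ` N)"
proof -
  have N: "N \<subseteq> carrier M" using assms by (simp add: submodule_iff)
  have "\<Theta> x + \<Theta> y \<in> \<Theta> ` N" if "x \<in> N" "y \<in> N" for x y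
    using assms that N \<Theta>_add[of x y] unfolding submodule_iff by (metis imageI subsetD)
  moreover have "act \<rho> h (\<Theta> x) \<in> \<Theta> ` N" if "h \<in> carrier H" "x \<in> N" for h x
    using assms that N \<Theta>_smult[of h x] unfolding submodule_iff by (metis imageI subsetD)
  moreover have "0 \<in> \<Theta> ` N" using assms \<Theta>_zero unfolding submodule_iff by (metis imageI)
  ultimately show ?thesis using N \<Theta>_vspace by (auto simp: stable_def)
qed

definition N0 where "N0 = {x \<in> carrier M. \<Theta> x \<in> rad}"

lemma submodule_N0: "submodule N0 H M"
proof -
  have "- F \<in> rad" if "F \<in> rad" for F
    using radical_diff[OF \<rho> radical_0[OF \<rho>] that] by simp
  then show ?thesis using stable_radical[OF \<rho>] unfolding submodule_iff
    by (auto simp: N0_def M_closed \<Theta>_zero \<Theta>_add \<Theta>_neg M_smult \<Theta>_smult stable_def)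
qed

lemma vconst_not_rad: "vconst (1 :: complex ^ 'm) \<notin> rad"
  using vconst_radical[OF \<rho>, of 1] by (auto simp: vec_eq_iff)

lemma N0_proper: "N0 \<noteq> carrier M"
proof
  assume "N0 = carrier M"
  obtain x where "x \<in> carrier M" "\<Theta> x = vconst 1" using \<Theta>_surj[OF vspace_closed(7)] .
  then have "x \<in> N0" using \<open>N0 = carrier M\<close> by simp
  then show False using \<open>\<Theta> x = vconst 1\<close> vconst_not_rad by (simp add: N0_def)
qed

text \<open>A submodule not inside \<open>N0\<close> corresponds to a stable set outside the
  radical, which \<open>stable_top\<close> forces to be everything. This gives existence and
  uniqueness of the maximal submodule at once.\<close>

lemma submodule_cases:
  assumes "submodule N H M" shows "N \<subseteq> N0 \<or> N = carrier M"
proof (cases "\<Theta> ` N \<subseteq> rad")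
  case True
  then show ?thesis using assms by (auto simp: N0_def submodule_iff)
next
  case False
  then have "\<Theta> ` N = vspace"
    using stable_top[OF \<rho> irreducible central stable_image[OF assms]] by blast
  have N: "N \<subseteq> carrier M" using assms by (simp add: submodule_iff)
  have "carrier M \<subseteq> N"
  proof
    fix x assume x: "x \<in> carrier M"
    then have "\<Theta> x \<in> \<Theta> ` N" using \<open>\<Theta> ` N = vspace\<close> \<Theta>_vspace by simp
    then obtain y where "y \<in> N" "\<Theta> x = \<Theta> y" by blast
    then show "x \<in> N" using \<Theta>_inj[OF x, of y] N by blast
  qed
  with N show ?thesis by blast
qed

lemma the_maximal_submodule: "(THE N. maximal_submodule H M N) = N0"
proof (rule the_equality)
  show "maximal_submodule H M N0"
    unfolding maximal_submodule_def using submodule_N0 N0_proper submodule_cases by blast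
  show "N = N0" if "maximal_submodule H M N" for N
    using that submodule_N0 N0_proper submodule_cases unfolding maximal_submodule_def by metis
qed

abbreviation L where "L \<equiv> quotient_module M N0"

text \<open>Cosets of \<open>N0\<close> are named by polynomials, so that computations in the
  quotient become computations modulo the radical.\<close>

definition cls where "cls F = {y \<in> carrier M. \<Theta> y - F \<in> rad}"

lemma rcoset_N0:
  assumes "x \<in> carrier M" shows "N0 +>\<^bsub>M\<^esub> x = cls (\<Theta> x)"
proof (intro equalityI subsetI)
  fix y assume "y \<in> N0 +>\<^bsub>M\<^esub> x"
  then show "y \<in> cls (\<Theta> x)" using assms
    by (auto simp: a_r_coset_def r_coset_def N0_def cls_def M_closed \<Theta>_add)
next
  fix y assume y: "y \<in> cls (\<Theta> x)"
  then obtain n where n: "n \<in> carrier M" "\<Theta> n = \<Theta> y - \<Theta> x"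
    using \<Theta>_surj[of "\<Theta> y - \<Theta> x"] \<Theta>_vspace assms by (auto simp: cls_def vspace_closed)
  have "y = n \<oplus>\<^bsub>M\<^esub> x"
    by (rule \<Theta>_inj) (use n y assms in \<open>auto simp: cls_def M_closed \<Theta>_add\<close>)
  then show "y \<in> N0 +>\<^bsub>M\<^esub> x"
    using n y by (auto simp: a_r_coset_def r_coset_def N0_def cls_def)
qed

lemma carrier_L: "carrier L = cls ` vspace"
proof -
  have "carrier L = {N0 +>\<^bsub>M\<^esub> x | x. x \<in> carrier M}"
    by (auto simp: quotient_module_def A_RCOSETS_def RCOSETS_def a_r_coset_def)
  also have "\<dots> = cls ` vspace"
    using rcoset_N0 \<Theta>_vspace \<Theta>_surj by (auto simp: image_iff) metis
  finally show ?thesis .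
qed

lemma cls_eq_iff: assumes "F \<in> vspace" "G \<in> vspace" shows "cls F = cls G \<longleftrightarrow> F - G \<in> rad"
proof
  assume eq: "cls F = cls G"
  obtain x where x: "x \<in> carrier M" "\<Theta> x = F" using \<Theta>_surj[OF assms(1)] .
  then have "x \<in> cls F" by (simp add: cls_def radical_0[OF \<rho>])
  then have "x \<in> cls G" by (simp only: eq)
  then show "F - G \<in> rad" using x by (simp add: cls_def)
next
  assume FG: "F - G \<in> rad"
  have "\<Theta> y - F \<in> rad \<longleftrightarrow> \<Theta> y - G \<in> rad" for y
    using radical_add[OF \<rho> _ FG, of "\<Theta> y - F"] radical_diff[OF \<rho> _ FG, of "\<Theta> y - G"] by auto
  then show "cls F = cls G" by (simp add: cls_def)
qed

lemma L_add: assumes "F \<in> vspace" "G \<in> vspace" shows "cls F \<oplus>\<^bsub>L\<^esub> cls G = cls (F + G)"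
proof -
  have "cls F \<oplus>\<^bsub>L\<^esub> cls G = {a \<oplus>\<^bsub>M\<^esub> b | a b. a \<in> cls F \<and> b \<in> cls G}"
    by (auto simp: quotient_module_def set_add_def set_mult_def)
  also have "\<dots> = cls (F + G)"
  proof (intro equalityI subsetI)
    fix y assume "y \<in> {a \<oplus>\<^bsub>M\<^esub> b | a b. a \<in> cls F \<and> b \<in> cls G}"
    then obtain a b where ab: "a \<in> cls F" "b \<in> cls G" "y = a \<oplus>\<^bsub>M\<^esub> b" by auto
    have "(\<Theta> a - F) + (\<Theta> b - G) \<in> rad" using ab by (intro radical_add[OF \<rho>]) (auto simp: cls_def)
    then show "y \<in> cls (F + G)" using ab by (auto simp: cls_def M_closed \<Theta>_add algebra_simps)
  next
    fix y assume y: "y \<in> cls (F + G)"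
    obtain a where a: "a \<in> carrier M" "\<Theta> a = F" using \<Theta>_surj[OF assms(1)] .
    obtain b where b: "b \<in> carrier M" "\<Theta> b = \<Theta> y - F"
      using \<Theta>_surj[of "\<Theta> y - F"] \<Theta>_vspace y assms by (auto simp: cls_def vspace_closed)
    have "y = a \<oplus>\<^bsub>M\<^esub> b" by (rule \<Theta>_inj) (use a b y in \<open>auto simp: cls_def M_closed \<Theta>_add\<close>)
    moreover have e: "\<Theta> b - G = \<Theta> y - (F + G)" using b by (simp add: algebra_simps)
    have "\<Theta> b - G \<in> rad" unfolding e using y by (simp add: cls_def)
    then have "b \<in> cls G" using b(1) by (simp add: cls_def)
    moreover have "a \<in> cls F" using a by (simp add: cls_def radical_0[OF \<rho>])
    ultimately show "y \<in> {a \<oplus>\<^bsub>M\<^esub> b | a b. a \<in> cls F \<and> b \<in> cls G}" by blast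
  qed
  finally show ?thesis .
qed

lemma act_diff_rad:
  assumes "h \<in> carrier H" "F \<in> vspace" "G \<in> vspace" "F - G \<in> rad"
  shows "act \<rho> h F - act \<rho> h G \<in> rad"
proof -
  have "act \<rho> h (F - G) + act \<rho> h G = act \<rho> h F"
    using act_add[OF \<rho>, of "F - G" G h] assms by (simp add: vspace_closed)
  then have "act \<rho> h F - act \<rho> h G = act \<rho> h (F - G)" by (metis add_diff_cancel_right')
  then show ?thesis using stable_radical[OF \<rho>] assms by (simp add: stable_def)
qed

lemma L_smult:
  assumes "h \<in> carrier H" "F \<in> vspace" shows "h \<odot>\<^bsub>L\<^esub> cls F = cls (act \<rho> h F)"
proof -
  obtain x where x: "x \<in> carrier M" "\<Theta> x = F" using \<Theta>_surj[OF assms(2)] .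
  then have xc: "x \<in> cls F" by (simp add: cls_def radical_0[OF \<rho>])
  have "N0 +>\<^bsub>M\<^esub> (h \<odot>\<^bsub>M\<^esub> y) = cls (act \<rho> h F)" if "y \<in> cls F" for y
  proof -
    have y: "y \<in> carrier M" "\<Theta> y - F \<in> rad" using that by (auto simp: cls_def)
    then show ?thesis
      using assms act_diff_rad[OF assms(1) \<Theta>_vspace[OF y(1)] assms(2) y(2)]
      by (simp add: rcoset_N0 M_smult \<Theta>_smult cls_eq_iff act_closed[OF \<rho>] \<Theta>_vspace)
  qed
  then have "(\<Union>y\<in>cls F. N0 +>\<^bsub>M\<^esub> (h \<odot>\<^bsub>M\<^esub> y)) = cls (act \<rho> h F)" using xc by auto
  then show ?thesis by (simp add: quotient_module_def)
qed

lemma L_zero: "\<zero>\<^bsub>L\<^esub> = cls 0"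
  by (auto simp: quotient_module_def cls_def N0_def)

lemma L_abelian_monoid: "abelian_monoid L"
  by (rule abelian_monoidI)
    (auto simp: carrier_L L_zero L_add vspace_closed add_ac intro!: imageI)

lemma L_finsum:
  assumes "finite A" "\<And>b. b \<in> A \<Longrightarrow> r b \<in> vspace \<and> f b = cls (r b)"
  shows "(\<Oplus>\<^bsub>L\<^esub>b\<in>A. f b) = cls (\<Sum>b\<in>A. r b)"
  using assms
proof (induction A rule: finite_induct)
  case empty
  then show ?case by (simp add: abelian_monoid.finsum_empty[OF L_abelian_monoid] L_zero)
next
  case (insert b A)
  have "(\<Oplus>\<^bsub>L\<^esub>b\<in>insert b A. f b) = f b \<oplus>\<^bsub>L\<^esub> (\<Oplus>\<^bsub>L\<^esub>b\<in>A. f b)"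
    by (rule abelian_monoid.finsum_insert[OF L_abelian_monoid insert.hyps])
      (use insert.prems in \<open>auto simp: carrier_L\<close>)
  then show ?case using insert by (simp add: L_add vspace_sum)
qed

text \<open>A finite spanning set involves only bounded degrees. A homogeneous F beyond the bound
  agrees modulo the radical with a combination of it, and comparing components of that degree leaves
  F alone.\<close>

lemma finite_dim_imp_cofinite:
  assumes "finite_dim L" shows "cofinite_radical \<rho>"
proof -
  obtain A where A: "finite A" "A \<subseteq> carrier L"
    "\<And>x. x \<in> carrier L \<Longrightarrow> \<exists>a. x = (\<Oplus>\<^bsub>L\<^esub>b\<in>A. scalar_op (a b) \<odot>\<^bsub>L\<^esub> b)"
    using assms by (auto simp: finite_dim_def)
  have "\<forall>b\<in>A. \<exists>F. F \<in> vspace \<and> b = cls F" using A(2) carrier_L by auto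
  then obtain r where r: "\<And>b. b \<in> A \<Longrightarrow> r b \<in> vspace \<and> b = cls (r b)" by metis
  have "\<exists>N G. (\<forall>d. vhomogeneous d (G d)) \<and> r b = (\<Sum>d<N. G d)" if "b \<in> A" for b
    using vhomogeneous_decomposition[of "r b"] r[OF that] by metis
  then obtain N G where G: "\<And>b d. b \<in> A \<Longrightarrow> vhomogeneous d (G b d)" "\<And>b. b \<in> A \<Longrightarrow> r b = (\<Sum>d<N b. G b d)"
    by metis
  define N1 where "N1 = (\<Sum>b\<in>A. N b)"
  have N1: "N b \<le> N1" if "b \<in> A" for b unfolding N1_def using A(1) that by (intro member_le_sum) auto
  show ?thesis unfolding cofinite_radical_def
  proof (intro exI allI impI)
    fix d and F :: "'m \<Rightarrow> 'n pfun" assume d: "N1 \<le> d" and F: "vhomogeneous d F"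
    have Fv: "F \<in> vspace" using F by (rule vhomogeneous_closed)
    then obtain a where a: "cls F = (\<Oplus>\<^bsub>L\<^esub>b\<in>A. scalar_op (a b) \<odot>\<^bsub>L\<^esub> b)"
      using A(3)[of "cls F"] carrier_L by auto
    define S where "S = (\<Sum>b\<in>A. vmul (pconst (a b)) (r b))"
    have Sv: "S \<in> vspace" unfolding S_def using r by (intro vspace_sum vspace_closed) auto
    have "(\<Oplus>\<^bsub>L\<^esub>b\<in>A. scalar_op (a b) \<odot>\<^bsub>L\<^esub> b) = cls S" unfolding S_def
    proof (rule L_finsum[OF A(1)])
      fix b assume b: "b \<in> A"
      have "scalar_op (a b) \<odot>\<^bsub>L\<^esub> cls (r b) = cls (vmul (pconst (a b)) (r b))"
        using L_smult[OF H_closed(3), of "r b" "a b"] r[OF b] by (simp add: act_scalar_op[OF \<rho>])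
      then show "vmul (pconst (a b)) (r b) \<in> vspace \<and> scalar_op (a b) \<odot>\<^bsub>L\<^esub> b = cls (vmul (pconst (a b)) (r b))"
        using r[OF b] by (auto intro: vspace_closed)
    qed
    then have "F - S \<in> rad" using a cls_eq_iff[OF Fv Sv] by simp
    \<comment> \<open>The component of degree e of \<open>F - S\<close>. The sum is cut off at
      \<open>N b\<close>, because \<open>G b e\<close> is not a component of \<open>r b\<close>
      beyond it.\<close>
    define g where "g e = (if e = d then F else 0) - (\<Sum>b\<in>A. if e < N b then vmul (pconst (a b)) (G b e) else 0)" for e
    have "S = (\<Sum>b\<in>A. \<Sum>e<Suc d. if e < N b then vmul (pconst (a b)) (G b e) else 0)"
      unfolding S_def
    proof (rule sum.cong[OF HOL.refl])
      fix b assume b: "b \<in> A"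
      show "vmul (pconst (a b)) (r b) = (\<Sum>e<Suc d. if e < N b then vmul (pconst (a b)) (G b e) else 0)"
        unfolding G(2)[OF b] vmul_sum
        by (rule sum.mono_neutral_cong_left) (use N1[OF b] d in auto)
    qed
    also have "\<dots> = (\<Sum>e<Suc d. \<Sum>b\<in>A. if e < N b then vmul (pconst (a b)) (G b e) else 0)"
      by (rule sum.swap)
    finally have "F - S = (\<Sum>e<Suc d. g e)"
      by (simp add: g_def sum_subtractf del: sum.lessThan_Suc)
    moreover have "vhomogeneous e (g e)" for e
    proof -
      have "vhomogeneous e (\<Sum>b\<in>A. if e < N b then vmul (pconst (a b)) (G b e) else 0)"
        by (intro vhomogeneous_sum) (auto intro: vhomogeneous_closed G(1))
      from vhomogeneous_closed(2)[OF _ vhomogeneous_closed(5)[OF this, of "-1"], of "if e = d then F else 0"]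
      show ?thesis using F by (auto simp: g_def pconst_minus vmul_simps vhomogeneous_closed(3))
    qed
    ultimately have "g d \<in> rad" using \<open>F - S \<in> rad\<close> radical_graded[OF \<rho>, of g "Suc d" d] by simp
    moreover have "(\<Sum>b\<in>A. if d < N b then vmul (pconst (a b)) (G b d) else 0) = 0"
      by (rule sum.neutral) (use N1 d in \<open>auto dest!: N1\<close>)
    ultimately show "F \<in> rad" by (simp add: g_def)
  qed
qed

definition vmono :: "nat \<Rightarrow> nat \<Rightarrow> 'm \<Rightarrow> 'm \<Rightarrow> 'n pfun" where
  "vmono a b i = vmul (plin e1 ^ a * plin e2 ^ b) (vconst (axis i 1))"

text \<open>Monomials with both exponents below N span modulo the radical, because all others have
  total degree at least N.\<close>

lemma cofinite_imp_finite_dim: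
  assumes "cofinite_radical \<rho>" shows "finite_dim L"
proof -
  obtain N where N: "\<And>d F. d \<ge> N \<Longrightarrow> vhomogeneous d F \<Longrightarrow> F \<in> rad"
    using assms by (auto simp: cofinite_radical_def)
  define I where "I = {..<N} \<times> {..<N} \<times> (UNIV :: 'm set)"
  define m where "m = (\<lambda>(a, b, i). vmono a b i)"
  have I: "finite I" by (simp add: I_def)
  have mv: "m t \<in> vspace" for t
    by (cases t) (auto simp: m_def vmono_def)
  define Sp where "Sp = {F \<in> vspace. \<exists>c. F - (\<Sum>t\<in>I. vmul (pconst (c t)) (m t)) \<in> rad}"
  have Sp_add: "F + G \<in> Sp" if FG: "F \<in> Sp" "G \<in> Sp" for F G
  proof -
    obtain c d where cd: "F - (\<Sum>t\<in>I. vmul (pconst (c t)) (m t)) \<in> rad"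
      "G - (\<Sum>t\<in>I. vmul (pconst (d t)) (m t)) \<in> rad" using FG by (auto simp: Sp_def)
    have "(F + G) - (\<Sum>t\<in>I. vmul (pconst (c t + d t)) (m t)) \<in> rad"
      using radical_add[OF \<rho> cd] by (simp add: pconst_add vmul_simps sum.distrib algebra_simps)
    then show ?thesis using FG by (auto simp: Sp_def intro!: exI[of _ "\<lambda>t. c t + d t"] vspace_closed)
  qed
  have Sp_cmul: "vmul (pconst x) F \<in> Sp" if F: "F \<in> Sp" for F x
  proof -
    obtain c where c: "F - (\<Sum>t\<in>I. vmul (pconst (c t)) (m t)) \<in> rad" using F by (auto simp: Sp_def)
    have "vmul (pconst x) F - (\<Sum>t\<in>I. vmul (pconst (x * c t)) (m t)) \<in> rad"
      using radical_cmul[OF \<rho> c, of x] by (simp add: pconst_mult vmul_simps vmul_sum)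
    then show ?thesis using F by (auto simp: Sp_def intro!: exI[of _ "\<lambda>t. x * c t"] vspace_closed)
  qed
  have Sp_mono: "vmono a b i \<in> Sp" for a b i
  proof (cases "a < N \<and> b < N")
    case True
    then have t: "(a, b, i) \<in> I" by (simp add: I_def)
    have "(\<Sum>t\<in>I. vmul (pconst (if t = (a, b, i) then 1 else 0)) (m t)) =
      (\<Sum>t\<in>I. if t = (a, b, i) then m t else 0)"
      by (intro sum.cong) (auto simp: vmul_simps)
    also have "\<dots> = vmono a b i" using I t by (simp add: m_def)
    finally have "vmono a b i - (\<Sum>t\<in>I. vmul (pconst (if t = (a, b, i) then 1 else 0)) (m t)) \<in> rad"
      by (simp add: radical_0[OF \<rho>])
    moreover have "vmono a b i \<in> vspace" using mv[of "(a, b, i)"] by (simp add: m_def)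
    ultimately show ?thesis unfolding Sp_def
      by (intro CollectI conjI exI[of _ "\<lambda>t. if t = (a, b, i) then 1 else 0"])
  next
    case False
    have "homogeneous (1 * a + 1 * b) (plin e1 ^ a * plin e2 ^ b)"
      by (intro homogeneous_mult homogeneous_power homogeneous_plin1)
    from vhomogeneous_closed(4)[OF this vhomogeneous_closed(7)[of "axis i 1"]]
    have "vhomogeneous (a + b) (vmono a b i)" by (simp add: vmono_def)
    then have "vmono a b i \<in> rad" using False by (intro N[of "a + b"]) auto
    then have "vmono a b i - (\<Sum>t\<in>I. vmul (pconst 0) (m t)) \<in> rad" by (simp add: vmul_simps)
    then show ?thesis using radical_vspace[OF \<rho> \<open>vmono a b i \<in> rad\<close>] unfolding Sp_def
      by (intro CollectI conjI exI[of _ "\<lambda>t. 0"])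
  qed
  have span: "vmul f (vmono a b i) \<in> Sp" if "f \<in> poly_space" for f a b i
    using that
  proof (induction arbitrary: a b rule: poly_space_induct)
    case (const c)
    then show ?case by (rule Sp_cmul[OF Sp_mono])
  next
    case (add f g)
    then show ?case by (simp add: vmul_simps Sp_add)
  next
    case (plin f v)
    have "vmul (plin v * f) (vmono a b i) = vmul (pconst (of_real (v \<bullet> e1))) (vmul f (vmono (Suc a) b i)) +
      vmul (pconst (of_real (v \<bullet> e2))) (vmul f (vmono a (Suc b) i))"
      unfolding plin_coordinates[OF \<rho>, of v] vmono_def vmul_simps(6)[symmetric] vmul_simps(3)[symmetric]
      by (rule arg_cong[of _ _ "\<lambda>p. vmul p _"]) (simp add: algebra_simps)
    then show ?case using Sp_add[OF Sp_cmul[OF plin(2)] Sp_cmul[OF plin(2)]] by simp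
  qed
  have all: "F \<in> Sp" if F: "F \<in> vspace" for F
  proof -
    have "(\<Sum>i\<in>J. vsingle i (F i)) \<in> Sp" for J
    proof (induction J rule: infinite_finite_induct)
      case (insert i J)
      have "vsingle i (F i) = vmul (F i) (vmono 0 0 i)" by (simp add: vsingle_vmul vmono_def vmul_simps)
      then show ?case using insert span[OF vspaceD[OF F]] by (simp add: Sp_add)
    qed (use Sp_cmul[OF Sp_mono, of 0] in \<open>simp_all add: vmul_simps\<close>)
    then show ?thesis using vspace_sum_vsingle[of F] by metis
  qed
  define A where "A = (\<lambda>t. cls (m t)) ` I"
  have A: "finite A" "A \<subseteq> carrier L" using I mv by (auto simp: A_def carrier_L)
  \<comment> \<open>\<open>finite_dim\<close> sums over a set of classes, and different monomials
    may share a class; one representative is chosen for each.\<close>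
  define r where "r b = m (SOME t. t \<in> I \<and> cls (m t) = b)" for b
  have r: "r b \<in> vspace" "cls (r b) = b" if "b \<in> A" for b
  proof -
    have "\<exists>t. t \<in> I \<and> cls (m t) = b" using that by (auto simp: A_def)
    from someI_ex[OF this] show "cls (r b) = b" by (simp add: r_def)
  qed (simp add: r_def mv)
  have "\<exists>a. x = (\<Oplus>\<^bsub>L\<^esub>b\<in>A. scalar_op (a b) \<odot>\<^bsub>L\<^esub> b)" if "x \<in> carrier L" for x
  proof -
    obtain F where F: "F \<in> vspace" "x = cls F" using \<open>x \<in> carrier L\<close> by (auto simp: carrier_L)
    obtain c where c: "F - (\<Sum>t\<in>I. vmul (pconst (c t)) (m t)) \<in> rad" using all[OF F(1)] by (auto simp: Sp_def)
    \<comment> \<open>Accordingly the coefficient of a class collects the coefficients of all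
      monomials in it.\<close>
    define a where "a b = (\<Sum>t | t \<in> I \<and> cls (m t) = b. c t)" for b
    define S where "S = (\<Sum>b\<in>A. vmul (pconst (a b)) (r b))"
    have Sv: "S \<in> vspace" unfolding S_def using r by (intro vspace_sum vspace_closed) auto
    have finsum: "(\<Oplus>\<^bsub>L\<^esub>b\<in>A. scalar_op (a b) \<odot>\<^bsub>L\<^esub> b) = cls S" unfolding S_def
    proof (rule L_finsum[OF A(1)])
      fix b assume b: "b \<in> A"
      have "scalar_op (a b) \<odot>\<^bsub>L\<^esub> cls (r b) = cls (vmul (pconst (a b)) (r b))"
        using L_smult[OF H_closed(3), of "r b" "a b"] r[OF b] by (simp add: act_scalar_op[OF \<rho>])
      then show "vmul (pconst (a b)) (r b) \<in> vspace \<and> scalar_op (a b) \<odot>\<^bsub>L\<^esub> b = cls (vmul (pconst (a b)) (r b))"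
        using r[OF b] by (auto intro: vspace_closed)
    qed
    have "(\<Sum>t\<in>I. vmul (pconst (c t)) (m t)) - (\<Sum>t\<in>I. vmul (pconst (c t)) (r (cls (m t)))) =
      (\<Sum>t\<in>I. vmul (pconst (c t)) (m t - r (cls (m t))))"
      by (simp add: sum_subtractf vmul_simps)
    also have "\<dots> \<in> rad"
    proof (intro radical_sum[OF \<rho>] radical_cmul[OF \<rho>])
      fix t assume "t \<in> I"
      then have "cls (m t) \<in> A" by (simp add: A_def)
      then show "m t - r (cls (m t)) \<in> rad" using r cls_eq_iff[OF mv[of t], of "r (cls (m t))"] by metis
    qed
    also have "(\<Sum>t\<in>I. vmul (pconst (c t)) (r (cls (m t)))) = S"
    proof -
      have "(\<Sum>t\<in>I. vmul (pconst (c t)) (r (cls (m t)))) =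
        (\<Sum>b\<in>A. \<Sum>t | t \<in> I \<and> cls (m t) = b. vmul (pconst (c t)) (r (cls (m t))))"
        unfolding A_def by (rule sum.image_gen[OF I])
      also have "\<dots> = (\<Sum>b\<in>A. \<Sum>t | t \<in> I \<and> cls (m t) = b. vmul (pconst (c t)) (r b))"
        by (intro sum.cong) auto
      also have "\<dots> = S" unfolding S_def
      proof (rule sum.cong[OF HOL.refl])
        have "(\<Sum>t\<in>J. vmul (pconst (c t)) G) = vmul (pconst (\<Sum>t\<in>J. c t)) G" for J and G :: "'m \<Rightarrow> 'n pfun"
          by (induction J rule: infinite_finite_induct) (auto simp: vmul_simps pconst_add)
        then show "(\<Sum>t | t \<in> I \<and> cls (m t) = b. vmul (pconst (c t)) (r b)) = vmul (pconst (a b)) (r b)" for b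
          by (simp add: a_def)
      qed
      finally show ?thesis .
    qed
    finally have "F - S \<in> rad" using radical_add[OF \<rho> c] by fastforce
    then have "cls F = cls S" using cls_eq_iff[OF F(1) Sv] by simp
    then show ?thesis by (intro exI[of _ a]) (simp only: F(2) finsum)
  qed
  then show ?thesis using A unfolding finite_dim_def by blast
qed

theorem finite_dim_iff: "finite_dim (simple_quotient H M) \<longleftrightarrow> cofinite_radical \<rho>"
  unfolding simple_quotient_def the_maximal_submodule
  using finite_dim_imp_cofinite cofinite_imp_finite_dim by blast

end

section \<open>The tensor product identified with vector-valued polynomials\<close>

context dunkl_setting begin

context
  fixes \<rho> :: "(real ^ 'n \<Rightarrow> real ^ 'n) \<Rightarrow> complex ^ 'm ^ 'm"
  assumes \<rho>: "weyl_rep \<rho>"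
begin

lemma End_poly_one_scalar: "\<one>\<^bsub>End_poly\<^esub> = (scalar_op 1 :: 'n pop)"
  by (rule End_poly_ext)
    (simp_all add: End_poly_one_zero scalar_op_eq_mult_op mult_op_carrier End_poly_apply mult_op_apply)

lemma End_poly_zero_scalar: "\<zero>\<^bsub>End_poly\<^esub> = (scalar_op 0 :: 'n pop)"
  by (rule End_poly_ext)
    (simp_all add: End_poly_one_zero scalar_op_eq_mult_op mult_op_carrier End_poly_apply mult_op_apply)

lemma vconst_eq_iff: "vconst u = (vconst v :: 'm \<Rightarrow> 'n pfun) \<longleftrightarrow> u = v"
proof
  assume "vconst u = (vconst v :: 'm \<Rightarrow> 'n pfun)"
  then have "vconst u i (0 :: real ^ 'n) = vconst v i (0 :: real ^ 'n)" for i by (simp only:)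
  then show "u = v" by (simp add: vconst_def pconst_apply vec_eq_iff)
qed simp

lemma vconst_uminus: "vconst (- v) = (- vconst v :: 'm \<Rightarrow> 'n pfun)"
  by (simp add: vconst_def pconst_minus fun_eq_iff[where 'a='m] uminus_apply)

lemma mat_scalar_mult: "mat c *v v = c *s (v :: complex ^ 'm)"
  by (simp add: matrix_vector_mult_def mat_def vec_eq_iff if_distrib if_distribR cong: if_cong)

lemma matrix_minus_mult: "(- A) *v v = - (A *v (v :: complex ^ 'm))"
  by (simp add: matrix_vector_mult_def vec_eq_iff sum_negf)

lemma act_const_dunkl: "act \<rho> (dunkl_op Rp k y) (vconst v) = 0"
  by (simp add: act_dunkl_op[OF \<rho>] vspace_closed vT_const vmul_simps)

lemma B_gens_cases:
  assumes "b \<in> B_gens"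
  obtains c where "b = scalar_op c" | w where "w \<in> W" "b = group_op w" | y where "b = dunkl_op Rp k y"
  using assms by (auto simp: B_gens_def)

text \<open>The subalgebra preserves constants, since Dunkl operators kill them and W acts on them
  by \<rho>. The matrices found here provide the extension of \<rho> that kills
  \<open>S_plus\<close>.\<close>

lemma act_const:
  assumes "b \<in> carrier B" shows "\<exists>A. \<forall>v. act \<rho> b (vconst v) = vconst (A *v v)"
  using assms unfolding B_simps
proof (induction rule: generate_ring.induct)
  case one
  show ?case by (rule exI[of _ "mat 1"]) (simp add: act_one[OF \<rho>])
next
  case (incl b)
  then show ?case
  proof (cases rule: B_gens_cases)
    case (1 c)
    then show ?thesis
      by (intro exI[of _ "mat c"]) (simp add: act_scalar_op[OF \<rho>] mat_scalar_mult vconst_simps)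
  next
    case (2 w)
    then show ?thesis by (intro exI[of _ "\<rho> w"]) (simp add: act_group_op[OF \<rho>] vW_const)
  next
    case (3 y)
    then show ?thesis by (intro exI[of _ 0]) (simp add: act_const_dunkl vconst_simps)
  qed
next
  case (a_inv b)
  then obtain A where "\<forall>v. act \<rho> b (vconst v) = vconst (A *v v)" by blast
  then show ?case using a_inv(1) B_H
    by (intro exI[of _ "- A"]) (simp add: act_neg_left[OF \<rho>] B_simps matrix_minus_mult vconst_uminus)
next
  case (eng_add b b')
  then obtain A A' where "\<forall>v. act \<rho> b (vconst v) = vconst (A *v v)" "\<forall>v. act \<rho> b' (vconst v) = vconst (A' *v v)"
    by blast
  then show ?case using eng_add B_H
    by (intro exI[of _ "A + A'"]) (simp add: act_add_left[OF \<rho>] B_simps matrix_vector_mult_add_rdistrib vconst_simps)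
next
  case (eng_mult b b')
  then obtain A A' where "\<forall>v. act \<rho> b (vconst v) = vconst (A *v v)" "\<forall>v. act \<rho> b' (vconst v) = vconst (A' *v v)"
    by blast
  then show ?case using eng_mult B_H
    by (intro exI[of _ "A ** A'"]) (simp add: act_mult[OF \<rho>] B_simps vspace_closed matrix_vector_mul_assoc)
qed

text \<open>The matrices of the action on constants form such an extension, so the choice made by
  \<open>SOME\<close> in \<open>inflated_module\<close> is meaningful.\<close>

lemma extends_rep_exists: "\<exists>\<phi>. extends_rep R Rp k \<rho> \<phi>"
proof -
  obtain \<phi> where \<phi>: "\<And>b v. b \<in> carrier B \<Longrightarrow> act \<rho> b (vconst v) = vconst (\<phi> b *v v)"
    using act_const by metis
  have eqI: "\<phi> b = A" if "b \<in> carrier B" "\<And>v. act \<rho> b (vconst v) = vconst (A *v v)" for b A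
    unfolding matrix_eq using \<phi>[OF that(1)] that(2) vconst_eq_iff by metis
  have S: "s \<in> carrier B \<and> \<phi> s = 0" if "s \<in> S_plus Rp k" for s
    using that
  proof (induction rule: S_plus.induct)
    case (dunkl y)
    show ?case using B_closed(5) by (auto intro!: eqI simp: act_const_dunkl vconst_simps)
  next
    case (prod s t)
    then have st: "s \<in> carrier B" "t \<in> carrier B" "\<phi> s = 0" "\<phi> t = 0" by auto
    have "act \<rho> (s \<otimes>\<^bsub>End_poly\<^esub> t) (vconst v) = vconst (0 *v v)" for v
      by (subst act_mult[OF \<rho>]) (use st B_H in \<open>simp_all add: vspace_closed \<phi> vconst_simps act_0[OF \<rho>]\<close>)
    then show ?case using eqI[OF B_closed(2)[OF st(1,2)]] B_closed(2)[OF st(1,2)] by blast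
  next
    case (add s t)
    then have st: "s \<in> carrier B" "t \<in> carrier B" "\<phi> s = 0" "\<phi> t = 0" by auto
    have "act \<rho> (s \<oplus>\<^bsub>End_poly\<^esub> t) (vconst v) = vconst (0 *v v)" for v
      by (subst act_add_left[OF \<rho>]) (use st B_H in \<open>simp_all add: \<phi> vconst_simps\<close>)
    then show ?case using eqI[OF B_closed(1)[OF st(1,2)]] B_closed(1)[OF st(1,2)] by blast
  next
    case (scal s c)
    then have s: "s \<in> carrier B" "\<phi> s = 0" by auto
    have "act \<rho> (scalar_op c \<otimes>\<^bsub>End_poly\<^esub> s) (vconst v) = vconst (0 *v v)" for v
      by (subst act_mult[OF \<rho>])
        (use s B_H H_closed(3) in \<open>simp_all add: vspace_closed \<phi> vconst_simps act_0[OF \<rho>]\<close>)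
    then show ?case using eqI[OF B_closed(2)[OF B_closed(3) s(1)]] B_closed(2)[OF B_closed(3) s(1)] by blast
  qed
  have "extends_rep R Rp k \<rho> \<phi>"
    unfolding extends_rep_def Let_def B_simps(2,3)
  proof (intro conjI ballI allI)
    fix b b' assume b: "b \<in> carrier B" "b' \<in> carrier B"
    show "\<phi> (b \<oplus>\<^bsub>End_poly\<^esub> b') = \<phi> b + \<phi> b'"
    proof (rule eqI[OF B_closed(1)[OF b]])
      show "act \<rho> (b \<oplus>\<^bsub>End_poly\<^esub> b') (vconst v) = vconst ((\<phi> b + \<phi> b') *v v)" for v
        by (subst act_add_left[OF \<rho> b[THEN B_H]])
          (use b in \<open>simp add: \<phi> matrix_vector_mult_add_rdistrib vconst_simps\<close>)
    qed
    show "\<phi> (b \<otimes>\<^bsub>End_poly\<^esub> b') = \<phi> b ** \<phi> b'"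
    proof (rule eqI[OF B_closed(2)[OF b]])
      show "act \<rho> (b \<otimes>\<^bsub>End_poly\<^esub> b') (vconst v) = vconst ((\<phi> b ** \<phi> b') *v v)" for v
        by (subst act_mult[OF \<rho> b[THEN B_H]])
          (use b in \<open>simp_all add: \<phi> vspace_closed matrix_vector_mul_assoc\<close>)
    qed
  next
    show "\<phi> (scalar_op c) = mat c" for c
      by (rule eqI) (simp_all add: B_closed(3) act_scalar_op[OF \<rho>] mat_scalar_mult vconst_simps)
    show "\<phi> (group_op w) = \<rho> w" if "w \<in> W" for w
      by (rule eqI) (simp_all add: that B_closed(4) act_group_op[OF \<rho>] vW_const)
  qed (use S in blast)
  then show ?thesis by (rule exI[of _ \<phi>])
qed

definition \<Phi> where "\<Phi> = (SOME \<phi>. extends_rep R Rp k \<rho> \<phi>)"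

lemma \<Phi>: "extends_rep R Rp k \<rho> \<Phi>"
  unfolding \<Phi>_def using extends_rep_exists by (rule someI_ex)

text \<open>Whatever extension is chosen, its values on the subalgebra are forced by the generators,
  so it agrees with the action on constants.\<close>

lemma act_\<Phi>:
  assumes "b \<in> carrier B" shows "act \<rho> b (vconst v) = vconst (\<Phi> b *v v)"
proof -
  have \<Phi>_add: "\<Phi> (b \<oplus>\<^bsub>End_poly\<^esub> b') = \<Phi> b + \<Phi> b'" and \<Phi>_mult: "\<Phi> (b \<otimes>\<^bsub>End_poly\<^esub> b') = \<Phi> b ** \<Phi> b'"
    if "b \<in> carrier B" "b' \<in> carrier B" for b b'
    using \<Phi> that unfolding extends_rep_def Let_def B_simps(2,3) by blast+
  have \<Phi>_scalar: "\<Phi> (scalar_op c) = mat c" and \<Phi>_group: "w \<in> W \<Longrightarrow> \<Phi> (group_op w) = \<rho> w"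
    and \<Phi>_S: "s \<in> S_plus Rp k \<Longrightarrow> \<Phi> s = 0" for c w s
    using \<Phi> unfolding extends_rep_def Let_def by blast+
  from assms show ?thesis unfolding B_simps
  proof (induction arbitrary: v rule: generate_ring.induct)
    case one
    then show ?case by (simp add: End_poly_one_scalar act_scalar_op[OF \<rho>] vmul_simps \<Phi>_scalar)
  next
    case (incl b)
    then show ?case
    proof (cases rule: B_gens_cases)
      case (1 c)
      then show ?thesis by (simp add: act_scalar_op[OF \<rho>] mat_scalar_mult vconst_simps \<Phi>_scalar)
    next
      case (2 w)
      then show ?thesis by (simp add: act_group_op[OF \<rho>] vW_const \<Phi>_group)
    next
      case (3 y)
      then show ?thesis by (simp add: act_const_dunkl vconst_simps \<Phi>_S S_plus.dunkl)
    qed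
  next
    case (a_inv b)
    interpret ring "End_poly :: 'n pop ring" by (rule ring_End_poly)
    have b: "b \<in> carrier B" "\<ominus>\<^bsub>End_poly\<^esub> b \<in> carrier B" using a_inv(1) generate_ring.a_inv
      by (auto simp: B_simps)
    \<comment> \<open>\<open>extends_rep\<close> does not mention negatives; they follow from
      additivity, since b and its negative add up to \<open>scalar_op 0\<close>.\<close>
    have "\<Phi> (b \<oplus>\<^bsub>End_poly\<^esub> \<ominus>\<^bsub>End_poly\<^esub> b) = \<Phi> b + \<Phi> (\<ominus>\<^bsub>End_poly\<^esub> b)" by (rule \<Phi>_add[OF b])
    moreover have "b \<oplus>\<^bsub>End_poly\<^esub> \<ominus>\<^bsub>End_poly\<^esub> b = scalar_op 0"
      using r_neg[OF H_carrier[OF B_H[OF b(1)]]] by (simp add: End_poly_zero_scalar)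
    moreover have "mat 0 = (0 :: complex ^ 'm ^ 'm)" by (simp add: mat_def vec_eq_iff)
    ultimately have "\<Phi> (\<ominus>\<^bsub>End_poly\<^esub> b) = - \<Phi> b" by (simp add: \<Phi>_scalar eq_neg_iff_add_eq_0 add.commute)
    then show ?case
      using a_inv.IH by (simp add: act_neg_left[OF \<rho> B_H[OF b(1)]] matrix_minus_mult vconst_uminus)
  next
    case (eng_add b b')
    then show ?case using B_H
      by (simp add: B_simps act_add_left[OF \<rho>] \<Phi>_add matrix_vector_mult_add_rdistrib vconst_simps)
  next
    case (eng_mult b b')
    then show ?case using B_H
      by (simp add: B_simps act_mult[OF \<rho>] vspace_closed \<Phi>_mult matrix_vector_mul_assoc)
  qed
qed

abbreviation V where "V \<equiv> inflated_module R Rp k \<rho>"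

lemma V_simps: "carrier V = UNIV" "v \<oplus>\<^bsub>V\<^esub> v' = v + v'" "b \<odot>\<^bsub>V\<^esub> v = \<Phi> b *v v"
  by (simp_all add: inflated_module_def \<Phi>_def)

abbreviation FG where "FG \<equiv> free_Abelian_group (carrier H \<times> (UNIV :: (complex ^ 'm) set))"

definition KK where "KK = generate FG (tensor_relations H B V)"

lemma relations_carrier: "tensor_relations H B V \<subseteq> carrier FG"
  unfolding tensor_relations_def V_simps H_simps(2,3)
  by (auto simp: H_closed B_H subset_iff dest!: keys_diff[THEN subsetD])

definition VG :: "('m \<Rightarrow> 'n pfun) monoid" where
  "VG = \<lparr>carrier = vspace, monoid.mult = (+), one = 0\<rparr>"

lemma VG: "comm_group VG"
proof (rule comm_groupI)
  fix F assume "F \<in> carrier VG"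
  then show "\<exists>G\<in>carrier VG. G \<otimes>\<^bsub>VG\<^esub> F = \<one>\<^bsub>VG\<^esub>"
    by (intro bexI[of _ "- F"]) (auto simp: VG_def vspace_closed)
qed (auto simp: VG_def vspace_closed add_ac)

text \<open>The tensor of h and v goes to h applied to the constant v. The map is lifted from the
  generators by the universal property of the free abelian group and turns out to have kernel
  \<open>KK\<close>.\<close>

definition ev :: "('n pop \<times> (complex ^ 'm) \<Rightarrow>\<^sub>0 int) \<Rightarrow> 'm \<Rightarrow> 'n pfun" where
  "ev = (SOME f. f \<in> hom FG VG \<and>
     (\<forall>h v. h \<in> carrier H \<longrightarrow> f (frag_of (h, v)) = act \<rho> h (vconst v)))"

lemma ev_props: "ev \<in> hom FG VG" "h \<in> carrier H \<Longrightarrow> ev (frag_of (h, v)) = act \<rho> h (vconst v)"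
proof -
  obtain f where "f \<in> hom FG VG" "\<And>x. x \<in> carrier H \<times> (UNIV :: (complex ^ 'm) set) \<Longrightarrow>
      f (frag_of x) = (\<lambda>(h, v). act \<rho> h (vconst v)) x"
    using comm_group.free_Abelian_group_universal[OF VG, of "\<lambda>(h, v). act \<rho> h (vconst v)"
        "carrier H \<times> (UNIV :: (complex ^ 'm) set)"] act_closed[OF \<rho>]
    by (auto simp: VG_def image_subset_iff vspace_closed)
  then have "\<exists>f. f \<in> hom FG VG \<and> (\<forall>h v. h \<in> carrier H \<longrightarrow> f (frag_of (h, v)) = act \<rho> h (vconst v))"
    by (intro exI[of _ f]) auto
  from someI_ex[OF this] show "ev \<in> hom FG VG"
    "h \<in> carrier H \<Longrightarrow> ev (frag_of (h, v)) = act \<rho> h (vconst v)" unfolding ev_def[symmetric] by auto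
qed

lemma FG_closed:
  "x \<in> carrier FG \<Longrightarrow> y \<in> carrier FG \<Longrightarrow> x + y \<in> carrier FG"
  "x \<in> carrier FG \<Longrightarrow> y \<in> carrier FG \<Longrightarrow> x - y \<in> carrier FG"
  "x \<in> carrier FG \<Longrightarrow> - x \<in> carrier FG" "0 \<in> carrier FG"
  "h \<in> carrier H \<Longrightarrow> frag_of (h, v) \<in> carrier FG"
  using keys_add[of x y] keys_diff[of x y] by (auto simp: keys_minus)

lemma FG_induct [consumes 1, case_names zero diff gen]:
  assumes "x \<in> carrier FG" and "P 0"
    and "\<And>x y. x \<in> carrier FG \<Longrightarrow> y \<in> carrier FG \<Longrightarrow> P x \<Longrightarrow> P y \<Longrightarrow> P (x - y)"
    and "\<And>h v. h \<in> carrier H \<Longrightarrow> P (frag_of (h, v))"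
  shows "P x"
proof -
  have "Poly_Mapping.keys x \<subseteq> carrier H \<times> UNIV" using assms(1) by simp
  then show ?thesis
    by (rule free_Abelian_group_induct) (use assms(2-4) in auto)
qed

lemma ev_add: "x \<in> carrier FG \<Longrightarrow> y \<in> carrier FG \<Longrightarrow> ev (x + y) = ev x + ev y"
  using ev_props(1) by (auto simp: hom_def VG_def)

lemma ev_vspace: "x \<in> carrier FG \<Longrightarrow> ev x \<in> vspace"
  using ev_props(1) by (auto simp: hom_def VG_def)

lemma ev_0: "ev 0 = 0"
  using ev_add[OF FG_closed(4) FG_closed(4)] by simp

lemma ev_diff: "x \<in> carrier FG \<Longrightarrow> y \<in> carrier FG \<Longrightarrow> ev (x - y) = ev x - ev y"
  using ev_add[of "x - y" y] FG_closed by (simp add: eq_diff_eq)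

lemma ev_uminus: "x \<in> carrier FG \<Longrightarrow> ev (- x) = - ev x"
  using ev_diff[OF FG_closed(4), of x] by (simp add: ev_0)

lemma KK_subgroup: "subgroup KK FG"
  unfolding KK_def by (rule group.generate_is_subgroup[OF group_free_Abelian_group relations_carrier])

lemma KK_carrier: "x \<in> KK \<Longrightarrow> x \<in> carrier FG"
  using subgroup.subset[OF KK_subgroup] by blast

lemma KK_closed: "0 \<in> KK" "x \<in> KK \<Longrightarrow> y \<in> KK \<Longrightarrow> x + y \<in> KK" "x \<in> KK \<Longrightarrow> - x \<in> KK"
  "x \<in> KK \<Longrightarrow> y \<in> KK \<Longrightarrow> x - y \<in> KK"
proof -
  show "0 \<in> KK" using subgroup.one_closed[OF KK_subgroup] by simp
  show add: "x \<in> KK \<Longrightarrow> y \<in> KK \<Longrightarrow> x + y \<in> KK" for x y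
    using subgroup.m_closed[OF KK_subgroup] by simp
  show neg: "x \<in> KK \<Longrightarrow> - x \<in> KK" for x
    using subgroup.m_inv_closed[OF KK_subgroup, of x] KK_carrier[of x] by simp
  show "x \<in> KK \<Longrightarrow> y \<in> KK \<Longrightarrow> x - y \<in> KK" using add[OF _ neg] by fastforce
qed

lemma KK_sum: "(\<And>i. i \<in> I \<Longrightarrow> f i \<in> KK) \<Longrightarrow> (\<Sum>i\<in>I. f i) \<in> KK"
  by (induction I rule: infinite_finite_induct) (auto intro: KK_closed)

lemma KK_rel:
  "h \<in> carrier H \<Longrightarrow> h' \<in> carrier H \<Longrightarrow>
     frag_of (h \<oplus>\<^bsub>End_poly\<^esub> h', v) - frag_of (h, v) - frag_of (h', v) \<in> KK"
  "h \<in> carrier H \<Longrightarrow> frag_of (h, v + v') - frag_of (h, v) - frag_of (h, v') \<in> KK"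
  "h \<in> carrier H \<Longrightarrow> b \<in> carrier B \<Longrightarrow> frag_of (h \<otimes>\<^bsub>End_poly\<^esub> b, v) - frag_of (h, \<Phi> b *v v) \<in> KK"
  unfolding KK_def tensor_relations_def V_simps H_simps(2,3)
  by (rule generate.incl, blast)+

lemma KK_induct [consumes 1, case_names rel zero add minus]:
  assumes "x \<in> KK" and "\<And>x. x \<in> tensor_relations H B V \<Longrightarrow> P x" and "P 0"
    and "\<And>x y. x \<in> KK \<Longrightarrow> y \<in> KK \<Longrightarrow> P x \<Longrightarrow> P y \<Longrightarrow> P (x + y)" and "\<And>x. x \<in> KK \<Longrightarrow> P x \<Longrightarrow> P (- x)"
  shows "P x"
  using assms(1) unfolding KK_def
proof (induction rule: generate.induct)
  case one
  show ?case using assms(3) by simp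
next
  case (incl h)
  then show ?case by (rule assms(2))
next
  case (inv h)
  have "h \<in> carrier FG" using relations_carrier inv by (rule subsetD)
  then have "Poly_Mapping.keys h \<subseteq> carrier H \<times> UNIV" by (simp only: carrier_free_Abelian_group_iff)
  then have "inv\<^bsub>FG\<^esub> h = - h" by (rule inv_free_Abelian_group)
  moreover have "h \<in> KK" unfolding KK_def using inv by (rule generate.incl)
  ultimately show ?case using assms(5)[OF _ assms(2)[OF inv]] by simp
next
  case (eng h h')
  then show ?case using assms(4)[of h h'] by (simp add: KK_def)
qed

lemma ev_KK: "x \<in> KK \<Longrightarrow> ev x = 0"
proof (induction rule: KK_induct)
  case (rel x)
  then show ?case
    unfolding tensor_relations_def V_simps H_simps(2,3)
    by (auto simp: ev_diff FG_closed H_closed B_H ev_props(2) act_add_left[OF \<rho>] act_add[OF \<rho>]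
        vconst_simps vspace_closed act_mult[OF \<rho>] act_\<Phi> simp del: carrier_free_Abelian_group_iff)
qed (simp_all add: ev_0 ev_add ev_uminus KK_carrier del: carrier_free_Abelian_group_iff)

definition lmul where "lmul h = frag_extend (\<lambda>(h', v :: complex ^ 'm). frag_of (h \<otimes>\<^bsub>End_poly\<^esub> h', v))"

lemma lmul_simps: "lmul h (x + y) = lmul h x + lmul h y" "lmul h (x - y) = lmul h x - lmul h y"
  "lmul h (- x) = - lmul h x" "lmul h 0 = 0" "lmul h (frag_of (h', v)) = frag_of (h \<otimes>\<^bsub>End_poly\<^esub> h', v)"
  by (simp_all add: lmul_def frag_extend_add frag_extend_diff frag_extend_minus)

lemma lmul_carrier:
  assumes "h \<in> carrier H" "x \<in> carrier FG" shows "lmul h x \<in> carrier FG"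
  using assms(2)
proof (induction rule: FG_induct)
  case zero
  then show ?case using FG_closed(4) by (simp only: lmul_simps)
next
  case (diff x y)
  then show ?case by (simp only: lmul_simps FG_closed)
next
  case (gen h' v)
  then show ?case unfolding lmul_simps by (intro FG_closed H_closed assms(1))
qed

lemma ev_lmul:
  assumes "h \<in> carrier H" "x \<in> carrier FG" shows "ev (lmul h x) = act \<rho> h (ev x)"
  using assms(2)
proof (induction rule: FG_induct)
  case zero
  then show ?case by (simp add: lmul_simps ev_0 act_0[OF \<rho>])
next
  case (diff x y)
  have "act \<rho> h (ev x - ev y) + act \<rho> h (ev y) = act \<rho> h (ev x)"
    using act_add[OF \<rho> vspace_closed(3)[OF ev_vspace[OF diff(1)] ev_vspace[OF diff(2)]] ev_vspace[OF diff(2)], of h]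
    by simp
  then have "act \<rho> h (ev x) - act \<rho> h (ev y) = act \<rho> h (ev x - ev y)" by (metis add_diff_cancel_right')
  then show ?case using diff
    by (simp only: lmul_simps ev_diff lmul_carrier[OF assms(1)])
next
  case (gen h' v)
  then show ?case using H_closed(2)[OF assms(1) gen] assms(1)
    by (simp add: lmul_simps ev_props(2) act_mult[OF \<rho>] vspace_closed)
qed

abbreviation eqK (infix \<open>\<doteq>\<close> 50) where "x \<doteq> y \<equiv> x - y \<in> KK"

lemma eqK_trans: "x \<doteq> y \<Longrightarrow> y \<doteq> z \<Longrightarrow> x \<doteq> z"
  using KK_closed(2)[of "x - y" "y - z"] by simp

lemma eqK_sym: "x \<doteq> y \<Longrightarrow> y \<doteq> x"
  using KK_closed(3)[of "x - y"] by simp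

lemma eqK_add: "x \<doteq> y \<Longrightarrow> x' \<doteq> y' \<Longrightarrow> x + x' \<doteq> y + y'"
  using KK_closed(2)[of "x - y" "x' - y'"] by (simp add: algebra_simps)

text \<open>Every tensor will be brought to this form, in which the Dunkl operators and the group
  elements have been absorbed into the representation space.\<close>

definition std_frag :: "('m \<Rightarrow> 'n pfun) \<Rightarrow> ('n pop \<times> (complex ^ 'm) \<Rightarrow>\<^sub>0 int)" where
  "std_frag P = (\<Sum>i\<in>UNIV. frag_of (mult_op (P i), axis i 1))"

lemma FG_sum: "(\<And>i. i \<in> I \<Longrightarrow> f i \<in> carrier FG) \<Longrightarrow> (\<Sum>i\<in>I. f i) \<in> carrier FG"
  by (induction I rule: infinite_finite_induct) (simp_all add: FG_closed del: carrier_free_Abelian_group_iff)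

lemma std_frag_carrier: "P \<in> vspace \<Longrightarrow> std_frag P \<in> carrier FG"
  unfolding std_frag_def by (intro FG_sum FG_closed mult_op_H) (simp add: vspace_iff)

lemma ev_sum: "(\<And>i. i \<in> I \<Longrightarrow> f i \<in> carrier FG) \<Longrightarrow> ev (\<Sum>i\<in>I. f i) = (\<Sum>i\<in>I. ev (f i))"
  by (induction I rule: infinite_finite_induct)
    (simp_all add: ev_0 ev_add FG_sum del: carrier_free_Abelian_group_iff)

lemma ev_std_frag: assumes "P \<in> vspace" shows "ev (std_frag P) = P"
proof -
  have P: "P i \<in> poly_space" for i using assms by (simp add: vspace_iff)
  have "ev (std_frag P) = (\<Sum>i\<in>UNIV. ev (frag_of (mult_op (P i), axis i 1)))"
    unfolding std_frag_def by (intro ev_sum FG_closed mult_op_H P)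
  also have "\<dots> = (\<Sum>i\<in>UNIV. vsingle i (P i))"
    by (simp add: ev_props(2) mult_op_H P act_mult_op[OF \<rho>] vsingle_vmul)
  finally show ?thesis by (simp flip: vspace_sum_vsingle)
qed

lemma mult_op_add: "p \<in> poly_space \<Longrightarrow> q \<in> poly_space \<Longrightarrow> mult_op (p + q) = mult_op p \<oplus>\<^bsub>End_poly\<^esub> mult_op q"
  by (rule End_poly_ext) (auto intro!: mult_op_carrier End_poly_closed simp: End_poly_apply mult_op_apply distrib_right)

lemma std_frag_add:
  assumes "P \<in> vspace" "Q \<in> vspace" shows "std_frag (P + Q) \<doteq> std_frag P + std_frag Q"
proof -
  have "frag_of (mult_op (P i + Q i), v) - frag_of (mult_op (P i), v) - frag_of (mult_op (Q i), v) \<in> KK" for i v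
    using assms by (auto simp: mult_op_add vspace_iff intro!: KK_rel mult_op_H)
  then have "(\<Sum>i\<in>UNIV. frag_of (mult_op (P i + Q i), axis i 1) - frag_of (mult_op (P i), axis i 1) -
      frag_of (mult_op (Q i), axis i 1)) \<in> KK" by (intro KK_sum)
  then show ?thesis by (simp add: std_frag_def sum_subtractf plus_fun_apply[of P Q] diff_diff_eq sum.distrib)
qed

lemma std_frag_0: "std_frag 0 \<in> KK"
  using KK_closed(3)[OF std_frag_add[of 0 0]] by (simp add: vspace_closed)

lemma frag_vector_sum:
  assumes "h \<in> carrier H"
  shows "frag_of (h, \<Sum>i\<in>I. u i) \<doteq> (\<Sum>i\<in>I. frag_of (h, u i))"
proof -
  have zero: "frag_of (h, 0) - 0 \<in> KK"
    using KK_closed(3)[OF KK_rel(2)[OF assms, of 0 0]] by simp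
  show ?thesis
  proof (induction I rule: infinite_finite_induct)
    case (insert i I)
    have "frag_of (h, u i + (\<Sum>i\<in>I. u i)) \<doteq> frag_of (h, u i) + frag_of (h, \<Sum>i\<in>I. u i)"
      using KK_rel(2)[OF assms, of "u i" "\<Sum>i\<in>I. u i"] by (simp add: diff_diff_eq)
    moreover have "frag_of (h, u i) + frag_of (h, \<Sum>i\<in>I. u i) \<doteq> frag_of (h, u i) + (\<Sum>i\<in>I. frag_of (h, u i))"
      using insert.IH by simp
    ultimately show ?case using insert.hyps eqK_trans by simp
  qed (use zero in simp_all)
qed

text \<open>Scalar operators lie in the subalgebra, so the complex coordinates of u cross the tensor
  sign although the free group has integer coefficients only.\<close>

lemma frag_mult_op:
  assumes "p \<in> poly_space"
  shows "frag_of (mult_op p, u) \<doteq> std_frag (\<lambda>i. pconst (u $ i) * p)"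
proof -
  have "frag_of (mult_op p, \<Sum>i\<in>UNIV. u $ i *s axis i 1) \<doteq> (\<Sum>i\<in>UNIV. frag_of (mult_op p, u $ i *s axis i 1))"
    by (rule frag_vector_sum[OF mult_op_H[OF assms]])
  then have expand: "frag_of (mult_op p, u) \<doteq> (\<Sum>i\<in>UNIV. frag_of (mult_op p, u $ i *s axis i 1))"
    by (simp only: basis_expansion)
  have "frag_of (mult_op p, c *s axis i 1) \<doteq> frag_of (mult_op (pconst c * p), axis i 1)" for c i
  proof -
    have "mult_op p \<otimes>\<^bsub>End_poly\<^esub> scalar_op c = mult_op (pconst c * p)"
      by (rule End_poly_ext) (use assms in \<open>auto intro!: mult_op_carrier End_poly_closed
          simp: scalar_op_eq_mult_op End_poly_apply mult_op_apply poly_space_mult mult_ac\<close>)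
    moreover have "\<Phi> (scalar_op c) = mat c" using \<Phi> by (simp add: extends_rep_def Let_def)
    ultimately show ?thesis
      using KK_closed(3)[OF KK_rel(3)[OF mult_op_H[OF assms] B_closed(3), of c "axis i 1"]]
      by (simp add: mat_scalar_mult)
  qed
  then have "(\<Sum>i\<in>UNIV. frag_of (mult_op p, u $ i *s axis i 1) - frag_of (mult_op (pconst (u $ i) * p), axis i 1)) \<in> KK"
    by (intro KK_sum)
  then have "(\<Sum>i\<in>UNIV. frag_of (mult_op p, u $ i *s axis i 1)) \<doteq> std_frag (\<lambda>i. pconst (u $ i) * p)"
    by (simp add: std_frag_def sum_subtractf)
  with expand show ?thesis by (rule eqK_trans)
qed

lemma dunkl_funpow_op: "\<exists>b\<in>carrier B. \<forall>f\<in>poly_space. b f = (sT v ^^ n) f"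
proof (induction n)
  case 0
  show ?case using B_closed(3)[of 1]
    by (intro bexI[of _ "scalar_op 1"]) (auto simp: scalar_op_eq_mult_op mult_op_apply)
next
  case (Suc n)
  then obtain b where b: "b \<in> carrier B" "\<forall>f\<in>poly_space. b f = (sT v ^^ n) f" by auto
  let ?y = "(\<chi> i. of_real (v $ i)) :: complex ^ 'n"
  have y: "Re_vec ?y = v" "Im_vec ?y = 0"
    by (simp_all add: Re_vec_def Im_vec_def vec_eq_iff)
  have "sT 0 f = 0" if "f \<in> poly_space" for f using sT_vector[OF that, of 0] by simp
  then have "(dunkl_op Rp k ?y \<otimes>\<^bsub>End_poly\<^esub> b) f = (sT v ^^ Suc n) f" if "f \<in> poly_space" for f
    using that b by (simp add: End_poly_apply dunkl_op_apply sT_funpow_closed y)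
  then show ?case using B_closed(2)[OF B_closed(5) b(1)] by blast
qed

text \<open>Each term of a normal form is multiplication by p after an element of the subalgebra.
  The balancing relation moves that element onto v, and only p remains.\<close>

lemma frag_std:
  assumes "h \<in> carrier H"
  shows "\<exists>P\<in>vspace. frag_of (h, v) \<doteq> std_frag P"
proof -
  obtain c where c: "has_nf h c" using H_has_nf[OF assms] .
  have "nf_ok c" using c by (simp add: has_nf_def)
  then have "\<exists>h'\<in>carrier H. (\<forall>f\<in>poly_space. h' f = snf_op c f) \<and> (\<forall>v. \<exists>P\<in>vspace. frag_of (h', v) \<doteq> std_frag P)"
  proof (induction c)
    case Nil
    have "frag_of (scalar_op 0, v) \<doteq> std_frag 0" for v
    proof -
      have "frag_of (mult_op 0, v) \<doteq> std_frag (\<lambda>i. pconst (v $ i) * 0)" by (rule frag_mult_op) auto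
      moreover have "(\<lambda>i. pconst (v $ i) * 0) = (0 :: 'm \<Rightarrow> 'n pfun)"
        by (simp add: fun_eq_iff[where 'a='m] zero_fun_apply)
      ultimately show ?thesis by (simp add: scalar_op_eq_mult_op)
    qed
    then show ?case using H_closed(3)[of 0]
      by (intro bexI[of _ "scalar_op 0"]) (auto simp: scalar_op_apply intro: vspace_closed)
  next
    case (Cons t c)
    obtain p w i j where t: "t = (p, w, i, j)" by (metis prod_cases4)
    have p: "p \<in> poly_space" "w \<in> W" "nf_ok c" using Cons.prems t by auto
    from Cons.IH[OF p(3)] obtain h' where h': "h' \<in> carrier H" "\<forall>f\<in>poly_space. h' f = snf_op c f"
      "\<forall>v. \<exists>P\<in>vspace. frag_of (h', v) \<doteq> std_frag P" by blast
    obtain b1 b2 where b12: "b1 \<in> carrier B" "\<forall>f\<in>poly_space. b1 f = (sT e1 ^^ i) f"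
      "b2 \<in> carrier B" "\<forall>f\<in>poly_space. b2 f = (sT e2 ^^ j) f" using dunkl_funpow_op by metis
    define b where "b = group_op w \<otimes>\<^bsub>End_poly\<^esub> (b1 \<otimes>\<^bsub>End_poly\<^esub> b2)"
    have b: "b \<in> carrier B" unfolding b_def using b12 p by (intro B_closed)
    define g where "g = (mult_op p \<otimes>\<^bsub>End_poly\<^esub> b) \<oplus>\<^bsub>End_poly\<^esub> h'"
    have pb: "mult_op p \<otimes>\<^bsub>End_poly\<^esub> b \<in> carrier H" using mult_op_H[OF p(1)] B_H[OF b] by (rule H_closed)
    have "g f = snf_op (t # c) f" if f: "f \<in> poly_space" for f
      using f h'(2) b12 p
      by (simp add: g_def b_def End_poly_apply t snterm_def sT_funpow_closed group_op_apply mult_op_apply poly_space_pull)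
    moreover have "\<exists>P\<in>vspace. frag_of (g, v) \<doteq> std_frag P" for v
    proof -
      obtain P where P: "P \<in> vspace" "frag_of (h', v) \<doteq> std_frag P" using h'(3) by blast
      let ?Q = "\<lambda>i. pconst ((\<Phi> b *v v) $ i) * p"
      have Q: "?Q \<in> vspace" using p(1) by (auto simp: vspace_iff)
      have "frag_of (mult_op p \<otimes>\<^bsub>End_poly\<^esub> b, v) \<doteq> std_frag ?Q"
        by (rule eqK_trans[OF KK_rel(3)[OF mult_op_H[OF p(1)] b] frag_mult_op[OF p(1)]])
      moreover have "frag_of (g, v) \<doteq> frag_of (mult_op p \<otimes>\<^bsub>End_poly\<^esub> b, v) + frag_of (h', v)"
        using KK_rel(1)[OF pb h'(1), of v] by (simp add: g_def diff_diff_eq)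
      ultimately have "frag_of (g, v) \<doteq> std_frag ?Q + std_frag P"
        using eqK_add P(2) eqK_trans by blast
      then have "frag_of (g, v) \<doteq> std_frag (?Q + P)"
        using eqK_sym[OF std_frag_add[OF Q P(1)]] eqK_trans by blast
      then show ?thesis using vspace_closed(2)[OF Q P(1)] by blast
    qed
    moreover have "g \<in> carrier H" unfolding g_def using pb h'(1) by (rule H_closed)
    ultimately show ?case by blast
  qed
  then obtain h' where h': "h' \<in> carrier H" "\<forall>f\<in>poly_space. h' f = snf_op c f"
    "\<exists>P\<in>vspace. frag_of (h', v) \<doteq> std_frag P" by blast
  \<comment> \<open>The operator rebuilt from the normal form has the same values on polynomials,
    and both are extensional.\<close>
  have "h' = h"
    by (rule End_poly_ext) (use h' c H_carrier assms in \<open>auto simp: has_nf_def\<close>)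
  then show ?thesis using h'(3) by simp
qed

text \<open>The polynomial of a standard form is recovered by \<open>ev\<close>, so modulo
  \<open>KK\<close> a tensor is determined by its image. This is the injectivity of the
  identification.\<close>

lemma eqK_std: assumes "x \<in> carrier FG" shows "x \<doteq> std_frag (ev x)"
proof -
  have "\<exists>P\<in>vspace. x \<doteq> std_frag P" using assms
  proof (induction rule: FG_induct)
    case zero
    then show ?case using KK_closed(3)[OF std_frag_0] by (intro bexI[of _ 0]) (auto intro: vspace_closed)
  next
    case (diff x y)
    then obtain P Q where PQ: "P \<in> vspace" "x \<doteq> std_frag P" "Q \<in> vspace" "y \<doteq> std_frag Q" by auto
    have "(x - y) - (std_frag P - std_frag Q) \<in> KK"
      using KK_closed(4)[OF PQ(2,4)] by (simp add: algebra_simps)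
    moreover have "std_frag P \<doteq> std_frag (P - Q) + std_frag Q"
      using std_frag_add[of "P - Q" Q] PQ by (simp add: vspace_closed)
    ultimately have "(x - y) - (std_frag P - std_frag Q) + (std_frag P - (std_frag (P - Q) + std_frag Q)) \<in> KK"
      by (rule KK_closed(2))
    then show ?case using PQ by (intro bexI[of _ "P - Q"]) (auto simp: algebra_simps intro: vspace_closed)
  next
    case (gen h v)
    then show ?case by (rule frag_std)
  qed
  then obtain P where P: "P \<in> vspace" "x \<doteq> std_frag P" by auto
  have "ev x - P = 0"
    using ev_KK[OF P(2)] assms P(1) by (simp add: ev_diff std_frag_carrier ev_std_frag del: carrier_free_Abelian_group_iff)
  then show ?thesis using P(2) by simp
qed

lemma ev_eq_0: "x \<in> carrier FG \<Longrightarrow> ev x = 0 \<Longrightarrow> x \<in> KK"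
  using KK_closed(2)[OF eqK_std std_frag_0, of x] by simp

abbreviation M where "M \<equiv> verma_module R Rp k \<rho>"

lemma M_simps:
  "carrier M = (\<lambda>x. KK #>\<^bsub>FG\<^esub> x) ` carrier FG" "\<zero>\<^bsub>M\<^esub> = KK" "X \<oplus>\<^bsub>M\<^esub> Y = X <#>\<^bsub>FG\<^esub> Y"
  "h \<odot>\<^bsub>M\<^esub> X = (\<Union>x\<in>X. KK #>\<^bsub>FG\<^esub> lmul h x)"
  by (simp_all add: verma_module_def tensor_module_def Let_def V_simps KK_def lmul_def H_simps
      carrier_FactGroup)

definition cosetK where "cosetK x = KK #>\<^bsub>FG\<^esub> x"

lemma cosetK_iff: "x \<in> carrier FG \<Longrightarrow> y \<in> cosetK x \<longleftrightarrow> y \<in> carrier FG \<and> ev y = ev x"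
proof -
  assume x: "x \<in> carrier FG"
  have "y \<in> cosetK x \<longleftrightarrow> y - x \<in> KK"
    by (auto simp: cosetK_def r_coset_def intro!: bexI[of _ "y - x"])
  also have "\<dots> \<longleftrightarrow> y \<in> carrier FG \<and> ev y = ev x"
  proof
    assume yx: "y - x \<in> KK"
    have "(y - x) + x \<in> carrier FG" by (rule FG_closed(1)[OF KK_carrier[OF yx] x])
    then have y: "y \<in> carrier FG" by (simp del: carrier_free_Abelian_group_iff)
    moreover have "ev y - ev x = 0" using ev_KK[OF yx] ev_diff[OF y x] by simp
    ultimately show "y \<in> carrier FG \<and> ev y = ev x" by simp
  next
    assume "y \<in> carrier FG \<and> ev y = ev x"
    then show "y - x \<in> KK" using x by (intro ev_eq_0) (simp_all add: FG_closed ev_diff del: carrier_free_Abelian_group_iff)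
  qed
  finally show ?thesis .
qed

lemma cosetK_self: "x \<in> carrier FG \<Longrightarrow> x \<in> cosetK x"
  by (simp only: cosetK_iff simp_thms)

lemma cosetK_eq_iff:
  assumes "x \<in> carrier FG" "y \<in> carrier FG"
  shows "cosetK x = cosetK y \<longleftrightarrow> ev x = ev y"
proof
  assume "cosetK x = cosetK y"
  then have "x \<in> cosetK y" using cosetK_self[OF assms(1)] by (simp only:)
  then show "ev x = ev y" by (simp only: cosetK_iff[OF assms(2)])
next
  assume "ev x = ev y"
  then show "cosetK x = cosetK y"
    by (intro equalityI subsetI) (simp_all only: cosetK_iff[OF assms(1)] cosetK_iff[OF assms(2)])
qed

text \<open>Any representative may be picked, because \<open>ev\<close> is constant on the cosets of
  \<open>KK\<close>.\<close>

definition \<Theta>M where "\<Theta>M X = ev (SOME x. x \<in> X)"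

lemma \<Theta>M_cosetK:
  assumes "x \<in> carrier FG" shows "\<Theta>M (cosetK x) = ev x"
proof -
  have "(SOME y. y \<in> cosetK x) \<in> cosetK x" using cosetK_self[OF assms] by (rule someI)
  then show ?thesis unfolding \<Theta>M_def by (simp only: cosetK_iff[OF assms])
qed

lemma M_add_cosetK:
  assumes "x \<in> carrier FG" "y \<in> carrier FG"
  shows "cosetK x \<oplus>\<^bsub>M\<^esub> cosetK y = cosetK (x + y)"
proof -
  have "cosetK x <#>\<^bsub>FG\<^esub> cosetK y = cosetK (x + y)"
    unfolding set_mult_def
  proof (intro equalityI subsetI)
    fix z assume "z \<in> (\<Union>h\<in>cosetK x. \<Union>k\<in>cosetK y. {h \<otimes>\<^bsub>FG\<^esub> k})"
    then show "z \<in> cosetK (x + y)"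
      using assms by (auto simp: cosetK_iff FG_closed ev_add simp del: carrier_free_Abelian_group_iff)
  next
    fix z assume "z \<in> cosetK (x + y)"
    then have z: "z \<in> carrier FG" "ev z = ev (x + y)" using assms cosetK_iff[of "x + y"] FG_closed by auto
    then have "z - y \<in> cosetK x" "y \<in> cosetK y"
      using assms by (simp_all add: cosetK_iff FG_closed ev_diff ev_add del: carrier_free_Abelian_group_iff)
    then show "z \<in> (\<Union>h\<in>cosetK x. \<Union>k\<in>cosetK y. {h \<otimes>\<^bsub>FG\<^esub> k})" by force
  qed
  then show ?thesis by (simp add: M_simps)
qed

lemma M_smult_cosetK:
  assumes "h \<in> carrier H" "x \<in> carrier FG"
  shows "h \<odot>\<^bsub>M\<^esub> cosetK x = cosetK (lmul h x)"
proof -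
  have "cosetK (lmul h y) = cosetK (lmul h x)" if "y \<in> cosetK x" for y
    using that assms by (simp add: cosetK_iff cosetK_eq_iff lmul_carrier ev_lmul del: carrier_free_Abelian_group_iff)
  moreover have "x \<in> cosetK x" using assms cosetK_iff by blast
  ultimately show ?thesis unfolding M_simps cosetK_def[symmetric] by blast
qed

lemma M_zero_cosetK: "\<zero>\<^bsub>M\<^esub> = cosetK 0"
  by (auto simp: M_simps cosetK_def r_coset_def)

lemma M_carrier_cosetK: "carrier M = cosetK ` carrier FG"
  by (simp add: M_simps cosetK_def)

lemma M_abelian_group: "abelian_group M"
proof (rule abelian_groupI)
  fix X assume "X \<in> carrier M"
  then obtain x where x: "x \<in> carrier FG" "X = cosetK x" by (auto simp: M_carrier_cosetK)
  then have "cosetK (- x) \<oplus>\<^bsub>M\<^esub> X = \<zero>\<^bsub>M\<^esub>"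
    by (simp add: M_add_cosetK FG_closed M_zero_cosetK del: carrier_free_Abelian_group_iff)
  then show "\<exists>Y\<in>carrier M. Y \<oplus>\<^bsub>M\<^esub> X = \<zero>\<^bsub>M\<^esub>"
    using FG_closed(3)[OF x(1)] M_carrier_cosetK by blast
qed (auto simp: M_carrier_cosetK M_add_cosetK M_zero_cosetK FG_closed add_ac
    simp del: carrier_free_Abelian_group_iff intro!: imageI)

lemma verma_model_verma_module:
  assumes "\<And>U. vec.subspace U \<Longrightarrow> (\<And>w u. w \<in> W \<Longrightarrow> u \<in> U \<Longrightarrow> \<rho> w *v u \<in> U) \<Longrightarrow> U = {0} \<or> U = UNIV"
    and "central_scalar \<rho> \<zeta>"
  shows "verma_model R e1 e2 k Rp \<rho> \<zeta> M \<Theta>M"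
proof (intro verma_model.intro verma_model_axioms.intro)
  show "dunkl_setting R e1 e2 k Rp" by (rule dunkl_setting_axioms)
  show "bij_betw \<Theta>M (carrier M) vspace"
  proof (rule bij_betw_imageI)
    show "inj_on \<Theta>M (carrier M)"
    proof (rule inj_onI)
      fix X Y assume XY: "X \<in> carrier M" "Y \<in> carrier M" "\<Theta>M X = \<Theta>M Y"
      then obtain x y where "x \<in> carrier FG" "X = cosetK x" "y \<in> carrier FG" "Y = cosetK y"
        unfolding M_carrier_cosetK by blast
      then show "X = Y" using XY(3) cosetK_eq_iff \<Theta>M_cosetK by metis
    qed
    show "\<Theta>M ` carrier M = vspace"
    proof (intro equalityI subsetI)
      fix F :: "'m \<Rightarrow> 'n pfun" assume F: "F \<in> vspace"
      have "\<Theta>M (cosetK (std_frag F)) = F"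
        by (simp only: \<Theta>M_cosetK[OF std_frag_carrier[OF F]] ev_std_frag[OF F])
      moreover have "\<Theta>M (cosetK (std_frag F)) \<in> \<Theta>M ` carrier M"
        unfolding M_carrier_cosetK by (intro imageI std_frag_carrier[OF F])
      ultimately show "F \<in> \<Theta>M ` carrier M" by (simp only:)
    next
      fix F assume "F \<in> \<Theta>M ` carrier M"
      then obtain x where "x \<in> carrier FG" "F = \<Theta>M (cosetK x)" unfolding M_carrier_cosetK by blast
      then show "F \<in> vspace" by (simp only: \<Theta>M_cosetK ev_vspace)
    qed
  qed
next
  show "weyl_rep \<rho>" by (rule \<rho>)
  show "central_scalar \<rho> \<zeta>" by (rule assms(2))
  show "abelian_group M" by (rule M_abelian_group)
next
  fix U assume U: "vec.subspace U" "\<And>w u. w \<in> W \<Longrightarrow> u \<in> U \<Longrightarrow> \<rho> w *v u \<in> U"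
  show "U = {0} \<or> U = UNIV" by (rule assms(1)[OF U])
next
  fix X Y assume "X \<in> carrier M" "Y \<in> carrier M"
  then obtain x y where xy: "x \<in> carrier FG" "X = cosetK x" "y \<in> carrier FG" "Y = cosetK y"
    unfolding M_carrier_cosetK by blast
  show "\<Theta>M (X \<oplus>\<^bsub>M\<^esub> Y) = \<Theta>M X + \<Theta>M Y"
    unfolding xy(2,4) M_add_cosetK[OF xy(1,3)] \<Theta>M_cosetK[OF xy(1)] \<Theta>M_cosetK[OF xy(3)]
      \<Theta>M_cosetK[OF FG_closed(1)[OF xy(1,3)]] by (rule ev_add[OF xy(1,3)])
next
  fix h X assume h: "h \<in> carrier H" and "X \<in> carrier M"
  then obtain x where x: "x \<in> carrier FG" "X = cosetK x" unfolding M_carrier_cosetK by blast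
  show "h \<odot>\<^bsub>M\<^esub> X \<in> carrier M"
    unfolding x(2) M_smult_cosetK[OF h x(1)] M_carrier_cosetK by (rule imageI[OF lmul_carrier[OF h x(1)]])
  show "\<Theta>M (h \<odot>\<^bsub>M\<^esub> X) = act \<rho> h (\<Theta>M X)"
    unfolding x(2) M_smult_cosetK[OF h x(1)] \<Theta>M_cosetK[OF x(1)] \<Theta>M_cosetK[OF lmul_carrier[OF h x(1)]]
    by (rule ev_lmul[OF h x(1)])
qed

theorem finite_dim_L_iff:
  assumes "\<And>U. vec.subspace U \<Longrightarrow> (\<And>w u. w \<in> W \<Longrightarrow> u \<in> U \<Longrightarrow> \<rho> w *v u \<in> U) \<Longrightarrow> U = {0} \<or> U = UNIV"
    and "central_scalar \<rho> \<zeta>"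
  shows "finite_dim (L_module R Rp k \<rho>) \<longleftrightarrow> cofinite_radical \<rho>"
proof -
  interpret verma_model R e1 e2 k Rp \<rho> \<zeta> M \<Theta>M by (rule verma_model_verma_module[OF assms])
  show ?thesis unfolding L_module_def by (rule finite_dim_iff)
qed

end

end

section \<open>The polynomial representation in type \<open>G\<^sub>2\<close>\<close>

definition \<omega> :: complex where "\<omega> = cis (pi / 3)"

lemma \<omega>_power: "\<omega> ^ n = cis (of_nat n * pi / 3)"
  by (simp add: \<omega>_def Complex.DeMoivre)

lemma \<omega>6: "\<omega> ^ 6 = 1"
proof -
  have "\<omega> ^ 6 = cis (2 * pi)" by (simp add: \<omega>_power)
  then show ?thesis by simp
qed

lemma \<omega>3: "\<omega> ^ 3 = - 1"
  by (simp add: \<omega>_power)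

lemma \<omega>_quadratic: "\<omega> ^ 2 = \<omega> - 1"
proof -
  have "(\<omega> + 1) * (\<omega> ^ 2 - \<omega> + 1) = \<omega> ^ 3 + 1" by (simp add: algebra_simps power2_eq_square power3_eq_cube)
  then have "\<omega> + 1 = 0 \<or> \<omega> ^ 2 - \<omega> + 1 = 0" by (simp add: \<omega>3)
  moreover have "Re (\<omega> + 1) > 0" by (simp add: \<omega>_def cos_60)
  then have "\<omega> + 1 \<noteq> 0" by (metis zero_complex.simps(1) less_irrefl)
  ultimately have "\<omega> ^ 2 - \<omega> + 1 = 0" by blast
  then show ?thesis by (simp add: algebra_simps add_eq_0_iff)
qed

lemma \<omega>_not_real: "Im \<omega> \<noteq> 0"
  by (simp add: \<omega>_def sin_60)

lemma \<omega>24: "\<omega> ^ 2 \<noteq> 1" "\<omega> ^ 4 \<noteq> 1"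
proof -
  have "\<omega> ^ 4 = - \<omega>"
  proof -
    have "\<omega> ^ 4 = \<omega> ^ 3 * \<omega>" by (simp add: eval_nat_numeral)
    then show ?thesis by (simp add: \<omega>3)
  qed
  then show "\<omega> ^ 4 \<noteq> 1" using \<omega>_not_real by (auto simp: complex_eq_iff)
  show "\<omega> ^ 2 \<noteq> 1" unfolding \<omega>_quadratic using \<omega>_not_real by (auto simp: complex_eq_iff)
qed

definition cv :: "real ^ 'n \<Rightarrow> real ^ 'n \<Rightarrow> complex \<Rightarrow> real ^ 'n" where
  "cv e1 e2 c = Re c *\<^sub>R e1 + Im c *\<^sub>R e2"

text \<open>The plane is identified with the complex numbers by means of \<open>e1\<close> and \<open>e2\<close>; the short roots are
  the multiples of the sixth roots of \<open>1\<close>, the long roots those of the sixth roots of \<open>-1\<close>.\<close>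

locale g2_setting = dunkl_setting R e1 e2 k Rp
  for R :: "(real ^ 'n::finite) set" and e1 e2 k Rp +
  fixes r1 r2 :: real and ks kl :: complex
  assumes r_pos: "r1 > 0" "r2 > 0"
    and R_eq: "R = (\<lambda>\<epsilon>. cv e1 e2 (of_real r1 * \<epsilon>)) ` {\<epsilon>. \<epsilon> ^ 6 = 1} \<union>
                  (\<lambda>\<epsilon>. cv e1 e2 (of_real r2 * \<epsilon>)) ` {\<epsilon>. \<epsilon> ^ 6 = - 1}"
    and k_short: "\<epsilon> ^ 6 = 1 \<Longrightarrow> k (cv e1 e2 (of_real r1 * \<epsilon>)) = ks"
    and k_long: "\<epsilon> ^ 6 = - 1 \<Longrightarrow> k (cv e1 e2 (of_real r2 * \<epsilon>)) = kl"
begin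

abbreviation cvec :: "complex \<Rightarrow> real ^ 'n" where "cvec \<equiv> cv e1 e2"

text \<open>The label s is 1 for short and - 1 for long roots. It equals the sixth power of the
  direction \<epsilon>, so that both lengths can be treated at once.\<close>

definition root :: "complex \<Rightarrow> complex \<Rightarrow> real ^ 'n" where
  "root s \<epsilon> = cvec (of_real (if s = 1 then r1 else r2) * \<epsilon>)"

definition rlen :: "complex \<Rightarrow> real" where "rlen s = (if s = 1 then r1 else r2)"

definition kval :: "complex \<Rightarrow> complex" where "kval s = (if s = 1 then ks else kl)"

abbreviation E :: "complex \<Rightarrow> complex set" where "E s \<equiv> {\<epsilon>. \<epsilon> ^ 6 = s}"

abbreviation sg :: "complex set" where "sg \<equiv> {1, - 1}"

definition z :: "'n pfun" where "z = plin e1 + pconst \<i> * plin e2"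
definition zb :: "'n pfun" where "zb = plin e1 - pconst \<i> * plin e2"

lemma z_poly [intro]: "z \<in> poly_space" and zb_poly [intro]: "zb \<in> poly_space"
  by (auto simp: z_def zb_def)

lemma root_eq: "root s \<epsilon> = cvec (of_real (rlen s) * \<epsilon>)"
  by (simp add: root_def rlen_def)

lemma rlen_pos: "rlen s > 0" using r_pos by (simp add: rlen_def)

lemma R_roots: "R = root 1 ` E 1 \<union> root (-1) ` E (-1)"
  unfolding R_eq root_def by simp

lemma root_R: "s \<in> sg \<Longrightarrow> \<epsilon> \<in> E s \<Longrightarrow> root s \<epsilon> \<in> R"
  using R_roots by auto

lemma k_root: "s \<in> sg \<Longrightarrow> \<epsilon> \<in> E s \<Longrightarrow> k (root s \<epsilon>) = kval s"
  using k_short k_long by (auto simp: root_def kval_def)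

lemma cvec_inner: "cvec c \<bullet> e1 = Re c" "cvec c \<bullet> e2 = Im c"
  using orthonormal by (simp_all add: cv_def inner_add_left inner_commute[of e2 e1])

lemma cvec_inner_self: "cvec c \<bullet> cvec c = (cmod c)\<^sup>2"
proof -
  have "cvec c \<bullet> cvec c = Re c * (cvec c \<bullet> e1) + Im c * (cvec c \<bullet> e2)"
    by (subst (2) cv_def) (simp add: inner_add_right)
  then show ?thesis by (simp add: cvec_inner cmod_def power2_eq_square)
qed

lemma cvec_inj: "cvec c = cvec d \<Longrightarrow> c = d"
  by (metis complex_eqI cvec_inner)

lemma E_norm: assumes "s \<in> sg" "\<epsilon> \<in> E s" shows "cmod \<epsilon> = 1"
proof -
  have "cmod \<epsilon> ^ 6 = 1" using assms by (auto simp flip: norm_power)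
  then show ?thesis using power_eq_imp_eq_base[of "cmod \<epsilon>" 6 1] by simp
qed

lemma E_cnj: assumes "s \<in> sg" "\<epsilon> \<in> E s" shows "\<epsilon> * cnj \<epsilon> = 1" "cnj \<epsilon> * \<epsilon> = 1" "\<epsilon> \<noteq> 0"
proof -
  show 1: "\<epsilon> * cnj \<epsilon> = 1" using E_norm[OF assms] by (simp add: complex_norm_square[symmetric])
  then show "cnj \<epsilon> * \<epsilon> = 1" "\<epsilon> \<noteq> 0" by (auto simp: mult.commute)
qed

lemma finite_E: "s \<in> sg \<Longrightarrow> finite (E s)" and card_E: "s \<in> sg \<Longrightarrow> card (E s) = 6"
proof -
  assume "s \<in> sg"
  then have "s \<noteq> 0" by auto
  then show "card (E s) = 6" using card_nth_roots[of s 6] by simp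
  then show "finite (E s)" by (metis card.infinite zero_neq_numeral)
qed

text \<open>Multiplication by \<omega> permutes the sixth roots of s and scales the sum by
  \<omega>^j.\<close>

lemma power_sum_E:
  assumes "s \<in> sg" "\<omega> ^ j \<noteq> 1"
  shows "(\<Sum>\<epsilon>\<in>E s. \<epsilon> ^ j) = 0"
proof -
  have "\<omega> \<noteq> 0" by (simp add: \<omega>_def)
  have "bij_betw (\<lambda>\<epsilon>. \<omega> * \<epsilon>) (E s) (E s)"
    by (rule bij_betw_byWitness[of _ "\<lambda>\<epsilon>. \<epsilon> / \<omega>"])
      (use \<open>\<omega> \<noteq> 0\<close> in \<open>auto simp: power_mult_distrib power_divide \<omega>6\<close>)
  then have "(\<Sum>\<epsilon>\<in>E s. \<epsilon> ^ j) = (\<Sum>\<epsilon>\<in>E s. (\<omega> * \<epsilon>) ^ j)"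
    by (rule sum.reindex_bij_betw[symmetric])
  also have "\<dots> = \<omega> ^ j * (\<Sum>\<epsilon>\<in>E s. \<epsilon> ^ j)"
    by (simp add: power_mult_distrib sum_distrib_left)
  finally have "(1 - \<omega> ^ j) * (\<Sum>\<epsilon>\<in>E s. \<epsilon> ^ j) = 0" by (simp add: algebra_simps)
  then show ?thesis using assms(2) by simp
qed

lemma E_sums:
  assumes "s \<in> sg"
  shows "(\<Sum>\<epsilon>\<in>E s. \<epsilon> ^ 2) = 0" "(\<Sum>\<epsilon>\<in>E s. \<epsilon> ^ 4) = 0" "(\<Sum>\<epsilon>\<in>E s. cnj \<epsilon> ^ 2) = 0" "(\<Sum>\<epsilon>\<in>E s. cnj \<epsilon> ^ 4) = 0"
proof -
  show 1: "(\<Sum>\<epsilon>\<in>E s. \<epsilon> ^ 2) = 0" "(\<Sum>\<epsilon>\<in>E s. \<epsilon> ^ 4) = 0"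
    using power_sum_E[OF assms] \<omega>24 by blast+
  have "cnj (\<Sum>\<epsilon>\<in>E s. \<epsilon> ^ 2) = 0" "cnj (\<Sum>\<epsilon>\<in>E s. \<epsilon> ^ 4) = 0" by (simp_all only: 1 complex_cnj_zero)
  then show "(\<Sum>\<epsilon>\<in>E s. cnj \<epsilon> ^ 2) = 0" "(\<Sum>\<epsilon>\<in>E s. cnj \<epsilon> ^ 4) = 0" by simp_all
qed

lemma sum_R:
  "(\<Sum>\<alpha>\<in>R. g \<alpha>) = (\<Sum>\<epsilon>\<in>E 1. g (root 1 \<epsilon>)) + (\<Sum>\<epsilon>\<in>E (-1). g (root (-1) \<epsilon>))"
proof -
  have inj: "inj_on (root s) A" for s A
    by (rule inj_onI) (use rlen_pos[of s] in \<open>auto simp: root_eq dest!: cvec_inj\<close>)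
  have "root 1 ` E 1 \<inter> root (-1) ` E (-1) = {}"
  proof -
    have False if "root 1 a = root (-1) b" "a ^ 6 = 1" "b ^ 6 = - 1" for a b
    proof -
      have "of_real (rlen 1) * a = of_real (rlen (-1)) * b" using that(1) by (auto simp: root_eq dest!: cvec_inj)
      then have "(of_real (rlen 1) * a) ^ 6 = (of_real (rlen (-1)) * b) ^ 6" by simp
      then have "of_real (rlen 1 ^ 6) = (- of_real (rlen (-1) ^ 6) :: complex)"
        using that by (simp add: power_mult_distrib)
      then have "rlen 1 ^ 6 = - (rlen (-1) ^ 6)" by (metis of_real_eq_iff of_real_minus)
      then show False using rlen_pos[of 1] rlen_pos[of "-1"] by (smt (verit) zero_less_power)
    qed
    then show ?thesis by auto
  qed
  then show ?thesis
    using finite_E[of 1] finite_E[of "-1"]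
    by (simp add: R_roots sum.union_disjoint sum.reindex[OF inj])
qed

text \<open>Twice the real part of z times the conjugate of \<epsilon>, that is, the root of
  direction \<epsilon> up to its length.\<close>

definition ell :: "complex \<Rightarrow> 'n pfun" where "ell \<epsilon> = pconst (cnj \<epsilon>) * z + pconst \<epsilon> * zb"

lemma plin_root: "plin (root s \<epsilon>) = pconst (of_real (rlen s / 2)) * ell \<epsilon>"
proof -
  have pc: "plin (cvec c) = pconst (of_real (Re c)) * plin e1 + pconst (of_real (Im c)) * plin e2" for c
    by (simp add: cv_def plin_add plin_scale)
  show ?thesis
    by (rule ext) (simp add: root_eq pc ell_def z_def zb_def fun_apply complex_eq_iff algebra_simps)
qed

lemma refl_z:
  assumes "s \<in> sg" "\<epsilon> \<in> E s"
  shows "refl_pull (root s \<epsilon>) z = pconst (- (\<epsilon> ^ 2)) * zb" "refl_pull (root s \<epsilon>) zb = pconst (- (cnj \<epsilon> ^ 2)) * z"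
proof -
  let ?\<alpha> = "root s \<epsilon>"
  have a: "?\<alpha> \<bullet> e1 = rlen s * Re \<epsilon>" "?\<alpha> \<bullet> e2 = rlen s * Im \<epsilon>" "?\<alpha> \<bullet> ?\<alpha> = (rlen s)\<^sup>2"
    using E_norm[OF assms] by (simp_all add: root_eq cvec_inner cvec_inner_self norm_mult)
  have c: "2 * (?\<alpha> \<bullet> e1) / (?\<alpha> \<bullet> ?\<alpha>) = 2 / rlen s * Re \<epsilon>" "2 * (?\<alpha> \<bullet> e2) / (?\<alpha> \<bullet> ?\<alpha>) = 2 / rlen s * Im \<epsilon>"
    using rlen_pos[of s] by (simp_all add: a power2_eq_square)
  have p: "refl_pull ?\<alpha> (plin e1) = plin e1 - pconst (of_real (Re \<epsilon>)) * ell \<epsilon>"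
    "refl_pull ?\<alpha> (plin e2) = plin e2 - pconst (of_real (Im \<epsilon>)) * ell \<epsilon>"
    unfolding refl_pull_plin c plin_root mult.assoc[symmetric] pconst_mult[symmetric]
    using rlen_pos[of s] by simp_all
  have e: "complex_of_real (Re \<epsilon>) + \<i> * complex_of_real (Im \<epsilon>) = \<epsilon>"
    "complex_of_real (Re \<epsilon>) - \<i> * complex_of_real (Im \<epsilon>) = cnj \<epsilon>" by (simp_all add: complex_eq_iff)
  have "refl_pull ?\<alpha> z = z - pconst (of_real (Re \<epsilon>) + \<i> * of_real (Im \<epsilon>)) * ell \<epsilon>"
    by (simp add: z_def p pconst_add pconst_mult algebra_simps)
  also have "\<dots> = z - (pconst (\<epsilon> * cnj \<epsilon>) * z + pconst (\<epsilon> ^ 2) * zb)"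
    unfolding e by (simp add: ell_def pconst_mult power2_eq_square algebra_simps)
  finally show "refl_pull ?\<alpha> z = pconst (- (\<epsilon> ^ 2)) * zb"
    unfolding E_cnj[OF assms] by (simp add: pconst_minus)
  have "refl_pull ?\<alpha> zb = zb - pconst (of_real (Re \<epsilon>) - \<i> * of_real (Im \<epsilon>)) * ell \<epsilon>"
    by (simp add: zb_def p pconst_diff pconst_mult algebra_simps)
  also have "\<dots> = zb - (pconst (cnj \<epsilon> ^ 2) * z + pconst (\<epsilon> * cnj \<epsilon>) * zb)"
    unfolding e by (simp add: ell_def pconst_mult power2_eq_square algebra_simps)
  finally show "refl_pull ?\<alpha> zb = pconst (- (cnj \<epsilon> ^ 2)) * z"
    unfolding E_cnj[OF assms] by (simp add: pconst_minus)
qed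

text \<open>The Wirtinger derivatives in z and zb; \<open>TZ\<close> and \<open>TZb\<close> below
  are their Dunkl analogues.\<close>

definition dz :: "'n pfun \<Rightarrow> 'n pfun" where
  "dz f = pconst (1/2) * (deriv_along e1 f - pconst \<i> * deriv_along e2 f)"
definition dzb :: "'n pfun \<Rightarrow> 'n pfun" where
  "dzb f = pconst (1/2) * (deriv_along e1 f + pconst \<i> * deriv_along e2 f)"
definition TZ :: "'n pfun \<Rightarrow> 'n pfun" where
  "TZ f = pconst (1/2) * (sT e1 f - pconst \<i> * sT e2 f)"
definition TZb :: "'n pfun \<Rightarrow> 'n pfun" where
  "TZb f = pconst (1/2) * (sT e1 f + pconst \<i> * sT e2 f)"

lemma sT_TZ: "sT e1 f = TZ f + TZb f" "sT e2 f = pconst \<i> * (TZ f - TZb f)"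
  by (rule ext, simp add: TZ_def TZb_def fun_apply field_simps)+

lemma TZ_closed [intro]: "f \<in> poly_space \<Longrightarrow> TZ f \<in> poly_space" "f \<in> poly_space \<Longrightarrow> TZb f \<in> poly_space"
  unfolding TZ_def TZb_def by (intro poly_space_mult poly_space_pconst poly_space_diff poly_space_add sT_closed; assumption)+

lemma dz_closed [intro]: "f \<in> poly_space \<Longrightarrow> dz f \<in> poly_space" "f \<in> poly_space \<Longrightarrow> dzb f \<in> poly_space"
  unfolding dz_def dzb_def by (intro poly_space_mult poly_space_pconst poly_space_diff poly_space_add poly_space_deriv_along; assumption)+

lemma dz_mult:
  assumes "f \<in> poly_space" "g \<in> poly_space"
  shows "dz (f * g) = f * dz g + dz f * g" "dzb (f * g) = f * dzb g + dzb f * g"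
  by (rule ext, simp add: dz_def dzb_def deriv_along_mult[OF assms] fun_apply algebra_simps)+

lemma dz_add:
  assumes "f \<in> poly_space" "g \<in> poly_space"
  shows "dz (f + g) = dz f + dz g" "dzb (f + g) = dzb f + dzb g"
  by (rule ext, simp add: dz_def dzb_def deriv_along_add[OF assms] fun_apply algebra_simps)+

lemma dz_base [simp]: "dz z = 1" "dzb z = 0" "dz zb = 0" "dzb zb = 1" "dz (pconst c) = 0" "dzb (pconst c) = 0"
proof -
  have D: "deriv_along v (plin e1 + pconst c * plin e2) = pconst (of_real (e1 \<bullet> v) + c * of_real (e2 \<bullet> v))" for v c
    by (simp add: deriv_along_add deriv_along_cmult poly_space_mult pconst_add pconst_mult)
  have zz: "z = plin e1 + pconst \<i> * plin e2" "zb = plin e1 + pconst (- \<i>) * plin e2"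
    by (simp_all add: z_def zb_def pconst_minus)
  have o: "e2 \<bullet> e1 = 0" using orthonormal by (simp add: inner_commute)
  show "dz z = 1" "dzb z = 0" "dz zb = 0" "dzb zb = 1"
    by (rule ext, simp add: dz_def dzb_def zz D orthonormal o fun_apply)+
  show "dz (pconst c) = 0" "dzb (pconst c) = 0" by (simp_all add: dz_def dzb_def)
qed

lemma dz_cmult: "f \<in> poly_space \<Longrightarrow> dz (pconst c * f) = pconst c * dz f"
  "f \<in> poly_space \<Longrightarrow> dzb (pconst c * f) = pconst c * dzb f"
  by (simp_all add: dz_mult)

lemma dz_power:
  assumes "f \<in> poly_space"
  shows "dz (f ^ n) = pconst (of_nat n) * f ^ (n - 1) * dz f" "dzb (f ^ n) = pconst (of_nat n) * f ^ (n - 1) * dzb f"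
proof -
  have "dz (f ^ n) = pconst (of_nat n) * f ^ (n - 1) * dz f \<and> dzb (f ^ n) = pconst (of_nat n) * f ^ (n - 1) * dzb f"
  proof (induction n)
    case 0
    show ?case using dz_base(5,6)[of 1] by simp
  next
    case (Suc n)
    have *: "f * (pconst (of_nat n) * f ^ (n - 1) * g) = pconst (of_nat n) * f ^ n * g" for g
      by (cases n) (auto simp: algebra_simps)
    have "dz (f ^ Suc n) = f * dz (f ^ n) + dz f * f ^ n" "dzb (f ^ Suc n) = f * dzb (f ^ n) + dzb f * f ^ n"
      using dz_mult[OF assms poly_space_power[OF assms]] by simp_all
    then have "dz (f ^ Suc n) = pconst (of_nat n) * f ^ n * dz f + dz f * f ^ n"
      "dzb (f ^ Suc n) = pconst (of_nat n) * f ^ n * dzb f + dzb f * f ^ n"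
      using Suc by (simp_all only: *)
    then show ?case by (simp add: pconst_add algebra_simps)
  qed
  then show "dz (f ^ n) = pconst (of_nat n) * f ^ (n - 1) * dz f" "dzb (f ^ n) = pconst (of_nat n) * f ^ (n - 1) * dzb f"
    by auto
qed

text \<open>It is enough to supply the quotients of f minus its reflections by
  \<open>ell \<epsilon>\<close>, because the root lengths cancel between \<open>dunkl_coeff\<close>
  and the divided difference. The factor 1/2 is that of the Wirtinger derivatives.\<close>

lemma TZ_general:
  assumes f: "f \<in> poly_space"
    and q: "\<And>s \<epsilon>. s \<in> sg \<Longrightarrow> \<epsilon> \<in> E s \<Longrightarrow> q s \<epsilon> \<in> poly_space \<and> ell \<epsilon> * q s \<epsilon> = f - refl_pull (root s \<epsilon>) f"
  shows "TZ f = dz f + pconst (1/2) * (\<Sum>s\<in>sg. pconst (kval s) * (\<Sum>\<epsilon>\<in>E s. pconst (cnj \<epsilon>) * q s \<epsilon>))"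
    and "TZb f = dzb f + pconst (1/2) * (\<Sum>s\<in>sg. pconst (kval s) * (\<Sum>\<epsilon>\<in>E s. pconst \<epsilon> * q s \<epsilon>))"
proof -
  have dd: "divided_difference (root s \<epsilon>) f = pconst (of_real (2 / rlen s)) * q s \<epsilon>"
    if "s \<in> sg" "\<epsilon> \<in> E s" for s \<epsilon>
  proof (rule divided_difference_eqI)
    show "root s \<epsilon> \<noteq> 0" using root_R[OF that] R_nonzero by blast
    have "plin (root s \<epsilon>) * (pconst (of_real (2 / rlen s)) * q s \<epsilon>) =
      pconst (of_real (rlen s / 2) * of_real (2 / rlen s)) * (ell \<epsilon> * q s \<epsilon>)"
      unfolding plin_root pconst_mult by (simp only: mult_ac)
    also have "of_real (rlen s / 2) * of_real (2 / rlen s) = (1 :: complex)"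
      using rlen_pos[of s] by (simp flip: of_real_mult)
    finally show "plin (root s \<epsilon>) * (pconst (of_real (2 / rlen s)) * q s \<epsilon>) = f - refl_pull (root s \<epsilon>) f"
      using q[OF that] by simp
  qed (use q[OF that] in auto)
  have co: "dunkl_coeff (root s \<epsilon>) e1 * of_real (2 / rlen s) = kval s * of_real (Re \<epsilon>)"
    "dunkl_coeff (root s \<epsilon>) e2 * of_real (2 / rlen s) = kval s * of_real (Im \<epsilon>)"
    if "s \<in> sg" "\<epsilon> \<in> E s" for s \<epsilon>
  proof -
    have "root s \<epsilon> \<bullet> e1 = rlen s * Re \<epsilon>" "root s \<epsilon> \<bullet> e2 = rlen s * Im \<epsilon>"
      by (simp_all add: root_eq cvec_inner)
    then show "dunkl_coeff (root s \<epsilon>) e1 * of_real (2 / rlen s) = kval s * of_real (Re \<epsilon>)"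
      "dunkl_coeff (root s \<epsilon>) e2 * of_real (2 / rlen s) = kval s * of_real (Im \<epsilon>)"
      using rlen_pos[of s] by (simp_all add: dunkl_coeff_def k_root[OF that])
  qed
  have sT: "sT e1 f = deriv_along e1 f + (\<Sum>s\<in>sg. \<Sum>\<epsilon>\<in>E s. pconst (kval s * of_real (Re \<epsilon>)) * q s \<epsilon>)"
    "sT e2 f = deriv_along e2 f + (\<Sum>s\<in>sg. \<Sum>\<epsilon>\<in>E s. pconst (kval s * of_real (Im \<epsilon>)) * q s \<epsilon>)"
  proof -
    have su: "(\<Sum>s\<in>sg. F s) = F 1 + F (-1)" for F :: "complex \<Rightarrow> 'n pfun" by simp
    have t: "pconst (dunkl_coeff (root s \<epsilon>) e1) * divided_difference (root s \<epsilon>) f = pconst (kval s * of_real (Re \<epsilon>)) * q s \<epsilon>"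
      "pconst (dunkl_coeff (root s \<epsilon>) e2) * divided_difference (root s \<epsilon>) f = pconst (kval s * of_real (Im \<epsilon>)) * q s \<epsilon>"
      if "s \<in> sg" "\<epsilon> \<in> E s" for s \<epsilon>
      by (simp_all only: dd[OF that] mult.assoc[symmetric] pconst_mult[symmetric] co[OF that])
    have X: "(\<Sum>\<epsilon>\<in>E s. pconst (dunkl_coeff (root s \<epsilon>) e1) * divided_difference (root s \<epsilon>) f)
        = (\<Sum>\<epsilon>\<in>E s. pconst (kval s * of_real (Re \<epsilon>)) * q s \<epsilon>)"
      "(\<Sum>\<epsilon>\<in>E s. pconst (dunkl_coeff (root s \<epsilon>) e2) * divided_difference (root s \<epsilon>) f)
        = (\<Sum>\<epsilon>\<in>E s. pconst (kval s * of_real (Im \<epsilon>)) * q s \<epsilon>)" if "s \<in> sg" for s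
      by (rule sum.cong[OF HOL.refl t(1)[OF that]], assumption, rule sum.cong[OF HOL.refl t(2)[OF that]], assumption)
    have sg: "1 \<in> sg" "- 1 \<in> sg" by simp_all
    show "sT e1 f = deriv_along e1 f + (\<Sum>s\<in>sg. \<Sum>\<epsilon>\<in>E s. pconst (kval s * of_real (Re \<epsilon>)) * q s \<epsilon>)"
      "sT e2 f = deriv_along e2 f + (\<Sum>s\<in>sg. \<Sum>\<epsilon>\<in>E s. pconst (kval s * of_real (Im \<epsilon>)) * q s \<epsilon>)"
      unfolding sT_def sum_R su X(1)[OF sg(1)] X(1)[OF sg(2)] X(2)[OF sg(1)] X(2)[OF sg(2)] by (rule HOL.refl)+
  qed
  have S: "(\<Sum>s\<in>sg. \<Sum>\<epsilon>\<in>E s. pconst (kval s * of_real (Re \<epsilon>)) * q s \<epsilon>) - pconst \<i> * (\<Sum>s\<in>sg. \<Sum>\<epsilon>\<in>E s. pconst (kval s * of_real (Im \<epsilon>)) * q s \<epsilon>)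
      = (\<Sum>s\<in>sg. pconst (kval s) * (\<Sum>\<epsilon>\<in>E s. pconst (cnj \<epsilon>) * q s \<epsilon>))"
    "(\<Sum>s\<in>sg. \<Sum>\<epsilon>\<in>E s. pconst (kval s * of_real (Re \<epsilon>)) * q s \<epsilon>) + pconst \<i> * (\<Sum>s\<in>sg. \<Sum>\<epsilon>\<in>E s. pconst (kval s * of_real (Im \<epsilon>)) * q s \<epsilon>)
      = (\<Sum>s\<in>sg. pconst (kval s) * (\<Sum>\<epsilon>\<in>E s. pconst \<epsilon> * q s \<epsilon>))"
  proof -
    have 1: "kval s * cnj \<epsilon> = kval s * of_real (Re \<epsilon>) - \<i> * (kval s * of_real (Im \<epsilon>))"
      "kval s * \<epsilon> = kval s * of_real (Re \<epsilon>) + \<i> * (kval s * of_real (Im \<epsilon>))" for s \<epsilon>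
      by (simp_all add: complex_eq_iff algebra_simps)
    have p: "pconst (kval s * of_real (Re \<epsilon>)) * q s \<epsilon> - pconst \<i> * (pconst (kval s * of_real (Im \<epsilon>)) * q s \<epsilon>) =
        pconst (kval s) * (pconst (cnj \<epsilon>) * q s \<epsilon>)"
      "pconst (kval s * of_real (Re \<epsilon>)) * q s \<epsilon> + pconst \<i> * (pconst (kval s * of_real (Im \<epsilon>)) * q s \<epsilon>) =
        pconst (kval s) * (pconst \<epsilon> * q s \<epsilon>)" for s \<epsilon>
      unfolding mult.assoc[symmetric] pconst_mult[symmetric] 1(1)[of s \<epsilon>] 1(2)[of s \<epsilon>]
      by (simp_all only: pconst_diff pconst_add left_diff_distrib distrib_right mult.assoc)
    show "(\<Sum>s\<in>sg. \<Sum>\<epsilon>\<in>E s. pconst (kval s * of_real (Re \<epsilon>)) * q s \<epsilon>) - pconst \<i> * (\<Sum>s\<in>sg. \<Sum>\<epsilon>\<in>E s. pconst (kval s * of_real (Im \<epsilon>)) * q s \<epsilon>)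
      = (\<Sum>s\<in>sg. pconst (kval s) * (\<Sum>\<epsilon>\<in>E s. pconst (cnj \<epsilon>) * q s \<epsilon>))"
      by (simp only: sum_distrib_left sum_subtractf[symmetric] p(1))
    show "(\<Sum>s\<in>sg. \<Sum>\<epsilon>\<in>E s. pconst (kval s * of_real (Re \<epsilon>)) * q s \<epsilon>) + pconst \<i> * (\<Sum>s\<in>sg. \<Sum>\<epsilon>\<in>E s. pconst (kval s * of_real (Im \<epsilon>)) * q s \<epsilon>)
      = (\<Sum>s\<in>sg. pconst (kval s) * (\<Sum>\<epsilon>\<in>E s. pconst \<epsilon> * q s \<epsilon>))"
      by (simp only: sum_distrib_left sum.distrib[symmetric] p(2))
  qed
  show "TZ f = dz f + pconst (1/2) * (\<Sum>s\<in>sg. pconst (kval s) * (\<Sum>\<epsilon>\<in>E s. pconst (cnj \<epsilon>) * q s \<epsilon>))"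
    unfolding S(1)[symmetric] TZ_def sT dz_def by (simp only: algebra_simps)
  show "TZb f = dzb f + pconst (1/2) * (\<Sum>s\<in>sg. pconst (kval s) * (\<Sum>\<epsilon>\<in>E s. pconst \<epsilon> * q s \<epsilon>))"
    unfolding S(2)[symmetric] TZb_def sT dzb_def by (simp only: algebra_simps)
qed

section \<open>Invariant polynomials and the Dunkl Laplacian\<close>

definition invariant :: "'n pfun \<Rightarrow> bool" where
  "invariant f \<longleftrightarrow> f \<in> poly_space \<and> (\<forall>\<alpha>\<in>R. refl_pull \<alpha> f = f)"

lemma invariant_mult: "invariant f \<Longrightarrow> invariant g \<Longrightarrow> invariant (f * g)"
  by (auto simp: invariant_def)

lemma invariant_power: "invariant f \<Longrightarrow> invariant (f ^ n)"
proof (induction n)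
  case 0
  then show ?case by (auto simp: invariant_def)
qed (simp add: invariant_mult)

lemma sT_invariant_mult:
  assumes "invariant p" "f \<in> poly_space"
  shows "sT v (p * f) = p * sT v f + deriv_along v p * f"
proof -
  have "divided_difference \<alpha> (p * f) = p * divided_difference \<alpha> f" if "\<alpha> \<in> R" for \<alpha>
    using assms that by (simp add: invariant_def divided_difference_mult divided_difference_invariant R_nonzero)
  moreover have "p \<in> poly_space" using assms(1) by (simp add: invariant_def)
  ultimately show ?thesis using assms(2)
    by (simp add: sT_def deriv_along_mult sum_distrib_left distrib_left mult.left_commute add_ac)
qed

lemma TZ_invariant_mult:
  assumes "invariant p" "f \<in> poly_space"
  shows "TZ (p * f) = p * TZ f + dz p * f" "TZb (p * f) = p * TZb f + dzb p * f"
  unfolding TZ_def TZb_def dz_def dzb_def sT_invariant_mult[OF assms] by (simp_all add: algebra_simps)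

lemma sT_cmult: "f \<in> poly_space \<Longrightarrow> sT v (pconst c * f) = pconst c * sT v f"
  and sT_add: "f \<in> poly_space \<Longrightarrow> g \<in> poly_space \<Longrightarrow> sT v (f + g) = sT v f + sT v g"
  using plinear_sT[of v] by (auto simp: plinear_def)

lemma TZ_linear:
  "f \<in> poly_space \<Longrightarrow> TZ (pconst c * f) = pconst c * TZ f" "f \<in> poly_space \<Longrightarrow> TZb (pconst c * f) = pconst c * TZb f"
  "f \<in> poly_space \<Longrightarrow> g \<in> poly_space \<Longrightarrow> TZ (f + g) = TZ f + TZ g"
  "f \<in> poly_space \<Longrightarrow> g \<in> poly_space \<Longrightarrow> TZb (f + g) = TZb f + TZb g"
  by (simp_all only: TZ_def TZb_def sT_cmult sT_add) (simp_all add: algebra_simps)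

lemma TZ_1: "TZ 1 = 0" "TZb 1 = 0"
proof -
  have "sT v 1 = 0" for v
  proof -
    have "divided_difference \<alpha> 1 = 0" if "\<alpha> \<in> R" for \<alpha>
      using divided_difference_pconst[OF R_nonzero[OF that], of 1] by simp
    then show ?thesis by (simp add: sT_def)
  qed
  then show "TZ 1 = 0" "TZb 1 = 0" by (simp_all add: TZ_def TZb_def)
qed

lemma TZ_invariant:
  assumes "invariant p" shows "TZ p = dz p" "TZb p = dzb p"
  using TZ_invariant_mult[OF assms poly_space_1] TZ_1 by simp_all

lemma sT_commute:
  assumes "f \<in> poly_space" shows "sT u (sT v f) = sT v (sT u f)"
proof -
  have "(\<lambda>_ :: 1. f) \<in> vspace" using assms by (simp add: vspace_def)
  from vT_commute[OF weyl_rep_triv this, of u v]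
  show ?thesis unfolding vT_triv by (rule fun_cong)
qed

lemma sT_diff: "f \<in> poly_space \<Longrightarrow> g \<in> poly_space \<Longrightarrow> sT v (f - g) = sT v f - sT v g"
  using sT_add[of "f - g" g v] by (simp add: poly_space_diff)

lemma TZ_commute: assumes "f \<in> poly_space" shows "TZ (TZb f) = TZb (TZ f)"
proof -
  have s: "sT v f \<in> poly_space" for v using assms by auto
  have 1: "sT v (TZb f) = pconst (1/2) * (sT v (sT e1 f) + pconst \<i> * sT v (sT e2 f))" for v
    unfolding TZb_def using s by (simp add: sT_cmult sT_add poly_space_mult poly_space_add)
  have 2: "sT v (TZ f) = pconst (1/2) * (sT v (sT e1 f) - pconst \<i> * sT v (sT e2 f))" for v
    unfolding TZ_def using s by (simp add: sT_cmult sT_diff poly_space_mult poly_space_diff)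
  show ?thesis
    unfolding TZ_def[of "TZb f"] TZb_def[of "TZ f"] 1 2 sT_commute[OF assms, of e2 e1]
    by (rule ext) (simp add: fun_apply algebra_simps)
qed

text \<open>A quarter of the Dunkl Laplacian, in factorised form.\<close>

definition Lam :: "'n pfun \<Rightarrow> 'n pfun" where "Lam f = TZ (TZb f)"

text \<open>On invariants the Dunkl operators act as derivatives, so besides the two Laplacians only
  the usual gradient term appears.\<close>

lemma Lam_mult:
  assumes p: "invariant p" and f: "invariant f"
  shows "Lam (p * f) = p * Lam f + f * Lam p + (dz p * dzb f + dzb p * dz f)"
proof -
  have P: "p \<in> poly_space" "f \<in> poly_space" using p f by (auto simp: invariant_def)
  have "TZb (p * f) = p * dzb f + f * dzb p"
    using TZ_invariant_mult(2)[OF p P(2)] TZ_invariant(2)[OF f] by (simp add: mult.commute)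
  then show ?thesis unfolding Lam_def
    using P by (simp add: TZ_linear TZ_invariant_mult[OF p] TZ_invariant_mult[OF f] poly_space_mult dz_closed
        TZ_invariant[OF f] TZ_invariant[OF p] algebra_simps)
qed

lemma nsq_z: "nsq = z * zb"
  by (rule ext) (simp add: nsq_def[OF weyl_rep_triv] z_def zb_def fun_apply algebra_simps)

lemma nsq_invariant: "invariant nsq"
  using nsq_poly[OF weyl_rep_triv] refl_pull_nsq[OF weyl_rep_triv] by (simp add: invariant_def)

definition zeta :: complex where "zeta = 3 * (ks + kl)"

text \<open>Six roots of each length, each with weight 1/2.\<close>

lemma central_triv: "central_scalar (\<lambda>_. mat 1 :: complex ^ 'a::finite ^ 'a) zeta"
proof -
  have "(\<Sum>\<alpha>\<in>R. k \<alpha> / 2) = (\<Sum>\<epsilon>\<in>E 1. ks / 2) + (\<Sum>\<epsilon>\<in>E (-1). kl / 2)"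
    unfolding sum_R using k_root by (simp add: kval_def)
  also have "\<dots> = zeta" using card_E[of 1] card_E[of "-1"] by (simp add: zeta_def)
  finally show ?thesis
    by (simp add: central_scalar_def vec.scale_sum_left[symmetric])
qed

lemma Lam_nsq: "Lam nsq = pconst (1 + zeta)"
proof -
  let ?\<rho> = "\<lambda>_. mat 1 :: complex ^ 1 ^ 1"
  have "vT ?\<rho> e1 (vT ?\<rho> e1 (vmul (nsq ^ Suc 0) (vconst 1))) + vT ?\<rho> e2 (vT ?\<rho> e2 (vmul (nsq ^ Suc 0) (vconst 1))) =
    vmul (pconst (4 * of_nat (Suc 0) * (of_nat (Suc 0) + zeta)) * nsq ^ 0) (vconst 1)"
    by (rule vLaplace_nsq[OF weyl_rep_triv central_triv])
  moreover have "vmul p (vconst 1 :: 1 \<Rightarrow> 'n pfun) = (\<lambda>_. p)" for p by (simp add: vmul_def vconst_def)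
  ultimately have "(\<lambda>_ :: 1. sT e1 (sT e1 nsq)) + (\<lambda>_. sT e2 (sT e2 nsq)) = (\<lambda>_. pconst (4 * (1 + zeta)))"
    by (simp add: vT_triv)
  then have "((\<lambda>_ :: 1. sT e1 (sT e1 nsq)) + (\<lambda>_. sT e2 (sT e2 nsq))) 1 = pconst (4 * (1 + zeta))" by simp
  then have "sT e1 (sT e1 nsq) + sT e2 (sT e2 nsq) = pconst (4 * (1 + zeta))" by (simp only: plus_fun_apply)
  moreover have "Lam nsq = pconst (1/4) * (sT e1 (sT e1 nsq) + sT e2 (sT e2 nsq))"
  proof -
    have n: "nsq \<in> poly_space" using nsq_invariant by (simp add: invariant_def)
    have "sT v (TZb nsq) = pconst (1/2) * (sT v (sT e1 nsq) + pconst \<i> * sT v (sT e2 nsq))" for v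
      unfolding TZb_def using n by (simp add: sT_cmult sT_add poly_space_mult poly_space_add sT_closed)
    then show ?thesis
      unfolding Lam_def TZ_def sT_commute[OF n, of e2 e1]
      by (intro ext) (simp add: fun_apply sT_commute[OF n, of e2 e1] algebra_simps)
  qed
  ultimately show ?thesis by (simp add: add_divide_distrib flip: pconst_mult)
qed

lemma pconst_numeral: "pconst (numeral m) = (numeral m :: 'n pfun)"
  by (simp add: pconst_def numeral_fun)

text \<open>The gradient term contributes d once for each pair of factors q, hence n (n - 1) / 2
  times. Used for \<open>nsq\<close> with a = 1 and for \<open>uu\<close> with a =
  \<open>nsq ^ 2\<close>.\<close>

lemma Lam_power:
  assumes q: "invariant q" and g: "Lam q = pconst c * a" "dz q * dzb q + dzb q * dz q = pconst d * q * a"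
  shows "Lam (q ^ n) = pconst (of_nat n * c + d * of_nat (n * (n - 1) div 2)) * q ^ (n - 1) * a"
proof (induction n)
  case 0
  show ?case using TZ_1 TZ_linear(1)[of 1 0] by (simp add: Lam_def)
next
  case (Suc n)
  note IH = Suc
  have Q: "q \<in> poly_space" using q by (simp add: invariant_def)
  show ?case
  proof (cases n)
    case 0
    then show ?thesis by (simp add: g)
  next
    case (Suc m)
    have tri: "(n * (n - 1)) div 2 + n = (Suc n * (Suc n - 1)) div 2"
    proof -
      have "even (m * Suc m)" by simp
      then show ?thesis unfolding Suc by (auto elim!: evenE simp: algebra_simps)
    qed
    have "Lam (q * q ^ n) = q * Lam (q ^ n) + q ^ n * Lam q + (dz q * dzb (q ^ n) + dzb q * dz (q ^ n))"
      by (rule Lam_mult[OF q invariant_power[OF q]])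
    also have "dz q * dzb (q ^ n) + dzb q * dz (q ^ n) =
        pconst (of_nat n) * q ^ (n - 1) * (dz q * dzb q + dzb q * dz q)"
      unfolding dz_power[OF Q] by (simp add: algebra_simps)
    also have "\<dots> = pconst (of_nat n * d) * (q ^ (n - 1) * q) * a"
      unfolding g(2) pconst_mult by (simp only: mult_ac)
    also have qq: "q ^ (n - 1) * q = q ^ n" unfolding Suc by (simp add: mult.commute)
    also have "q * Lam (q ^ n) = pconst (of_nat n * c + d * of_nat (n * (n - 1) div 2)) * q ^ n * a"
    proof -
      have "q * (pconst t * q ^ (n - 1) * a) = pconst t * (q ^ (n - 1) * q) * a" for t :: complex
        by (simp only: mult_ac)
      then show ?thesis unfolding IH by (simp only: qq)
    qed
    also have "q ^ n * Lam q = pconst c * q ^ n * a" unfolding g(1) by (simp add: mult_ac)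
    finally have "Lam (q ^ Suc n) = pconst ((of_nat n * c + d * of_nat (n * (n - 1) div 2)) + c + of_nat n * d) * q ^ n * a"
      by (simp only: pconst_add distrib_right power_Suc add_ac)
    also have "(of_nat n * c + d * of_nat (n * (n - 1) div 2)) + c + of_nat n * d =
      of_nat (Suc n) * c + d * of_nat (Suc n * (Suc n - 1) div 2)"
      unfolding tri[symmetric] by (simp add: algebra_simps)
    finally show ?thesis by simp
  qed
qed

lemma Lam_nsq_power: "Lam (nsq ^ n) = pconst (of_nat n * (of_nat n + zeta)) * nsq ^ (n - 1)"
proof -
  have n: "dz nsq = zb" "dzb nsq = z" by (simp_all add: nsq_z dz_mult z_poly zb_poly)
  have "Lam (nsq ^ n) = pconst (of_nat n * (1 + zeta) + 2 * of_nat (n * (n - 1) div 2)) * nsq ^ (n - 1) * 1"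
  proof (rule Lam_power[OF nsq_invariant])
    show "Lam nsq = pconst (1 + zeta) * 1" by (simp add: Lam_nsq)
    show "dz nsq * dzb nsq + dzb nsq * dz nsq = pconst 2 * nsq * 1"
      unfolding n by (simp add: nsq_z pconst_numeral mult.commute[of zb z])
  qed
  moreover have "of_nat n * (1 + zeta) + 2 * of_nat (n * (n - 1) div 2) = of_nat n * (of_nat n + zeta)"
  proof -
    have "2 * (n * (n - 1) div 2) = n * (n - 1)" by (cases n) auto
    then have "2 * of_nat (n * (n - 1) div 2) = (of_nat (n * (n - 1)) :: complex)" by (metis of_nat_mult of_nat_numeral)
    moreover have "of_nat (n * (n - 1)) = (of_nat n * (of_nat n - 1) :: complex)"
      by (cases n) (auto simp: algebra_simps)
    ultimately show ?thesis by (simp add: algebra_simps)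
  qed
  ultimately show ?thesis by simp
qed

end

lemma power_fun_apply: "(f ^ m) x = f x ^ m" for f :: "('n::finite) pfun"
  by (induction m) (simp_all add: fun_apply)

subsection \<open>The radical of the polynomial representation\<close>

context dunkl_setting
begin

definition srad :: "'n pfun set" where
  "srad = {f \<in> poly_space. \<forall>vs. foldr sT vs f 0 = 0}"

lemma foldr_vT_triv: "foldr (vT (\<lambda>_. mat 1)) vs F = (\<lambda>i. foldr sT vs (F i))"
  by (induction vs) (simp_all add: vT_triv)

lemma form_radical_triv: "F \<in> form_radical (\<lambda>_. mat 1) \<longleftrightarrow> (\<forall>i. F i \<in> srad)"
  unfolding form_radical_def vspace_iff mem_Collect_eq foldr_vT_triv srad_def by blast

lemma srad_iff: "f \<in> srad \<longleftrightarrow> (\<lambda>_ :: 1. f) \<in> form_radical (\<lambda>_. mat 1)"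
  by (simp add: form_radical_triv)

text \<open>The trivial action treats components separately, so the condition does not depend on the
  index type. This allows passing from an arbitrary one-element type to type 1.\<close>

lemma cofinite_triv_iff:
  "cofinite_radical (\<lambda>_. mat 1 :: complex ^ 'm::finite ^ 'm) \<longleftrightarrow> (\<exists>N. \<forall>d\<ge>N. \<forall>f. homogeneous d f \<longrightarrow> f \<in> srad)"
proof -
  have "(\<forall>F :: 'm \<Rightarrow> 'n pfun. vhomogeneous d F \<longrightarrow> F \<in> form_radical (\<lambda>_. mat 1)) \<longleftrightarrow> (\<forall>f. homogeneous d f \<longrightarrow> f \<in> srad)" for d
  proof (intro iffI allI impI)
    fix f :: "'n pfun"
    assume "\<forall>F :: 'm \<Rightarrow> 'n pfun. vhomogeneous d F \<longrightarrow> F \<in> form_radical (\<lambda>_. mat 1)" "homogeneous d f"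
    then show "f \<in> srad" unfolding form_radical_triv vhomogeneous_def by (auto dest: spec[of _ "\<lambda>_. f"])
  next
    fix F :: "'m \<Rightarrow> 'n pfun"
    assume "\<forall>f. homogeneous d f \<longrightarrow> f \<in> srad" "vhomogeneous d F"
    then show "F \<in> form_radical (\<lambda>_. mat 1)" unfolding form_radical_triv vhomogeneous_def by simp
  qed
  then show ?thesis unfolding cofinite_radical_def by simp
qed

end

context g2_setting
begin

lemma srad_mult: "p \<in> poly_space \<Longrightarrow> f \<in> srad \<Longrightarrow> p * f \<in> srad"
  using radical_vmul[OF weyl_rep_triv, of p "\<lambda>_ :: 1. f"] by (simp add: srad_iff vmul_def)

lemma srad_0: "0 \<in> srad"
proof -
  have "foldr sT vs 0 = 0" for vs
    by (induction vs) (simp_all add: plinear_0[OF plinear_sT])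
  then show ?thesis by (simp add: srad_def poly_space_0 zero_fun_apply)
qed

lemma srad_add: "f \<in> srad \<Longrightarrow> g \<in> srad \<Longrightarrow> f + g \<in> srad"
proof -
  assume a: "f \<in> srad" "g \<in> srad"
  have "(\<lambda>_ :: 1. f) + (\<lambda>_. g) = (\<lambda>_. f + g)" by (rule ext) (simp add: plus_fun_apply)
  then show "f + g \<in> srad"
    using radical_add[OF weyl_rep_triv a[unfolded srad_iff]] by (simp add: srad_iff)
qed

lemma srad_diff: "f \<in> srad \<Longrightarrow> g \<in> srad \<Longrightarrow> f - g \<in> srad"
  using srad_add[of f "pconst (-1) * g"] srad_mult[OF poly_space_pconst[of "-1"], of g] by (simp add: pconst_minus)

lemma srad_sum: "(\<And>i. i \<in> I \<Longrightarrow> f i \<in> srad) \<Longrightarrow> (\<Sum>i\<in>I. f i) \<in> srad"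
  by (induction I rule: infinite_finite_induct) (auto intro: srad_0 srad_add)

lemma srad_sT: "f \<in> srad \<Longrightarrow> sT v f \<in> srad"
  using radical_vT[OF weyl_rep_triv, of "\<lambda>_ :: 1. f" v] by (simp add: srad_iff vT_triv)

lemma srad_TZ: "f \<in> srad \<Longrightarrow> TZ f \<in> srad" "f \<in> srad \<Longrightarrow> TZb f \<in> srad"
  unfolding TZ_def TZb_def by (intro srad_mult srad_add srad_diff srad_sT poly_space_pconst; assumption)+

lemma srad_Lam: "f \<in> srad \<Longrightarrow> Lam f \<in> srad"
  by (simp add: Lam_def srad_TZ)

lemma srad_refl: "f \<in> srad \<Longrightarrow> \<alpha> \<in> R \<Longrightarrow> refl_pull \<alpha> f \<in> srad"
  using radical_vW[OF weyl_rep_triv, of "\<lambda>_ :: 1. f" "reflection \<alpha>"]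
  by (simp add: srad_iff vW_triv reflection_W pull_reflection R_nonzero)

lemma srad_pconst: "pconst c \<in> srad \<Longrightarrow> c = 0"
  unfolding srad_def by (drule CollectD, drule conjunct2, drule spec[of _ "[]"]) (simp add: pconst_def)

lemma srad_cancel:
  assumes "pconst c * f \<in> srad" "c \<noteq> 0"
  shows "f \<in> srad"
proof -
  have "pconst (1 / c) * (pconst c * f) = pconst (1 / c * c) * f" by (simp only: pconst_mult mult.assoc)
  then show ?thesis using srad_mult[OF poly_space_pconst assms(1), of "1 / c"] assms(2) by simp
qed

lemma sT_decomp: "f \<in> poly_space \<Longrightarrow> sT v f = pconst (of_real (v \<bullet> e1) + \<i> * of_real (v \<bullet> e2)) * TZ f + pconst (of_real (v \<bullet> e1) - \<i> * of_real (v \<bullet> e2)) * TZb f"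
  by (subst sT_vector, assumption) (rule ext, simp add: sT_TZ fun_apply algebra_simps)

lemma TZ_0: "TZ 0 = 0" "TZb 0 = 0"
  using TZ_linear(1,2)[of 0 0] by simp_all

text \<open>The first operator of a nonempty word to act is a combination of \<open>TZ\<close> and
  \<open>TZb\<close> and kills f; the empty word is covered by the value at 0.\<close>

lemma srad_singular:
  assumes "f \<in> poly_space" "f 0 = 0" "TZ f = 0" "TZb f = 0"
  shows "f \<in> srad"
proof -
  have z: "foldr sT vs 0 = 0" for vs
    by (induction vs) (simp_all add: plinear_0[OF plinear_sT])
  have "foldr sT vs f 0 = 0" for vs
    using assms(2) by (cases vs rule: rev_cases) (simp_all add: sT_decomp[OF assms(1)] assms(3,4) z zero_fun_apply)
  then show ?thesis using assms(1) by (simp add: srad_def)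
qed

lemma plin_z: obtains a b where "plin v = pconst a * z + pconst b * zb"
proof
  show "plin v = pconst (1/2 * (of_real (v \<bullet> e1) - \<i> * of_real (v \<bullet> e2))) * z + pconst (1/2 * (of_real (v \<bullet> e1) + \<i> * of_real (v \<bullet> e2))) * zb"
    by (subst plin_coordinates[OF weyl_rep_triv]) (rule ext, simp add: z_def zb_def fun_apply field_simps)
qed

text \<open>Linear forms are combinations of z and zb, so a homogeneous polynomial of degree at
  least 2 N is a combination of monomials in which one of the two exponents reaches N.\<close>

lemma cofinite_powers:
  assumes zN: "z ^ N \<in> srad" "zb ^ N \<in> srad"
  shows "cofinite_radical (\<lambda>_. mat 1 :: complex ^ 1 ^ 1)"
proof -
  have pz: "z ^ a * zb ^ b \<in> poly_space" for a b by (intro poly_space_mult poly_space_power z_poly zb_poly)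
  have mono: "z ^ a * zb ^ b * f \<in> srad" if "a + b \<ge> 2 * N" "f \<in> poly_space" for a b f
  proof (cases "a \<ge> N")
    case True
    then have "z ^ a = z ^ N * z ^ (a - N)" by (simp flip: power_add)
    then have "z ^ a * zb ^ b * f = (z ^ (a - N) * zb ^ b * f) * z ^ N" by (simp only: mult_ac)
    then show ?thesis using srad_mult[OF _ zN(1)] that(2) by (simp only: pz poly_space_mult)
  next
    case False
    then have "b \<ge> N" using that by simp
    then have "zb ^ b = zb ^ N * zb ^ (b - N)" by (simp flip: power_add)
    then have "z ^ a * zb ^ b * f = (z ^ a * zb ^ (b - N) * f) * zb ^ N" by (simp only: mult_ac)
    then show ?thesis using srad_mult[OF _ zN(2)] that(2) by (simp only: pz poly_space_mult)
  qed
  \<comment> \<open>Generalised by a monomial prefix, to which the linear factors of f are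
    transferred one by one.\<close>
  have "homogeneous d f \<Longrightarrow> \<forall>a b. d + a + b \<ge> 2 * N \<longrightarrow> z ^ a * zb ^ b * f \<in> srad" for d f
  proof (induction rule: homogeneous.induct)
    case (homogeneous_const c)
    show ?case by (intro allI impI mono) (auto intro: poly_space_pconst)
  next
    case (homogeneous_0 d)
    show ?case by (simp add: srad_0)
  next
    case (homogeneous_add d f g)
    then show ?case by (simp add: distrib_left srad_add)
  next
    case (homogeneous_plin d f v)
    show ?case
    proof (intro allI impI)
      fix a b assume ab: "2 * N \<le> Suc d + a + b"
      obtain s t where st: "plin v = pconst s * z + pconst t * zb" by (rule plin_z)
      have "z ^ a * zb ^ b * (plin v * f) = pconst s * (z ^ Suc a * zb ^ b * f) + pconst t * (z ^ a * zb ^ Suc b * f)"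
        unfolding st power_Suc by (simp only: algebra_simps)
      moreover have "z ^ Suc a * zb ^ b * f \<in> srad" "z ^ a * zb ^ Suc b * f \<in> srad"
        using homogeneous_plin.IH[rule_format, of "Suc a" b] homogeneous_plin.IH[rule_format, of a "Suc b"] ab by simp_all
      ultimately show "z ^ a * zb ^ b * (plin v * f) \<in> srad"
        by (simp only: srad_add srad_mult poly_space_pconst)
    qed
  qed
  from this[rule_format, of _ _ 0 0] show ?thesis
    unfolding cofinite_triv_iff by (intro exI[of _ "2 * N"]) auto
qed

text \<open>In each term of the binomial expansion f has exponent at least m or g has exponent at
  least m'.\<close>

lemma srad_power_add:
  assumes "f \<in> poly_space" "g \<in> poly_space" "f ^ m \<in> srad" "g ^ m' \<in> srad"
  shows "(f + g) ^ (m + m') \<in> srad"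
proof -
  have "of_nat ((m + m') choose l) * f ^ l * g ^ (m + m' - l) \<in> srad" for l
  proof -
    have c: "of_nat ((m + m') choose l) = (pconst (of_nat ((m + m') choose l)) :: 'n pfun)"
      by (rule ext) (simp add: pconst_def of_nat_fun)
    show ?thesis
    proof (cases "l \<ge> m")
      case True
      then have "f ^ l = f ^ m * f ^ (l - m)" by (simp flip: power_add)
      then have "of_nat ((m + m') choose l) * f ^ l * g ^ (m + m' - l) =
        (pconst (of_nat ((m + m') choose l)) * f ^ (l - m) * g ^ (m + m' - l)) * f ^ m"
        unfolding c by (simp only: mult_ac)
      then show ?thesis using assms by (simp only: srad_mult poly_space_mult poly_space_power poly_space_pconst)
    next
      case False
      then have "g ^ (m + m' - l) = g ^ m' * g ^ (m - l)" by (simp add: add.commute flip: power_add)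
      then have "of_nat ((m + m') choose l) * f ^ l * g ^ (m + m' - l) =
        (pconst (of_nat ((m + m') choose l)) * f ^ l * g ^ (m - l)) * g ^ m'"
        unfolding c by (simp only: mult_ac)
      then show ?thesis using assms by (simp only: srad_mult poly_space_mult poly_space_power poly_space_pconst)
    qed
  qed
  then show ?thesis unfolding binomial_ring by (rule srad_sum)
qed

text \<open>Up to a constant, \<open>AA s\<close> is the product of the three positive roots of one length; \<open>QQ \<epsilon>\<close> is the
  cofactor of the root \<open>\<epsilon>\<close> in it. A power of it is singular for suitable half-integral multiplicities.\<close>

definition AA :: "complex \<Rightarrow> 'n pfun" where "AA s = z ^ 3 + pconst s * zb ^ 3"
definition QQ :: "complex \<Rightarrow> 'n pfun" where
  "QQ \<epsilon> = pconst \<epsilon> * z ^ 2 - pconst (\<epsilon> ^ 3) * z * zb + pconst (\<epsilon> ^ 5) * zb ^ 2"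

lemma AA_poly [intro]: "AA s \<in> poly_space" and QQ_poly [intro]: "QQ \<epsilon> \<in> poly_space"
  unfolding AA_def QQ_def
  by (intro poly_space_add poly_space_diff poly_space_mult poly_space_power poly_space_pconst z_poly zb_poly)+

lemma pconst_power: "pconst c ^ n = (pconst (c ^ n) :: 'n pfun)"
  by (induction n) (simp_all add: pconst_mult)

lemma sg_square: "s \<in> sg \<Longrightarrow> s * s = 1" by auto

lemma cnj_E6: "t \<in> sg \<Longrightarrow> \<epsilon> \<in> E t \<Longrightarrow> cnj \<epsilon> ^ 6 = t"
  by (auto simp flip: complex_cnj_power)

text \<open>The product of the roots of one length is negated by their own reflections and fixed by
  those of the other length; - s t is this sign.\<close>

lemma refl_AA:
  assumes "s \<in> sg" "t \<in> sg" "\<epsilon> \<in> E t"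
  shows "refl_pull (root t \<epsilon>) (AA s) = pconst (- s * t) * AA s"
proof -
  have e: "(- (\<epsilon> ^ 2)) ^ 3 = - t" "(- (cnj \<epsilon> ^ 2)) ^ 3 = - t"
    using assms(3) cnj_E6[OF assms(2,3)] by (simp_all flip: power_mult)
  have "refl_pull (root t \<epsilon>) (AA s) = (pconst (- (\<epsilon> ^ 2)) * zb) ^ 3 + pconst s * (pconst (- (cnj \<epsilon> ^ 2)) * z) ^ 3"
    unfolding AA_def by (simp add: refl_pull_power[OF weyl_rep_triv] refl_z[OF assms(2,3)])
  also have "\<dots> = pconst (- t) * zb ^ 3 + pconst (- s * t) * z ^ 3"
    unfolding power_mult_distrib pconst_power e mult.assoc[symmetric] pconst_mult[symmetric] by simp
  also have "- t = - s * t * s" using sg_square[OF assms(1)] by (simp add: mult.commute mult.left_commute)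
  finally show ?thesis unfolding AA_def by (simp only: pconst_mult algebra_simps)
qed

text \<open>Since \<epsilon>^6 = s, the polynomial \<open>AA s\<close> is a sum of two cubes up to
  the unit \<epsilon>^3, and \<open>ell \<epsilon>\<close> is its linear factor.\<close>

lemma ell_QQ:
  assumes "s \<in> sg" "\<epsilon> \<in> E s"
  shows "ell \<epsilon> * QQ \<epsilon> = AA s"
proof -
  have c: "cnj \<epsilon> * \<epsilon> = 1" "cnj \<epsilon> * \<epsilon> ^ 3 = \<epsilon> ^ 2" "cnj \<epsilon> * \<epsilon> ^ 5 = \<epsilon> ^ 4" "\<epsilon> * \<epsilon> ^ 5 = s"
    "\<epsilon> * \<epsilon> ^ 3 = \<epsilon> ^ 4" "\<epsilon> * \<epsilon> = \<epsilon> ^ 2"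
    using assms(2) E_cnj[OF assms] by (auto simp: eval_nat_numeral algebra_simps)
  have "ell \<epsilon> * QQ \<epsilon> = pconst (cnj \<epsilon> * \<epsilon>) * z ^ 3 + pconst (\<epsilon> * \<epsilon> - cnj \<epsilon> * \<epsilon> ^ 3) * z ^ 2 * zb +
     pconst (cnj \<epsilon> * \<epsilon> ^ 5 - \<epsilon> * \<epsilon> ^ 3) * z * zb ^ 2 + pconst (\<epsilon> * \<epsilon> ^ 5) * zb ^ 3"
    by (rule ext) (simp add: ell_def QQ_def fun_apply pconst_def power_fun_apply algebra_simps power2_eq_square power3_eq_cube)
  then show ?thesis unfolding c AA_def by simp
qed

text \<open>Reflections of the other length fix the power; those of its own length negate it because
  m is odd. Summed over the six directions the latter contribute 6 \<open>kval s\<close> times the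
  polynomial to which the derivative contributes the factor 3 m, and the two cancel.\<close>

lemma AA_power_singular:
  assumes "s \<in> sg" "odd m" "kval s = - of_nat m / 2"
  shows "AA s ^ m \<in> srad"
proof -
  obtain l where m: "m = Suc l" "even l" using assms(2) by (cases m) auto
  let ?A = "AA s"
  have P: "?A \<in> poly_space" ..
  have ss: "s * s = 1" using assms(1) by auto
  have dA: "dz ?A = pconst 3 * z ^ 2" "dzb ?A = pconst (3 * s) * zb ^ 2"
    unfolding AA_def
    by (simp_all add: dz_add dz_cmult dz_power poly_space_mult poly_space_power poly_space_pconst z_poly zb_poly
        dz_power[OF z_poly] dz_power[OF zb_poly] pconst_mult mult_ac)
  define q where "q t \<epsilon> = (if t = s then pconst 2 * ?A ^ l * QQ \<epsilon> else 0)" for t \<epsilon>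
  have q: "q t \<epsilon> \<in> poly_space \<and> ell \<epsilon> * q t \<epsilon> = ?A ^ m - refl_pull (root t \<epsilon>) (?A ^ m)"
    if "t \<in> sg" "\<epsilon> \<in> E t" for t \<epsilon>
  proof (cases "t = s")
    case True
    have "refl_pull (root t \<epsilon>) (?A ^ m) = pconst ((- 1) ^ m) * ?A ^ m"
      unfolding refl_pull_power[OF weyl_rep_triv] refl_AA[OF assms(1) that]
      using ss True by (simp add: power_mult_distrib pconst_power)
    also have "(- 1) ^ m = (- 1 :: complex)" using assms(2) by simp
    finally have rA: "refl_pull (root t \<epsilon>) (?A ^ m) = pconst (- 1) * ?A ^ m" .
    have r: "?A ^ m - refl_pull (root t \<epsilon>) (?A ^ m) = pconst 2 * ?A ^ l * ?A"
      unfolding rA unfolding m(1) by (rule ext) (simp add: fun_apply power_fun_apply pconst_def algebra_simps)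
    have "ell \<epsilon> * q t \<epsilon> = pconst 2 * ?A ^ l * (ell \<epsilon> * QQ \<epsilon>)"
      by (simp add: q_def True mult_ac)
    also have "ell \<epsilon> * QQ \<epsilon> = ?A" using ell_QQ[of s \<epsilon>] that True assms(1) by blast
    finally show ?thesis
      unfolding r by (simp only: q_def True if_True poly_space_mult poly_space_power poly_space_pconst P QQ_poly simp_thms)
  next
    case False
    then have "- s * t = 1" using that(1) assms(1) by auto
    then have "refl_pull (root t \<epsilon>) (?A ^ m) = ?A ^ m"
      unfolding refl_pull_power[OF weyl_rep_triv] refl_AA[OF assms(1) that] by simp
    then show ?thesis using False by (simp add: q_def poly_space_0)
  qed
  \<comment> \<open>The sums of second and of fourth powers over the six directions vanish, so only
    one monomial survives.\<close>
  have Q1: "(\<Sum>\<epsilon>\<in>E s. pconst (cnj \<epsilon>) * QQ \<epsilon>) = pconst 6 * z ^ 2"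
  proof -
    have "pconst (cnj \<epsilon>) * QQ \<epsilon> = z ^ 2 - pconst (\<epsilon> ^ 2) * (z * zb) + pconst (\<epsilon> ^ 4) * zb ^ 2" if "\<epsilon> \<in> E s" for \<epsilon>
    proof -
      have c: "cnj \<epsilon> * \<epsilon> = 1" "cnj \<epsilon> * \<epsilon> ^ 3 = \<epsilon> ^ 2" "cnj \<epsilon> * \<epsilon> ^ 5 = \<epsilon> ^ 4"
        using E_cnj[OF assms(1) that] by (auto simp: eval_nat_numeral algebra_simps)
      show ?thesis unfolding QQ_def distrib_left right_diff_distrib mult.assoc[symmetric] pconst_mult[symmetric] c by simp
    qed
    then have "(\<Sum>\<epsilon>\<in>E s. pconst (cnj \<epsilon>) * QQ \<epsilon>) = (\<Sum>\<epsilon>\<in>E s. z ^ 2 - pconst (\<epsilon> ^ 2) * (z * zb) + pconst (\<epsilon> ^ 4) * zb ^ 2)"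
      by (intro sum.cong HOL.refl) blast
    also have "\<dots> = of_nat (card (E s)) * z ^ 2 - pconst (\<Sum>\<epsilon>\<in>E s. \<epsilon> ^ 2) * (z * zb) + pconst (\<Sum>\<epsilon>\<in>E s. \<epsilon> ^ 4) * zb ^ 2"
      by (simp add: sum.distrib sum_subtractf sum_distrib_right pconst_sum)
    also have "of_nat (card (E s)) = (pconst 6 :: 'n pfun)" by (simp add: card_E[OF assms(1)] pconst_numeral)
    finally show ?thesis unfolding E_sums[OF assms(1)] by simp
  qed
  have Q2: "(\<Sum>\<epsilon>\<in>E s. pconst \<epsilon> * QQ \<epsilon>) = pconst (6 * s) * zb ^ 2"
  proof -
    have "pconst \<epsilon> * QQ \<epsilon> = pconst (\<epsilon> ^ 2) * z ^ 2 - pconst (\<epsilon> ^ 4) * (z * zb) + pconst s * zb ^ 2" if "\<epsilon> \<in> E s" for \<epsilon>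
    proof -
      have c: "\<epsilon> * \<epsilon> = \<epsilon> ^ 2" "\<epsilon> * \<epsilon> ^ 3 = \<epsilon> ^ 4" "\<epsilon> * \<epsilon> ^ 5 = s"
        using that by (auto simp: eval_nat_numeral algebra_simps)
      show ?thesis unfolding QQ_def distrib_left right_diff_distrib mult.assoc[symmetric] pconst_mult[symmetric] c by simp
    qed
    then have "(\<Sum>\<epsilon>\<in>E s. pconst \<epsilon> * QQ \<epsilon>) = (\<Sum>\<epsilon>\<in>E s. pconst (\<epsilon> ^ 2) * z ^ 2 - pconst (\<epsilon> ^ 4) * (z * zb) + pconst s * zb ^ 2)"
      by (intro sum.cong HOL.refl) blast
    also have "\<dots> = pconst (\<Sum>\<epsilon>\<in>E s. \<epsilon> ^ 2) * z ^ 2 - pconst (\<Sum>\<epsilon>\<in>E s. \<epsilon> ^ 4) * (z * zb) + of_nat (card (E s)) * (pconst s * zb ^ 2)"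
      by (simp add: sum.distrib sum_subtractf sum_distrib_right pconst_sum)
    also have "of_nat (card (E s)) = (pconst 6 :: 'n pfun)" by (simp add: card_E[OF assms(1)] pconst_numeral)
    finally show ?thesis unfolding E_sums[OF assms(1)] by (simp add: pconst_mult mult.assoc)
  qed
  have D: "dz (?A ^ m) = pconst (of_nat m) * ?A ^ l * (pconst 3 * z ^ 2)"
    "dzb (?A ^ m) = pconst (of_nat m) * ?A ^ l * (pconst (3 * s) * zb ^ 2)"
    unfolding dz_power[OF P] dA m(1) diff_Suc_1 by (rule HOL.refl)+
  have S: "(\<Sum>t\<in>sg. pconst (kval t) * (\<Sum>\<epsilon>\<in>E t. pconst (c \<epsilon>) * q t \<epsilon>)) =
      pconst (- of_nat m) * ?A ^ l * (\<Sum>\<epsilon>\<in>E s. pconst (c \<epsilon>) * QQ \<epsilon>)" for c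
  proof -
    have 0: "(\<Sum>\<epsilon>\<in>E t. pconst (c \<epsilon>) * q t \<epsilon>) = (if t = s then pconst 2 * ?A ^ l * (\<Sum>\<epsilon>\<in>E s. pconst (c \<epsilon>) * QQ \<epsilon>) else 0)" for t
      by (simp add: q_def sum_distrib_left mult_ac)
    have "(\<Sum>t\<in>sg. pconst (kval t) * (\<Sum>\<epsilon>\<in>E t. pconst (c \<epsilon>) * q t \<epsilon>)) =
      (\<Sum>t\<in>sg. if t = s then pconst (kval s) * (pconst 2 * ?A ^ l * (\<Sum>\<epsilon>\<in>E s. pconst (c \<epsilon>) * QQ \<epsilon>)) else 0)"
      unfolding 0 by (rule sum.cong[OF HOL.refl]) simp
    also have "\<dots> = pconst (kval s) * (pconst 2 * ?A ^ l * (\<Sum>\<epsilon>\<in>E s. pconst (c \<epsilon>) * QQ \<epsilon>))"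
      using assms(1) by (subst sum.delta) auto
    also have "\<dots> = pconst (kval s * 2) * ?A ^ l * (\<Sum>\<epsilon>\<in>E s. pconst (c \<epsilon>) * QQ \<epsilon>)"
      by (simp only: pconst_mult mult.assoc)
    also have "kval s * 2 = - of_nat m" using assms(3) by simp
    finally show ?thesis .
  qed
  have Am: "?A ^ m \<in> poly_space" by (rule poly_space_power[OF P])
  have "TZ (?A ^ m) = dz (?A ^ m) + pconst (1/2) * (\<Sum>t\<in>sg. pconst (kval t) * (\<Sum>\<epsilon>\<in>E t. pconst (cnj \<epsilon>) * q t \<epsilon>))"
    by (rule TZ_general(1)[OF Am q])
  also have "\<dots> = 0"
    unfolding D S[of cnj] Q1 by (rule ext) (simp add: fun_apply pconst_def)
  finally have T1: "TZ (?A ^ m) = 0" .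
  have "TZb (?A ^ m) = dzb (?A ^ m) + pconst (1/2) * (\<Sum>t\<in>sg. pconst (kval t) * (\<Sum>\<epsilon>\<in>E t. pconst \<epsilon> * q t \<epsilon>))"
    by (rule TZ_general(2)[OF Am q])
  also have "\<dots> = 0"
    unfolding D S[of "\<lambda>\<epsilon>. \<epsilon>"] Q2 by (rule ext) (simp add: fun_apply pconst_def)
  finally have T2: "TZb (?A ^ m) = 0" .
  have "?A 0 = 0" by (simp add: AA_def z_def zb_def fun_apply power_fun_apply plin_def)
  then have "(?A ^ m) 0 = 0" unfolding power_fun_apply by (simp add: m(1))
  then show ?thesis by (rule srad_singular[OF Am _ T1 T2])
qed

text \<open>The exponents - 2 \<open>ks\<close> and - 2 \<open>kl\<close> make powers of the two
  products of roots singular. The sum and the difference of these products are 2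
  \<open>z ^ 3\<close> and 2 \<open>zb ^ 3\<close>, so powers of z and of zb fall into the
  radical.\<close>

lemma cofinite_half_integers:
  assumes "ks = - 1 / 2 - of_nat a" "kl = - 1 / 2 - of_nat b"
  shows "cofinite_radical (\<lambda>_. mat 1 :: complex ^ 1 ^ 1)"
proof -
  let ?a = "2 * a + 1" and ?b = "2 * b + 1"
  have A: "AA 1 ^ ?a \<in> srad" "AA (- 1) ^ ?b \<in> srad"
  proof -
    have k: "kval 1 = ks" "kval (- 1) = kl" by (simp_all add: kval_def)
    show "AA 1 ^ ?a \<in> srad"
      by (rule AA_power_singular) (simp_all only: trans[OF k(1) assms(1)], simp_all add: field_simps)
    show "AA (- 1) ^ ?b \<in> srad"
      by (rule AA_power_singular) (simp_all only: trans[OF k(2) assms(2)], simp_all add: field_simps)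
  qed
  have B: "(pconst (- 1) * AA (- 1)) ^ ?b \<in> srad"
    unfolding power_mult_distrib using A(2) by (intro srad_mult poly_space_power poly_space_pconst)
  have s: "(AA 1 + AA (- 1)) ^ (?a + ?b) \<in> srad" "(AA 1 + pconst (- 1) * AA (- 1)) ^ (?a + ?b) \<in> srad"
    by (rule srad_power_add[OF AA_poly AA_poly A])
      (rule srad_power_add[OF AA_poly poly_space_mult[OF poly_space_pconst AA_poly] A(1) B])
  have "AA 1 + AA (- 1) = pconst 2 * z ^ 3" "AA 1 + pconst (- 1) * AA (- 1) = pconst 2 * zb ^ 3"
    by (rule ext, simp add: AA_def fun_apply pconst_def)+
  note s = s[unfolded this power_mult_distrib pconst_power]
  have "(2 :: complex) ^ (?a + ?b) \<noteq> 0" by (rule power_not_zero) simp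
  note this [THEN srad_cancel[rotated]]
  from this[OF s(1)] this[OF s(2)] show ?thesis
    unfolding power_mult[symmetric] by (rule cofinite_powers)
qed

lemma TZ_funpow_closed: "f \<in> poly_space \<Longrightarrow> (TZ ^^ m) f \<in> poly_space" "f \<in> poly_space \<Longrightarrow> (TZb ^^ m) f \<in> poly_space"
  by (induction m) auto

lemma TZ_funpow_0: "(TZ ^^ m) 0 = 0" "(TZb ^^ m) 0 = 0"
  by (induction m) (simp_all add: TZ_0)

subsection \<open>Non-integral sum of the multiplicities\<close>

text \<open>On a polynomial killed by \<open>Lam\<close>, products of Dunkl operators reduce to powers of \<open>TZ\<close> and of \<open>TZb\<close>.
  The rotation by \<open>\<omega>\<close> multiplies the constants obtained from \<open>nsq ^ n\<close> by a root of unity different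
  from \<open>1\<close>, so that \<open>nsq ^ n\<close> is in the radical.\<close>

lemma harmonic_TZ:
  assumes "f \<in> poly_space" "Lam f = 0"
  shows "TZb ((TZ ^^ Suc m) f) = 0" "TZ ((TZb ^^ Suc m) f) = 0"
proof -
  have 1: "g \<in> poly_space \<Longrightarrow> TZb ((TZ ^^ m) g) = (TZ ^^ m) (TZb g)" for g m
    by (induction m) (simp_all add: TZ_commute[symmetric] TZ_funpow_closed)
  have 2: "g \<in> poly_space \<Longrightarrow> TZ ((TZb ^^ m) g) = (TZb ^^ m) (TZ g)" for g m
    by (induction m) (simp_all add: TZ_commute TZ_funpow_closed)
  have "TZb ((TZ ^^ Suc m) f) = (TZ ^^ m) (TZb (TZ f))"
    using assms(1) by (simp add: funpow_Suc_right 1 TZ_closed del: funpow.simps)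
  then show "TZb ((TZ ^^ Suc m) f) = 0"
    using assms TZ_commute[OF assms(1)] by (simp add: Lam_def TZ_funpow_0)
  have "TZ ((TZb ^^ Suc m) f) = (TZb ^^ m) (TZ (TZb f))"
    using assms(1) by (simp add: funpow_Suc_right 2 TZ_closed del: funpow.simps)
  then show "TZ ((TZb ^^ Suc m) f) = 0"
    using assms by (simp add: Lam_def TZ_funpow_0)
qed

lemma harmonic_foldr:
  assumes "f \<in> poly_space" "Lam f = 0"
  shows "\<exists>a b. foldr sT (v # vs) f = pconst a * (TZ ^^ Suc (length vs)) f + pconst b * (TZb ^^ Suc (length vs)) f"
proof (induction vs arbitrary: v)
  case Nil
  show ?case using sT_decomp[OF assms(1), of v] by auto
next
  case (Cons w ws)
  define m where "m = length ws"
  obtain a b where ab: "foldr sT (w # ws) f = pconst a * (TZ ^^ Suc m) f + pconst b * (TZb ^^ Suc m) f"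
    using Cons.IH[of w] unfolding m_def by blast
  have P: "(TZ ^^ Suc m) f \<in> poly_space" "(TZb ^^ Suc m) f \<in> poly_space"
    using assms(1) by (rule TZ_funpow_closed)+
  have PP: "pconst a * (TZ ^^ Suc m) f \<in> poly_space" "pconst b * (TZb ^^ Suc m) f \<in> poly_space"
    using P by (auto intro: poly_space_mult poly_space_pconst)
  define g where "g = pconst a * (TZ ^^ Suc m) f + pconst b * (TZb ^^ Suc m) f"
  have g: "g \<in> poly_space" unfolding g_def using PP by (rule poly_space_add)
  have h: "TZb ((TZ ^^ Suc m) f) = 0" "TZ ((TZb ^^ Suc m) f) = 0" by (rule harmonic_TZ[OF assms])+
  have T: "TZ g = pconst a * (TZ ^^ Suc (Suc m)) f" "TZb g = pconst b * (TZb ^^ Suc (Suc m)) f"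
    unfolding g_def TZ_linear(3,4)[OF PP] TZ_linear(1,2)[OF P(1)] TZ_linear(1,2)[OF P(2)] h by simp_all
  define c d where "c = of_real (v \<bullet> e1) + \<i> * of_real (v \<bullet> e2)" and "d = of_real (v \<bullet> e1) - \<i> * of_real (v \<bullet> e2)"
  have "foldr sT (v # w # ws) f = sT v g" using ab by (simp add: g_def)
  also have "\<dots> = pconst (c * a) * (TZ ^^ Suc (Suc m)) f + pconst (d * b) * (TZb ^^ Suc (Suc m)) f"
    unfolding sT_decomp[OF g] T c_def[symmetric] d_def[symmetric] by (simp only: pconst_mult mult.assoc)
  finally show ?case unfolding m_def by auto
qed

text \<open>Equivariance of the Dunkl operators in complex directions: a reflection exchanges the
  two conjugate directions up to a unit.\<close>

lemma refl_TZ: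
  assumes "s \<in> sg" "\<epsilon> \<in> E s" "f \<in> poly_space"
  shows "refl_pull (root s \<epsilon>) (TZ f) = pconst (- (cnj \<epsilon> ^ 2)) * TZb (refl_pull (root s \<epsilon>) f)"
proof -
  let ?\<alpha> = "root s \<epsilon>"
  have \<alpha>: "?\<alpha> \<in> R" "?\<alpha> \<noteq> 0" using root_R[OF assms(1,2)] R_nonzero by auto
  have F: "(\<lambda>_ :: 1. f) \<in> vspace" using assms(3) by (simp add: vspace_iff)
  have rT: "refl_pull ?\<alpha> (sT v f) = sT (reflection ?\<alpha> v) (refl_pull ?\<alpha> f)" for v
    using vW_vT[OF weyl_rep_triv reflection_W[OF \<alpha>(1)] F, of v]
    unfolding vT_triv vW_triv pull_reflection by (rule fun_cong)
  let ?g = "refl_pull ?\<alpha> f"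
  have g: "?g \<in> poly_space" using assms(3) by auto
  have a: "?\<alpha> \<bullet> e1 = rlen s * Re \<epsilon>" "?\<alpha> \<bullet> e2 = rlen s * Im \<epsilon>" "?\<alpha> \<bullet> ?\<alpha> = (rlen s)\<^sup>2"
    using E_norm[OF assms(1,2)] by (simp_all add: root_eq cvec_inner cvec_inner_self norm_mult)
  have o: "e1 \<bullet> e1 = 1" "e2 \<bullet> e2 = 1" "e1 \<bullet> e2 = 0" "e2 \<bullet> e1 = 0"
    using orthonormal by (auto simp: inner_commute)
  have r: "reflection ?\<alpha> e1 \<bullet> e1 = 1 - 2 * Re \<epsilon> * Re \<epsilon>" "reflection ?\<alpha> e1 \<bullet> e2 = - 2 * Re \<epsilon> * Im \<epsilon>"
    "reflection ?\<alpha> e2 \<bullet> e1 = - 2 * Re \<epsilon> * Im \<epsilon>" "reflection ?\<alpha> e2 \<bullet> e2 = 1 - 2 * Im \<epsilon> * Im \<epsilon>"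
    using rlen_pos[of s] by (simp_all add: reflection_def inner_diff_left a o field_simps power2_eq_square)
  have n: "Re \<epsilon> * Re \<epsilon> = 1 - Im \<epsilon> * Im \<epsilon>"
    using E_norm[OF assms(1,2)] by (simp add: cmod_def power2_eq_square)
  have e: "of_real (reflection ?\<alpha> e1 \<bullet> e1) + \<i> * of_real (reflection ?\<alpha> e1 \<bullet> e2) = - (\<epsilon> ^ 2)"
    "of_real (reflection ?\<alpha> e1 \<bullet> e1) - \<i> * of_real (reflection ?\<alpha> e1 \<bullet> e2) = - (cnj \<epsilon> ^ 2)"
    "of_real (reflection ?\<alpha> e2 \<bullet> e1) + \<i> * of_real (reflection ?\<alpha> e2 \<bullet> e2) = \<i> * \<epsilon> ^ 2"
    "of_real (reflection ?\<alpha> e2 \<bullet> e1) - \<i> * of_real (reflection ?\<alpha> e2 \<bullet> e2) = - \<i> * cnj \<epsilon> ^ 2"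
    unfolding r by (simp_all add: complex_eq_iff power2_eq_square n algebra_simps)
  have "refl_pull ?\<alpha> (TZ f) = pconst (1/2) * (sT (reflection ?\<alpha> e1) ?g - pconst \<i> * sT (reflection ?\<alpha> e2) ?g)"
    by (simp only: TZ_def refl_pull_simps rT)
  also have "\<dots> = pconst (- (cnj \<epsilon> ^ 2)) * TZb ?g"
    unfolding sT_decomp[OF g] e by (rule ext) (simp add: fun_apply pconst_def field_simps)
  finally show ?thesis .
qed

lemma refl_TZ_funpow:
  assumes "s \<in> sg" "\<epsilon> \<in> E s" "f \<in> poly_space"
  shows "refl_pull (root s \<epsilon>) ((TZ ^^ m) f) = pconst ((- (cnj \<epsilon> ^ 2)) ^ m) * (TZb ^^ m) (refl_pull (root s \<epsilon>) f)"
proof (induction m)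
  case (Suc m)
  have "refl_pull (root s \<epsilon>) ((TZ ^^ Suc m) f) = pconst (- (cnj \<epsilon> ^ 2)) * TZb (refl_pull (root s \<epsilon>) ((TZ ^^ m) f))"
    using refl_TZ[OF assms(1,2) TZ_funpow_closed(1)[OF assms(3)]] by simp
  also have "\<dots> = pconst (- (cnj \<epsilon> ^ 2)) * (pconst ((- (cnj \<epsilon> ^ 2)) ^ m) * (TZb ^^ Suc m) (refl_pull (root s \<epsilon>) f))"
    unfolding Suc using assms(3) by (simp add: TZ_linear TZ_funpow_closed poly_space_refl_pull)
  finally show ?case by (simp only: power_Suc pconst_mult mult.assoc)
qed simp

text \<open>\<omega>^4 has order 3.\<close>

lemma \<omega>4n:
  assumes "\<not> 3 dvd n" shows "(\<omega> ^ 4) ^ n \<noteq> 1"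
proof -
  have \<omega>12: "(\<omega> ^ 4) ^ 3 = 1"
  proof -
    have "(\<omega> ^ 4) ^ 3 = (\<omega> ^ 6) ^ 2" by (simp flip: power_mult)
    then show ?thesis by (simp add: \<omega>6)
  qed
  have \<omega>8: "(\<omega> ^ 4) ^ 2 = \<omega> ^ 2"
  proof -
    have "(\<omega> ^ 4) ^ 2 = \<omega> ^ 6 * \<omega> ^ 2" by (simp flip: power_mult power_add)
    then show ?thesis by (simp add: \<omega>6)
  qed
  have "(\<omega> ^ 4) ^ n = (\<omega> ^ 4) ^ (3 * (n div 3) + n mod 3)" by simp
  also have "\<dots> = (\<omega> ^ 4) ^ (n mod 3)" unfolding power_add power_mult \<omega>12 by simp
  finally have p: "(\<omega> ^ 4) ^ n = (\<omega> ^ 4) ^ (n mod 3)" .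
  have "n mod 3 = 1 \<or> n mod 3 = 2" using assms by presburger
  then show ?thesis unfolding p using \<omega>24 \<omega>8 by auto
qed

lemma nsq_closed: "nsq \<in> poly_space" using nsq_invariant by (simp add: invariant_def)

lemma homogeneous_z: "homogeneous 1 z" "homogeneous 1 zb"
  unfolding z_def zb_def by (intro homogeneous_add homogeneous_diff homogeneous_cmult homogeneous_plin1)+

lemma homogeneous_nsq_power: "homogeneous (2 * j) (nsq ^ j)"
  unfolding nsq_z using homogeneous_power[OF homogeneous_mult[OF homogeneous_z], of j] by (simp only: one_add_one)

lemma nsq_power_srad:
  assumes "zeta = - of_nat n" "n \<ge> 1" "\<not> 3 dvd n"
  shows "nsq ^ n \<in> srad"
proof -
  let ?f = "nsq ^ n"
  have P: "?f \<in> poly_space" using nsq_closed by (rule poly_space_power)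
  have L: "Lam ?f = 0" unfolding Lam_nsq_power assms(1) by simp
  define c d where "c = (TZ ^^ (2 * n)) ?f 0" and "d = (TZb ^^ (2 * n)) ?f 0"
  have inv: "refl_pull (root 1 \<epsilon>) ?f = ?f" if "\<epsilon> \<in> E 1" for \<epsilon>
    using invariant_power[OF nsq_invariant, of n] root_R[of 1 \<epsilon>] that by (auto simp: invariant_def)
  \<comment> \<open>\<open>nsq ^ n\<close> is invariant and reflections fix the origin, so each
    short direction gives a relation between the two constants. The directions 1 and \<omega> are
    compared below; together they amount to a rotation.\<close>
  have cd: "c = (cnj \<epsilon> ^ 4) ^ n * d" if "\<epsilon> \<in> E 1" for \<epsilon>
  proof -
    have "refl_pull (root 1 \<epsilon>) ((TZ ^^ (2 * n)) ?f) 0 = (pconst ((- (cnj \<epsilon> ^ 2)) ^ (2 * n)) * (TZb ^^ (2 * n)) ?f) 0"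
      using refl_TZ_funpow[OF _ that P, of "2 * n"] by (simp add: inv[OF that])
    moreover have "(- (cnj \<epsilon> ^ 2)) ^ (2 * n) = (cnj \<epsilon> ^ 4) ^ n"
      by (simp add: power_mult flip: power_mult)
    ultimately show ?thesis
      by (simp add: c_def d_def refl_pull_apply reflection_def fun_apply pconst_def)
  qed
  have "c = d" using cd[of 1] by simp
  moreover have "c = (cnj \<omega> ^ 4) ^ n * d" using cd[of \<omega>] \<omega>6 by simp
  moreover have "(cnj \<omega> ^ 4) ^ n \<noteq> 1"
    using \<omega>4n[OF assms(3)] by (metis complex_cnj_cancel_iff complex_cnj_one complex_cnj_power)
  ultimately have 0: "c = 0" "d = 0" by auto
  have "foldr sT vs ?f 0 = 0" for vs
  proof (cases "length vs = 2 * n")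
    case True
    then obtain w ws where vs: "vs = w # ws" "Suc (length ws) = 2 * n" using assms(2) by (cases vs) auto
    from harmonic_foldr[OF P L, of w ws] obtain a b
      where "foldr sT vs ?f = pconst a * (TZ ^^ (2 * n)) ?f + pconst b * (TZb ^^ (2 * n)) ?f"
      unfolding vs by blast
    then have "foldr sT vs ?f 0 = a * c + b * d" by (simp add: fun_apply pconst_def c_def d_def)
    then show ?thesis using 0 by simp
  next
    case False
    \<comment> \<open>Words of any other length give 0 at the origin for reasons of degree.\<close>
    have "vhomogeneous (2 * n) (\<lambda>_ :: 1. ?f)" by (simp add: vhomogeneous_def homogeneous_nsq_power)
    from vhomogeneous_foldr_at_0[OF weyl_rep_triv this False, of 1] show ?thesis
      by (simp add: foldr_vT_triv)
  qed
  then show ?thesis using P by (simp add: srad_def)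
qed

text \<open>Differentiating \<open>nsq\<close> supplies the factors zb. The terms where
  \<open>TZ\<close> hits the cofactor keep the factor \<open>nsq\<close>, hence a factor z, and are
  absorbed into g. For m = n this leaves \<open>zb ^ n\<close> modulo z.\<close>

lemma TZ_funpow_nsq:
  "m \<le> n \<Longrightarrow> \<exists>c g. c \<noteq> 0 \<and> g \<in> poly_space \<and> (TZ ^^ m) (nsq ^ n) = pconst c * (nsq ^ (n - m) * (zb ^ m + z * g))"
proof (induction m)
  case 0
  show ?case by (intro exI[of _ 1] exI[of _ 0]) (simp add: poly_space_0)
next
  case (Suc m)
  then obtain c g where cg: "c \<noteq> 0" "g \<in> poly_space" "(TZ ^^ m) (nsq ^ n) = pconst c * (nsq ^ (n - m) * (zb ^ m + z * g))"
    by auto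
  define j where "j = n - Suc m"
  have j: "n - m = Suc j" using Suc.prems by (simp add: j_def)
  let ?h = "zb ^ m + z * g"
  have h: "?h \<in> poly_space" using cg(2) by (intro poly_space_add poly_space_mult poly_space_power z_poly zb_poly)
  have Th: "TZ ?h \<in> poly_space" using h by auto
  have dn: "dz (nsq ^ Suc j) = pconst (of_nat (Suc j)) * nsq ^ j * zb"
    using dz_power(1)[OF nsq_closed, of "Suc j"] by (simp add: nsq_z dz_mult z_poly zb_poly)
  have "TZ (nsq ^ Suc j * ?h) = nsq ^ Suc j * TZ ?h + dz (nsq ^ Suc j) * ?h"
    by (rule TZ_invariant_mult(1)[OF invariant_power[OF nsq_invariant] h])
  \<comment> \<open>Brought to the same leading factor as the derivative term; the reciprocal
    constant goes into the new g.\<close>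
  also have "nsq ^ Suc j * TZ ?h = pconst (of_nat (Suc j)) * (nsq ^ j * (z * (pconst (1 / of_nat (Suc j)) * (zb * TZ ?h))))"
  proof -
    have "pconst (of_nat (Suc j)) * (nsq ^ j * (z * (pconst (1 / of_nat (Suc j)) * (zb * TZ ?h)))) =
      pconst (of_nat (Suc j) * (1 / of_nat (Suc j))) * (nsq ^ j * (z * zb) * TZ ?h)"
      by (simp only: pconst_mult mult_ac)
    also have "of_nat (Suc j) * (1 / of_nat (Suc j)) = (1 :: complex)" using of_nat_neq_0[of j] by (simp del: of_nat_Suc)
    finally show ?thesis by (simp only: power_Suc nsq_z pconst_1 mult_1_left mult_ac)
  qed
  also have "dz (nsq ^ Suc j) * ?h = pconst (of_nat (Suc j)) * (nsq ^ j * (zb ^ Suc m + z * (zb * g)))"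
    unfolding dn unfolding power_Suc by (simp only: algebra_simps)
  finally have T: "TZ (nsq ^ Suc j * ?h) = pconst (of_nat (Suc j)) * (nsq ^ j * (zb ^ Suc m + z * (zb * g + pconst (1 / of_nat (Suc j)) * (zb * TZ ?h))))"
    by (simp only: algebra_simps)
  have P: "nsq ^ Suc j * ?h \<in> poly_space" using h nsq_closed by (intro poly_space_mult poly_space_power)
  have "(TZ ^^ Suc m) (nsq ^ n) = pconst (c * of_nat (Suc j)) * (nsq ^ j * (zb ^ Suc m + z * (zb * g + pconst (1 / of_nat (Suc j)) * (zb * TZ ?h))))"
    using TZ_linear(1)[OF P, of c] by (simp only: funpow.simps o_apply cg(3) j T pconst_mult mult.assoc)
  moreover have "zb * g + pconst (1 / of_nat (Suc j)) * (zb * TZ ?h) \<in> poly_space"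
    using cg(2) Th by (intro poly_space_add poly_space_mult poly_space_pconst zb_poly)
  moreover have "c * of_nat (Suc j) \<noteq> 0" using cg(1) of_nat_neq_0[of j] by (simp del: of_nat_Suc)
  ultimately show ?case unfolding j_def by blast
qed

text \<open>Modulo the radical \<open>zb ^ n\<close> equals - z g. Hence its n-th power times
  \<open>zb ^ n\<close> becomes a multiple of \<open>nsq ^ n\<close>, which lies in the radical. So
  a power of zb does too, and by a reflection the same power of z.\<close>

lemma cofinite_not_dvd:
  assumes "zeta = - of_nat n" "n \<ge> 1" "\<not> 3 dvd n"
  shows "cofinite_radical (\<lambda>_. mat 1 :: complex ^ 1 ^ 1)"
proof -
  have N: "nsq ^ n \<in> srad" by (rule nsq_power_srad[OF assms])
  obtain c g where cg: "c \<noteq> 0" "g \<in> poly_space" "(TZ ^^ n) (nsq ^ n) = pconst c * (nsq ^ (n - n) * (zb ^ n + z * g))"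
    using TZ_funpow_nsq[of n n] by auto
  have "(TZ ^^ m) (nsq ^ n) \<in> srad" for m by (induction m) (simp_all add: N srad_TZ)
  then have "pconst c * (zb ^ n + z * g) \<in> srad" using cg(3) by (metis diff_self_eq_0 power_0 mult_1_left)
  then have D: "zb ^ n + z * g \<in> srad" using cg(1) by (rule srad_cancel)
  define a b where "a = zb ^ n" and "b = pconst (- 1) * (z * g)"
  have P: "a \<in> poly_space" "b \<in> poly_space"
    unfolding a_def b_def using cg(2) by (intro poly_space_mult poly_space_power poly_space_pconst z_poly zb_poly)+
  have ab: "a - b \<in> srad" using D by (simp add: a_def b_def pconst_minus)
  have pw: "a ^ m - b ^ m \<in> srad" for m
  proof (induction m)
    case (Suc m)
    have "a ^ Suc m - b ^ Suc m = a * (a ^ m - b ^ m) + b ^ m * (a - b)" by (simp add: algebra_simps)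
    then show ?case using Suc ab P by (simp only: srad_add srad_mult poly_space_power)
  qed (simp add: srad_0)
  have "b ^ n * a = (pconst ((- 1) ^ n) * g ^ n) * nsq ^ n"
    unfolding a_def b_def nsq_z power_mult_distrib pconst_power by (simp only: mult_ac)
  then have "b ^ n * a \<in> srad" using N cg(2) by (simp only: srad_mult poly_space_mult poly_space_power poly_space_pconst)
  moreover have "a ^ n * a = a * (a ^ n - b ^ n) + b ^ n * a" by (simp add: algebra_simps)
  ultimately have "a ^ n * a \<in> srad" using pw[of n] P by (simp only: srad_add srad_mult)
  then have zb: "zb ^ (n * n + n) \<in> srad" by (simp only: a_def power_add power_mult)
  have 1: "1 \<in> sg" "1 \<in> E 1" by auto
  have "refl_pull (root 1 1) (zb ^ (n * n + n)) = pconst ((- 1) ^ (n * n + n)) * z ^ (n * n + n)"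
    unfolding refl_pull_power[OF weyl_rep_triv] refl_z(2)[OF 1] power_mult_distrib pconst_power by simp
  then have "pconst ((- 1) ^ (n * n + n)) * z ^ (n * n + n) \<in> srad"
    using srad_refl[OF zb root_R[OF 1]] by simp
  then have "z ^ (n * n + n) \<in> srad" by (rule srad_cancel) simp
  then show ?thesis using zb by (rule cofinite_powers)
qed

subsection \<open>Integral sum of the multiplicities\<close>

text \<open>The polynomials \<open>nsq\<close> and \<open>uu\<close> generate the invariants. Applying \<open>Lam\<close> to their monomials in
  the radical lowers the degree until \<open>1\<close> is reached, unless one of the coefficients
  \<open>2 * ks + 2 * i - 1\<close> vanishes.\<close>

definition uu :: "'n pfun" where "uu = AA 1 ^ 2"

lemma uu_invariant: "invariant uu"
proof -
  have A: "refl_pull (root t \<epsilon>) uu = uu" if "t \<in> sg" "\<epsilon> \<in> E t" for t \<epsilon>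
  proof -
    have "(pconst (- 1 * t) * AA 1) ^ 2 = AA 1 ^ 2"
      unfolding power_mult_distrib pconst_power using sg_square[OF that(1)] by (simp add: power2_eq_square)
    then show ?thesis
      unfolding uu_def refl_pull_power[OF weyl_rep_triv] by (subst refl_AA[OF _ that]) simp_all
  qed
  have "refl_pull \<alpha> uu = uu" if "\<alpha> \<in> R" for \<alpha>
  proof -
    from that equalityD1[OF R_roots] obtain t \<epsilon> where "t \<in> sg" "\<epsilon> \<in> E t" "\<alpha> = root t \<epsilon>" by blast
    then show ?thesis using A by simp
  qed
  moreover have "uu \<in> poly_space" unfolding uu_def by (intro poly_space_power AA_poly)
  ultimately show ?thesis by (simp add: invariant_def)
qed

lemma dz_AA1: "dz (AA 1) = pconst 3 * z ^ 2" "dzb (AA 1) = pconst 3 * zb ^ 2"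
  unfolding AA_def
  by (simp_all add: dz_add poly_space_power z_poly zb_poly dz_power[OF z_poly] dz_power[OF zb_poly])

lemma dz_uu: "dz uu = pconst 6 * z ^ 2 * AA 1" "dzb uu = pconst 6 * zb ^ 2 * AA 1"
proof -
  have "pconst (of_nat 2) * AA 1 ^ (2 - 1) * (pconst 3 * f) = pconst (2 * 3) * f * AA 1" for f
    by (simp only: pconst_mult) (simp add: mult_ac)
  then show "dz uu = pconst 6 * z ^ 2 * AA 1" "dzb uu = pconst 6 * zb ^ 2 * AA 1"
    unfolding uu_def dz_power[OF AA_poly] dz_AA1 by simp_all
qed

text \<open>\<open>TZb\<close> yields 6 \<open>zb ^ 2 * AA 1\<close>. For long roots
  \<open>AA 1\<close> is fixed and the weighted quotients sum to 0, so \<open>kl\<close> drops out;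
  for short roots the sum over directions is 12 \<open>nsq ^ 2\<close>.\<close>

lemma Lam_uu: "Lam uu = pconst (18 * (1 + 2 * ks)) * nsq ^ 2"
proof -
  let ?f = "zb ^ 2 * AA 1"
  have f: "?f \<in> poly_space" by (intro poly_space_mult poly_space_power zb_poly AA_poly)
  \<comment> \<open>For a short root \<open>AA 1\<close> changes sign and is itself divisible by
    \<open>ell \<epsilon>\<close>; for a long root it is fixed, and the divisible factor is a
    difference of squares.\<close>
  define q where "q t \<epsilon> = (if t = 1 then QQ \<epsilon> * (zb ^ 2 + pconst (cnj \<epsilon> ^ 4) * z ^ 2)
    else AA 1 * (pconst (cnj \<epsilon>) * (zb - pconst (cnj \<epsilon> ^ 2) * z)))" for t \<epsilon> :: complex
  have q: "q t \<epsilon> \<in> poly_space \<and> ell \<epsilon> * q t \<epsilon> = ?f - refl_pull (root t \<epsilon>) ?f" if te: "t \<in> sg" "\<epsilon> \<in> E t" for t \<epsilon>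
  proof
    show "q t \<epsilon> \<in> poly_space"
      unfolding q_def by (auto intro!: poly_space_mult poly_space_add poly_space_diff poly_space_power poly_space_pconst)
    have "refl_pull (root t \<epsilon>) ?f = refl_pull (root t \<epsilon>) zb ^ 2 * refl_pull (root t \<epsilon>) (AA 1)"
      by (simp add: refl_pull_power[OF weyl_rep_triv])
    also have "\<dots> = pconst ((- (cnj \<epsilon> ^ 2)) ^ 2) * z ^ 2 * (pconst (- t) * AA 1)"
      unfolding refl_z(2)[OF te] power_mult_distrib pconst_power using refl_AA[OF _ te, of 1] by simp
    also have "(- (cnj \<epsilon> ^ 2)) ^ 2 = cnj \<epsilon> ^ 4" by simp
    finally have r: "refl_pull (root t \<epsilon>) ?f = pconst (cnj \<epsilon> ^ 4) * z ^ 2 * (pconst (- t) * AA 1)" .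
    show "ell \<epsilon> * q t \<epsilon> = ?f - refl_pull (root t \<epsilon>) ?f"
    proof (cases "t = 1")
      case True
      have "ell \<epsilon> * q t \<epsilon> = (ell \<epsilon> * QQ \<epsilon>) * (zb ^ 2 + pconst (cnj \<epsilon> ^ 4) * z ^ 2)" by (simp add: q_def True mult_ac)
      also have "ell \<epsilon> * QQ \<epsilon> = AA 1" by (rule ell_QQ) (use te True in auto)
      finally show ?thesis unfolding r unfolding True by (simp add: pconst_minus algebra_simps)
    next
      case False
      then have t: "t = - 1" using te by simp
      have c: "cnj \<epsilon> * \<epsilon> = 1" by (rule E_cnj(2)[OF te])
      have c3: "cnj \<epsilon> ^ 3 * \<epsilon> = cnj \<epsilon> ^ 2" using c by (simp add: power2_eq_square power3_eq_cube mult.assoc)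
      have "ell \<epsilon> * (pconst (cnj \<epsilon>) * (zb - pconst (cnj \<epsilon> ^ 2) * z)) = 
        pconst (cnj \<epsilon> * \<epsilon>) * zb ^ 2 - pconst (cnj \<epsilon> ^ 4) * z ^ 2 + pconst (cnj \<epsilon> ^ 2 - cnj \<epsilon> ^ 3 * \<epsilon>) * (z * zb)"
        by (rule ext) (simp add: ell_def fun_apply pconst_def power_fun_apply algebra_simps eval_nat_numeral)
      then have X: "ell \<epsilon> * (pconst (cnj \<epsilon>) * (zb - pconst (cnj \<epsilon> ^ 2) * z)) = zb ^ 2 - pconst (cnj \<epsilon> ^ 4) * z ^ 2"
        unfolding c c3 by simp
      have "ell \<epsilon> * q t \<epsilon> = AA 1 * (ell \<epsilon> * (pconst (cnj \<epsilon>) * (zb - pconst (cnj \<epsilon> ^ 2) * z)))"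
        by (simp add: q_def False mult_ac)
      then show ?thesis unfolding X r unfolding t by (simp add: algebra_simps)
    qed
  qed
  have c: "cnj \<epsilon> * \<epsilon> = 1" if "\<epsilon> \<in> E 1" for \<epsilon> using E_cnj(2)[OF _ that] by simp
  have S1: "(\<Sum>\<epsilon>\<in>E 1. pconst (cnj \<epsilon>) * q 1 \<epsilon>) = pconst 12 * nsq ^ 2"
  proof -
    have "pconst (cnj \<epsilon>) * q 1 \<epsilon> = pconst 2 * nsq ^ 2 + pconst (cnj \<epsilon> ^ 4) * z ^ 4 - pconst (\<epsilon> ^ 2) * (z * zb ^ 3) -
      pconst (cnj \<epsilon> ^ 2) * (z ^ 3 * zb) + pconst (\<epsilon> ^ 4) * zb ^ 4" if "\<epsilon> \<in> E 1" for \<epsilon>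
    proof -
      have c3: "cnj \<epsilon> * \<epsilon> ^ 3 = \<epsilon> ^ 2" "cnj \<epsilon> * \<epsilon> ^ 5 = \<epsilon> ^ 4" "cnj \<epsilon> ^ 5 * \<epsilon> = cnj \<epsilon> ^ 4"
        "cnj \<epsilon> ^ 5 * \<epsilon> ^ 3 = cnj \<epsilon> ^ 2" "cnj \<epsilon> ^ 5 * \<epsilon> ^ 5 = 1"
      proof -
        have C: "cnj \<epsilon> * (\<epsilon> * x) = x" for x using c[OF that] by (simp flip: mult.assoc)
        show "cnj \<epsilon> * \<epsilon> ^ 3 = \<epsilon> ^ 2" "cnj \<epsilon> * \<epsilon> ^ 5 = \<epsilon> ^ 4" "cnj \<epsilon> ^ 5 * \<epsilon> = cnj \<epsilon> ^ 4"
          "cnj \<epsilon> ^ 5 * \<epsilon> ^ 3 = cnj \<epsilon> ^ 2" "cnj \<epsilon> ^ 5 * \<epsilon> ^ 5 = 1"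
          by (simp_all add: eval_nat_numeral mult.assoc C c[OF that])
      qed
      have "pconst (cnj \<epsilon>) * q 1 \<epsilon> = pconst (cnj \<epsilon> * \<epsilon> + cnj \<epsilon> ^ 5 * \<epsilon> ^ 5) * (z * zb) ^ 2 + pconst (cnj \<epsilon> ^ 5 * \<epsilon>) * z ^ 4 -
         pconst (cnj \<epsilon> * \<epsilon> ^ 3) * (z * zb ^ 3) - pconst (cnj \<epsilon> ^ 5 * \<epsilon> ^ 3) * (z ^ 3 * zb) + pconst (cnj \<epsilon> * \<epsilon> ^ 5) * zb ^ 4"
        by (rule ext) (simp add: q_def QQ_def fun_apply pconst_def power_fun_apply algebra_simps eval_nat_numeral)
      then show ?thesis unfolding c3 c[OF that] nsq_z by simp
    qed
    then have "(\<Sum>\<epsilon>\<in>E 1. pconst (cnj \<epsilon>) * q 1 \<epsilon>) = (\<Sum>\<epsilon>\<in>E 1. pconst 2 * nsq ^ 2 + pconst (cnj \<epsilon> ^ 4) * z ^ 4 -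
        pconst (\<epsilon> ^ 2) * (z * zb ^ 3) - pconst (cnj \<epsilon> ^ 2) * (z ^ 3 * zb) + pconst (\<epsilon> ^ 4) * zb ^ 4)"
      by (intro sum.cong HOL.refl) blast
    also have "\<dots> = of_nat (card (E 1)) * (pconst 2 * nsq ^ 2) + pconst (\<Sum>\<epsilon>\<in>E 1. cnj \<epsilon> ^ 4) * z ^ 4 -
        pconst (\<Sum>\<epsilon>\<in>E 1. \<epsilon> ^ 2) * (z * zb ^ 3) - pconst (\<Sum>\<epsilon>\<in>E 1. cnj \<epsilon> ^ 2) * (z ^ 3 * zb) + pconst (\<Sum>\<epsilon>\<in>E 1. \<epsilon> ^ 4) * zb ^ 4"
      by (simp add: sum.distrib sum_subtractf sum_distrib_right pconst_sum)
    also have "\<dots> = pconst (6 * 2) * nsq ^ 2"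
      using card_E[of 1] E_sums[of 1] by (simp only: pconst_mult) (simp add: pconst_numeral)
    finally show ?thesis by simp
  qed
  have S2: "(\<Sum>\<epsilon>\<in>E (-1). pconst (cnj \<epsilon>) * q (-1) \<epsilon>) = 0"
  proof -
    have "pconst (cnj \<epsilon>) * q (-1) \<epsilon> = pconst (cnj \<epsilon> ^ 2) * (AA 1 * zb) - pconst (cnj \<epsilon> ^ 4) * (AA 1 * z)" for \<epsilon>
      by (rule ext) (simp add: q_def fun_apply pconst_def algebra_simps eval_nat_numeral)
    then have "(\<Sum>\<epsilon>\<in>E (-1). pconst (cnj \<epsilon>) * q (-1) \<epsilon>) =
        pconst (\<Sum>\<epsilon>\<in>E (-1). cnj \<epsilon> ^ 2) * (AA 1 * zb) - pconst (\<Sum>\<epsilon>\<in>E (-1). cnj \<epsilon> ^ 4) * (AA 1 * z)"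
      by (simp add: sum_subtractf sum_distrib_right pconst_sum)
    then show ?thesis using E_sums(3,4)[of "-1"] by simp
  qed
  have "TZ ?f = dz ?f + pconst (1/2) * (\<Sum>t\<in>sg. pconst (kval t) * (\<Sum>\<epsilon>\<in>E t. pconst (cnj \<epsilon>) * q t \<epsilon>))"
    by (rule TZ_general(1)[OF f q])
  also have "(\<Sum>t\<in>sg. pconst (kval t) * (\<Sum>\<epsilon>\<in>E t. pconst (cnj \<epsilon>) * q t \<epsilon>)) = pconst (kval 1) * (pconst 12 * nsq ^ 2)"
  proof -
    have "(\<Sum>t\<in>sg. F t) = F 1 + F (- 1)" for F :: "complex \<Rightarrow> 'n pfun" by simp
    then show ?thesis by (simp only: S1 S2) simp
  qed
  also have "dz ?f = pconst 3 * nsq ^ 2"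
  proof -
    have "dz (zb ^ 2) = 0" by (simp add: dz_power[OF zb_poly])
    then show ?thesis
      using dz_mult(1)[OF poly_space_power[OF zb_poly] AA_poly, of 2 1]
      by (simp add: dz_AA1 nsq_z power_mult_distrib mult_ac)
  qed
  also have "kval 1 = ks" by (simp add: kval_def)
  finally have T0: "TZ ?f = pconst 3 * nsq ^ 2 + pconst (1/2) * (pconst ks * (pconst 12 * nsq ^ 2))" .
  have T: "TZ ?f = pconst (3 + 6 * ks) * nsq ^ 2"
    unfolding T0 by (rule ext) (simp add: fun_apply pconst_def algebra_simps)
  have "TZb uu = pconst 6 * ?f"
    unfolding TZ_invariant(2)[OF uu_invariant] dz_uu by (simp only: mult.assoc)
  then have "Lam uu = pconst 6 * TZ ?f" unfolding Lam_def using TZ_linear(1)[OF f] by simp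
  also have "\<dots> = pconst (6 * (3 + 6 * ks)) * nsq ^ 2" unfolding T by (simp only: pconst_mult mult.assoc)
  also have "6 * (3 + 6 * ks) = 18 * (1 + 2 * ks)" by simp
  finally show ?thesis .
qed

text \<open>For i \<ge> 1 the factor vanishes exactly when \<open>ks\<close> = 1/2 - i: this is the
  origin of the half-integers.\<close>

lemma Lam_uu_power:
  "Lam (uu ^ i) = pconst (18 * of_nat i * (2 * ks + 2 * of_nat i - 1)) * uu ^ (i - 1) * nsq ^ 2"
proof -
  have "Lam (uu ^ i) = pconst (of_nat i * (18 * (1 + 2 * ks)) + 72 * of_nat (i * (i - 1) div 2)) * uu ^ (i - 1) * nsq ^ 2"
  proof (rule Lam_power[OF uu_invariant Lam_uu])
    show "dz uu * dzb uu + dzb uu * dz uu = pconst 72 * uu * nsq\<^sup>2"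
      unfolding dz_uu unfolding uu_def nsq_z
      by (rule ext) (simp add: fun_apply pconst_def power_fun_apply algebra_simps power2_eq_square)
  qed
  moreover have "of_nat i * (18 * (1 + 2 * ks)) + 72 * of_nat (i * (i - 1) div 2) = 18 * of_nat i * (2 * ks + 2 * of_nat i - 1)"
  proof -
    have "2 * (i * (i - 1) div 2) = i * (i - 1)" by (cases i) auto
    then have "2 * of_nat (i * (i - 1) div 2) = (of_nat (i * (i - 1)) :: complex)" by (metis of_nat_mult of_nat_numeral)
    moreover have "of_nat (i * (i - 1)) = (of_nat i * (of_nat i - 1) :: complex)" by (cases i) (auto simp: algebra_simps)
    ultimately have "72 * of_nat (i * (i - 1) div 2) = (36 * (of_nat i * (of_nat i - 1)) :: complex)" by simp
    then show ?thesis by (simp add: algebra_simps)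
  qed
  ultimately show ?thesis by simp
qed

text \<open>The derivatives of \<open>nsq\<close> are zb and z, so the mixed gradient term is
  Euler's identity for \<open>uu\<close>, of degree 6.\<close>

lemma Lam_uu_nsq:
  "Lam (uu ^ i * nsq ^ j) = pconst (18 * of_nat i * (2 * ks + 2 * of_nat i - 1)) * (uu ^ (i - 1) * nsq ^ (j + 2)) +
     pconst (of_nat j * (of_nat j + zeta + 6 * of_nat i)) * (uu ^ i * nsq ^ (j - 1))"
proof -
  have U: "uu \<in> poly_space" using uu_invariant by (simp add: invariant_def)
  have n: "dz nsq = zb" "dzb nsq = z" by (simp_all add: nsq_z dz_mult z_poly zb_poly)
  have up: "pconst (of_nat i) * uu ^ (i - 1) * uu = pconst (of_nat i) * uu ^ i"
    by (cases i) (simp_all add: mult_ac)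
  have cross: "dz (uu ^ i) * dzb (nsq ^ j) + dzb (uu ^ i) * dz (nsq ^ j) =
      pconst (6 * of_nat i * of_nat j) * (uu ^ i * nsq ^ (j - 1))"
  proof -
    have "dz uu * z + dzb uu * zb = pconst 6 * uu"
      unfolding dz_uu unfolding uu_def AA_def
      by (rule ext) (simp add: fun_apply pconst_def power_fun_apply algebra_simps power2_eq_square power3_eq_cube)
    moreover have "dz (uu ^ i) * dzb (nsq ^ j) + dzb (uu ^ i) * dz (nsq ^ j) =
      (pconst (of_nat i) * uu ^ (i - 1)) * (pconst (of_nat j) * nsq ^ (j - 1)) * (dz uu * z + dzb uu * zb)"
      unfolding dz_power[OF U] dz_power[OF nsq_closed] n by (simp add: algebra_simps)
    ultimately have "dz (uu ^ i) * dzb (nsq ^ j) + dzb (uu ^ i) * dz (nsq ^ j) =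
      (pconst (of_nat i) * uu ^ (i - 1) * uu) * (pconst 6 * pconst (of_nat j) * nsq ^ (j - 1))" by (simp only: mult_ac)
    then show ?thesis unfolding up by (simp only: pconst_mult mult_ac)
  qed
  have "Lam (uu ^ i * nsq ^ j) = uu ^ i * Lam (nsq ^ j) + nsq ^ j * Lam (uu ^ i) + pconst (6 * of_nat i * of_nat j) * (uu ^ i * nsq ^ (j - 1))"
    unfolding cross[symmetric] by (rule Lam_mult[OF invariant_power[OF uu_invariant] invariant_power[OF nsq_invariant]])
  also have "nsq ^ j * Lam (uu ^ i) = pconst (18 * of_nat i * (2 * ks + 2 * of_nat i - 1)) * (uu ^ (i - 1) * nsq ^ (j + 2))"
    unfolding Lam_uu_power power_add by (simp only: mult_ac)
  also have "uu ^ i * Lam (nsq ^ j) = pconst (of_nat j * (of_nat j + zeta)) * (uu ^ i * nsq ^ (j - 1))"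
    unfolding Lam_nsq_power by (simp only: mult_ac)
  finally have L: "Lam (uu ^ i * nsq ^ j) = pconst (of_nat j * (of_nat j + zeta)) * (uu ^ i * nsq ^ (j - 1)) +
      pconst (18 * of_nat i * (2 * ks + 2 * of_nat i - 1)) * (uu ^ (i - 1) * nsq ^ (j + 2)) +
      pconst (6 * of_nat i * of_nat j) * (uu ^ i * nsq ^ (j - 1))" .
  have "of_nat j * (of_nat j + zeta + 6 * of_nat i) = of_nat j * (of_nat j + zeta) + 6 * of_nat i * of_nat j"
    by (simp add: algebra_simps)
  then show ?thesis unfolding L by (simp only: pconst_add distrib_right add_ac)
qed

lemma homogeneous_uu_nsq: "homogeneous (2 * (3 * i + j)) (uu ^ i * nsq ^ j)"
proof -
  have "homogeneous (1 * 3) (AA 1)"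
    using homogeneous_power[OF homogeneous_z(1), of 3] homogeneous_power[OF homogeneous_z(2), of 3]
    unfolding AA_def by (intro homogeneous_add homogeneous_cmult) simp_all
  then have "homogeneous (1 * 3 * 2 * i) (uu ^ i)" unfolding uu_def by (intro homogeneous_power)
  from homogeneous_mult[OF this homogeneous_nsq_power[of j]] show ?thesis by (simp add: algebra_simps)
qed

text \<open>Measured by half the degree, there are three regimes: down to 3 r all monomials in
  \<open>uu\<close> and \<open>nsq\<close> descend together, the step from 3 r to 3 r - 1 uses the
  coefficients with \<open>ks\<close>, and below that the powers of \<open>nsq\<close>
  suffice.\<close>

lemma cofinite_imp_half_integer:
  assumes zeta: "zeta = - of_nat (3 * r)" and "r \<ge> 1" and cof: "cofinite_radical (\<lambda>_. mat 1 :: complex ^ 1 ^ 1)"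
  shows "\<exists>i. 1 \<le> i \<and> i \<le> r \<and> 2 * ks + 2 * of_nat i - 1 = 0"
proof (rule ccontr)
  assume no: "\<not> ?thesis"
  have P: "uu ^ i * nsq ^ j \<in> poly_space" for i j
    using uu_invariant nsq_closed by (simp add: invariant_def poly_space_mult poly_space_power)
  obtain N where N: "\<And>d f. d \<ge> N \<Longrightarrow> homogeneous d f \<Longrightarrow> f \<in> srad"
    using cof unfolding cofinite_triv_iff by blast
  \<comment> \<open>The Laplacian also produces a monomial with one factor \<open>uu\<close> less,
    hence the inner induction on i. With e = 3 i + j the remaining coefficient has the factor e + 1
    - 3 r + 3 i, which is positive.\<close>
  have step: "\<forall>i j. 3 * i + j = e \<longrightarrow> uu ^ i * nsq ^ j \<in> srad"
    if e: "3 * r \<le> e" and up: "\<forall>i j. 3 * i + j = Suc e \<longrightarrow> uu ^ i * nsq ^ j \<in> srad" for e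
  proof (intro allI)
    fix i j show "3 * i + j = e \<longrightarrow> uu ^ i * nsq ^ j \<in> srad"
    proof (induction i arbitrary: j)
      case (Suc i)
      show ?case
      proof
        assume s: "3 * Suc i + j = e"
        let ?c = "of_nat (Suc j) * (of_nat (Suc j) + zeta + 6 * of_nat (Suc i)) :: complex"
        have "Lam (uu ^ Suc i * nsq ^ Suc j) \<in> srad" by (rule srad_Lam, rule up[rule_format]) (use s in simp)
        moreover have "pconst c * (uu ^ (Suc i - 1) * nsq ^ (Suc j + 2)) \<in> srad" for c
          using Suc.IH[of "Suc j + 2"] s by (intro srad_mult[OF poly_space_pconst]) (simp del: power_Suc)
        ultimately have "Lam (uu ^ Suc i * nsq ^ Suc j) - pconst (18 * of_nat (Suc i) * (2 * ks + 2 * of_nat (Suc i) - 1)) * (uu ^ (Suc i - 1) * nsq ^ (Suc j + 2)) \<in> srad"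
          by (rule srad_diff)
        then have "pconst ?c * (uu ^ Suc i * nsq ^ j) \<in> srad"
          unfolding Lam_uu_nsq by (simp only: add_diff_cancel_left' diff_Suc_1)
        moreover have "?c \<noteq> 0"
        proof -
          obtain x where x: "e = 3 * r + x" using e le_Suc_ex by blast
          have "of_nat (3 * Suc i + j) = (of_nat (3 * r + x) :: complex)" by (simp only: s x)
          then have "(of_nat j :: complex) = 3 * of_nat r + of_nat x - 3 - 3 * of_nat i" by (simp add: algebra_simps)
          then have "of_nat (Suc j) + zeta + 6 * of_nat (Suc i) = of_nat (Suc (x + 3 * Suc i))"
            by (simp add: zeta algebra_simps)
          then show ?thesis by (simp only: mult_eq_0_iff of_nat_neq_0) simp
        qed
        ultimately show "uu ^ Suc i * nsq ^ j \<in> srad" by (rule srad_cancel)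
      qed
    next
      case 0
      show ?case
      proof
        assume s: "3 * 0 + j = e"
        let ?c = "of_nat (Suc j) * (of_nat (Suc j) + zeta) :: complex"
        have "Lam (uu ^ 0 * nsq ^ Suc j) \<in> srad" by (rule srad_Lam, rule up[rule_format]) (use s in simp)
        then have "pconst ?c * (uu ^ 0 * nsq ^ j) \<in> srad" unfolding Lam_uu_nsq by simp
        moreover have "?c \<noteq> 0"
        proof -
          obtain x where x: "e = 3 * r + x" using e le_Suc_ex by blast
          have "of_nat (Suc j) + zeta = of_nat (Suc x)" using s by (simp add: zeta x)
          then show ?thesis by (simp only: mult_eq_0_iff of_nat_neq_0) simp
        qed
        ultimately show "uu ^ 0 * nsq ^ j \<in> srad" by (rule srad_cancel)
      qed
    qed
  qed
  have all: "\<forall>i j. 3 * i + j = 3 * r \<longrightarrow> uu ^ i * nsq ^ j \<in> srad"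
  proof (rule inc_induct[of "3 * r" "3 * r + N"])
    show "\<forall>i j. 3 * i + j = 3 * r + N \<longrightarrow> uu ^ i * nsq ^ j \<in> srad"
      using N[OF _ homogeneous_uu_nsq] by simp
  qed (auto intro: step[rule_format])
  \<comment> \<open>The step from 3 r to 3 r - 1, starting with \<open>uu ^ r\<close>. Each
    Laplacian exchanges one more factor \<open>uu\<close> for three factors \<open>nsq\<close>; its
    other term is the monomial obtained just before.\<close>
  have low: "l < r \<Longrightarrow> uu ^ (r - Suc l) * nsq ^ (3 * l + 2) \<in> srad" for l
  proof (induction l)
    case 0
    have "Lam (uu ^ r * nsq ^ 0) \<in> srad" by (rule srad_Lam, rule all[rule_format]) simp
    then have "pconst (18 * of_nat r * (2 * ks + 2 * of_nat r - 1)) * (uu ^ (r - 1) * nsq ^ (0 + 2)) \<in> srad"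
      unfolding Lam_uu_nsq by simp
    moreover have "18 * of_nat r * (2 * ks + 2 * of_nat r - 1) \<noteq> 0" using no assms(2) by auto
    ultimately have "uu ^ (r - 1) * nsq ^ (0 + 2) \<in> srad" by (rule srad_cancel)
    then show ?case by simp
  next
    case (Suc l)
    define i where "i = r - Suc l"
    let ?j = "3 * Suc l"
    have i: "1 \<le> i" "i \<le> r" "i - 1 = r - Suc (Suc l)" and ij: "3 * i + ?j = 3 * r"
      using Suc.prems by (auto simp: i_def)
    have j: "?j - 1 = 3 * l + 2" by simp
    have IH: "uu ^ i * nsq ^ (?j - 1) \<in> srad"
      unfolding j i_def by (rule Suc.IH) (use Suc.prems in simp)
    have "Lam (uu ^ i * nsq ^ ?j) \<in> srad" by (rule srad_Lam, rule all[rule_format], rule ij)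
    then have "Lam (uu ^ i * nsq ^ ?j) - pconst (of_nat ?j * (of_nat ?j + zeta + 6 * of_nat i)) * (uu ^ i * nsq ^ (?j - 1)) \<in> srad"
      using srad_mult[OF poly_space_pconst IH] by (rule srad_diff)
    then have "pconst (18 * of_nat i * (2 * ks + 2 * of_nat i - 1)) * (uu ^ (i - 1) * nsq ^ (?j + 2)) \<in> srad"
      unfolding Lam_uu_nsq by (simp only: add_diff_cancel_right')
    moreover have "2 * ks + 2 * of_nat i - 1 \<noteq> 0" "of_nat i \<noteq> (0 :: complex)" using no i by auto
    then have "18 * of_nat i * (2 * ks + 2 * of_nat i - 1) \<noteq> 0" by (simp only: mult_eq_0_iff) simp
    ultimately have "uu ^ (i - 1) * nsq ^ (?j + 2) \<in> srad" by (rule srad_cancel)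
    then show ?case unfolding i(3) .
  qed
  have "3 * (r - 1) + 2 = 3 * r - 1" "r - Suc (r - 1) = 0" using assms(2) by auto
  then have top: "nsq ^ (3 * r - 1) \<in> srad" using low[of "r - 1"] assms(2) by simp
  \<comment> \<open>The factors m + 1 - 3 r are nonzero below 3 r, so the powers of
    \<open>nsq\<close> lead down to 1.\<close>
  have "nsq ^ 0 \<in> srad"
  proof (rule inc_induct[of 0 "3 * r - 1"])
    fix m assume m: "m < 3 * r - 1" "nsq ^ Suc m \<in> srad"
    then have "pconst (of_nat (Suc m) * (of_nat (Suc m) + zeta)) * nsq ^ m \<in> srad"
      using srad_Lam[OF m(2)] unfolding Lam_nsq_power by simp
    moreover have "of_nat (Suc m) * (of_nat (Suc m) + zeta) \<noteq> 0"
    proof -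
      have "of_nat (Suc m) \<noteq> (of_nat (3 * r) :: complex)" using m(1) unfolding of_nat_eq_iff by linarith
      then show ?thesis unfolding zeta using of_nat_neq_0[of m, where 'a=complex] by (simp del: of_nat_Suc of_nat_mult)
    qed
    ultimately show "nsq ^ m \<in> srad" by (rule srad_cancel)
  qed (use top in auto)
  then show False using srad_pconst[of 1] by simp
qed

theorem cofinite_triv:
  "cofinite_radical (\<lambda>_. mat 1 :: complex ^ 1 ^ 1) \<longleftrightarrow>
    (\<exists>n::nat. n \<ge> 1 \<and> zeta = - of_nat n \<and>
       (\<not> 3 dvd n \<or> (\<exists>a b::nat. ks = - 1 / 2 - of_nat a \<and> kl = - 1 / 2 - of_nat b)))"
proof
  assume cof: "cofinite_radical (\<lambda>_. mat 1 :: complex ^ 1 ^ 1)"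
  then obtain n where n: "n \<ge> 1" "zeta = - of_nat n"
    using cofinite_imp_central[OF weyl_rep_triv central_triv] by blast
  have "\<exists>a b::nat. ks = - 1 / 2 - of_nat a \<and> kl = - 1 / 2 - of_nat b" if "3 dvd n"
  proof -
    from that obtain r where r: "n = 3 * r" by (elim dvdE)
    obtain i where i: "1 \<le> i" "i \<le> r" "2 * ks + 2 * of_nat i - 1 = 0"
    proof -
      have "zeta = - of_nat (3 * r)" "r \<ge> 1" using n r by simp_all
      from cofinite_imp_half_integer[OF this cof] show ?thesis using that by blast
    qed
    have k: "ks = 1 / 2 - of_nat i" using i(3) by (simp add: field_simps)
    have "3 * (ks + kl) = 3 * (- of_nat r)" using n(2) unfolding zeta_def r by simp
    then have "ks + kl = - of_nat r" by (simp only: mult_cancel_left) simp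
    \<comment> \<open>The bound i \<le> r turns this value into a negative half-integer.\<close>
    then have "kl = - of_nat r - ks" by (simp add: eq_diff_eq add.commute)
    then have "kl = - 1 / 2 - of_nat (r - i)" unfolding k using i(2) by (simp add: of_nat_diff field_simps)
    moreover have "ks = - 1 / 2 - of_nat (i - 1)" unfolding k using i(1) by (simp add: of_nat_diff field_simps)
    ultimately show ?thesis by blast
  qed
  then show "\<exists>n::nat. n \<ge> 1 \<and> zeta = - of_nat n \<and>
       (\<not> 3 dvd n \<or> (\<exists>a b::nat. ks = - 1 / 2 - of_nat a \<and> kl = - 1 / 2 - of_nat b))"
    using n by blast
next
  assume "\<exists>n::nat. n \<ge> 1 \<and> zeta = - of_nat n \<and>
       (\<not> 3 dvd n \<or> (\<exists>a b::nat. ks = - 1 / 2 - of_nat a \<and> kl = - 1 / 2 - of_nat b))"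
  then show "cofinite_radical (\<lambda>_. mat 1 :: complex ^ 1 ^ 1)"
    by (elim exE conjE disjE) ((rule cofinite_not_dvd cofinite_half_integers; assumption)+)
qed

end

section \<open>Finite-dimensionality criteria\<close>

lemma trace_mat: "trace (mat c :: complex ^ 'm::finite ^ 'm) = of_nat CARD('m) * c"
  by (simp add: trace_def mat_def)

lemma mat_vector_mult: "mat c *v v = c *s v" for c :: complex
  by (simp add: vec_eq_iff matrix_vector_mult_def mat_def if_distrib[of "\<lambda>x. x * _"] cong: if_cong)

lemma triv_rep_eq: "triv_rep = (\<lambda>_. mat 1)"
  by (rule ext) (simp add: triv_rep_def)

lemma subspace_complex1:
  assumes "vec.subspace (U :: (complex ^ 1) set)" shows "U = {0} \<or> U = UNIV"
proof (cases "\<exists>u\<in>U. u \<noteq> 0")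
  case True
  then obtain u where u: "u \<in> U" "u $ 1 \<noteq> 0" by (auto simp: vec_eq_iff)
  have "x = (x $ 1 / u $ 1) *s u" for x using u(2) by (simp add: vec_eq_iff)
  then have "x \<in> U" for x using vec.subspace_scale[OF assms u(1)] by metis
  then show ?thesis by auto
next
  case False
  then show ?thesis using vec.subspace_0[OF assms] by auto
qed

context dunkl_setting
begin

lemma very_singular_cofinite:
  "very_singular R Rp k \<longleftrightarrow> cofinite_radical (\<lambda>_. mat 1 :: complex ^ 1 ^ 1)"
proof -
  have c: "central_scalar (\<lambda>_. mat 1 :: complex ^ 1 ^ 1) (\<Sum>\<alpha>\<in>R. k \<alpha> / 2)"
    by (simp add: central_scalar_def vec.scale_sum_left[symmetric])
  show ?thesis unfolding very_singular_def triv_rep_eq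
    by (rule finite_dim_L_iff[OF weyl_rep_triv subspace_complex1 c])
qed

lemma irreducible_rep_weyl_rep:
  assumes "irreducible_rep R \<rho>"
  shows "weyl_rep \<rho>"
    and "\<And>U. vec.subspace U \<Longrightarrow> (\<And>w u. w \<in> W \<Longrightarrow> u \<in> U \<Longrightarrow> \<rho> w *v u \<in> U) \<Longrightarrow> U = {0} \<or> U = UNIV"
  using assms by (auto simp: irreducible_rep_def weyl_rep_def)

text \<open>Conjugate elements have equal values under a homomorphism into a commutative group; this
  makes the twisted multiplicity W-invariant.\<close>

lemma linear_character_conj:
  assumes "linear_character R ch" "w \<in> W" "\<alpha> \<in> R"
  shows "ch (reflection (w \<alpha>)) = ch (reflection \<alpha>)"
proof -
  have m: "u \<in> W \<Longrightarrow> v \<in> W \<Longrightarrow> ch (u \<circ> v) = ch u * ch v" for u v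
    using assms(1) by (simp add: linear_character_def)
  have "w \<circ> inv_into UNIV w = id" using assms(2) by (auto simp: fun_eq_iff)
  then have "ch w * ch (inv_into UNIV w) = 1"
    using m[OF assms(2) W_inv[OF assms(2)]] assms(1) by (simp add: linear_character_def)
  then have nz: "ch w \<noteq> 0" by auto
  have "ch (reflection (w \<alpha>)) * ch w = ch (reflection \<alpha>) * ch w"
    using m[OF reflection_W[OF W_R[OF assms(2,3)]] assms(2)] m[OF assms(2) reflection_W[OF assms(3)]]
      reflection_W_conj[OF assms(2), of \<alpha>] by (metis mult.commute)
  then show ?thesis by (metis nz mult_right_cancel)
qed

lemma twisted_multiplicity_invariant:
  assumes "linear_character R ch"
  shows "multiplicity_function R (twisted_multiplicity ch k)"
  unfolding multiplicity_function_def
  by (simp add: twisted_multiplicity_def linear_character_conj[OF assms] k_W)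

lemma mat_act_mat: "mat_act (mat c) G = vmul (pconst c) G"
  by (rule ext, rule ext)
    (simp add: mat_act_def vmul_def mat_def sum_fun_apply fun_apply pconst_def if_distrib[of "\<lambda>x. x * _"] cong: if_cong)

text \<open>A one-dimensional representation enters the Dunkl operators only through
  \<open>ch (reflection \<alpha>)\<close>, which can be absorbed into the multiplicity. The two
  settings then have the same operators and hence the same radical.\<close>

theorem finite_dim_linear_character:
  fixes \<rho> :: "(real ^ 'n \<Rightarrow> real ^ 'n) \<Rightarrow> complex ^ 'm::finite ^ 'm"
  assumes ch: "linear_character R ch" and irr: "irreducible_rep R \<rho>" and char: "has_character R \<rho> ch"
  shows "finite_dim (L_module R Rp k \<rho>) \<longleftrightarrow> very_singular R Rp (twisted_multiplicity ch k)"
proof -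
  have id: "id \<in> W" by (rule weyl_group.id)
  \<comment> \<open>The trace at the identity shows that the index type has a single
    element.\<close>
  have "of_nat CARD('m) = trace (mat 1 :: complex ^ 'm ^ 'm)" by (simp add: trace_mat)
  also have "mat 1 = \<rho> id" using irr by (simp add: irreducible_rep_def)
  also have "trace (\<rho> id) = ch id" using char id by (simp add: has_character_def)
  also have "ch id = 1" using ch by (simp add: linear_character_def)
  finally have "of_nat CARD('m) = (1 :: complex)" .
  then have "CARD('m) = 1" by (metis of_nat_1 of_nat_eq_iff)
  then obtain i0 :: 'm where U: "(UNIV :: 'm set) = {i0}" by (auto simp: card_1_singleton_iff)
  then have all_eq: "i = i0" for i :: 'm by auto
  have \<rho>: "\<rho> w = mat (ch w)" if "w \<in> W" for w
  proof -
    have "trace (\<rho> w) = \<rho> w $ i0 $ i0" by (simp add: trace_def U)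
    then have "\<rho> w $ i0 $ i0 = ch w" using char that by (simp add: has_character_def)
    then have "\<rho> w $ i $ j = mat (ch w) $ i $ j" for i j
      unfolding all_eq[of i] all_eq[of j] by (simp add: mat_def)
    then show ?thesis by (simp add: vec_eq_iff)
  qed
  interpret T: dunkl_setting R e1 e2 "twisted_multiplicity ch k" Rp
    by unfold_locales (rule finite_R zero_notin_R span_R orthonormal coordinates positive
        twisted_multiplicity_invariant[OF ch] | erule (1) reflection_R)+
  have vT: "vT \<rho> v F = T.vT (\<lambda>_. mat 1) v F" for v F
  proof -
    have X: "vmul (pconst (dunkl_coeff \<alpha> v)) (mat_act (\<rho> (reflection \<alpha>)) G) =
        vmul (pconst (T.dunkl_coeff \<alpha> v)) (mat_act (mat 1) G)" if "\<alpha> \<in> R" for \<alpha> G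
      unfolding \<rho>[OF reflection_W[OF that]] mat_act_mat
      by (rule ext, rule ext) (simp add: vmul_def fun_apply pconst_def dunkl_coeff_def T.dunkl_coeff_def twisted_multiplicity_def)
    show ?thesis unfolding vT_def T.vT_def
      by (rule arg_cong2[where f = "(+)", OF HOL.refl sum.cong[OF HOL.refl X]])
  qed
  have "form_radical \<rho> = T.form_radical (\<lambda>_. mat 1)"
    unfolding form_radical_def T.form_radical_def by (simp only: vT[abs_def])
  then have "cofinite_radical \<rho> \<longleftrightarrow> T.cofinite_radical (\<lambda>_. mat 1 :: complex ^ 'm ^ 'm)"
    unfolding cofinite_radical_def T.cofinite_radical_def by simp
  also have "\<dots> \<longleftrightarrow> T.cofinite_radical (\<lambda>_. mat 1 :: complex ^ 1 ^ 1)"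
    unfolding T.cofinite_triv_iff ..
  also have "\<dots> \<longleftrightarrow> very_singular R Rp (twisted_multiplicity ch k)"
    by (rule T.very_singular_cofinite[symmetric])
  finally have 1: "cofinite_radical \<rho> \<longleftrightarrow> very_singular R Rp (twisted_multiplicity ch k)" .
  have "central_scalar \<rho> (\<Sum>\<alpha>\<in>R. k \<alpha> / 2 * ch (reflection \<alpha>))"
    unfolding central_scalar_def vec.scale_sum_left
  proof (intro allI sum.cong HOL.refl)
    fix v \<alpha> assume "\<alpha> \<in> R"
    then show "(k \<alpha> / 2) *s (\<rho> (reflection \<alpha>) *v v) = (k \<alpha> / 2 * ch (reflection \<alpha>)) *s v"
      by (simp add: \<rho>[OF reflection_W] mat_vector_mult)
  qed
  from finite_dim_L_iff[OF irreducible_rep_weyl_rep[OF irr] this] 1 show ?thesis by simp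
qed

text \<open>The central element \<open>\<Sum>k\<^sub>\<alpha> r\<^sub>\<alpha>\<close> acts by a scalar, which the trace identifies as \<open>0\<close>, whereas on a
  finite-dimensional quotient the scalar has to be negative.\<close>

theorem infinite_dim_traceless:
  fixes \<rho> :: "(real ^ 'n \<Rightarrow> real ^ 'n) \<Rightarrow> complex ^ 'm::finite ^ 'm"
  assumes irr: "irreducible_rep R \<rho>" and tr: "\<And>\<alpha>. \<alpha> \<in> R \<Longrightarrow> trace (\<rho> (reflection \<alpha>)) = 0"
    and card: "CARD('m) = 2"
  shows "\<not> finite_dim (L_module R Rp k \<rho>)"
proof -
  note \<rho> = irreducible_rep_weyl_rep[OF irr]
  define A :: "complex ^ 'm ^ 'm" where "A = (\<chi> i j. \<Sum>\<alpha>\<in>R. k \<alpha> / 2 * \<rho> (reflection \<alpha>) $ i $ j)"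
  have Av: "A *v v = (\<Sum>\<alpha>\<in>R. (k \<alpha> / 2) *s (\<rho> (reflection \<alpha>) *v v))" for v
    by (simp add: vec_eq_iff A_def matrix_vector_mult_def sum_distrib_left sum_distrib_right mult.assoc sum.swap[of _ UNIV R])
  have trA: "trace A = 0"
  proof -
    have "trace A = (\<Sum>\<alpha>\<in>R. k \<alpha> / 2 * trace (\<rho> (reflection \<alpha>)))"
      by (simp add: trace_def A_def sum_distrib_left sum.swap[of _ UNIV R])
    then show ?thesis using tr by simp
  qed
  have comm: "\<rho> w *v (A *v v) = A *v (\<rho> w *v v)" if w: "w \<in> W" for w v
  proof -
    have "\<rho> w *v (A *v v) = (\<Sum>\<alpha>\<in>R. (k \<alpha> / 2) *s (\<rho> w *v (\<rho> (reflection \<alpha>) *v v)))"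
    proof -
      have "\<rho> w *v (\<Sum>\<alpha>\<in>S. f \<alpha>) = (\<Sum>\<alpha>\<in>S. \<rho> w *v f \<alpha>)" for S and f :: "real ^ 'n \<Rightarrow> complex ^ 'm"
        by (induction S rule: infinite_finite_induct) (simp_all add: matrix_vector_right_distrib)
      then show ?thesis unfolding Av by (simp add: vector_scalar_commute)
    qed
    also have "\<dots> = (\<Sum>\<alpha>\<in>R. (k (w \<alpha>) / 2) *s (\<rho> (reflection (w \<alpha>)) *v (\<rho> w *v v)))"
    proof (rule sum.cong[OF HOL.refl])
      fix \<alpha> assume \<alpha>: "\<alpha> \<in> R"
      have "\<rho> w ** \<rho> (reflection \<alpha>) = \<rho> (reflection (w \<alpha>)) ** \<rho> w"
        using weyl_repD[OF \<rho>(1) w reflection_W[OF \<alpha>]] weyl_repD[OF \<rho>(1) reflection_W[OF W_R[OF w \<alpha>]] w]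
          reflection_W_conj[OF w, of \<alpha>] by simp
      then show "(k \<alpha> / 2) *s (\<rho> w *v (\<rho> (reflection \<alpha>) *v v)) = (k (w \<alpha>) / 2) *s (\<rho> (reflection (w \<alpha>)) *v (\<rho> w *v v))"
        by (simp add: matrix_vector_mul_assoc k_W[OF w \<alpha>])
    qed
    also have "\<dots> = A *v (\<rho> w *v v)"
      unfolding Av by (rule sum.reindex_bij_betw[OF W_bij_R[OF w]])
    finally show ?thesis .
  qed
  obtain i j :: 'm where ij: "UNIV = {i, j}" "i \<noteq> j" using card by (auto simp: card_2_iff)
  \<comment> \<open>A traceless 2 by 2 matrix squares to the scalar given by minus its determinant.
    \<mu> is a square root of this scalar, so (A - \<mu>) (A + \<mu>) = 0.\<close>
  define \<mu> where "\<mu> = csqrt (A $ i $ i * A $ i $ i + A $ i $ j * A $ j $ i)"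
  have \<mu>: "\<mu> * \<mu> = A $ i $ i * A $ i $ i + A $ i $ j * A $ j $ i"
    unfolding \<mu>_def by (simp flip: power2_eq_square)
  have Ajj: "A $ j $ j = - (A $ i $ i)" using trA ij(2) by (simp add: trace_def ij(1) add_eq_0_iff)
  have ij_all: "x = i \<or> x = j" for x using ij(1) by auto
  have "(A *v (A *v v)) $ x = (\<mu> * \<mu>) * v $ x" for v x
    using ij_all[of x] ij(2) unfolding \<mu> by (auto simp: matrix_vector_mult_def ij(1) Ajj algebra_simps)
  then have sq: "A *v (A *v v) = (\<mu> * \<mu>) *s v" for v by (simp add: vec_eq_iff)
  have lin: "A *v (u + v) = A *v u + A *v v" "A *v (c *s v) = c *s (A *v v)" "A *v 0 = 0" for u v c
    by (simp_all add: matrix_vector_right_distrib vector_scalar_commute)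
  have eig: "{v. A *v v = c *s v} = {0} \<or> {v. A *v v = c *s v} = UNIV" for c
  proof (rule \<rho>(2))
    show "vec.subspace {v. A *v v = c *s v}"
      by (rule vec.subspaceI) (auto simp: lin vector_add_ldistrib vector_smult_assoc mult.commute)
    show "\<rho> w *v u \<in> {v. A *v v = c *s v}" if "w \<in> W" "u \<in> {v. A *v v = c *s v}" for w u
      using that comm[OF that(1), of u, symmetric] by (simp add: vector_scalar_commute)
  qed
  have scalar: "c = 0" if "\<And>v. A *v v = c *s v" for c
  proof -
    have "A = mat c"
      unfolding matrix_eq by (simp add: that mat_vector_mult)
    then have "trace A = 2 * c" by (simp add: trace_mat card)
    then show ?thesis using trA by simp
  qed
  \<comment> \<open>Schur's lemma by hand: the \<mu>-eigenspace is invariant, so A = \<mu> unless it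
    is 0. In the latter case the image of A + \<mu>, which consists of eigenvectors and 0, is 0 and
    A = - \<mu>. A traceless scalar is 0.\<close>
  have "A *v v = 0" for v
  proof (cases "{v. A *v v = \<mu> *s v} = UNIV")
    case True
    then have all: "A *v v = \<mu> *s v" for v by blast
    show ?thesis using all scalar[OF all] by simp
  next
    case False
    then have 0: "A *v u = \<mu> *s u \<Longrightarrow> u = 0" for u using eig[of \<mu>] by blast
    have "A *v v = (- \<mu>) *s v" for v
    proof -
      have "A *v (A *v v + \<mu> *s v) = \<mu> *s (A *v v + \<mu> *s v)"
        unfolding lin sq by (simp add: vector_add_ldistrib vector_smult_assoc add.commute)
      then have "A *v v + \<mu> *s v = 0" by (rule 0)
      then have "A *v v = - (\<mu> *s v)" by (simp only: eq_neg_iff_add_eq_0)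
      then show ?thesis by (simp only: vec.scale_minus_left)
    qed
    note all = this
    show ?thesis using all scalar[OF all] by simp
  qed
  then have c: "central_scalar \<rho> 0" by (simp add: central_scalar_def flip: Av)
  show ?thesis
  proof
    assume "finite_dim (L_module R Rp k \<rho>)"
    then have "cofinite_radical \<rho>" using finite_dim_L_iff[OF \<rho> c] by simp
    then obtain n :: nat where "n \<ge> 1" "0 = - (of_nat n :: complex)" by (rule cofinite_imp_central[OF \<rho>(1) c])
    then show False by simp
  qed
qed

text \<open>Parseval: the squared lengths of the standard basis vectors add up to the squared
  lengths of e1 and e2.\<close>

lemma card_n: "CARD('n) = 2"
proof -
  have "real CARD('n) = (\<Sum>i\<in>UNIV. axis i 1 \<bullet> (axis i 1 :: real ^ 'n))" by (simp add: inner_axis_axis)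
  also have "\<dots> = (\<Sum>i\<in>UNIV. e1 $ i * e1 $ i + e2 $ i * e2 $ i)"
  proof (rule sum.cong[OF HOL.refl])
    fix i :: 'n
    have "axis i 1 \<bullet> (axis i 1 :: real ^ 'n) = axis i 1 \<bullet> ((axis i 1 \<bullet> e1) *\<^sub>R e1 + (axis i 1 \<bullet> e2) *\<^sub>R e2)"
      using coordinates[of "axis i 1"] by simp
    then show "axis i 1 \<bullet> (axis i 1 :: real ^ 'n) = e1 $ i * e1 $ i + e2 $ i * e2 $ i"
      by (simp add: inner_add_right inner_axis')
  qed
  also have "\<dots> = e1 \<bullet> e1 + e2 \<bullet> e2" by (simp add: inner_vec_def sum.distrib)
  finally show ?thesis using orthonormal by simp
qed

text \<open>A reflection of the plane has eigenvalues 1 and - 1.\<close>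

lemma trace_reflection: assumes "\<alpha> \<in> R" shows "trace (matrix (reflection \<alpha>)) = 0"
proof -
  have "trace (matrix (reflection \<alpha>)) = (\<Sum>i\<in>UNIV. 1 - 2 / (\<alpha> \<bullet> \<alpha>) * (\<alpha> $ i * \<alpha> $ i))"
    unfolding trace_def
  proof (rule sum.cong[OF HOL.refl])
    show "matrix (reflection \<alpha>) $ i $ i = 1 - 2 / (\<alpha> \<bullet> \<alpha>) * (\<alpha> $ i * \<alpha> $ i)" for i
      by (simp add: matrix_def reflection_def inner_axis)
  qed
  also have "\<dots> = real CARD('n) - 2 / (\<alpha> \<bullet> \<alpha>) * (\<alpha> \<bullet> \<alpha>)"
    by (simp add: sum_subtractf inner_vec_def sum_distrib_left)
  finally show ?thesis using R_nonzero[OF assms] by (simp add: card_n)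
qed

lemma char_sgn_linear: "linear_character R char_sgn"
  by (auto simp: linear_character_def char_sgn_def matrix_id det_I matrix_compose W_linear det_mul)

lemma infinite_dim_std:
  fixes \<rho> :: "(real ^ 'n \<Rightarrow> real ^ 'n) \<Rightarrow> complex ^ 'm::finite ^ 'm"
  assumes irr: "irreducible_rep R \<rho>" and char: "has_character R \<rho> (\<lambda>w. ch w * char_std w)" and "ch id = 1"
  shows "\<not> finite_dim (L_module R Rp k \<rho>)"
proof (rule infinite_dim_traceless[OF irr])
  show "trace (\<rho> (reflection \<alpha>)) = 0" if "\<alpha> \<in> R" for \<alpha>
    using char reflection_W[OF that] trace_reflection[OF that] by (simp add: has_character_def char_std_def)
  have "trace (\<rho> id) = char_std (id :: real ^ 'n \<Rightarrow> real ^ 'n)"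
    using char weyl_group.id[of R] assms(3) by (simp add: has_character_def)
  moreover have "char_std (id :: real ^ 'n \<Rightarrow> real ^ 'n) = 2"
    by (simp add: char_std_def matrix_id_mat_1 trace_def mat_def card_n)
  moreover have "\<rho> id = mat 1" using irr by (simp add: irreducible_rep_def)
  ultimately have "of_nat CARD('m) = (2 :: complex)" by (simp add: trace_mat)
  then show "CARD('m) = 2" by (metis of_nat_eq_iff of_nat_numeral)
qed

end

section \<open>Roots as complex numbers\<close>

text \<open>The sixth roots of \<open>d ^ 6\<close> are d times powers of \<omega>, and these are
  also powers of its conjugate. The conjugate appears because it is the rotation given by the
  product of the two simple reflections.\<close>

lemma rotation_closed:
  assumes step: "\<And>c. P c \<Longrightarrow> P (cnj \<omega> * c)" and "P d" "d \<noteq> 0" "\<epsilon> ^ 6 = d ^ 6"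
  shows "P \<epsilon>"
proof -
  have "(\<epsilon> / d) ^ 6 = 1" using assms by (simp add: power_divide)
  then have "\<epsilon> / d \<in> (\<lambda>j. cis (2 * pi * real j / real 6)) ` {..<6}"
    using Complex.bij_betw_roots_unity[of 6] by (simp add: bij_betw_def)
  then obtain j where "\<epsilon> / d = cis (2 * pi * real j / real 6)" by blast
  also have "\<dots> = \<omega> ^ j" unfolding \<omega>_power by (simp add: mult.commute)
  finally have "\<epsilon> = \<omega> ^ j * d" using assms(3) by (simp add: field_simps)
  moreover have "\<omega> * cnj \<omega> = 1" by (simp add: \<omega>_def cis_mult cis_cnj)
  then have "\<omega> * (cnj \<omega> ^ 5 * cnj \<omega>) = cnj \<omega> ^ 5" by (simp add: mult.left_commute)
  moreover have "cnj \<omega> ^ 5 * cnj \<omega> = 1"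
  proof -
    have "cnj \<omega> ^ 5 * cnj \<omega> = cnj (\<omega> ^ 6)" by (simp only: complex_cnj_power power_Suc2[symmetric]) simp
    then show ?thesis by (simp add: \<omega>6)
  qed
  ultimately have e: "\<epsilon> = cnj \<omega> ^ (5 * j) * d" by (simp add: power_mult)
  have "P (cnj \<omega> ^ l * d)" for l
    by (induction l) (use step assms(2) in \<open>simp_all add: mult.assoc\<close>)
  then show ?thesis unfolding e .
qed

text \<open>p + q \<omega> is an Eisenstein integer of norm N, and s, t are Cartan numbers up to
  sign. Their integrality gives N dvd 3, which leaves the units (short roots) and the elements of
  norm 3 (long roots).\<close>

lemma Eisenstein_norm:
  fixes p q s t :: int
  assumes N: "N = p\<^sup>2 + p * q + q\<^sup>2" "N \<noteq> 0" and s: "2 * p + q = s * N" and t: "3 * p = t * N"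
  defines "\<epsilon> \<equiv> of_int p + of_int q * \<omega>"
  shows "N = 1 \<and> \<epsilon> ^ 6 = 1 \<or> N = 3 \<and> \<epsilon> ^ 6 = - 27"
proof -
  have 4: "4 * N = (2 * p + q)\<^sup>2 + 3 * q\<^sup>2" "4 * N = (2 * q + p)\<^sup>2 + 3 * p\<^sup>2"
    unfolding N(1) by (simp_all add: power2_eq_square algebra_simps)
  \<comment> \<open>The quadratic form is chosen so that its value at (3 p, 2 p + q) is 3 N.\<close>
  have "N * (N * (t\<^sup>2 - 3 * t * s + 3 * s\<^sup>2)) = (t * N)\<^sup>2 - 3 * (t * N) * (s * N) + 3 * (s * N)\<^sup>2"
    by (simp add: power2_eq_square algebra_simps)
  also have "\<dots> = N * 3"
    unfolding s[symmetric] t[symmetric] unfolding N(1) by (simp add: power2_eq_square algebra_simps)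
  finally have "N * (t\<^sup>2 - 3 * t * s + 3 * s\<^sup>2) = 3" using N(2) by simp
  then have "N dvd 3" by (metis dvd_triv_left)
  moreover have "N > 0" using 4(1) N(2) by (smt (verit) zero_le_power2)
  moreover have "N \<le> 3" using \<open>N dvd 3\<close> zdvd_imp_le by fastforce
  ultimately have "N \<in> {1, 2, 3}" "\<not> (2 :: int) dvd 3" by auto
  with \<open>N dvd 3\<close> have N13: "N = 1 \<or> N = 3" by auto
  have "3 * q\<^sup>2 \<le> 12" "3 * p\<^sup>2 \<le> 12" using 4 N13 zero_le_power2[of "2 * p + q"] zero_le_power2[of "2 * q + p"] by linarith+
  then have "q\<^sup>2 \<le> 2\<^sup>2" "p\<^sup>2 \<le> 2\<^sup>2" by simp_all
  then have "\<bar>q\<bar> \<le> 2" "\<bar>p\<bar> \<le> 2" by (simp_all only: abs_le_square_iff[symmetric])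
  \<comment> \<open>What remains is a finite check over the pairs (p, q).\<close>
  then have pq: "p \<in> {-2, -1, 0, 1, 2}" "q \<in> {-2, -1, 0, 1, 2}" by auto
  have sq: "\<epsilon> ^ 2 = of_int (p * p - q * q) + of_int (2 * p * q + q * q) * \<omega>"
  proof -
    have w: "\<omega> * \<omega> = \<omega> - 1" using \<omega>_quadratic by (simp add: power2_eq_square)
    have ww: "\<omega> * (\<omega> * x) = \<omega> * x - x" for x by (simp only: mult.assoc[symmetric] w) (simp add: algebra_simps)
    show ?thesis by (simp add: \<epsilon>_def power2_eq_square algebra_simps w ww)
  qed
  have w: "\<omega> ^ 2 = \<omega> - 1" "\<omega> ^ 3 = - 1" by (rule \<omega>_quadratic, rule \<omega>3)
  have c: "(a + b * \<omega>) ^ 3 = a ^ 3 + 3 * a\<^sup>2 * b * \<omega> + 3 * a * b\<^sup>2 * (\<omega> - 1) - b ^ 3" for a b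
  proof -
    have "(a + b * \<omega>) ^ 3 = a ^ 3 + 3 * a\<^sup>2 * b * \<omega> + 3 * a * b\<^sup>2 * \<omega> ^ 2 + b ^ 3 * \<omega> ^ 3"
      by (simp add: power2_eq_square power3_eq_cube algebra_simps)
    then show ?thesis by (simp add: w)
  qed
  have "\<epsilon> ^ 6 = (\<epsilon> ^ 2) ^ 3" by (simp flip: power_mult)
  then have six: "\<epsilon> ^ 6 = (of_int (p * p - q * q) + of_int (2 * p * q + q * q) * \<omega>) ^ 3" by (simp only: sq)
  show ?thesis
    unfolding six c using pq N13 N(1) by (elim insertE emptyE) (simp_all add: algebra_simps)
qed

lemma G2_roots:
  fixes R :: "(real ^ 'n::finite) set"
  assumes "root_system_G2 R"
  obtains e1 e2 :: "real ^ 'n" and r :: real and d :: complex where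
    "r > 0" "e1 \<bullet> e1 = 1" "e2 \<bullet> e2 = 1" "e1 \<bullet> e2 = 0" "\<And>x. x = (x \<bullet> e1) *\<^sub>R e1 + (x \<bullet> e2) *\<^sub>R e2"
    "R = (\<lambda>\<epsilon>. cv e1 e2 (of_real r * \<epsilon>)) ` {\<epsilon>. \<epsilon> ^ 6 = 1} \<union> (\<lambda>\<epsilon>. cv e1 e2 (of_real (sqrt 3 * r) * \<epsilon>)) ` {\<epsilon>. \<epsilon> ^ 6 = - 1}"
    "\<And>k \<epsilon>. multiplicity_function R k \<Longrightarrow> \<epsilon> ^ 6 = 1 \<Longrightarrow> k (cv e1 e2 (of_real r * \<epsilon>)) = k (cv e1 e2 (of_real r))"
    "\<And>k \<epsilon>. multiplicity_function R k \<Longrightarrow> \<epsilon> ^ 6 = - 1 \<Longrightarrow> k (cv e1 e2 (of_real (sqrt 3 * r) * \<epsilon>)) = k (cv e1 e2 (of_real (sqrt 3 * r) * d))"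
proof -
  obtain a b where RS: "reduced_root_system R" and base: "a \<noteq> b" "root_base R {a, b}"
    and cartan: "cartan_number b a = - 3" "cartan_number a b = - 1"
    using assms by (auto simp: root_system_G2_def)
  have ab: "a \<in> R" "b \<in> R" using base(2) by (auto simp: root_base_def)
  have nz: "\<alpha> \<noteq> 0" if "\<alpha> \<in> R" for \<alpha> using RS that by (auto simp: reduced_root_system_def)
  define A where "A = a \<bullet> a"
  define r where "r = sqrt A"
  have A: "A > 0" using nz[OF ab(1)] by (simp add: A_def)
  have r: "r > 0" "r * r = A" using A by (simp_all add: r_def)
  have bn: "b \<bullet> b > 0" using nz[OF ab(2)] by simp
  have ip: "a \<bullet> a = A" "b \<bullet> a = - (3/2) * A" "a \<bullet> b = - (3/2) * A" "b \<bullet> b = 3 * A"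
  proof -
    show "a \<bullet> a = A" by (simp add: A_def)
    show 1: "b \<bullet> a = - (3/2) * A" using cartan(1) A by (simp add: cartan_number_def A_def field_simps)
    then show 2: "a \<bullet> b = - (3/2) * A" by (simp add: inner_commute)
    show "b \<bullet> b = 3 * A" using cartan(2) bn 2 by (simp add: cartan_number_def field_simps)
  qed
  \<comment> \<open>h is the imaginary part of \<omega>; e2 below is the normalised component of b
    orthogonal to a.\<close>
  define h where "h = sqrt 3 / 2"
  have h: "h * h = 3 / 4" "h > 0" by (simp_all add: h_def)
  define e1 where "e1 = (1 / r) *\<^sub>R a"
  define e2 where "e2 = (1 / (h * r)) *\<^sub>R (b + (3/2) *\<^sub>R a)"
  have o: "e1 \<bullet> e1 = 1" "e2 \<bullet> e2 = 1" "e1 \<bullet> e2 = 0"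
  proof -
    show "e1 \<bullet> e1 = 1" using r A by (simp add: e1_def ip field_simps)
    have "e2 \<bullet> e2 = (1 / (h * r)) * (1 / (h * r)) * (3 / 4 * A)"
      by (simp add: e2_def inner_add_left inner_add_right ip)
    also have "\<dots> = 3 / 4 * A / ((h * h) * (r * r))" by (simp add: field_simps)
    finally show "e2 \<bullet> e2 = 1" unfolding h(1) r(2) using A by simp
    show "e1 \<bullet> e2 = 0" by (simp add: e1_def e2_def inner_add_right ip)
  qed
  have o': "e2 \<bullet> e1 = 0" using o(3) by (simp add: inner_commute)
  have a: "a = r *\<^sub>R e1" and b: "b = (- (3/2) * r) *\<^sub>R e1 + (h * r) *\<^sub>R e2"
    using r(1) h(2) by (simp_all add: e1_def e2_def)
  let ?c = "cv e1 e2"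
  have c_add: "?c (u + v) = ?c u + ?c v" and c_diff: "?c (u - v) = ?c u - ?c v" and c_scale: "?c (of_real t * u) = t *\<^sub>R ?c u" for u v t
    by (simp_all add: cv_def algebra_simps scaleR_add_left scaleR_diff_left)
  have c_inner: "?c u \<bullet> ?c v = Re (cnj u * v)" for u v
    by (simp add: cv_def inner_add_left inner_add_right o o' )
  have \<omega>: "Re \<omega> = 1 / 2" "Im \<omega> = h" by (simp_all add: \<omega>_def cos_60 sin_60 h_def)
  have ca: "a = ?c (of_real r)" and cb: "b = ?c (of_real r * (\<omega> - 2))"
    by (simp_all add: a b cv_def \<omega> mult.commute)
  have span: "\<exists>s t. x = s *\<^sub>R a + t *\<^sub>R b" for x
  proof -
    have "R \<subseteq> span {a, b}"
    proof
      fix \<beta> assume "\<beta> \<in> R"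
      then obtain n :: "real ^ 'n \<Rightarrow> int" where "\<beta> = (\<Sum>\<delta>\<in>{a, b}. real_of_int (n \<delta>) *\<^sub>R \<delta>)"
        using base(2) unfolding root_base_def by blast
      also have "\<dots> \<in> span {a, b}" by (intro span_sum span_scale span_base)
      finally show "\<beta> \<in> span {a, b}" .
    qed
    then have "span R \<subseteq> span {a, b}" by (metis span_mono span_span)
    then have "x \<in> span {a, b}" using RS by (auto simp: reduced_root_system_def)
    then obtain s where "x - s *\<^sub>R a \<in> span {b}" by (auto simp: span_insert)
    then obtain t where "x - s *\<^sub>R a = t *\<^sub>R b" by (auto simp: span_singleton)
    then show ?thesis by (metis add.commute diff_add_cancel)
  qed
  have coords: "x = (x \<bullet> e1) *\<^sub>R e1 + (x \<bullet> e2) *\<^sub>R e2" for x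
  proof -
    obtain s t where "x = s *\<^sub>R a + t *\<^sub>R b" using span by blast
    then have "x = ?c (of_real s * of_real r + of_real t * (of_real r * (\<omega> - 2)))"
      by (simp only: c_add c_scale ca cb)
    then obtain u where u: "x = ?c u" by blast
    have "x \<bullet> e1 = Re u" "x \<bullet> e2 = Im u" by (simp_all add: u cv_def inner_add_left o o')
    then show ?thesis by (simp add: u cv_def)
  qed
  have refl: "reflection (?c (of_real t * d)) (?c u) = ?c (- (d * d) * cnj u)" if "cmod d = 1" "t \<noteq> 0" for t d u
  proof -
    have dd: "d * cnj d = 1" using that(1) by (simp add: complex_norm_square[symmetric])
    have "cnj (of_real t * d) * (of_real t * d) = of_real (t * t) * (d * cnj d)" by (simp add: mult_ac)
    then have "?c (of_real t * d) \<bullet> ?c (of_real t * d) = t * t" unfolding c_inner by (simp only: dd mult_1_right Re_complex_of_real)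
    moreover have "?c (of_real t * d) \<bullet> ?c u = t * Re (cnj d * u)" unfolding c_inner by (simp add: algebra_simps)
    ultimately have "reflection (?c (of_real t * d)) (?c u) = ?c u - (2 * Re (cnj d * u)) *\<^sub>R ?c d"
      using that(2) unfolding reflection_def by (simp add: c_scale)
    also have "\<dots> = ?c (u - of_real (2 * Re (cnj d * u)) * d)" by (simp only: c_diff c_scale)
    also have "of_real (2 * Re (cnj d * u)) = cnj d * u + d * cnj u"
      by (simp add: complex_eq_iff)
    also have "u - (cnj d * u + d * cnj u) * d = u - (d * cnj d) * u - d * d * cnj u" by (simp add: algebra_simps)
    finally show ?thesis by (simp add: dd)
  qed
  \<comment> \<open>The direction of the long simple root b, a unit whose square is the conjugate of
    \<omega>.\<close>
  define d where "d = (\<omega> - 2) / of_real (sqrt 3)"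
  have \<omega>n: "\<omega> * cnj \<omega> = 1" by (simp add: \<omega>_def cis_cnj cis_mult)
  have s3: "complex_of_real (sqrt 3) * complex_of_real (sqrt 3) = 3" by (simp flip: of_real_mult)
  have d1: "cmod d = 1"
  proof -
    have "(cmod (\<omega> - 2))\<^sup>2 = 3" using h(1) by (simp add: cmod_def \<omega> power2_eq_square)
    then have "cmod (\<omega> - 2) = sqrt 3" by (metis norm_ge_zero real_sqrt_abs abs_of_nonneg)
    then show ?thesis by (simp add: d_def norm_divide)
  qed
  have dd: "d * d = cnj \<omega>"
  proof -
    have "d * d = (\<omega> - 2) * (\<omega> - 2) / 3" by (simp add: d_def s3)
    also have "(\<omega> - 2) * (\<omega> - 2) = 3 * (1 - \<omega>)"
      using \<omega>_quadratic by (simp add: power2_eq_square algebra_simps)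
    also have "1 - \<omega> = cnj \<omega>" by (simp add: complex_eq_iff \<omega>)
    finally show ?thesis by simp
  qed
  have d6: "d ^ 6 = - 1"
  proof -
    have "d ^ 6 = cnj (\<omega> ^ 3)" unfolding complex_cnj_power dd[symmetric] by (simp add: eval_nat_numeral)
    then show ?thesis by (simp add: \<omega>3)
  qed
  have cb': "b = ?c (of_real (sqrt 3 * r) * d)" unfolding cb d_def by (simp add: mult.commute)
  \<comment> \<open>The Coxeter element, a rotation by - 60 degrees; the short roots and the long
    roots are its two orbits.\<close>
  define w where "w = reflection b \<circ> (reflection a \<circ> id)"
  have w: "w \<in> weyl_group R" unfolding w_def using ab by (intro weyl_group.intros)
  have wc: "w (?c u) = ?c (cnj \<omega> * u)" for u
  proof -
    have "reflection a (?c u) = ?c (- cnj u)" using refl[of 1 r u] r(1) unfolding ca by simp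
    moreover have "reflection b (?c (- cnj u)) = ?c (d * d * u)"
      unfolding cb' using refl[OF d1, of "sqrt 3 * r" "- cnj u"] r(1) by simp
    ultimately show ?thesis unfolding w_def dd by simp
  qed
  have wR: "w \<beta> \<in> R" if "\<beta> \<in> R" for \<beta>
    using RS ab that by (simp add: w_def reduced_root_system_def)
  \<comment> \<open>Membership in R and the value of k are carried along the rotation
    together.\<close>
  have orbit: "?c (of_real t * \<epsilon>) \<in> R \<and> (multiplicity_function R k \<longrightarrow> k (?c (of_real t * \<epsilon>)) = k (?c (of_real t * u)))"
    if "?c (of_real t * u) \<in> R" "u \<noteq> 0" "\<epsilon> ^ 6 = u ^ 6" for t u \<epsilon> k
  proof (rule rotation_closed[where d = u and P = "\<lambda>\<epsilon>. ?c (of_real t * \<epsilon>) \<in> R \<and>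
      (multiplicity_function R k \<longrightarrow> k (?c (of_real t * \<epsilon>)) = k (?c (of_real t * u)))"])
    fix v
    assume v: "?c (of_real t * v) \<in> R \<and> (multiplicity_function R k \<longrightarrow> k (?c (of_real t * v)) = k (?c (of_real t * u)))"
    have eq: "w (?c (of_real t * v)) = ?c (of_real t * (cnj \<omega> * v))" unfolding wc by (simp add: mult.left_commute)
    have "multiplicity_function R k \<Longrightarrow> k (w (?c (of_real t * v))) = k (?c (of_real t * v))"
      using v w by (simp add: multiplicity_function_def)
    then show "?c (of_real t * (cnj \<omega> * v)) \<in> R \<and>
        (multiplicity_function R k \<longrightarrow> k (?c (of_real t * (cnj \<omega> * v))) = k (?c (of_real t * u)))"
      using v wR[of "?c (of_real t * v)"] unfolding eq by simp
  qed (use that in auto)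
  have "\<beta> \<in> (\<lambda>\<epsilon>. ?c (of_real r * \<epsilon>)) ` {\<epsilon>. \<epsilon> ^ 6 = 1} \<union> (\<lambda>\<epsilon>. ?c (of_real (sqrt 3 * r) * \<epsilon>)) ` {\<epsilon>. \<epsilon> ^ 6 = - 1}"
    if \<beta>: "\<beta> \<in> R" for \<beta>
  proof -
    obtain n :: "real ^ 'n \<Rightarrow> int" where "\<beta> = (\<Sum>\<delta>\<in>{a, b}. real_of_int (n \<delta>) *\<^sub>R \<delta>)"
      using base(2) \<beta> unfolding root_base_def by blast
    then have n: "\<beta> = real_of_int (n a) *\<^sub>R a + real_of_int (n b) *\<^sub>R b" using base(1) by simp
    \<comment> \<open>In complex coordinates b is \<omega> - 2 times a, so shifting the first
      coefficient by 2 q makes \<beta> the multiple p + q \<omega> of a.\<close>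
    define q where "q = n b"
    define p where "p = n a - 2 * q"
    have na: "n a = p + 2 * q" by (simp add: p_def)
    have be: "\<beta> = real_of_int (p + 2 * q) *\<^sub>R a + real_of_int q *\<^sub>R b" unfolding n na q_def[symmetric] ..
    define N where "N = p\<^sup>2 + p * q + q\<^sup>2"
    have bb: "\<beta> \<bullet> \<beta> = A * of_int N"
      unfolding be N_def by (simp add: inner_add_left inner_add_right ip power2_eq_square algebra_simps)
    have "\<beta> \<bullet> \<beta> \<noteq> 0" using nz[OF \<beta>] by simp
    then have N0: "N \<noteq> 0" using bb by auto
    have ip\<beta>: "a \<bullet> \<beta> = A * (of_int (2 * p + q) / 2)" "b \<bullet> \<beta> = - A * (of_int (3 * p) / 2)"
      unfolding be by (simp_all add: inner_add_right ip algebra_simps)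
    have cn: "cartan_number a \<beta> = of_int (2 * p + q) / of_int N" "cartan_number b \<beta> = - (of_int (3 * p) / of_int N)"
      using A N0 unfolding cartan_number_def bb ip\<beta> by (simp_all add: field_simps)
    have "cartan_number a \<beta> \<in> \<int>" "cartan_number b \<beta> \<in> \<int>"
      using RS ab \<beta> by (simp_all add: reduced_root_system_def)
    then obtain s t :: int where st: "of_int (2 * p + q) / of_int N = (of_int s :: real)" "- (of_int (3 * p) / of_int N) = (of_int t :: real)"
      unfolding cn by (metis Ints_cases)
    have "of_int (2 * p + q) = (of_int (s * N) :: real)" "of_int (3 * p) = (of_int (- t * N) :: real)"
      using st N0 by (simp_all add: field_simps)
    then have S: "2 * p + q = s * N" "3 * p = - t * N" by (simp_all only: of_int_eq_iff)
    define \<epsilon> where "\<epsilon> = of_int p + of_int q * \<omega>"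
    have "\<beta> = ?c (of_real (of_int (p + 2 * q)) * of_real r + of_real (of_int q) * (of_real r * (\<omega> - 2)))"
      unfolding be by (simp only: c_add c_scale ca cb)
    also have "of_real (of_int (p + 2 * q)) * of_real r + of_real (of_int q) * (of_real r * (\<omega> - 2)) = of_real r * \<epsilon>"
      by (simp add: \<epsilon>_def algebra_simps)
    finally have b\<epsilon>: "\<beta> = ?c (of_real r * \<epsilon>)" .
    from Eisenstein_norm[OF N_def N0 S] show ?thesis unfolding \<epsilon>_def[symmetric]
    proof (elim disjE conjE)
      assume "\<epsilon> ^ 6 = 1" then show ?thesis using b\<epsilon> by blast
    next
      assume e: "\<epsilon> ^ 6 = - 27"
      have "complex_of_real (sqrt 3) ^ 6 = (complex_of_real (sqrt 3) * complex_of_real (sqrt 3)) ^ 3" by (simp add: eval_nat_numeral)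
      then have "(\<epsilon> / of_real (sqrt 3)) ^ 6 = - 1" unfolding s3 using e by (simp add: power_divide)
      moreover have "\<beta> = ?c (of_real (sqrt 3 * r) * (\<epsilon> / of_real (sqrt 3)))" unfolding b\<epsilon> by (simp add: mult.commute)
      ultimately show ?thesis by blast
    qed
  qed
  moreover have "?c (of_real r * \<epsilon>) \<in> R" if "\<epsilon> ^ 6 = 1" for \<epsilon>
    using orbit[of r 1 \<epsilon>] ab(1) that unfolding ca by simp
  moreover have "d \<noteq> 0" using d1 by auto
  moreover have "?c (of_real (sqrt 3 * r) * \<epsilon>) \<in> R" if "\<epsilon> ^ 6 = - 1" for \<epsilon>
    using orbit[of "sqrt 3 * r" d \<epsilon>] ab(2) that d6 \<open>d \<noteq> 0\<close> unfolding cb' by simp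
  ultimately have "R = (\<lambda>\<epsilon>. ?c (of_real r * \<epsilon>)) ` {\<epsilon>. \<epsilon> ^ 6 = 1} \<union> (\<lambda>\<epsilon>. ?c (of_real (sqrt 3 * r) * \<epsilon>)) ` {\<epsilon>. \<epsilon> ^ 6 = - 1}"
    by blast
  moreover have "k (?c (of_real r * \<epsilon>)) = k (?c (of_real r))" if "multiplicity_function R k" "\<epsilon> ^ 6 = 1" for k \<epsilon>
    using orbit[of r 1 \<epsilon> k] ab(1) that unfolding ca by simp
  moreover have "k (?c (of_real (sqrt 3 * r) * \<epsilon>)) = k (?c (of_real (sqrt 3 * r) * d))"
    if "multiplicity_function R k" "\<epsilon> ^ 6 = - 1" for k \<epsilon>
    using orbit[of "sqrt 3 * r" d \<epsilon> k] ab(2) that d6 \<open>d \<noteq> 0\<close> unfolding cb' by simp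
  ultimately show thesis by (rule that[OF r(1) o coords])
qed

lemma norm_cv:
  assumes "e1 \<bullet> e1 = 1" "e2 \<bullet> e2 = 1" "e1 \<bullet> e2 = 0"
  shows "norm (cv e1 e2 c) = cmod c"
proof -
  have "cv e1 e2 c \<bullet> cv e1 e2 c = Re c * Re c + Im c * Im c"
    using assms by (simp add: cv_def inner_add_left inner_add_right inner_commute[of e2 e1])
  then show ?thesis unfolding norm_eq_sqrt_inner[of "cv e1 e2 c"] cmod_def by (simp add: power2_eq_square)
qed

section \<open>The multiplicities\<close>

text \<open>Here n/3 = a + b + 1, so a - b is even exactly when n/3 is odd, and j is half of a - b,
  rounded up. The assumption b \<le> a gives the lower bound on j.\<close>

lemma half_integers_imp:
  fixes x y :: complex and a b n :: nat
  assumes "b \<le> a" and n: "n = 3 * (a + b + 1)" and xy: "x = - 1 / 2 - of_nat a" "y = - 1 / 2 - of_nat b"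
  shows "n mod 6 = 0 \<and> (\<exists>j::int. 1 \<le> j \<and> real_of_int j \<le> real n / 6 \<and>
      x = - (1/2) * (of_nat n / 3 + 2 * of_int j - 1) \<and> y = - (1/2) * (of_nat n / 3 - 2 * of_int j + 1)) \<or>
    n mod 6 = 3 \<and> (\<exists>j::int. 0 \<le> j \<and> real_of_int j \<le> (real n - 3) / 6 \<and>
      x = - (1/2) * (of_nat n / 3 + 2 * of_int j) \<and> y = - (1/2) * (of_nat n / 3 - 2 * of_int j))"
proof (cases "even (a + b)")
  case True
  then obtain m where m: "a + b = 2 * m" by blast
  have b: "of_nat b = 2 * of_nat m - (of_nat a :: complex)"
    using arg_cong[OF m, of "of_nat :: nat \<Rightarrow> complex"] by (simp add: algebra_simps)
  have nm: "n = 6 * m + 3" using n m by simp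
  have "m \<le> a" using m assms(1) by simp
  moreover have "a \<le> 2 * m" using m by simp
  ultimately have "0 \<le> int a - int m" "real_of_int (int a - int m) \<le> (real n - 3) / 6" using nm by simp_all
  moreover have "x = - (1/2) * (of_nat n / 3 + 2 * of_int (int a - int m))"
    "y = - (1/2) * (of_nat n / 3 - 2 * of_int (int a - int m))"
    unfolding xy b nm by (simp_all add: field_simps)
  moreover have "n mod 6 = 3" using nm by presburger
  ultimately show ?thesis by blast
next
  case False
  then have "even (a + b + 1)" by simp
  then obtain m where m: "a + b + 1 = 2 * m" by blast
  have b: "of_nat b = 2 * of_nat m - 1 - (of_nat a :: complex)"
    using arg_cong[OF m, of "of_nat :: nat \<Rightarrow> complex"] by (simp add: algebra_simps)
  have nm: "n = 6 * m" using n m by simp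
  have "m \<le> a" using m assms(1) by presburger
  moreover have "a + 1 \<le> 2 * m" using m by simp
  ultimately have "1 \<le> int a + 1 - int m" "real_of_int (int a + 1 - int m) \<le> real n / 6" using nm by simp_all
  moreover have "x = - (1/2) * (of_nat n / 3 + 2 * of_int (int a + 1 - int m) - 1)"
    "y = - (1/2) * (of_nat n / 3 - 2 * of_int (int a + 1 - int m) + 1)"
    unfolding xy b nm by (simp_all add: field_simps)
  moreover have "n mod 6 = 0" using nm by simp
  ultimately show ?thesis by blast
qed

text \<open>The upper bound on j says exactly that the smaller of the two integers a and b is
  nonnegative.\<close>

lemma half_integers_conv:
  fixes x y :: complex and n :: nat
  assumes "n mod 6 = 0 \<and> (\<exists>j::int. 1 \<le> j \<and> real_of_int j \<le> real n / 6 \<and>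
      x = - (1/2) * (of_nat n / 3 + 2 * of_int j - 1) \<and> y = - (1/2) * (of_nat n / 3 - 2 * of_int j + 1)) \<or>
    n mod 6 = 3 \<and> (\<exists>j::int. 0 \<le> j \<and> real_of_int j \<le> (real n - 3) / 6 \<and>
      x = - (1/2) * (of_nat n / 3 + 2 * of_int j) \<and> y = - (1/2) * (of_nat n / 3 - 2 * of_int j))"
  shows "3 * (x + y) = - of_nat n \<and> (\<exists>a b::nat. x = - 1 / 2 - of_nat a \<and> y = - 1 / 2 - of_nat b)"
  using assms
proof (elim disjE conjE exE)
  fix j :: int
  assume n: "n mod 6 = 0" and j: "1 \<le> j" "real_of_int j \<le> real n / 6"
    and xy: "x = - (1/2) * (of_nat n / 3 + 2 * of_int j - 1)" "y = - (1/2) * (of_nat n / 3 - 2 * of_int j + 1)"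
  obtain m where m: "n = 6 * m" using n by (metis dvd_eq_mod_eq_0 dvdE)
  have "real_of_int j \<le> real_of_int (int m)" using j(2) m by simp
  then have jm: "j \<le> int m" by (simp only: of_int_le_iff)
  define a b where "a = nat (int m + j - 1)" and "b = nat (int m - j)"
  have "int a = int m + j - 1" "int b = int m - j" using j(1) jm by (simp_all add: a_def b_def)
  from this[THEN arg_cong[of _ _ "of_int :: int \<Rightarrow> complex"]]
  have ab: "(of_nat a :: complex) = of_nat m + of_int j - 1" "(of_nat b :: complex) = of_nat m - of_int j" by simp_all
  have "x = - 1 / 2 - of_nat a" "y = - 1 / 2 - of_nat b" unfolding xy m ab by (simp_all add: field_simps)
  moreover have "3 * (x + y) = - of_nat n" unfolding xy by (simp add: field_simps)
  ultimately show ?thesis by blast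
next
  fix j :: int
  assume n: "n mod 6 = 3" and j: "0 \<le> j" "real_of_int j \<le> (real n - 3) / 6"
    and xy: "x = - (1/2) * (of_nat n / 3 + 2 * of_int j)" "y = - (1/2) * (of_nat n / 3 - 2 * of_int j)"
  define m where "m = n div 6"
  have m: "n = 6 * m + 3" using n unfolding m_def by presburger
  have "real_of_int j \<le> real_of_int (int m)" using j(2) m by simp
  then have jm: "j \<le> int m" by (simp only: of_int_le_iff)
  define a b where "a = nat (int m + j)" and "b = nat (int m - j)"
  have "int a = int m + j" "int b = int m - j" using j(1) jm by (simp_all add: a_def b_def)
  from this[THEN arg_cong[of _ _ "of_int :: int \<Rightarrow> complex"]]
  have ab: "(of_nat a :: complex) = of_nat m + of_int j" "(of_nat b :: complex) = of_nat m - of_int j" by simp_all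
  have "x = - 1 / 2 - of_nat a" "y = - 1 / 2 - of_nat b" unfolding xy m ab by (simp_all add: field_simps)
  moreover have "3 * (x + y) = - of_nat n" unfolding xy by (simp add: field_simps)
  ultimately show ?thesis by blast
qed

lemma very_singular_conditions:
  fixes k\<^sub>1 k\<^sub>2 :: complex
  shows "(\<exists>n::nat. 1 \<le> n \<and> 3 * (k\<^sub>1 + k\<^sub>2) = - of_nat n \<and>
       (\<not> 3 dvd n \<or> (\<exists>a b::nat. k\<^sub>1 = - 1 / 2 - of_nat a \<and> k\<^sub>2 = - 1 / 2 - of_nat b))) \<longleftrightarrow>
    (\<exists>n::nat. 1 \<le> n \<and>
      ((n mod 3 \<noteq> 0 \<and> k\<^sub>1 + k\<^sub>2 = - (of_nat n / 3)) \<or>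
       (n mod 6 = 0 \<and>
         (\<exists>j::int. 1 \<le> j \<and> real_of_int j \<le> real n / 6 \<and>
           (let a = - (1/2) * (of_nat n / 3 + 2 * of_int j - 1);
                b = - (1/2) * (of_nat n / 3 - 2 * of_int j + 1)
            in (k\<^sub>1, k\<^sub>2) = (a, b) \<or> (k\<^sub>2, k\<^sub>1) = (a, b)))) \<or>
       (n mod 6 = 3 \<and>
         (\<exists>j::int. 0 \<le> j \<and> real_of_int j \<le> (real n - 3) / 6 \<and>
           (let a = - (1/2) * (of_nat n / 3 + 2 * of_int j);
                b = - (1/2) * (of_nat n / 3 - 2 * of_int j)
            in (k\<^sub>1, k\<^sub>2) = (a, b) \<or> (k\<^sub>2, k\<^sub>1) = (a, b))))))"
  (is "(\<exists>n. 1 \<le> n \<and> ?L n) \<longleftrightarrow> (\<exists>n. 1 \<le> n \<and> (?A n \<or> ?B n \<or> ?C n))")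
proof -
  let ?X = "\<lambda>n x y. n mod 6 = 0 \<and> (\<exists>j::int. 1 \<le> j \<and> real_of_int j \<le> real n / 6 \<and>
      x = - (1/2) * (of_nat n / 3 + 2 * of_int j - 1) \<and> y = - (1/2) * (of_nat n / 3 - 2 * of_int j + 1)) \<or>
    n mod 6 = 3 \<and> (\<exists>j::int. 0 \<le> j \<and> real_of_int j \<le> (real n - 3) / 6 \<and>
      x = - (1/2) * (of_nat n / 3 + 2 * of_int j) \<and> y = - (1/2) * (of_nat n / 3 - 2 * of_int j))"
  have BC: "?B n \<or> ?C n \<longleftrightarrow> ?X n k\<^sub>1 k\<^sub>2 \<or> ?X n k\<^sub>2 k\<^sub>1" for n
    unfolding Let_def prod.inject by blast
  have "?L n \<longleftrightarrow> ?A n \<or> ?X n k\<^sub>1 k\<^sub>2 \<or> ?X n k\<^sub>2 k\<^sub>1" for n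
  proof
    assume L: "?L n"
    show "?A n \<or> ?X n k\<^sub>1 k\<^sub>2 \<or> ?X n k\<^sub>2 k\<^sub>1"
    proof (cases "3 dvd n")
      case False
      then have "n mod 3 \<noteq> 0" by presburger
      moreover have "3 * (k\<^sub>1 + k\<^sub>2) = 3 * (- (of_nat n / 3))" using L by simp
      then have "k\<^sub>1 + k\<^sub>2 = - (of_nat n / 3)" by (simp only: mult_cancel_left) simp
      ultimately show ?thesis by blast
    next
      case True
      then obtain a b where ab: "k\<^sub>1 = - 1 / 2 - of_nat a" "k\<^sub>2 = - 1 / 2 - of_nat b" using L by blast
      have "(of_nat n :: complex) = - (3 * (k\<^sub>1 + k\<^sub>2))" using L by simp
      also have "\<dots> = of_nat (3 * (a + b + 1))" unfolding ab by (simp add: field_simps)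
      finally have n: "n = 3 * (a + b + 1)" by (simp only: of_nat_eq_iff)
      then have n': "n = 3 * (b + a + 1)" by simp
      show ?thesis
      proof (cases "b \<le> a")
        case True
        from half_integers_imp[OF this n ab] show ?thesis by (rule disjI2[OF disjI1])
      next
        case False
        then have "a \<le> b" by simp
        from half_integers_imp[OF this n' ab(2,1)] show ?thesis by (rule disjI2[OF disjI2])
      qed
    qed
  next
    assume "?A n \<or> ?X n k\<^sub>1 k\<^sub>2 \<or> ?X n k\<^sub>2 k\<^sub>1"
    then show "?L n"
    proof (rule disjE)
      assume "?A n" then show ?thesis by (auto simp: mod_0_imp_dvd)
    next
      assume "?X n k\<^sub>1 k\<^sub>2 \<or> ?X n k\<^sub>2 k\<^sub>1"
      then show ?thesis
      proof (rule disjE)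
        assume "?X n k\<^sub>1 k\<^sub>2"
        from half_integers_conv[OF this] show ?thesis by (elim conjE) (intro conjI disjI2)
      next
        assume "?X n k\<^sub>2 k\<^sub>1"
        from half_integers_conv[OF this] show ?thesis unfolding add.commute[of k\<^sub>1 k\<^sub>2] by blast
      qed
    qed
  qed
  then show ?thesis unfolding BC by simp
qed

theorem mainTheorem7:
  fixes R Rp :: "(real ^ 'n) set"
    and k :: "real ^ 'n \<Rightarrow> complex"
    and \<alpha>\<^sub>1 \<alpha>\<^sub>2 :: "real ^ 'n"
    and k\<^sub>1 k\<^sub>2 :: complex
    and \<tau> :: "(real ^ 'n \<Rightarrow> real ^ 'n) \<Rightarrow> complex"
  assumes "root_system_G2 R"
    and "positive_system R Rp"
    and "multiplicity_function R k"
    and "short_root R \<alpha>\<^sub>1" and "long_root R \<alpha>\<^sub>2"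
    and "k \<alpha>\<^sub>1 = k\<^sub>1" and "k \<alpha>\<^sub>2 = k\<^sub>2"
    and "linear_character R \<tau>"
    and "\<tau> (reflection \<alpha>\<^sub>1) = 1" and "\<tau> (reflection \<alpha>\<^sub>2) = -1"
  shows
    "((\<forall>q :: nat. \<forall>\<kappa>.
          phi_poly (2 * q) \<kappa> = (\<Prod>j = 1..q. \<kappa>\<^sup>2 - (2 * of_nat j - 1)\<^sup>2) \<and>
          phi_poly (2 * q + 1) \<kappa> = \<kappa> * (\<Prod>j = 1..q. \<kappa>\<^sup>2 - (2 * of_nat j)\<^sup>2))
      \<longrightarrow>
      (very_singular R Rp k \<longleftrightarrow>
        (\<exists>n::nat. 1 \<le> n \<and>
          ((n mod 3 \<noteq> 0 \<and> k\<^sub>1 + k\<^sub>2 = - (of_nat n / 3)) \<or>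
           (n mod 6 = 0 \<and>
             (\<exists>j::int. 1 \<le> j \<and> real_of_int j \<le> real n / 6 \<and>
               (let a = - (1/2) * (of_nat n / 3 + 2 * of_int j - 1);
                    b = - (1/2) * (of_nat n / 3 - 2 * of_int j + 1)
                in (k\<^sub>1, k\<^sub>2) = (a, b) \<or> (k\<^sub>2, k\<^sub>1) = (a, b)))) \<or>
           (n mod 6 = 3 \<and>
             (\<exists>j::int. 0 \<le> j \<and> real_of_int j \<le> (real n - 3) / 6 \<and>
               (let a = - (1/2) * (of_nat n / 3 + 2 * of_int j);
                    b = - (1/2) * (of_nat n / 3 - 2 * of_int j)
                in (k\<^sub>1, k\<^sub>2) = (a, b) \<or> (k\<^sub>2, k\<^sub>1) = (a, b))))))))
     \<and>
     (\<forall>ch \<in> {char_sgn, \<tau>, \<lambda>w. char_sgn w * \<tau> w}.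
        \<forall>\<rho> :: (real ^ 'n \<Rightarrow> real ^ 'n) \<Rightarrow> complex ^ 'm ^ 'm.
          irreducible_rep R \<rho> \<and> has_character R \<rho> ch \<longrightarrow>
          (finite_dim (L_module R Rp k \<rho>) \<longleftrightarrow> very_singular R Rp (twisted_multiplicity ch k)))
     \<and>
     (\<forall>ch \<in> {char_std, \<lambda>w. \<tau> w * char_std w}.
        \<forall>\<rho> :: (real ^ 'n \<Rightarrow> real ^ 'n) \<Rightarrow> complex ^ 'm ^ 'm.
          irreducible_rep R \<rho> \<and> has_character R \<rho> ch \<longrightarrow>
          \<not> finite_dim (L_module R Rp k \<rho>))"
proof -
  note RS = assms(1) and pos = assms(2) and mult = assms(3)
  obtain e1 e2 :: "real ^ 'n" and r :: real and d :: complex where r: "r > 0"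
    and o: "e1 \<bullet> e1 = 1" "e2 \<bullet> e2 = 1" "e1 \<bullet> e2 = 0" and coords: "\<And>x. x = (x \<bullet> e1) *\<^sub>R e1 + (x \<bullet> e2) *\<^sub>R e2"
    and R: "R = (\<lambda>\<epsilon>. cv e1 e2 (of_real r * \<epsilon>)) ` {\<epsilon>. \<epsilon> ^ 6 = 1} \<union>
      (\<lambda>\<epsilon>. cv e1 e2 (of_real (sqrt 3 * r) * \<epsilon>)) ` {\<epsilon>. \<epsilon> ^ 6 = - 1}"
    and ks: "\<And>k \<epsilon>. multiplicity_function R k \<Longrightarrow> \<epsilon> ^ 6 = 1 \<Longrightarrow> k (cv e1 e2 (of_real r * \<epsilon>)) = k (cv e1 e2 (of_real r))"
    and kl: "\<And>k \<epsilon>. multiplicity_function R k \<Longrightarrow> \<epsilon> ^ 6 = - 1 \<Longrightarrow>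
      k (cv e1 e2 (of_real (sqrt 3 * r) * \<epsilon>)) = k (cv e1 e2 (of_real (sqrt 3 * r) * d))"
    by (rule G2_roots[OF RS]) (rule that; assumption)
  have e: "cmod \<epsilon> = 1" if "\<epsilon> ^ 6 = 1 \<or> \<epsilon> ^ 6 = - 1" for \<epsilon>
  proof -
    have "cmod \<epsilon> ^ 6 = 1" using that by (auto simp flip: norm_power)
    then show ?thesis using power_eq_imp_eq_base[of "cmod \<epsilon>" 6 1] by simp
  qed
  have n: "norm (cv e1 e2 (of_real t * \<epsilon>)) = t" if "\<epsilon> ^ 6 = 1 \<or> \<epsilon> ^ 6 = - 1" "t > 0" for t \<epsilon>
    unfolding norm_cv[OF o] using e[OF that(1)] that(2) by (simp add: norm_mult)
  have lt: "r < sqrt 3 * r" "0 < sqrt 3 * r" using r by simp_all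
  have i6: "\<i> ^ 6 = - 1" by (simp add: eval_nat_numeral)
  have mem: "cv e1 e2 (of_real r * 1) \<in> R" "cv e1 e2 (of_real (sqrt 3 * r) * \<i>) \<in> R"
    unfolding R by (rule UnI1, rule image_eqI[of _ _ 1], simp, simp) (rule UnI2, rule image_eqI[of _ _ \<i>], simp, simp add: i6)
  \<comment> \<open>Short roots are characterised by their length; comparison with one member of the
    first family excludes the second.\<close>
  obtain \<epsilon>1 where \<epsilon>1: "\<alpha>\<^sub>1 = cv e1 e2 (of_real r * \<epsilon>1)" "\<epsilon>1 ^ 6 = 1"
  proof -
    have "\<alpha>\<^sub>1 \<in> R" "norm \<alpha>\<^sub>1 \<le> r" using assms(4) mem(1) n[of 1 r] r by (auto simp: short_root_def)
    then consider \<epsilon> where "\<alpha>\<^sub>1 = cv e1 e2 (of_real r * \<epsilon>)" "\<epsilon> ^ 6 = 1"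
      | \<epsilon> where "\<alpha>\<^sub>1 = cv e1 e2 (of_real (sqrt 3 * r) * \<epsilon>)" "\<epsilon> ^ 6 = - 1" unfolding R by blast
    then show thesis
    proof cases
      case 1 then show ?thesis by (rule that)
    next
      case 2
      then have "norm \<alpha>\<^sub>1 = sqrt 3 * r" using n[of \<epsilon> "sqrt 3 * r"] lt(2) by simp
      then show ?thesis using \<open>norm \<alpha>\<^sub>1 \<le> r\<close> lt(1) by linarith
    qed
  qed
  obtain \<epsilon>2 where \<epsilon>2: "\<alpha>\<^sub>2 = cv e1 e2 (of_real (sqrt 3 * r) * \<epsilon>2)" "\<epsilon>2 ^ 6 = - 1"
  proof -
    have "\<alpha>\<^sub>2 \<in> R" "sqrt 3 * r \<le> norm \<alpha>\<^sub>2"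
      using assms(5) mem(2) n[of \<i> "sqrt 3 * r"] i6 lt(2) by (auto simp: long_root_def)
    then consider \<epsilon> where "\<alpha>\<^sub>2 = cv e1 e2 (of_real (sqrt 3 * r) * \<epsilon>)" "\<epsilon> ^ 6 = - 1"
      | \<epsilon> where "\<alpha>\<^sub>2 = cv e1 e2 (of_real r * \<epsilon>)" "\<epsilon> ^ 6 = 1" unfolding R by blast
    then show thesis
    proof cases
      case 1 then show ?thesis by (rule that)
    next
      case 2
      then have "norm \<alpha>\<^sub>2 = r" using n[of \<epsilon> r] r by simp
      then show ?thesis using \<open>sqrt 3 * r \<le> norm \<alpha>\<^sub>2\<close> lt(1) by linarith
    qed
  qed
  have RD: "finite R" "0 \<notin> R" "span R = UNIV" "\<And>\<alpha> \<beta>. \<alpha> \<in> R \<Longrightarrow> \<beta> \<in> R \<Longrightarrow> reflection \<alpha> \<beta> \<in> R"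
    using RS by (simp_all add: root_system_G2_def reduced_root_system_def)
  have K1: "k (cv e1 e2 (of_real r * \<epsilon>)) = k\<^sub>1" if "\<epsilon> ^ 6 = 1" for \<epsilon>
    using ks[OF mult that] ks[OF mult \<epsilon>1(2)] assms(6) \<epsilon>1(1) by simp
  have K2: "k (cv e1 e2 (of_real (sqrt 3 * r) * \<epsilon>)) = k\<^sub>2" if "\<epsilon> ^ 6 = - 1" for \<epsilon>
    using kl[OF mult that] kl[OF mult \<epsilon>2(2)] assms(7) \<epsilon>2(1) by simp
  interpret g2_setting R e1 e2 k Rp r "sqrt 3 * r" k\<^sub>1 k\<^sub>2
    by unfold_locales (rule RD(1-3) mult o coords pos r lt(2) R K1 K2
        | assumption | erule (1) RD(4))+
  have lin: "linear_character R ch" if "ch \<in> {char_sgn, \<tau>, \<lambda>w. char_sgn w * \<tau> w}" for ch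
    using that assms(8) char_sgn_linear by (auto simp: linear_character_def)
  have 1: "very_singular R Rp k \<longleftrightarrow> (\<exists>n::nat. 1 \<le> n \<and> 3 * (k\<^sub>1 + k\<^sub>2) = - of_nat n \<and>
       (\<not> 3 dvd n \<or> (\<exists>a b::nat. k\<^sub>1 = - 1 / 2 - of_nat a \<and> k\<^sub>2 = - 1 / 2 - of_nat b)))"
    unfolding very_singular_cofinite cofinite_triv zeta_def ..
  show ?thesis
  proof (intro conjI impI ballI allI)
    fix ch and \<rho> :: "(real ^ 'n \<Rightarrow> real ^ 'n) \<Rightarrow> complex ^ 'm ^ 'm"
    assume "ch \<in> {char_sgn, \<tau>, \<lambda>w. char_sgn w * \<tau> w}" "irreducible_rep R \<rho> \<and> has_character R \<rho> ch"
    then show "finite_dim (L_module R Rp k \<rho>) \<longleftrightarrow> very_singular R Rp (twisted_multiplicity ch k)"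
      using finite_dim_linear_character[OF lin] by blast
  next
    fix ch and \<rho> :: "(real ^ 'n \<Rightarrow> real ^ 'n) \<Rightarrow> complex ^ 'm ^ 'm"
    assume a: "ch \<in> {char_std, \<lambda>w. \<tau> w * char_std w}" "irreducible_rep R \<rho> \<and> has_character R \<rho> ch"
    then have "has_character R \<rho> (\<lambda>w. 1 * char_std w) \<or> has_character R \<rho> (\<lambda>w. \<tau> w * char_std w)"
      by (auto simp: has_character_def)
    then show "\<not> finite_dim (L_module R Rp k \<rho>)"
      using infinite_dim_std[of \<rho> "\<lambda>_. 1"] infinite_dim_std[of \<rho> \<tau>] a(2) assms(8)
      by (auto simp only: linear_character_def)
  qed (unfold 1, rule very_singular_conditions)
qed

end
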